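(* Let $(\sigma,u)\in\Sigma\times V$ be the solution of the continuous problem $$(A\sigma,\tau)+(\operatorname{div}\tau,u)=0\ \ \forall \tau\in\Sigma,\qquad (\operatorname{div}\sigma,v)=(f,v)\ \ \forall v\in V,$$ and let $(\sigma_h,u_h)\in\Sigma_h\times V_h$ be the solution of the discrete problem $$(A\sigma_h,\tau)+(\operatorname{div}\tau,u_h)=0\ \ \forall \tau\in\Sigma_h,\qquad (\operatorname{div}\sigma_h,v)=(f,v)\ \ \forall v\in V_h.$$ Suppose that $\sigma\in H^3(\Omega,\mathbb{S})$ and $u\in H^1(\Omega,\mathbb{R}^n)$. Then there is a constant $C$, independent of the mesh size $h$ and of $(\sigma,u)$, such that $$\|\sigma_h-\Pi_h\sigma\|_{H(\operatorname{div})}^2+\|u_h-P_hu\|_0^2\le C h^3\left(\|\sigma\|_3^2+\|u\|_1^2\right).$$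
   Context: Let $n\ge 2$ and let $\mathbb{S}$ be the space of real symmetric $n\times n$ matrices. $\Omega=\prod_{k=1}^n(a_k,b_k)\subset\mathbb{R}^n$ is a fixed rectangular domain. For the admissible mesh sizes $h$, $\mathcal{T}_h$ is the uniform rectangular grid of $\Omega$ consisting of closed axis-parallel cubes $K$ of edge length $h$. $(\cdot,\cdot)$ is the $L^2(\Omega)$ inner product; $\|\cdot\|_k$ is the norm of $H^k(\Omega)$ (for scalar, vector or matrix functions); $\operatorname{div}$ acts row-wise on matrix fields; $\|\tau\|_{H(\operatorname{div})}^2=\|\tau\|_0^2+\|\operatorname{div}\tau\|_0^2$. Continuous spaces: $\Sigma=H(\operatorname{div},\Omega,\mathbb{S})$ (square-integrable symmetric matrix fields with square-integrable divergence), $V=L^2(\Omega,\mathbb{R}^n)$; $f\in V$ is given. The operator $A$ is $A\sigma=\frac{1}{2\mu}\left(\sigma-\frac{\lambda}{2\mu+n\lambda}\operatorname{tr}(\sigma)\,\delta\right)$, with $\delta$ the $n\times n$ identity matrix and $\mu>0$, $\lambda\ge 0$ fixed Lamé constants. (The continuous problem is the pure displacement problem with $u=0$ on $\partial\Omega$, imposed weakly.) Discrete spaces: for $K\in\mathcal{T}_h$ let $P_1(x_i)=\operatorname{span}\{1,x_i\}$, $P_2(x_i)=\operatorname{span}\{1,x_i,x_i^2\}$, $Q_1(x_i,x_j)=\operatorname{span}\{1,x_i,x_j,x_ix_j\}$, and $V(K)=\{v=(v_1,\dots,v_n): v_i\in P_1(x_i)\}$, $\Sigma(K)=\{\sigma=(\sigma_{ij})\text{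 symmetric}: \sigma_{ii}\in P_2(x_i),\ \sigma_{ij}\in Q_1(x_i,x_j)\ (i\ne j)\}$. Then $\Sigma_h=\{\sigma\in H(\operatorname{div},\Omega,\mathbb{S}):\sigma|_K\in\Sigma(K)\ \forall K\in\mathcal{T}_h\}$ and $V_h=\{v\in L^2(\Omega,\mathbb{R}^n): v|_K\in V(K)\ \forall K\in\mathcal{T}_h\}$. The discrete problem is well posed. $P_h:V\to V_h$ is the $L^2$-orthogonal projection. Interpolation operator: for $\sigma\in H^2(\Omega,\mathbb{S})$, $\Pi_h\sigma\in\Sigma_h$ has entries $(\Pi_h\sigma)_{ij}=\Pi_{ij}\sigma_{ij}$, with $\Pi_{ij}=\Pi_{ji}$, defined on each $K\in\mathcal{T}_h$ as follows. For $i=j$: $\Pi_{ii}\sigma_{ii}|_K\in P_2(x_i)$ is determined by $\int_F\Pi_{ii}\sigma_{ii}\,dF=\int_F\sigma_{ii}\,dF$ for both $(n-1)$-dimensional faces $F$ of $K$ perpendicular to the $x_i$-axis, and $\int_K\Pi_{ii}\sigma_{ii}\,dV=\int_K\sigma_{ii}\,dV$. For $i\neq j$: $\Pi_{ij}\sigma_{ij}|_K\in Q_1(x_i,x_j)$ is the unique function whose (constant) value on each of the four $(n-2)$-dimensional faces $F$ of $K$ perpendicular to both the $x_i$- and $x_j$-axes equals the mean $\frac{1}{|F|}\int_F\sigma_{ij}\,dF$ (for $n=2$, the point value of $\sigma_{ij}$ at the vertex $F$). *)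

theory Defs
  imports "HOL-Analysis.Analysis"
begin

text \<open>
  Elements of Lebesgue and Sobolev spaces over an open set \<open>\<Omega>\<close> are represented by functions on the
  whole of \<open>\<real>\<^sup>n\<close>; values outside \<open>\<Omega>\<close> and on null sets are irrelevant to every notion below.
  Matrix fields take values in \<open>real^'n^'n\<close>, whose inner product is the Frobenius product.
\<close>

section \<open>Lebesgue and Sobolev spaces\<close>

definition L2 :: "(real^'n) set \<Rightarrow> (real^'n \<Rightarrow> 'c::euclidean_space) set" where
  "L2 \<Omega> = {f. f \<in> borel_measurable (lebesgue_on \<Omega>) \<and>
              integrable (lebesgue_on \<Omega>) (\<lambda>x. (norm (f x))\<^sup>2)}"

definition L2_inner ::
    "(real^'n) set \<Rightarrow> (real^'n \<Rightarrow> 'c::euclidean_space) \<Rightarrow> (real^'n \<Rightarrow> 'c) \<Rightarrow> real" where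
  "L2_inner \<Omega> f g = (LINT x|lebesgue_on \<Omega>. f x \<bullet> g x)"

definition L2_norm :: "(real^'n) set \<Rightarrow> (real^'n \<Rightarrow> 'c::euclidean_space) \<Rightarrow> real" where
  "L2_norm \<Omega> f = sqrt (L2_inner \<Omega> f f)"

fun partials :: "'n list \<Rightarrow> (real^'n \<Rightarrow> real) \<Rightarrow> real^'n \<Rightarrow> real" where
  "partials [] \<phi> = \<phi>"
| "partials (i # is) \<phi> = (\<lambda>x. frechet_derivative (partials is \<phi>) (at x) (axis i 1))"

text \<open>
  Differentiability (rather than continuity) of all iterated partial derivatives is required, so
  that the Frechet derivatives used in \<open>partials\<close> exist; this is the usual class of
  infinitely differentiable functions.
\<close>

definition smooth :: "(real^'n \<Rightarrow> real) \<Rightarrow> bool" where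
  "smooth \<phi> \<longleftrightarrow> (\<forall>is x. partials is \<phi> differentiable (at x))"

definition test_functions :: "(real^'n) set \<Rightarrow> (real^'n \<Rightarrow> real) set" where
  "test_functions \<Omega> = {\<phi>. smooth \<phi> \<and> compact (closure {x. \<phi> x \<noteq> 0}) \<and>
                              closure {x. \<phi> x \<noteq> 0} \<subseteq> \<Omega>}"

text \<open>
  A multi-index is a function \<open>\<alpha>\<close> from coordinates to naturals. The classical derivative of a test
  function of multi-index \<open>\<alpha>\<close> is \<open>partials xs \<phi>\<close> for any list \<open>xs\<close> containing each coordinate \<open>i\<close>
  exactly \<open>\<alpha> i\<close> times; by symmetry of higher derivatives the order in \<open>xs\<close> does not matter.
\<close>

definition has_weak_deriv ::
    "(real^'n) set \<Rightarrow> ('n \<Rightarrow> nat) \<Rightarrow> (real^'n \<Rightarrow> 'c::euclidean_space) \<Rightarrow> (real^'n \<Rightarrow> 'c) \<Rightarrow> bool" where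
  "has_weak_deriv \<Omega> \<alpha> u g \<longleftrightarrow>
     (\<forall>\<phi>\<in>test_functions \<Omega>. \<forall>xs. (\<forall>i. count_list xs i = \<alpha> i) \<longrightarrow>
        (LINT x|lebesgue_on \<Omega>. partials xs \<phi> x *\<^sub>R u x) =
        (-1) ^ (\<Sum>i\<in>UNIV. \<alpha> i) *\<^sub>R (LINT x|lebesgue_on \<Omega>. \<phi> x *\<^sub>R g x))"

definition weak_deriv ::
    "(real^'n) set \<Rightarrow> ('n \<Rightarrow> nat) \<Rightarrow> (real^'n \<Rightarrow> 'c::euclidean_space) \<Rightarrow> real^'n \<Rightarrow> 'c" where
  "weak_deriv \<Omega> \<alpha> u = (SOME g. g \<in> L2 \<Omega> \<and> has_weak_deriv \<Omega> \<alpha> u g)"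

definition sobolev :: "nat \<Rightarrow> (real^'n) set \<Rightarrow> (real^'n \<Rightarrow> 'c::euclidean_space) set" where
  "sobolev k \<Omega> = {u \<in> L2 \<Omega>. \<forall>\<alpha>. (\<Sum>i\<in>UNIV. \<alpha> i) \<le> k \<longrightarrow> (\<exists>g\<in>L2 \<Omega>. has_weak_deriv \<Omega> \<alpha> u g)}"

definition sobolev_norm :: "nat \<Rightarrow> (real^'n) set \<Rightarrow> (real^'n \<Rightarrow> 'c::euclidean_space) \<Rightarrow> real" where
  "sobolev_norm k \<Omega> u =
     sqrt (\<Sum>\<alpha>\<in>{\<alpha>. (\<Sum>i\<in>UNIV. \<alpha> i) \<le> k}. (L2_norm \<Omega> (weak_deriv \<Omega> \<alpha> u))\<^sup>2)"

section \<open>The space \<open>H(div, \<Omega>, S)\<close> and the elasticity problem\<close>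

text \<open>The divergence acts on the rows of the matrix field.\<close>

definition has_weak_div ::
    "(real^'n) set \<Rightarrow> (real^'n \<Rightarrow> real^'n^'n) \<Rightarrow> (real^'n \<Rightarrow> real^'n) \<Rightarrow> bool" where
  "has_weak_div \<Omega> \<tau> w \<longleftrightarrow>
     (\<forall>\<phi>\<in>test_functions \<Omega>.
        (LINT x|lebesgue_on \<Omega>. \<tau> x *v (\<chi> j. partials [j] \<phi> x)) =
        - (LINT x|lebesgue_on \<Omega>. \<phi> x *\<^sub>R w x))"

definition weak_div :: "(real^'n) set \<Rightarrow> (real^'n \<Rightarrow> real^'n^'n) \<Rightarrow> real^'n \<Rightarrow> real^'n" where
  "weak_div \<Omega> \<tau> = (SOME w. w \<in> L2 \<Omega> \<and> has_weak_div \<Omega> \<tau> w)"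

definition Hdiv_sym :: "(real^'n) set \<Rightarrow> (real^'n \<Rightarrow> real^'n^'n) set" where
  "Hdiv_sym \<Omega> = {\<tau> \<in> L2 \<Omega>. (AE x in lebesgue_on \<Omega>. transpose (\<tau> x) = \<tau> x) \<and>
                             (\<exists>w\<in>L2 \<Omega>. has_weak_div \<Omega> \<tau> w)}"

definition Hdiv_norm :: "(real^'n) set \<Rightarrow> (real^'n \<Rightarrow> real^'n^'n) \<Rightarrow> real" where
  "Hdiv_norm \<Omega> \<tau> = sqrt ((L2_norm \<Omega> \<tau>)\<^sup>2 + (L2_norm \<Omega> (weak_div \<Omega> \<tau>))\<^sup>2)"

definition compliance :: "real \<Rightarrow> real \<Rightarrow> real^'n^'n \<Rightarrow> real^'n^'n" where
  "compliance mu lam s =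
     (1 / (2 * mu)) *\<^sub>R (s - (lam / (2 * mu + real CARD('n) * lam) * trace s) *\<^sub>R mat 1)"

text \<open>
  The continuous and the discrete problem are the same mixed problem, posed on
  different pairs of spaces \<open>S\<close> (stresses) and \<open>V\<close> (displacements).
\<close>

definition solves_mixed_problem ::
    "(real^'n) set \<Rightarrow> real \<Rightarrow> real \<Rightarrow> (real^'n \<Rightarrow> real^'n) \<Rightarrow>
     (real^'n \<Rightarrow> real^'n^'n) set \<Rightarrow> (real^'n \<Rightarrow> real^'n) set \<Rightarrow>
     (real^'n \<Rightarrow> real^'n^'n) \<Rightarrow> (real^'n \<Rightarrow> real^'n) \<Rightarrow> bool" where
  "solves_mixed_problem \<Omega> mu lam f S V \<sigma> u \<longleftrightarrow>
     \<sigma> \<in> S \<and> u \<in> V \<and>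
     (\<forall>\<tau>\<in>S. L2_inner \<Omega> (\<lambda>x. compliance mu lam (\<sigma> x)) \<tau> + L2_inner \<Omega> (weak_div \<Omega> \<tau>) u = 0) \<and>
     (\<forall>v\<in>V. L2_inner \<Omega> (weak_div \<Omega> \<sigma>) v = L2_inner \<Omega> f v)"

section \<open>The mesh and the discrete spaces\<close>

definition admissible_mesh_size :: "real^'n \<Rightarrow> real^'n \<Rightarrow> real \<Rightarrow> bool" where
  "admissible_mesh_size a b h \<longleftrightarrow> 0 < h \<and> (\<forall>i. \<exists>m::nat. b $ i - a $ i = real m * h)"

text \<open>A cell of the mesh is referred to by its lower corner.\<close>

definition cell :: "real \<Rightarrow> real^'n \<Rightarrow> (real^'n) set" where
  "cell h p = cbox p (\<chi> i. p $ i + h)"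

definition mesh_corners :: "real^'n \<Rightarrow> real^'n \<Rightarrow> real \<Rightarrow> (real^'n) set" where
  "mesh_corners a b h = {p. \<forall>i. (\<exists>k::nat. p $ i = a $ i + real k * h) \<and> p $ i + h \<le> b $ i}"

definition V_local :: "(real^'n \<Rightarrow> real^'n) set" where
  "V_local = {v. \<forall>i. \<exists>c0 c1. \<forall>x. v x $ i = c0 + c1 * x $ i}"

definition Sigma_local :: "(real^'n \<Rightarrow> real^'n^'n) set" where
  "Sigma_local =
     {\<tau>. (\<forall>x. transpose (\<tau> x) = \<tau> x) \<and>
         (\<forall>i. \<exists>c0 c1 c2. \<forall>x. \<tau> x $ i $ i = c0 + c1 * x $ i + c2 * (x $ i)\<^sup>2) \<and>
         (\<forall>i j. i \<noteq> j \<longrightarrow> (\<exists>c0 c1 c2 c3. \<forall>x.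
            \<tau> x $ i $ j = c0 + c1 * x $ i + c2 * x $ j + c3 * (x $ i * x $ j)))}"

text \<open>
  Membership of the restriction to a closed cell is meant almost everywhere, since the
  polynomial pieces of neighbouring cells need not agree on the common face.
\<close>

definition V_h :: "real^'n \<Rightarrow> real^'n \<Rightarrow> real \<Rightarrow> (real^'n \<Rightarrow> real^'n) set" where
  "V_h a b h = {v \<in> L2 (box a b). \<forall>p\<in>mesh_corners a b h.
                  \<exists>q\<in>V_local. AE x in lebesgue_on (cell h p). v x = q x}"

definition Sigma_h :: "real^'n \<Rightarrow> real^'n \<Rightarrow> real \<Rightarrow> (real^'n \<Rightarrow> real^'n^'n) set" where
  "Sigma_h a b h = {\<tau> \<in> Hdiv_sym (box a b). \<forall>p\<in>mesh_corners a b h.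
                      \<exists>q\<in>Sigma_local. AE x in lebesgue_on (cell h p). \<tau> x = q x}"

definition is_L2_projection ::
    "real^'n \<Rightarrow> real^'n \<Rightarrow> real \<Rightarrow> (real^'n \<Rightarrow> real^'n) \<Rightarrow> (real^'n \<Rightarrow> real^'n) \<Rightarrow> bool" where
  "is_L2_projection a b h u w \<longleftrightarrow>
     w \<in> V_h a b h \<and> (\<forall>v\<in>V_h a b h. L2_inner (box a b) (\<lambda>x. u x - w x) v = 0)"

section \<open>The interpolation operator\<close>

text \<open>
  For a set \<open>I\<close> of coordinates and \<open>c\<close> with \<open>c $ i \<in> {p $ i, p $ i + h}\<close> for \<open>i \<in> I\<close>, the face
  below is the face of \<open>cell h p\<close> perpendicular to the axes in \<open>I\<close> and passing through these
  coordinates; only the components of \<open>c\<close> in \<open>I\<close> matter. It has dimension \<open>n - |I|\<close>, and integration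
  over it is integration over the free coordinates. If \<open>I\<close> consists of all coordinates, the product
  measure is the unit point mass and the integral is the value at the vertex.
\<close>

definition face :: "real \<Rightarrow> real^'n \<Rightarrow> 'n set \<Rightarrow> real^'n \<Rightarrow> (real^'n) set" where
  "face h p I c = {x \<in> cell h p. \<forall>i\<in>I. x $ i = c $ i}"

definition face_integral ::
    "real \<Rightarrow> real^'n \<Rightarrow> 'n set \<Rightarrow> real^'n \<Rightarrow> (real^'n \<Rightarrow> real) \<Rightarrow> real" where
  "face_integral h p I c \<phi> =
     (LINT y:(\<Pi>\<^sub>E k\<in>- I. {p $ k .. p $ k + h})|(\<Pi>\<^sub>M k\<in>- I. lborel).
        \<phi> (\<chi> k. if k \<in> I then c $ k else y k))"

text \<open>
  The integral over a face of (the trace of) \<open>u \<in> H\<^sup>2(\<Omega>)\<close>: the trace is the continuous extension,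
  with respect to the norm of \<open>H\<^sup>2(\<Omega>)\<close>, of the restriction of functions smooth up to the boundary.
  No continuous representative of \<open>u\<close> need exist in higher dimensions.
\<close>

definition has_trace_integral ::
    "(real^'n) set \<Rightarrow> real \<Rightarrow> real^'n \<Rightarrow> 'n set \<Rightarrow> real^'n \<Rightarrow> (real^'n \<Rightarrow> real) \<Rightarrow> real \<Rightarrow> bool" where
  "has_trace_integral \<Omega> h p I c u m \<longleftrightarrow>
     u \<in> sobolev 2 \<Omega> \<and>
     (\<exists>\<phi> :: nat \<Rightarrow> real^'n \<Rightarrow> real.
        (\<forall>k. smooth (\<phi> k)) \<and>
        (\<lambda>k. sobolev_norm 2 \<Omega> (\<lambda>x. \<phi> k x - u x)) \<longlonglongrightarrow> 0 \<and>
        (\<lambda>k. face_integral h p I c (\<phi> k)) \<longlonglongrightarrow> m)"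

definition is_local_interpolant ::
    "(real^'n) set \<Rightarrow> real \<Rightarrow> real^'n \<Rightarrow> (real^'n \<Rightarrow> real^'n^'n) \<Rightarrow> (real^'n \<Rightarrow> real^'n^'n) \<Rightarrow> bool" where
  "is_local_interpolant \<Omega> h p \<sigma> q \<longleftrightarrow>
     q \<in> Sigma_local \<and>
     (\<forall>i c. c $ i \<in> {p $ i, p $ i + h} \<longrightarrow>
        has_trace_integral \<Omega> h p {i} c (\<lambda>x. \<sigma> x $ i $ i)
          (face_integral h p {i} c (\<lambda>x. q x $ i $ i))) \<and>
     (\<forall>i. (LINT x|lebesgue_on (cell h p). q x $ i $ i) =
          (LINT x|lebesgue_on (cell h p). \<sigma> x $ i $ i)) \<and>
     (\<forall>i j c. i \<noteq> j \<longrightarrow> c $ i \<in> {p $ i, p $ i + h} \<longrightarrow> c $ j \<in> {p $ j, p $ j + h} \<longrightarrow>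
        (\<exists>m. has_trace_integral \<Omega> h p {i, j} c (\<lambda>x. \<sigma> x $ i $ j) m \<and>
             (\<forall>x\<in>face h p {i, j} c. q x $ i $ j = m / h ^ (CARD('n) - 2))))"

definition is_interpolant ::
    "real^'n \<Rightarrow> real^'n \<Rightarrow> real \<Rightarrow> (real^'n \<Rightarrow> real^'n^'n) \<Rightarrow> (real^'n \<Rightarrow> real^'n^'n) \<Rightarrow> bool" where
  "is_interpolant a b h \<sigma> \<pi> \<longleftrightarrow>
     \<pi> \<in> Sigma_h a b h \<and>
     (\<forall>p\<in>mesh_corners a b h. \<exists>q. is_local_interpolant (box a b) h p \<sigma> q \<and>
        (AE x in lebesgue_on (cell h p). \<pi> x = q x))"

end

theory Submission
  imports Defs "HOL-Computational_Algebra.Polynomial" "HOL-Library.Multiset"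
begin

text \<open>
  The error \<open>\<sigma>\<^sub>h - \<Pi>\<^sub>h \<sigma>\<close> satisfies \<open>(A (\<sigma>\<^sub>h - \<Pi>\<^sub>h \<sigma>), \<tau>) = (A (\<sigma> - \<Pi>\<^sub>h \<sigma>), \<tau>)\<close> for divergence-free discrete \<open>\<tau>\<close>,
  and discrete stability is explicit: every \<open>v \<in> V\<^sub>h\<close> is the divergence of the diagonal field obtained by
  integrating \<open>v\<^sub>i\<close> along the \<open>i\<close>-th direction. So it suffices to bound two consistency terms by \<open>h\<^sup>3\<^sup>/\<^sup>2\<close>.

  On a cell, \<open>\<sigma>\<^sub>i\<^sub>j - \<Pi>\<^sub>i\<^sub>j \<sigma>\<^sub>i\<^sub>j\<close> is of order \<open>h\<^sup>2\<close> up to an affine function of the remaining variables, which is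
  orthogonal to \<open>\<tau>\<^sub>i\<^sub>j\<close>. The trace part of \<open>A\<close> also pairs it with \<open>\<tau>\<^sub>k\<^sub>k\<close> for \<open>k \<noteq> i = j\<close>. The resulting cell
  contribution is the mean of \<open>\<partial>\<^sub>k \<sigma>\<^sub>i\<^sub>i\<close> times the increment of \<open>\<tau>\<^sub>k\<^sub>k\<close> across the cell, and \<open>\<tau>\<^sub>k\<^sub>k\<close> is continuous across the
  faces normal to the \<open>k\<close>-axis. Summation by parts along the columns of the mesh moves the increment to the
  means and leaves two boundary terms per column; these are what limits the rate to \<open>h\<^sup>3\<^sup>/\<^sup>2\<close>.

  In the divergence, the cell integral of \<open>\<partial>\<^sub>j (\<sigma>\<^sub>i\<^sub>j - \<Pi>\<^sub>i\<^sub>j \<sigma>\<^sub>i\<^sub>j)\<close> against an affine function of \<open>x\<^sub>i\<close> reduces by the trace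
  conditions and integration by parts to an integral of \<open>\<partial>\<^sub>i\<^sup>2 \<partial>\<^sub>j \<sigma>\<^sub>i\<^sub>j\<close> with a factor \<open>h\<^sup>2\<close>.
\<close>

section \<open>Integrals over faces of a cell\<close>

text \<open>In high dimension the entries of \<sigma> have no values at points or on thin faces: the
  degrees of freedom are only known as limits of face integrals of smooth functions. Each of them is
  turned into an integral, over the whole cell, of weak derivatives of order at most two with affine
  weights. After that every estimate is an L2 estimate on a cell. The Poincare constant is explicit
  and scales with \<open>h\<close> by itself, so that neither a reference cell nor a compactness
  argument occurs. The power 3/2 arises as follows. A boundary term of a column contains the mean of
  a first derivative over a single cell. Its square is bounded by the average of the squares over
  the column plus squared increments, and averaging over L/h cells gains one factor \<open>h\<close>
  where the interior terms gain two. Everything else is of order \<open>h ^ 4\<close> after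
  squaring, and the surplus power is absorbed into a constant of the domain. Bounds are kept squared
  and carry a free Young parameter, which is fixed only when part of the left side is
  absorbed.\<close>

lemma lborel_vec_eq_PiM:
  "(lborel :: (real^'n) measure) = distr (\<Pi>\<^sub>M k\<in>UNIV. lborel) borel (\<lambda>f. \<chi> k. f k)"
proof (rule lborel_eqI)
  interpret product_sigma_finite "\<lambda>k::'n. lborel :: real measure" by standard
  have m[measurable]: "(\<lambda>f. (\<chi> k. f k) :: real^'n) \<in> (\<Pi>\<^sub>M k\<in>(UNIV::'n set). lborel) \<rightarrow>\<^sub>M borel"
    by (subst borel_measurable_euclidean_space) (auto simp: Basis_vec_def inner_axis)
  fix l u :: "real^'n"
  assume le: "\<And>b. b \<in> Basis \<Longrightarrow> l \<bullet> b \<le> u \<bullet> b"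
  have le': "l $ k \<le> u $ k" for k using le[of "axis k 1"] by (simp add: inner_axis)
  have "emeasure (distr (\<Pi>\<^sub>M k\<in>(UNIV::'n set). lborel) borel (\<lambda>f. \<chi> k. f k)) (box l u)
      = emeasure (\<Pi>\<^sub>M k\<in>(UNIV::'n set). lborel) (\<Pi>\<^sub>E k\<in>UNIV. {l $ k<..<u $ k})"
    by (subst emeasure_distr) (auto intro!: arg_cong[where f="emeasure _"] simp: space_PiM mem_box_cart PiE_iff)
  also have "\<dots> = (\<Prod>k\<in>UNIV. ennreal (u $ k - l $ k))"
    by (subst emeasure_PiM) (auto simp: le')
  also have "\<dots> = ennreal (\<Prod>k\<in>UNIV. u $ k - l $ k)"
    by (intro prod_ennreal) (use le' in auto)
  also have "(\<Prod>k\<in>UNIV. u $ k - l $ k) = (\<Prod>b\<in>Basis. (u - l) \<bullet> b)"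
    by (simp add: Basis_vec_def UNION_singleton_eq_range prod.reindex axis_eq_axis inj_on_def inner_axis)
  finally show "emeasure (distr (\<Pi>\<^sub>M k\<in>(UNIV::'n set). lborel) borel (\<lambda>f. \<chi> k. f k)) (box l u)
      = ennreal (\<Prod>b\<in>Basis. (u - l) \<bullet> b)" .
qed simp

lemma cell_sets_lebesgue [simp]: "cell h p \<in> sets lebesgue"
  by (simp add: cell_def)

lemma integral_lebesgue_on_continuous:
  fixes f :: "real^'n \<Rightarrow> real"
  assumes "continuous_on UNIV f" "S \<in> sets borel"
  shows "(LINT x|lebesgue_on S. f x) = (LINT x:S|lborel. f x)"
proof -
  have f[measurable]: "f \<in> borel_measurable borel"
    using assms(1) by (rule borel_measurable_continuous_onI)
  have [measurable]: "S \<in> sets borel" by fact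
  have "(LINT x|lebesgue_on S. f x) = (LINT x|lebesgue. indicator S x *\<^sub>R f x)"
    by (rule integral_restrict_space) (use assms(2) in simp)
  also have "\<dots> = (LINT x|lborel. indicator S x *\<^sub>R f x)"
    by (rule integral_completion) measurable
  finally show ?thesis by (simp add: set_lebesgue_integral_def)
qed

text \<open>The face perpendicular to no axis is the cell itself. Here the product measure is
  carried over to the Lebesgue measure on vectors, so that arguments which free or fix one
  coordinate at a time can end in cell integrals.\<close>

lemma face_integral_empty:
  fixes f :: "real^'n \<Rightarrow> real"
  assumes "continuous_on UNIV f"
  shows "face_integral h p {} c f = (LINT x|lebesgue_on (cell h p). f x)"
proof -
  have f[measurable]: "f \<in> borel_measurable borel"
    using assms(1) by (rule borel_measurable_continuous_onI)
  have m[measurable]: "(\<lambda>f. (\<chi> k. f k) :: real^'n) \<in> (\<Pi>\<^sub>M k\<in>(UNIV::'n set). lborel) \<rightarrow>\<^sub>M borel"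
    by (subst borel_measurable_euclidean_space) (auto simp: Basis_vec_def inner_axis)
  have [measurable]: "cell h p \<in> sets borel" by (simp add: cell_def)
  have "(LINT x|lebesgue_on (cell h p). f x) = (LINT x|lborel. indicator (cell h p) x *\<^sub>R f x)"
    by (simp add: integral_lebesgue_on_continuous assms set_lebesgue_integral_def)
  also have "\<dots> = (LINT y|(\<Pi>\<^sub>M k\<in>(UNIV::'n set). lborel). indicator (cell h p) (\<chi> k. y k) *\<^sub>R f (\<chi> k. y k))"
    by (subst lborel_vec_eq_PiM, rule integral_distr) measurable
  also have "\<dots> = face_integral h p {} c f"
    unfolding face_integral_def set_lebesgue_integral_def
    by (auto intro!: Bochner_Integration.integral_cong simp: indicator_def cell_def mem_box_cart PiE_iff space_PiM)
  finally show ?thesis by simp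
qed

lemma continuous_on_face_map:
  "continuous_on UNIV (\<lambda>s. \<chi> k. if k \<in> I then (c::real^'n) $ k else if k = j then s else y k)"
proof -
  have "continuous_on UNIV (\<lambda>s. if k \<in> I then c $ k else if k = j then s else y k)" for k
    by (cases "k \<in> I"; cases "k = j"; simp)
  then show ?thesis by (intro continuous_on_vec_lambda)
qed

lemma face_map_measurable:
  "(\<lambda>y. \<chi> k. if k \<in> I then (c::real^'n) $ k else y k) \<in> (\<Pi>\<^sub>M k\<in>-I. lborel) \<rightarrow>\<^sub>M borel"
proof -
  have "(\<lambda>y. if k \<in> I then c $ k else y k) \<in> borel_measurable (\<Pi>\<^sub>M k\<in>-I. lborel)" for k
    by (cases "k \<in> I") auto
  then show ?thesis
    by (subst borel_measurable_euclidean_space) (auto simp: Basis_vec_def inner_axis)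
qed

lemma face_box_sets: "(\<Pi>\<^sub>E k\<in>J. {p $ k .. p $ k + h}) \<in> sets (\<Pi>\<^sub>M k\<in>J. (lborel::real measure))"
  by (rule sets_PiM_I_finite) auto

lemma emeasure_face_box:
  fixes p :: "real^'n"
  assumes "0 \<le> h"
  shows "emeasure (\<Pi>\<^sub>M k\<in>J. (lborel::real measure)) (\<Pi>\<^sub>E k\<in>J. {p $ k .. p $ k + h}) = ennreal (h ^ card J)"
proof -
  interpret product_sigma_finite "\<lambda>k::'n. lborel :: real measure" by standard
  show ?thesis
    by (subst emeasure_PiM) (auto simp: assms ennreal_power)
qed

lemma face_integrable:
  fixes f :: "real^'n \<Rightarrow> real"
  assumes "continuous_on UNIV f" "0 \<le> h"
  shows "set_integrable (\<Pi>\<^sub>M k\<in>-I. lborel) (\<Pi>\<^sub>E k\<in>-I. {p $ k .. p $ k + h})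
     (\<lambda>y. f (\<chi> k. if k \<in> I then c $ k else y k))"
proof -
  have f[measurable]: "f \<in> borel_measurable borel"
    using assms(1) by (rule borel_measurable_continuous_onI)
  note [measurable] = face_map_measurable[of I c]
  have [measurable]: "(\<Pi>\<^sub>E k\<in>-I. {p $ k .. p $ k + h}) \<in> sets (\<Pi>\<^sub>M k\<in>-I. lborel)"
    by (rule face_box_sets)
  define q where "q = (\<chi> k. if k \<in> I then c $ k else p $ k)"
  define r where "r = (\<chi> k. if k \<in> I then c $ k else p $ k + h)"
  have "compact (f ` cbox q r)"
    by (intro compact_continuous_image continuous_on_subset[OF assms(1)]) auto
  then obtain B where B: "\<And>x. x \<in> cbox q r \<Longrightarrow> \<bar>f x\<bar> \<le> B"
    by (force dest!: compact_imp_bounded simp: bounded_iff)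
  have "(\<chi> k. if k \<in> I then c $ k else y k) \<in> cbox q r"
    if "y \<in> (\<Pi>\<^sub>E k\<in>-I. {p $ k .. p $ k + h})" for y
    using that by (auto simp: mem_box_cart q_def r_def PiE_def Pi_def)
  then have "\<bar>f (\<chi> k. if k \<in> I then c $ k else y k)\<bar> \<le> B" if "y \<in> (\<Pi>\<^sub>E k\<in>-I. {p $ k .. p $ k + h})" for y
    using that B by blast
  then show ?thesis
    unfolding set_integrable_def
    by (intro integrableI_bounded_set_indicator[where B=B])
       (auto simp: emeasure_face_box assms)
qed

text \<open>The coordinate \<open>j\<close>, free on the face, is split off; the inner integral runs
  along the segment that joins the two opposite subfaces perpendicular to the
  \<open>j\<close>-axis.\<close>

lemma face_integral_Fubini:
  fixes f :: "real^'n \<Rightarrow> real"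
  assumes "continuous_on UNIV f" "0 \<le> h" "j \<notin> I"
  shows "face_integral h p I c f =
    (LINT y:(\<Pi>\<^sub>E k\<in>- insert j I. {p $ k .. p $ k + h})|(\<Pi>\<^sub>M k\<in>- insert j I. lborel).
      (LINT s:{p $ j .. p $ j + h}|lborel.
         f (\<chi> k. if k \<in> I then c $ k else if k = j then s else y k)))"
proof -
  interpret product_sigma_finite "\<lambda>k::'n. lborel :: real measure" by standard
  have J: "- I = insert j (- insert j I)" using assms(3) by auto
  let ?F = "\<lambda>y. indicator (\<Pi>\<^sub>E k\<in>-I. {p $ k .. p $ k + h}) y *\<^sub>R f (\<chi> k. if k \<in> I then c $ k else y k)"
  have int: "integrable (Pi\<^sub>M (insert j (- insert j I)) (\<lambda>k. lborel)) ?F"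
    using face_integrable[OF assms(1,2), of I p c] unfolding set_integrable_def J[symmetric] .
  have "face_integral h p I c f = integral\<^sup>L (Pi\<^sub>M (insert j (- insert j I)) (\<lambda>k. lborel)) ?F"
    unfolding face_integral_def set_lebesgue_integral_def J[symmetric] ..
  also have "\<dots> = (LINT y|(\<Pi>\<^sub>M k\<in>- insert j I. lborel). LINT s|lborel. ?F (y(j := s)))"
    by (rule product_integral_insert[OF _ _ int]) auto
  also have "\<dots> = (LINT y|(\<Pi>\<^sub>M k\<in>- insert j I. lborel). LINT s|lborel.
      indicator (\<Pi>\<^sub>E k\<in>- insert j I. {p $ k .. p $ k + h}) y *\<^sub>R (indicator {p $ j .. p $ j + h} s *\<^sub>R 
         f (\<chi> k. if k \<in> I then c $ k else if k = j then s else y k)))"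
  proof (intro Bochner_Integration.integral_cong refl)
    fix y s assume y: "y \<in> space (\<Pi>\<^sub>M k\<in>- insert j I. (lborel::real measure))"
    have ind: "y(j := s) \<in> (\<Pi>\<^sub>E k\<in>-I. {p $ k .. p $ k + h}) \<longleftrightarrow>
       y \<in> (\<Pi>\<^sub>E k\<in>- insert j I. {p $ k .. p $ k + h}) \<and> s \<in> {p $ j .. p $ j + h}"
      using y assms(3) by (auto simp: space_PiM PiE_iff extensional_def split: if_splits)
    have "(\<chi> k. if k \<in> I then c $ k else (y(j := s)) k) = (\<chi> k. if k \<in> I then c $ k else if k = j then s else y k)"
      by (auto simp: vec_eq_iff)
    then show "?F (y(j := s)) = indicator (\<Pi>\<^sub>E k\<in>- insert j I. {p $ k .. p $ k + h}) y *\<^sub>R (indicator {p $ j .. p $ j + h} s *\<^sub>R 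
         f (\<chi> k. if k \<in> I then c $ k else if k = j then s else y k))"
      using ind by (auto simp: indicator_def)
  qed
  also have "\<dots> = (LINT y|(\<Pi>\<^sub>M k\<in>- insert j I. lborel). 
      indicator (\<Pi>\<^sub>E k\<in>- insert j I. {p $ k .. p $ k + h}) y *\<^sub>R (LINT s|lborel. (indicator {p $ j .. p $ j + h} s *\<^sub>R 
         f (\<chi> k. if k \<in> I then c $ k else if k = j then s else y k))))"
    by (intro Bochner_Integration.integral_cong refl integral_scaleR_right)
  finally show ?thesis by (simp add: set_lebesgue_integral_def)
qed

section \<open>Derivatives in one direction and integration by parts on faces\<close>

definition has_partial :: "'n::finite \<Rightarrow> (real^'n \<Rightarrow> real) \<Rightarrow> (real^'n \<Rightarrow> real) \<Rightarrow> bool" where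
  "has_partial j F F' \<longleftrightarrow> continuous_on UNIV F \<and> continuous_on UNIV F' \<and>
     (\<forall>x. ((\<lambda>t. F (x + t *\<^sub>R axis j 1)) has_real_derivative F' x) (at 0))"

abbreviation upd :: "real^'n \<Rightarrow> 'n \<Rightarrow> real \<Rightarrow> real^'n" where
  "upd c j s \<equiv> (\<chi> k. if k = j then s else c $ k)"

lemma face_integral_upd:
  assumes "j \<in> I"
  shows "face_integral h p I (upd c j s) f =
    (LINT y:(\<Pi>\<^sub>E k\<in>- I. {p $ k .. p $ k + h})|(\<Pi>\<^sub>M k\<in>- I. lborel).
         f (\<chi> k. if k \<in> I - {j} then c $ k else if k = j then s else y k))"
  unfolding face_integral_def
  by (intro arg_cong2[where f="set_lebesgue_integral _"] ext arg_cong[where f=f] refl)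
     (use assms in \<open>auto simp: vec_eq_iff\<close>)

text \<open>Gauss's theorem in one direction: Fubini isolates the segment in direction
  \<open>j\<close>, and the fundamental theorem of calculus leaves the values at its end points,
  that is, on two opposite faces of codimension one higher.\<close>

lemma face_integral_partial:
  fixes F :: "real^'n \<Rightarrow> real"
  assumes F: "has_partial j F F'" and h: "0 \<le> h" and j: "j \<notin> I"
  shows "face_integral h p I c F' = 
    face_integral h p (insert j I) (upd c j (p $ j + h)) F - face_integral h p (insert j I) (upd c j (p $ j)) F"
proof -
  have cF: "continuous_on UNIV F" and cF': "continuous_on UNIV F'"
    and der: "\<And>x. ((\<lambda>t. F (x + t *\<^sub>R axis j 1)) has_real_derivative F' x) (at 0)"
    using F by (auto simp: has_partial_def)
  let ?z = "\<lambda>y s. (\<chi> k. if k \<in> I then c $ k else if k = j then s else y k) :: real^'n"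
  have FTC: "(LINT s:{p $ j .. p $ j + h}|lborel. F' (?z y s)) = F (?z y (p $ j + h)) - F (?z y (p $ j))" for y
    unfolding set_lebesgue_integral_def
  proof (rule integral_FTC_Icc)
    show "p $ j \<le> p $ j + h" using h by simp
    show "continuous_on {p $ j .. p $ j + h} (\<lambda>s. F' (?z y s))"
      by (rule continuous_on_compose2[OF cF' continuous_on_subset[OF continuous_on_face_map]]) auto
    fix s
    have eq: "?z y (t + s) = ?z y s + t *\<^sub>R axis j 1" for t
      using j by (auto simp: vec_eq_iff axis_def)
    have "((\<lambda>t. F (?z y (t + s))) has_real_derivative F' (?z y s)) (at 0)"
      unfolding eq by (rule der)
    then have "((\<lambda>s. F (?z y s)) has_real_derivative F' (?z y s)) (at s)"
      using DERIV_shift[of "\<lambda>s. F (?z y s)" "F' (?z y s)" 0 s] by simp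
    then show "((\<lambda>s. F (?z y s)) has_vector_derivative F' (?z y s)) (at s within {p $ j .. p $ j + h})"
      by (simp add: has_field_derivative_at_within has_real_derivative_iff_has_vector_derivative[symmetric])
  qed
  have I: "insert j I - {j} = I" using j by auto
  have int: "set_integrable (\<Pi>\<^sub>M k\<in>-insert j I. lborel) (\<Pi>\<^sub>E k\<in>-insert j I. {p $ k .. p $ k + h})
     (\<lambda>y. F (?z y s))" for s
  proof -
    have "(\<lambda>y. F (\<chi> k. if k \<in> insert j I then upd c j s $ k else y k)) = (\<lambda>y. F (?z y s))"
      using j by (intro ext arg_cong[where f=F]) (auto simp: vec_eq_iff)
    then show ?thesis using face_integrable[OF cF h, of "insert j I" p "upd c j s"] by simp
  qed
  have "face_integral h p I c F' = 
      (LINT y:(\<Pi>\<^sub>E k\<in>- insert j I. {p $ k .. p $ k + h})|(\<Pi>\<^sub>M k\<in>- insert j I. lborel).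
         F (?z y (p $ j + h)) - F (?z y (p $ j)))"
    by (simp add: face_integral_Fubini[OF cF' h j] FTC)
  also have "\<dots> = face_integral h p (insert j I) (upd c j (p $ j + h)) F - face_integral h p (insert j I) (upd c j (p $ j)) F"
    by (simp add: face_integral_upd I set_integral_diff int)
  finally show ?thesis .
qed

lemma face_integral_cong:
  assumes "\<And>x. (\<And>k. k \<in> I \<Longrightarrow> x $ k = c $ k) \<Longrightarrow> f x = g x"
  shows "face_integral h p I c f = face_integral h p I c g"
  unfolding face_integral_def
  by (intro arg_cong2[where f="set_lebesgue_integral _"] ext refl assms) auto

lemma face_integral_const:
  fixes p :: "real^'n"
  assumes "0 \<le> h"
  shows "face_integral h p I c (\<lambda>x. r) = r * h ^ (CARD('n) - card I)"
  using assms
  by (simp add: face_integral_def set_lebesgue_integral_def measure_def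
      emeasure_face_box face_box_sets Compl_eq_Diff_UNIV card_Diff_subset)

lemma face_integral_mult:
  "face_integral h p I c (\<lambda>x. r * f x) = r * face_integral h p I c f"
  by (simp add: face_integral_def)

lemma has_partial_mult:
  assumes "has_partial j F F'" "has_partial j G G'"
  shows "has_partial j (\<lambda>x. F x * G x) (\<lambda>x. F' x * G x + F x * G' x)"
proof -
  have "((\<lambda>t. F (x + t *\<^sub>R axis j 1) * G (x + t *\<^sub>R axis j 1)) has_real_derivative F' x * G x + F x * G' x) (at 0)" for x
  proof -
    have "((\<lambda>t. F (x + t *\<^sub>R axis j 1)) has_real_derivative F' x) (at 0)" 
      "((\<lambda>t. G (x + t *\<^sub>R axis j 1)) has_real_derivative G' x) (at 0)" using assms by (auto simp: has_partial_def)
    from DERIV_mult[OF this] show ?thesis by (simp add: mult.commute add.commute)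
  qed
  then show ?thesis using assms by (auto simp: has_partial_def intro!: continuous_intros)
qed

lemma has_partial_add:
  assumes "has_partial j F F'" "has_partial j G G'"
  shows "has_partial j (\<lambda>x. F x + G x) (\<lambda>x. F' x + G' x)"
  using assms by (auto simp: has_partial_def intro!: continuous_intros DERIV_add)

lemma has_partial_coord:
  fixes j :: "'n::finite"
  assumes "\<And>s. (f has_real_derivative f' s) (at s)" "continuous_on UNIV f'"
  shows "has_partial j (\<lambda>x. f (x $ j)) (\<lambda>x. f' (x $ j))"
proof -
  have "((\<lambda>t. f ((x + t *\<^sub>R axis j 1) $ j)) has_real_derivative f' (x $ j)) (at 0)" for x
    using assms(1)[of "x $ j"] DERIV_shift[of f "f' (x $ j)" 0 "x $ j"] by (simp add: add.commute axis_def)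
  moreover have "continuous_on UNIV f" 
    using assms(1) by (meson DERIV_continuous_on has_field_derivative_at_within)
  ultimately show ?thesis
    by (auto simp: has_partial_def intro!: continuous_on_compose2[of UNIV f] continuous_on_compose2[of UNIV f'] assms continuous_intros)
qed

lemma has_partial_indep:
  assumes "\<And>x t. G (x + t *\<^sub>R axis j 1) = G x" "continuous_on UNIV G"
  shows "has_partial j G (\<lambda>x. 0)"
  using assms by (auto simp: has_partial_def)

text \<open>The trace on a face is a volume integral: integrate the derivative of \<open>\<phi>\<close> times the
  affine function which vanishes on the opposite face.\<close>

lemma face_integral_trace:
  fixes F :: "real^'n \<Rightarrow> real"
  assumes F: "has_partial j F F'" and h: "0 < h" and j: "j \<notin> I" and c: "c $ j \<in> {p $ j, p $ j + h}"
  shows "h * face_integral h p (insert j I) c F = 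
     face_integral h p I c (\<lambda>x. F x + (x $ j - (2 * p $ j + h - c $ j)) * F' x)"
proof -
  \<comment> \<open>The coordinate of the opposite face: the coordinates of the two faces add up to
    \<open>2 * p $ j + h\<close>.\<close>
  let ?c = "2 * p $ j + h - c $ j"
  have "has_partial j (\<lambda>x. x $ j - ?c) (\<lambda>x. 1)"
    by (rule has_partial_coord[where f = "\<lambda>s. s - ?c" and f' = "\<lambda>s. 1"]) (auto intro!: derivative_eq_intros)
  then have "has_partial j (\<lambda>x. (x $ j - ?c) * F x) (\<lambda>x. 1 * F x + (x $ j - ?c) * F' x)"
    by (rule has_partial_mult[OF _ F])
  from face_integral_partial[OF this _ j, of h p c] h
  have eq: "face_integral h p I c (\<lambda>x. F x + (x $ j - ?c) * F' x) =
     face_integral h p (insert j I) (upd c j (p $ j + h)) (\<lambda>x. (x $ j - ?c) * F x)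
     - face_integral h p (insert j I) (upd c j (p $ j)) (\<lambda>x. (x $ j - ?c) * F x)"
    by simp
  have "face_integral h p (insert j I) (upd c j s) (\<lambda>x. (x $ j - ?c) * F x) =
     (s - ?c) * face_integral h p (insert j I) (upd c j s) F" for s
    by (subst face_integral_mult[symmetric], rule face_integral_cong) auto
  note eq = eq[unfolded this]
  have up: "upd c j (c $ j) = c" by (simp add: vec_eq_iff)
  from c show ?thesis
  proof
    assume 1: "c $ j = p $ j"
    with up have "upd c j (p $ j) = c" by metis
    with eq 1 show ?thesis by simp
  next
    assume "c $ j \<in> {p $ j + h}"
    then have 1: "c $ j = p $ j + h" by simp
    with up have "upd c j (p $ j + h) = c" by metis
    with eq 1 show ?thesis by simp
  qed
qed

section \<open>Square-integrable functions\<close>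

text \<open>Subsets of null sets are already measurable for the completed measure, and restriction
  to \<open>S\<close> keeps this. Hence changes almost everywhere preserve measurability, and with
  it membership in \<open>L2\<close>.\<close>

lemma complete_measure_lebesgue_on:
  assumes "S \<in> sets lebesgue"
  shows "complete_measure (lebesgue_on S)"
proof
  fix A B :: "'a set" assume "B \<subseteq> A" "A \<in> null_sets (lebesgue_on S)"
  then have "A \<in> null_sets lebesgue" "A \<subseteq> S" using assms by (auto simp: null_sets_restrict_space)
  with \<open>B \<subseteq> A\<close> have "B \<in> null_sets lebesgue" "B \<subseteq> S"
    using negligible_iff_null_sets negligible_subset by blast+
  then show "B \<in> sets (lebesgue_on S)" using assms
    by (simp add: null_setsD2 sets_restrict_space_iff)
qed

lemma borel_measurable_lebesgue_on_AE:
  assumes S: "S \<in> sets lebesgue" and g: "g \<in> borel_measurable (lebesgue_on S)"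
    and ae: "AE x in lebesgue_on S. f x = g x"
  shows "f \<in> borel_measurable (lebesgue_on S)"
proof (rule measurableI)
  interpret complete_measure "lebesgue_on S" by (rule complete_measure_lebesgue_on[OF S])
  fix A :: "'b set" assume "A \<in> sets borel"
  then have "g -` A \<inter> space (lebesgue_on S) \<in> sets (lebesgue_on S)" by (rule measurable_sets[OF g])
  then show "f -` A \<inter> space (lebesgue_on S) \<in> sets (lebesgue_on S)"
    by (rule in_sets_AE[rotated]) (use ae in \<open>auto\<close>)
qed auto

text \<open>The mesh is formulated with closed cells and the calculus of test functions with open
  ones; the two differ by a null set, and integrals may be read over either.\<close>

lemma lebesgue_on_null_diff:
  fixes f :: "'a::euclidean_space \<Rightarrow> 'b::euclidean_space"
  assumes S: "S \<in> sets lebesgue" "T \<in> sets lebesgue" and ST: "S \<subseteq> T" and null: "T - S \<in> null_sets lebesgue"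
  shows "f \<in> borel_measurable (lebesgue_on T) \<longleftrightarrow> f \<in> borel_measurable (lebesgue_on S)" (is ?m)
    and "integrable (lebesgue_on T) f \<longleftrightarrow> integrable (lebesgue_on S) f" (is ?i)
    and "(LINT x|lebesgue_on T. f x) = (LINT x|lebesgue_on S. f x)" (is ?e)
proof -
  let ?f = "\<lambda>S x. if x \<in> S then f x else 0"
  have null': "AE x in lebesgue. x \<notin> T - S" by (rule AE_not_in[OF null])
  have ae: "AE x in lebesgue. ?f T x = ?f S x"
    using null' by eventually_elim (use ST in auto)
  have ae': "AE x in lebesgue. ?f S x = ?f T x"
    using null' by eventually_elim (use ST in auto)
  have L: "lebesgue_on UNIV = (lebesgue::'a measure)" by (rule lebesgue_on_UNIV_eq)
  have U: "(UNIV::'a set) \<in> sets lebesgue" by simp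
  have m: "?f T \<in> borel_measurable lebesgue \<longleftrightarrow> ?f S \<in> borel_measurable lebesgue"
    using borel_measurable_lebesgue_on_AE[OF U, of "?f S" "?f T"]
      borel_measurable_lebesgue_on_AE[OF U, of "?f T" "?f S"] ae ae' unfolding L by blast
  then show ?m using S by (simp add: borel_measurable_if)
  show ?i
    unfolding Lebesgue_Measure.integrable_restrict_UNIV[OF S(1), symmetric] Lebesgue_Measure.integrable_restrict_UNIV[OF S(2), symmetric]
    using m ae ae' integrable_cong_AE_imp[of lebesgue "?f T" "?f S"] integrable_cong_AE_imp[of lebesgue "?f S" "?f T"]
      borel_measurable_integrable[of lebesgue "?f T"] borel_measurable_integrable[of lebesgue "?f S"] by blast
  show ?e
    unfolding Lebesgue_Measure.integral_restrict_UNIV[OF S(1), symmetric] Lebesgue_Measure.integral_restrict_UNIV[OF S(2), symmetric]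
  proof (cases "?f S \<in> borel_measurable lebesgue")
    case True
    then show "integral\<^sup>L lebesgue (?f T) = integral\<^sup>L lebesgue (?f S)"
      using m ae by (intro integral_cong_AE) auto
  next
    \<comment> \<open>Without measurability neither function is integrable, and both integrals take
      the default value 0.\<close>
    case False
    then have "\<not> integrable lebesgue (?f S)" "\<not> integrable lebesgue (?f T)"
      using m borel_measurable_integrable by blast+
    then show "integral\<^sup>L lebesgue (?f T) = integral\<^sup>L lebesgue (?f S)"
      using not_integrable_integral_eq[of lebesgue "?f S"] not_integrable_integral_eq[of lebesgue "?f T"] by presburger
  qed
qed

text \<open>Open cells of a mesh are disjoint and carry test functions of their own; being boxes,
  they fall under the results on weak derivatives over subboxes.\<close>

definition ocell :: "real \<Rightarrow> real^'n \<Rightarrow> (real^'n) set" where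
  "ocell h p = box p (\<chi> i. p $ i + h)"

lemma ocell_sets_lebesgue [simp]: "ocell h p \<in> sets lebesgue" by (simp add: ocell_def)

lemma ocell_lmeasurable [simp]: "ocell h p \<in> lmeasurable" by (simp add: ocell_def)

lemma mem_ocell: "x \<in> ocell h p \<longleftrightarrow> (\<forall>i. p $ i < x $ i \<and> x $ i < p $ i + h)"
  by (simp add: ocell_def mem_box_cart)

lemma ocell_subset_cell: "ocell h p \<subseteq> cell h p"
  by (simp add: ocell_def cell_def box_subset_cbox)

lemma cell_diff_ocell: "cell h p - ocell h p \<in> null_sets lebesgue"
  unfolding cell_def ocell_def negligible_iff_null_sets[symmetric]
  by (rule negligible_frontier_interval)

lemmas cell_ocell = lebesgue_on_null_diff[OF ocell_sets_lebesgue cell_sets_lebesgue ocell_subset_cell cell_diff_ocell]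

lemma AE_lebesgue_on_subset:
  assumes "S \<in> sets lebesgue" "T \<in> sets lebesgue" "S \<subseteq> T" "AE x in lebesgue_on T. P x"
  shows "AE x in lebesgue_on S. P x"
proof -
  have "AE x in lebesgue. x \<in> T \<longrightarrow> P x" using assms by (simp add: AE_restrict_space_iff)
  then have "AE x in lebesgue. x \<in> S \<longrightarrow> P x" by eventually_elim (use assms(3) in auto)
  then show ?thesis using assms by (simp add: AE_restrict_space_iff)
qed

lemma measure_ocell: "0 \<le> h \<Longrightarrow> measure lebesgue (ocell h (p::real^'n)) = h ^ CARD('n)"
proof -
  assume h: "0 \<le> h"
  have "(\<Prod>b\<in>Basis. ((\<chi> i. p $ i + h) - p) \<bullet> b) = (\<Prod>k\<in>(UNIV::'n set). h)"
    by (simp add: Basis_vec_def UNION_singleton_eq_range prod.reindex axis_eq_axis inj_on_def inner_axis)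
  then show ?thesis using h unfolding ocell_def
    by (auto simp: measure_lborel_box_eq Basis_vec_def inner_axis measure_completion)
qed

lemma integrable_lebesgue_on_subset:
  fixes f :: "'a::euclidean_space \<Rightarrow> 'b::euclidean_space"
  assumes "integrable (lebesgue_on T) f" "S \<subseteq> T" "S \<in> sets lebesgue" "T \<in> sets lebesgue"
  shows "integrable (lebesgue_on S) f"
  using set_integrable_subset[of lebesgue T f S] assms
  by (simp add: set_integrable_def integrable_restrict_space)

lemma measurable_lebesgue_on_subset:
  assumes "f \<in> borel_measurable (lebesgue_on T)" "S \<subseteq> T"
  shows "f \<in> borel_measurable (lebesgue_on S)"
  using measurable_restrict_mono assms by blast

section \<open>Closure properties of L2\<close>

lemma L2D:
  assumes "f \<in> L2 S"
  shows "f \<in> borel_measurable (lebesgue_on S)" "integrable (lebesgue_on S) (\<lambda>x. (norm (f x))\<^sup>2)"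
  using assms by (auto simp: L2_def)

lemma L2_real_iff: "(f::_\<Rightarrow>real) \<in> L2 S \<longleftrightarrow> f \<in> borel_measurable (lebesgue_on S) \<and> integrable (lebesgue_on S) (\<lambda>x. (f x)\<^sup>2)"
  by (simp add: L2_def)

lemma L2_subset:
  assumes "f \<in> L2 T" "S \<subseteq> T" "S \<in> sets lebesgue" "T \<in> sets lebesgue"
  shows "f \<in> L2 S"
  using assms integrable_lebesgue_on_subset[of T "\<lambda>x. (norm (f x))\<^sup>2" S]
  by (auto simp: L2_def intro: measurable_lebesgue_on_subset)

lemma L2_dominated:
  assumes "f \<in> L2 S" "g \<in> borel_measurable (lebesgue_on S)" "\<And>x. x \<in> S \<Longrightarrow> norm (g x) \<le> B * norm (f x)"
  shows "g \<in> L2 S"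
proof -
  have "integrable (lebesgue_on S) (\<lambda>x. B\<^sup>2 * (norm (f x))\<^sup>2)" using L2D(2)[OF assms(1)] by simp
  then have "integrable (lebesgue_on S) (\<lambda>x. (norm (g x))\<^sup>2)"
  proof (rule Bochner_Integration.integrable_bound)
    show "AE x in lebesgue_on S. norm ((norm (g x))\<^sup>2) \<le> norm (B\<^sup>2 * (norm (f x))\<^sup>2)"
    proof (rule AE_I2)
      fix x assume "x \<in> space (lebesgue_on S)"
      then have "norm (g x) \<le> B * norm (f x)" using assms(3) by simp
      then have "(norm (g x))\<^sup>2 \<le> (B * norm (f x))\<^sup>2" by (intro power_mono) auto
      then show "norm ((norm (g x))\<^sup>2) \<le> norm (B\<^sup>2 * (norm (f x))\<^sup>2)" by (simp add: power_mult_distrib)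
    qed
  qed (use assms(2) in measurable)
  then show ?thesis using assms(2) by (simp add: L2_def)
qed

lemma L2_add [intro]:
  assumes "f \<in> L2 S" "g \<in> L2 S"
  shows "(\<lambda>x. f x + g x) \<in> L2 S"
proof -
  note [measurable] = assms[THEN L2D(1)]
  have "integrable (lebesgue_on S) (\<lambda>x. 2 * (norm (f x))\<^sup>2 + 2 * (norm (g x))\<^sup>2)"
    using assms[THEN L2D(2)] by simp
  then have "integrable (lebesgue_on S) (\<lambda>x. (norm (f x + g x))\<^sup>2)"
  proof (rule Bochner_Integration.integrable_bound)
    show "AE x in lebesgue_on S. norm ((norm (f x + g x))\<^sup>2) \<le> norm (2 * (norm (f x))\<^sup>2 + 2 * (norm (g x))\<^sup>2)"
    proof (rule AE_I2)
      fix x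
      have "(norm (f x + g x))\<^sup>2 \<le> (norm (f x) + norm (g x))\<^sup>2" by (intro power_mono norm_triangle_ineq) auto
      also have "\<dots> \<le> 2 * (norm (f x))\<^sup>2 + 2 * (norm (g x))\<^sup>2"
        using sum_squares_bound[of "norm (f x)" "norm (g x)"] by (simp add: power2_sum)
      finally show "norm ((norm (f x + g x))\<^sup>2) \<le> norm (2 * (norm (f x))\<^sup>2 + 2 * (norm (g x))\<^sup>2)" by simp
    qed
  qed measurable
  then show ?thesis using assms by (auto simp: L2_def)
qed

lemma L2_scaleR [intro]: "f \<in> L2 S \<Longrightarrow> (\<lambda>x. r *\<^sub>R f x) \<in> L2 S"
  by (rule L2_dominated[where B="\<bar>r\<bar>"]) (auto dest: L2D(1))

lemma L2_cmult [intro]: "f \<in> L2 S \<Longrightarrow> (\<lambda>x. r * f x :: real) \<in> L2 S"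
  using L2_scaleR[of f S r] by simp

lemma L2_uminus [intro]: "f \<in> L2 S \<Longrightarrow> (\<lambda>x. - f x) \<in> L2 S"
  using L2_scaleR[of f S "-1"] by simp

lemma L2_diff [intro]: "f \<in> L2 S \<Longrightarrow> g \<in> L2 S \<Longrightarrow> (\<lambda>x. f x - g x) \<in> L2 S"
  using L2_add[of f S "\<lambda>x. - g x"] by auto

lemma L2_zero [simp]: "(\<lambda>x. 0) \<in> L2 S" by (simp add: L2_def)

lemma L2_sum [intro]: "(\<And>i. i \<in> A \<Longrightarrow> f i \<in> L2 S) \<Longrightarrow> (\<lambda>x. \<Sum>i\<in>A. f i x) \<in> L2 S"
  by (induction A rule: infinite_finite_induct) auto

lemma L2_bounded:
  assumes "g \<in> borel_measurable (lebesgue_on S)" "S \<in> lmeasurable" "\<And>x. x \<in> S \<Longrightarrow> norm (g x) \<le> B"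
  shows "g \<in> L2 S"
proof (rule L2_dominated[where f="\<lambda>x. 1::real" and B=B])
  interpret finite_measure "lebesgue_on S" by (rule finite_measure_lebesgue_on[OF assms(2)])
  show "(\<lambda>x. 1::real) \<in> L2 S" by (simp add: L2_def)
qed (use assms in auto)

lemma L2_const [simp]: "S \<in> lmeasurable \<Longrightarrow> (\<lambda>x. c) \<in> L2 S"
  by (rule L2_bounded[where B="norm c"]) auto

lemma L2_scaleR_bounded:
  assumes "f \<in> L2 S" "g \<in> borel_measurable (lebesgue_on S)" "\<And>x. x \<in> S \<Longrightarrow> \<bar>g x\<bar> \<le> B"
  shows "(\<lambda>x. g x *\<^sub>R f x) \<in> L2 S"
  by (rule L2_dominated[OF assms(1), where B=B]) (use assms L2D(1)[OF assms(1)] in \<open>auto intro!: mult_right_mono\<close>)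

lemma L2_continuous:
  fixes g :: "real^'n \<Rightarrow> 'c::euclidean_space"
  assumes "continuous_on UNIV g" "bounded S" "S \<in> sets lebesgue"
  shows "g \<in> L2 S"
proof -
  have "compact (g ` closure S)"
    by (intro compact_continuous_image continuous_on_subset[OF assms(1)]) (use assms in auto)
  then obtain B where B: "\<And>x. x \<in> closure S \<Longrightarrow> norm (g x) \<le> B"
    by (force dest!: compact_imp_bounded simp: bounded_iff)
  show ?thesis
  proof (rule L2_bounded)
    have "g \<in> borel_measurable borel" using assms(1) by (rule borel_measurable_continuous_onI)
    then have "g \<in> borel_measurable lebesgue" by (simp add: measurable_completion)
    then show "g \<in> borel_measurable (lebesgue_on S)" by (rule measurable_restrict_space1)
    show "S \<in> lmeasurable" using assms(2,3) by (simp add: bounded_set_imp_lmeasurable)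
    show "\<And>x. x \<in> S \<Longrightarrow> norm (g x) \<le> B" using B closure_subset by blast
  qed
qed

lemma L2_AE:
  assumes "f \<in> L2 S" "S \<in> sets lebesgue" "AE x in lebesgue_on S. g x = f x"
  shows "g \<in> L2 S"
proof -
  have g: "g \<in> borel_measurable (lebesgue_on S)"
    by (rule borel_measurable_lebesgue_on_AE[OF assms(2) L2D(1)[OF assms(1)] assms(3)])
  moreover have "integrable (lebesgue_on S) (\<lambda>x. (norm (g x))\<^sup>2)"
  proof (rule integrable_cong_AE_imp[OF L2D(2)[OF assms(1)]])
    show "AE x in lebesgue_on S. (norm (f x))\<^sup>2 = (norm (g x))\<^sup>2" using assms(3) by eventually_elim simp
  qed (use g in measurable)
  ultimately show ?thesis by (simp add: L2_def)
qed

lemma L2_nth [intro]: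
  fixes f :: "real^'n \<Rightarrow> 'c::euclidean_space^'m"
  shows "f \<in> L2 S \<Longrightarrow> (\<lambda>x. f x $ i) \<in> L2 S"
proof (rule L2_dominated[where f=f and B=1])
  assume f: "f \<in> L2 S"
  have "(\<lambda>v::'c^'m. v $ i) \<in> borel_measurable borel"
    by (intro borel_measurable_continuous_onI continuous_intros)
  from measurable_compose[OF L2D(1)[OF f] this] show "(\<lambda>x. f x $ i) \<in> borel_measurable (lebesgue_on S)" .
qed (simp_all add: Finite_Cartesian_Product.norm_nth_le)

lemma L2_vecI:
  fixes f :: "real^'n \<Rightarrow> 'c::euclidean_space^'m"
  assumes "\<And>i. (\<lambda>x. f x $ i) \<in> L2 S"
  shows "f \<in> L2 S"
proof -
  have "(\<lambda>x. \<Sum>i\<in>UNIV. axis i (f x $ i)) \<in> L2 S"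
  proof (rule L2_sum)
    fix i
    have c: "continuous_on UNIV (axis i :: 'c \<Rightarrow> 'c^'m)"
    proof -
      have "continuous_on UNIV (\<lambda>v::'c. if k = i then v else 0)" for k :: 'm by (cases "k = i") auto
      then show ?thesis unfolding axis_def by (intro continuous_on_vec_lambda)
    qed
    show "(\<lambda>x. axis i (f x $ i)) \<in> L2 S"
    proof (rule L2_dominated[where B=1, OF assms[of i]])
      show "(\<lambda>x. axis i (f x $ i) :: 'c^'m) \<in> borel_measurable (lebesgue_on S)"
        by (rule measurable_compose[OF L2D(1)[OF assms[of i]] borel_measurable_continuous_onI[OF c]])
    qed (simp add: norm_eq_sqrt_inner inner_axis_axis)
  qed
  moreover have "(\<lambda>x. \<Sum>i\<in>UNIV. axis i (f x $ i)) = f"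
    by (auto simp: vec_eq_iff axis_def fun_eq_iff sum.delta)
  ultimately show ?thesis by simp
qed

lemma L2_inner_integrable:
  fixes f g :: "real^'n \<Rightarrow> 'c::euclidean_space"
  assumes "f \<in> L2 S" "g \<in> L2 S"
  shows "integrable (lebesgue_on S) (\<lambda>x. f x \<bullet> g x)"
proof -
  note [measurable] = assms[THEN L2D(1)]
  have "integrable (lebesgue_on S) (\<lambda>x. (norm (f x))\<^sup>2 + (norm (g x))\<^sup>2)"
    using assms[THEN L2D(2)] by simp
  then show ?thesis
  proof (rule Bochner_Integration.integrable_bound)
    show "AE x in lebesgue_on S. norm (f x \<bullet> g x) \<le> norm ((norm (f x))\<^sup>2 + (norm (g x))\<^sup>2)"
    proof (rule AE_I2)
      fix x
      have "\<bar>f x \<bullet> g x\<bar> \<le> norm (f x) * norm (g x)" by (rule Cauchy_Schwarz_ineq2)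
      also have "\<dots> \<le> (norm (f x))\<^sup>2 + (norm (g x))\<^sup>2"
        using sum_squares_bound[of "norm (f x)" "norm (g x)"] mult_nonneg_nonneg[OF norm_ge_zero[of "f x"] norm_ge_zero[of "g x"]]
        by linarith
      finally show "norm (f x \<bullet> g x) \<le> norm ((norm (f x))\<^sup>2 + (norm (g x))\<^sup>2)" by simp
    qed
  qed measurable
qed

lemma L2_mult_integrable:
  fixes f g :: "real^'n \<Rightarrow> real"
  assumes "f \<in> L2 S" "g \<in> L2 S"
  shows "integrable (lebesgue_on S) (\<lambda>x. f x * g x)"
  using L2_inner_integrable[OF assms] by simp

lemma L2_integrable:
  fixes f :: "real^'n \<Rightarrow> 'c::euclidean_space"
  assumes "f \<in> L2 S" "S \<in> lmeasurable"
  shows "integrable (lebesgue_on S) f"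
proof -
  interpret finite_measure "lebesgue_on S" by (rule finite_measure_lebesgue_on[OF assms(2)])
  have "integrable (lebesgue_on S) (\<lambda>x. (norm (f x))\<^sup>2 + 1)"
    using assms(1)[THEN L2D(2)] by simp
  then show ?thesis
  proof (rule Bochner_Integration.integrable_bound)
    show "AE x in lebesgue_on S. norm (f x) \<le> norm ((norm (f x))\<^sup>2 + 1)"
    proof (rule AE_I2)
      fix x
      show "norm (f x) \<le> norm ((norm (f x))\<^sup>2 + 1)"
        using sum_squares_bound[of "norm (f x)" 1] norm_ge_zero[of "f x"]
        unfolding real_norm_def by (simp del: norm_ge_zero; linarith)
    qed
  qed (use L2D[OF assms(1)] in auto)
qed

section \<open>Squared norms, Cauchy-Schwarz and Young\<close>

definition sq :: "(real^'n) set \<Rightarrow> (real^'n \<Rightarrow> real) \<Rightarrow> real" where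
  "sq S f = (LINT x|lebesgue_on S. (f x)\<^sup>2)"

lemma sq_nonneg [simp]: "0 \<le> sq S f" by (simp add: sq_def)

lemma L2_sq_integrable: "f \<in> L2 S \<Longrightarrow> integrable (lebesgue_on S) (\<lambda>x. (f x :: real)\<^sup>2)"
  by (simp add: L2_real_iff)

lemma sq_uminus: "sq S (\<lambda>x. - f x) = sq S f" by (simp add: sq_def)

lemma sq_add_le:
  assumes "f \<in> L2 S" "g \<in> L2 S"
  shows "sq S (\<lambda>x. f x + g x) \<le> 2 * sq S f + 2 * sq S g"
proof -
  have "sq S (\<lambda>x. f x + g x) \<le> (LINT x|lebesgue_on S. 2 * (f x)\<^sup>2 + 2 * (g x)\<^sup>2)"
    unfolding sq_def
  proof (rule integral_mono)
    show "integrable (lebesgue_on S) (\<lambda>x. (f x + g x)\<^sup>2)"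
      using L2_sq_integrable[OF L2_add[OF assms]] .
    show "integrable (lebesgue_on S) (\<lambda>x. 2 * (f x)\<^sup>2 + 2 * (g x)\<^sup>2)"
      using assms by (simp add: L2_sq_integrable)
    fix x
    show "(f x + g x)\<^sup>2 \<le> 2 * (f x)\<^sup>2 + 2 * (g x)\<^sup>2"
      using sum_squares_bound[of "f x" "g x"] by (simp add: power2_sum)
  qed
  also have "\<dots> = 2 * sq S f + 2 * sq S g" using assms by (simp add: L2_sq_integrable sq_def)
  finally show ?thesis .
qed

lemma sq_diff_le:
  assumes "f \<in> L2 S" "g \<in> L2 S"
  shows "sq S (\<lambda>x. f x - g x) \<le> 2 * sq S f + 2 * sq S g"
  using sq_add_le[OF assms(1) L2_uminus[OF assms(2)]] by (simp add: sq_uminus)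

lemma sq_mono_set:
  assumes "f \<in> L2 T" "S \<subseteq> T" "S \<in> sets lebesgue" "T \<in> sets lebesgue"
  shows "sq S f \<le> sq T f"
  unfolding sq_def by (rule integral_mono_lebesgue_on_AE) (use assms in \<open>auto simp: L2_sq_integrable\<close>)

lemma sq_bounded:
  assumes "f \<in> L2 S" "S \<in> lmeasurable" "\<And>x. x \<in> S \<Longrightarrow> \<bar>f x\<bar> \<le> B"
  shows "sq S f \<le> B\<^sup>2 * measure lebesgue S"
proof -
  interpret finite_measure "lebesgue_on S" by (rule finite_measure_lebesgue_on[OF assms(2)])
  have "sq S f \<le> (LINT x|lebesgue_on S. B\<^sup>2)"
    unfolding sq_def
  proof (rule integral_mono)
    show "\<And>x. x \<in> space (lebesgue_on S) \<Longrightarrow> (f x)\<^sup>2 \<le> B\<^sup>2" by (rule power2_le_iff_abs_le[THEN iffD2]) (use assms(3) in \<open>force+\<close>)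
  qed (use assms in \<open>auto simp: L2_sq_integrable\<close>)
  also have "\<dots> = B\<^sup>2 * measure lebesgue S" using assms(2)
    by (simp add: measure_restrict_space fmeasurableD)
  finally show ?thesis .
qed

text \<open>The squared norm of r f - t g is a nonnegative quadratic form in r and t; it is
  evaluated at r = \<open>sq S g\<close> and t equal to the integral of the product.\<close>

lemma L2_Cauchy_Schwarz:
  assumes "f \<in> L2 S" "g \<in> L2 S"
  shows "(LINT x|lebesgue_on S. f x * g x)\<^sup>2 \<le> sq S f * sq S g"
proof -
  let ?C = "LINT x|lebesgue_on S. f x * g x"
  have q: "0 \<le> r\<^sup>2 * sq S f - 2 * r * t * ?C + t\<^sup>2 * sq S g" for r t :: real
  proof -
    have "0 \<le> sq S (\<lambda>x. r * f x - t * g x)" by simp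
    also have "\<dots> = (LINT x|lebesgue_on S. r\<^sup>2 * (f x)\<^sup>2 - (2 * r * t) * (f x * g x) + t\<^sup>2 * (g x)\<^sup>2)"
      unfolding sq_def by (intro Bochner_Integration.integral_cong) (auto simp: power2_eq_square algebra_simps)
    also have "\<dots> = r\<^sup>2 * sq S f - 2 * r * t * ?C + t\<^sup>2 * sq S g"
      using assms by (simp add: L2_sq_integrable L2_mult_integrable sq_def)
    finally show ?thesis .
  qed
  show ?thesis
  proof (cases "sq S g = 0")
    case False
    with sq_nonneg[of S g] have pos: "0 < sq S g" by linarith
    from q[of "sq S g" ?C] have "0 \<le> sq S g * (sq S g * sq S f - ?C\<^sup>2)"
      by (simp add: power2_eq_square algebra_simps)
    with pos show ?thesis by (simp add: zero_le_mult_iff mult.commute)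
  next
    case True
    have "?C = 0"
    proof (rule ccontr)
      assume "?C \<noteq> 0"
      \<comment> \<open>When \<open>sq S g\<close> is zero the form is affine in its second
        argument; this value makes it equal to -1.\<close>
      with q[of 1 "(sq S f + 1) / (2 * ?C)"] True show False by simp
    qed
    with True show ?thesis by simp
  qed
qed

lemma integral_L2_square_le:
  assumes "f \<in> L2 S" "S \<in> lmeasurable"
  shows "(LINT x|lebesgue_on S. f x)\<^sup>2 \<le> measure lebesgue S * sq S f"
proof -
  have "sq S (\<lambda>x. 1) = measure lebesgue S"
    using assms(2) by (simp add: sq_def measure_restrict_space fmeasurableD)
  with L2_Cauchy_Schwarz[OF assms(1) L2_const[OF assms(2), of 1]] show ?thesis by (simp add: mult.commute)
qed

text \<open>Nonnegativity of (s f - g)^2 + (s f)^2 + g^2 gives a bound without fractional constants.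
  The parameter \<open>s\<close> stays free through the consistency estimates, since the proper
  choice depends on what has to be absorbed at the end.\<close>

lemma L2_Young:
  assumes "f \<in> L2 S" "g \<in> L2 S" "0 < s"
  shows "(LINT x|lebesgue_on S. f x * g x) \<le> s * sq S f + sq S g / s"
proof -
  have "(LINT x|lebesgue_on S. f x * g x) \<le> (LINT x|lebesgue_on S. s * (f x)\<^sup>2 + (1/s) * (g x)\<^sup>2)"
  proof (rule integral_mono)
    fix x
    have "0 \<le> (s * f x - g x)\<^sup>2 + (s * f x)\<^sup>2 + (g x)\<^sup>2" by simp
    then have "s * (f x * g x) \<le> s * (s * (f x)\<^sup>2 + (1/s) * (g x)\<^sup>2)"
      using assms(3) by (simp add: power2_eq_square algebra_simps)
    then show "f x * g x \<le> s * (f x)\<^sup>2 + (1/s) * (g x)\<^sup>2" using assms(3) by simp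
  qed (use assms in \<open>auto simp: L2_sq_integrable L2_mult_integrable\<close>)
  also have "\<dots> = s * sq S f + sq S g / s" using assms by (simp add: L2_sq_integrable sq_def)
  finally show ?thesis .
qed

text \<open>By Cauchy-Schwarz, convergence in norm suffices against a fixed weight. This is how
  identities for smooth approximants pass to weak derivatives.\<close>

lemma sq_tendsto_integral:
  assumes "\<And>k. f k \<in> L2 S" "g \<in> L2 S" "\<theta> \<in> L2 S" "(\<lambda>k. sq S (\<lambda>x. f k x - g x)) \<longlonglongrightarrow> 0"
  shows "(\<lambda>k. LINT x|lebesgue_on S. f k x * \<theta> x) \<longlonglongrightarrow> (LINT x|lebesgue_on S. g x * \<theta> x)"
proof -
  have eq: "(LINT x|lebesgue_on S. (f k x - g x) * \<theta> x) =
     (LINT x|lebesgue_on S. f k x * \<theta> x) - (LINT x|lebesgue_on S. g x * \<theta> x)" for k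
    using assms by (simp add: left_diff_distrib L2_mult_integrable)
  have "(\<lambda>k. sqrt (sq S (\<lambda>x. f k x - g x) * sq S \<theta>)) \<longlonglongrightarrow> sqrt (0 * sq S \<theta>)"
    by (intro tendsto_intros assms)
  then have "(\<lambda>k. LINT x|lebesgue_on S. (f k x - g x) * \<theta> x) \<longlonglongrightarrow> 0"
  proof (intro Lim_null_comparison[where f="\<lambda>k. LINT x|lebesgue_on S. (f k x - g x) * \<theta> x"] always_eventually allI)
    fix k
    show "norm (LINT x|lebesgue_on S. (f k x - g x) * \<theta> x) \<le> sqrt (sq S (\<lambda>x. f k x - g x) * sq S \<theta>)"
      using real_sqrt_le_mono[OF L2_Cauchy_Schwarz[OF L2_diff[OF assms(1)[of k] assms(2)] assms(3)]] by simp
  qed simp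
  then show ?thesis unfolding eq by (simp add: LIM_zero_iff)
qed

section \<open>Test functions\<close>

text \<open>For \<open>P = 1\<close> this is the classical exp(-1/y) extended by zero. The
  polynomial in 1/y makes the family closed under differentiation.\<close>

definition flat :: "real poly \<Rightarrow> real \<Rightarrow> real" where
  "flat P y = (if 0 < y then poly P (1 / y) * exp (- 1 / y) else 0)"

lemma poly_exp_tendsto_0: "((\<lambda>t::real. poly P t * exp (- t)) \<longlongrightarrow> 0) at_top"
proof -
  have "((\<lambda>t. \<Sum>i\<le>degree P. coeff P i * (t ^ i / exp t)) \<longlongrightarrow> (\<Sum>i\<le>degree P. coeff P i * 0)) at_top"
    by (intro tendsto_intros tendsto_power_div_exp_0)
  then show ?thesis by (simp add: poly_altdef sum_distrib_right sum_divide_distrib exp_minus field_simps)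
qed

lemma flat_tendsto_0: "(flat P \<longlongrightarrow> 0) (at 0)"
proof (rule filterlim_split_at)
  have "((\<lambda>y. 0) \<longlongrightarrow> (0::real)) (at_left 0)" by simp
  then show "(flat P \<longlongrightarrow> 0) (at_left 0)"
    by (rule Lim_transform_eventually) (auto simp: flat_def eventually_at_filter)
  have "((\<lambda>y. poly P (inverse y) * exp (- inverse y)) \<longlongrightarrow> 0) (at_right (0::real))"
    by (rule filterlim_compose[OF poly_exp_tendsto_0 filterlim_inverse_at_top_right])
  then show "(flat P \<longlongrightarrow> 0) (at_right 0)"
    by (rule Lim_transform_eventually) (auto simp: flat_def eventually_at_filter field_simps)
qed

text \<open>With t = 1/y the derivative in y is -t^2 times the derivative in t, which turns P
  exp(-t) into t^2 (P - P') exp(-t).\<close>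

lemma flat_has_derivative:
  "(flat P has_real_derivative flat ([:0, 0, 1:] * (P - pderiv P)) y) (at y)"
proof -
  let ?Q = "[:0, 0, 1:] * (P - pderiv P)"
  consider "y < 0" | "y = 0" | "0 < y" by linarith
  then show ?thesis
  proof cases
    case 1
    have "((\<lambda>y. 0) has_real_derivative 0) (at y)" by simp
    then have "(flat P has_real_derivative 0) (at y)"
      by (rule has_field_derivative_transform_within_open[where S="{..<0}"]) (use 1 in \<open>auto simp: flat_def\<close>)
    then show ?thesis using 1 by (simp add: flat_def)
  next
    case 3
    have "((\<lambda>y. poly P (1 / y) * exp (- 1 / y)) has_real_derivative
       (poly (pderiv P) (1 / y) * (- 1 / y\<^sup>2)) * exp (- 1 / y) + poly P (1 / y) * (exp (- 1 / y) * (1 / y\<^sup>2))) (at y)"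
      using 3 by (auto intro!: derivative_eq_intros DERIV_chain2[OF poly_DERIV] simp: power2_eq_square divide_simps)
    also have "(poly (pderiv P) (1 / y) * (- 1 / y\<^sup>2)) * exp (- 1 / y) + poly P (1 / y) * (exp (- 1 / y) * (1 / y\<^sup>2))
       = flat ?Q y"
      using 3 by (simp add: flat_def power2_eq_square field_simps)
    finally show ?thesis
      by (rule has_field_derivative_transform_within_open[where S="{0<..}"]) (use 3 in \<open>auto simp: flat_def\<close>)
  next
    case 2
    \<comment> \<open>Dividing by the increment multiplies the polynomial in 1/y by its variable, so
      the difference quotient at 0 is \<open>flat (pCons 0 P)\<close>.\<close>
    have "((\<lambda>h. (flat P (0 + h) - flat P 0) / h) \<longlongrightarrow> 0) (at 0)"
      by (rule Lim_transform_eventually[OF flat_tendsto_0[of "pCons 0 P"]])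
         (auto simp: flat_def eventually_at_filter)
    then show ?thesis using 2 by (simp add: DERIV_def flat_def)
  qed
qed

text \<open>A class of functions closed under partial differentiation, which hence consists of smooth
  functions; it contains the polynomials and the bump functions.\<close>

inductive elementary :: "(real^'n \<Rightarrow> real) \<Rightarrow> bool" where
  const: "elementary (\<lambda>x. c)"
| coord: "elementary (\<lambda>x. x $ k)"
| flat: "elementary (\<lambda>x. flat P (c * x $ k + d))"
| add: "elementary f \<Longrightarrow> elementary g \<Longrightarrow> elementary (\<lambda>x. f x + g x)"
| mult: "elementary f \<Longrightarrow> elementary g \<Longrightarrow> elementary (\<lambda>x. f x * g x)"

lemma elementary_derivative:
  fixes f :: "real^'n \<Rightarrow> real"
  assumes "elementary f"
  shows "\<exists>f'. (\<forall>j. elementary (f' j)) \<and> (\<forall>x. (f has_derivative (\<lambda>v. \<Sum>j\<in>UNIV. f' j x * v $ j)) (at x))"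
  using assms
proof induction
  case (const c)
  show ?case by (rule exI[of _ "\<lambda>j x. 0"]) (auto intro: elementary.const)
next
  case (coord k)
  have "((\<lambda>x::real^'n. x $ k) has_derivative (\<lambda>v. \<Sum>j\<in>UNIV. (if j = k then 1 else 0) * v $ j)) (at x)" for x
    by (auto intro!: derivative_eq_intros bounded_linear.has_derivative[OF bounded_linear_vec_nth] simp: if_distrib[of "\<lambda>a. a * _"] cong: if_cong)
  then show ?case by (intro exI[of _ "\<lambda>j x. if j = k then 1 else 0"]) (auto intro: elementary.const)
next
  case (flat P c k d)
  let ?Q = "[:0, 0, 1:] * (P - pderiv P)"
  let ?f' = "\<lambda>j x. (if j = k then c else 0) * flat ?Q (c * x $ k + d)"
  have "((\<lambda>x::real^'n. flat P (c * x $ k + d)) has_derivative (\<lambda>v. \<Sum>j\<in>UNIV. ?f' j x * v $ j)) (at x)" for x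
  proof -
    have 1: "((\<lambda>x::real^'n. c * x $ k + d) has_derivative (\<lambda>v. c * v $ k)) (at x)"
      by (auto intro!: derivative_eq_intros bounded_linear.has_derivative[OF bounded_linear_vec_nth])
    have "(flat P has_derivative (\<lambda>u. flat ?Q (c * x $ k + d) * u)) (at (c * x $ k + d))"
      using flat_has_derivative unfolding has_field_derivative_def .
    from has_derivative_compose[OF 1 this] show ?thesis
      by (rule has_derivative_eq_rhs) (auto simp: if_distrib[of "\<lambda>a. a * _"] fun_eq_iff cong: if_cong)
  qed
  moreover have "elementary (?f' j)" for j by (intro elementary.mult elementary.const elementary.flat)
  ultimately show ?case by (intro exI[of _ ?f']) auto
next
  case (add f g)
  then obtain f' g' where *: "\<forall>j. elementary (f' j)" "\<forall>x. (f has_derivative (\<lambda>v. \<Sum>j\<in>UNIV. f' j x * v $ j)) (at x)"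
    "\<forall>j. elementary (g' j)" "\<forall>x. (g has_derivative (\<lambda>v. \<Sum>j\<in>UNIV. g' j x * v $ j)) (at x)" by auto
  have "((\<lambda>x. f x + g x) has_derivative (\<lambda>v. \<Sum>j\<in>UNIV. (f' j x + g' j x) * v $ j)) (at x)" for x
    using has_derivative_add[OF *(2)[rule_format] *(4)[rule_format], of x] by (simp add: algebra_simps sum.distrib)
  then show ?case using * by (intro exI[of _ "\<lambda>j x. f' j x + g' j x"]) (auto intro: elementary.add)
next
  case (mult f g)
  then obtain f' g' where *: "\<forall>j. elementary (f' j)" "\<forall>x. (f has_derivative (\<lambda>v. \<Sum>j\<in>UNIV. f' j x * v $ j)) (at x)"
    "\<forall>j. elementary (g' j)" "\<forall>x. (g has_derivative (\<lambda>v. \<Sum>j\<in>UNIV. g' j x * v $ j)) (at x)" by auto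
  have "((\<lambda>x. f x * g x) has_derivative (\<lambda>v. \<Sum>j\<in>UNIV. (f' j x * g x + f x * g' j x) * v $ j)) (at x)" for x
    using has_derivative_mult[OF *(2)[rule_format] *(4)[rule_format], of x] 
    by (simp add: algebra_simps sum.distrib sum_distrib_left)
  moreover have "elementary (\<lambda>x. f' j x * g x + f x * g' j x)" for j
    using * mult.hyps by (intro elementary.add elementary.mult) auto
  ultimately show ?case by (intro exI[of _ "\<lambda>j x. f' j x * g x + f x * g' j x"]) auto
qed

lemma elementary_partials: "elementary f \<Longrightarrow> elementary (partials is f)"
proof (induction "is")
  case (Cons i "is")
  then have "elementary (partials is f)" by simp
  from elementary_derivative[OF this] obtain f' where
    f': "\<forall>j. elementary (f' j)" "\<And>x. (partials is f has_derivative (\<lambda>v. \<Sum>j\<in>UNIV. f' j x * v $ j)) (at x)" by blast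
  have "frechet_derivative (partials is f) (at x) = (\<lambda>v. \<Sum>j\<in>UNIV. f' j x * v $ j)" for x
    using f'(2) by (rule frechet_derivative_at[symmetric])
  then have "partials (i # is) f = f' i"
    by (simp add: fun_eq_iff axis_def if_distrib cong: if_cong)
  with f'(1) show ?case by metis
qed simp

lemma elementary_smooth: "elementary f \<Longrightarrow> smooth f"
  unfolding smooth_def using elementary_partials elementary_derivative differentiableI by metis

lemma elementary_prod: "finite A \<Longrightarrow> (\<And>i. i \<in> A \<Longrightarrow> elementary (f i)) \<Longrightarrow> elementary (\<lambda>x. \<Prod>i\<in>A. f i x)"
  by (induction A rule: finite_induct) (auto intro: elementary.intros)

lemma elementary_poly: "elementary (\<lambda>x. poly P (x $ k))"
proof (induction P)
  case 0
  show ?case by (simp add: elementary.const)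
next
  case (pCons a P)
  show ?case using elementary.add[OF elementary.const[of a] elementary.mult[OF elementary.coord[of k] pCons.IH]] by simp
qed

section \<open>Iterated partial derivatives of smooth functions\<close>

lemma partials_append: "partials xs (partials ys f) = partials (xs @ ys) f"
  by (induction xs) auto

lemma smooth_partials: "smooth f \<Longrightarrow> smooth (partials ys f)"
  by (simp add: smooth_def partials_append)

lemma smooth_differentiable: "smooth f \<Longrightarrow> f differentiable (at x)"
  unfolding smooth_def by (metis partials.simps(1))

lemma smooth_continuous: "smooth f \<Longrightarrow> continuous_on UNIV f"
  by (simp add: smooth_differentiable continuous_at_imp_continuous_on differentiable_imp_continuous_within)

lemma differentiable_axis_derivative:
  assumes "f differentiable (at x)"
  shows "((\<lambda>t. f (x + t *\<^sub>R axis j 1)) has_real_derivative frechet_derivative f (at x) (axis j 1)) (at 0)"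
proof -
  have f: "(f has_derivative frechet_derivative f (at x)) (at x)"
    using assms by (simp add: frechet_derivative_works)
  have "((\<lambda>t. x + t *\<^sub>R axis j 1) has_derivative (\<lambda>t. t *\<^sub>R axis j 1)) (at 0)"
    by (auto intro!: derivative_eq_intros)
  from has_derivative_compose[OF this] f
  have "((\<lambda>t. f (x + t *\<^sub>R axis j 1)) has_derivative (\<lambda>t. frechet_derivative f (at x) (t *\<^sub>R axis j 1))) (at 0)" by simp
  then show ?thesis
    unfolding has_field_derivative_def using linear_frechet_derivative[OF assms]
    by (rule_tac has_derivative_eq_rhs) (auto simp: linear_cmul fun_eq_iff mult.commute)
qed

lemma smooth_has_partial: "smooth f \<Longrightarrow> has_partial j f (partials [j] f)"
  using smooth_continuous smooth_partials[of f "[j]"] differentiable_axis_derivative[OF smooth_differentiable]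
  by (auto simp: has_partial_def)

lemma has_partial_partials:
  assumes "has_partial j f f'" "smooth f"
  shows "partials [j] f = f'"
  using assms(1) differentiable_axis_derivative[OF smooth_differentiable[OF assms(2)]]
  by (auto simp: has_partial_def fun_eq_iff intro!: DERIV_unique)

text \<open>Differentiation does not enlarge the closed support: off it the function vanishes in a
  whole neighbourhood, and so does its derivative.\<close>

lemma test_functions_partials:
  assumes "\<psi> \<in> test_functions S"
  shows "partials ys \<psi> \<in> test_functions S"
proof (induction ys)
  case (Cons j ys)
  let ?f = "partials ys \<psi>"
  have f: "smooth ?f" "compact (closure {x. ?f x \<noteq> 0})" "closure {x. ?f x \<noteq> 0} \<subseteq> S"
    using Cons by (auto simp: test_functions_def)
  have "partials (j # ys) \<psi> x = 0" if x: "x \<notin> closure {x. ?f x \<noteq> 0}" for x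
  proof -
    have "((\<lambda>x. 0) has_derivative (\<lambda>v. 0)) (at x)" by simp
    then have "(?f has_derivative (\<lambda>v. 0)) (at x)"
    proof (rule has_derivative_transform_within_open)
      show "open (- closure {x. ?f x \<noteq> 0})" "x \<in> - closure {x. ?f x \<noteq> 0}" using x by auto
      show "\<And>y. y \<in> - closure {x. ?f x \<noteq> 0} \<Longrightarrow> 0 = ?f y"
        using closure_subset[of "{x. ?f x \<noteq> 0}"] by auto
    qed
    then have "frechet_derivative ?f (at x) = (\<lambda>v. 0)" by (rule frechet_derivative_at[symmetric])
    then show ?thesis by simp
  qed
  then have sub: "{x. partials (j # ys) \<psi> x \<noteq> 0} \<subseteq> closure {x. ?f x \<noteq> 0}" by blast
  then have sub': "closure {x. partials (j # ys) \<psi> x \<noteq> 0} \<subseteq> closure {x. ?f x \<noteq> 0}"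
    by (simp add: closure_minimal)
  moreover have "compact (closure {x. partials (j # ys) \<psi> x \<noteq> 0})"
    using f(2) sub' by (metis bounded_subset closed_closure compact_eq_bounded_closed)
  moreover have "smooth (partials (j # ys) \<psi>)"
    using smooth_partials[OF f(1), of "[j]"] by simp
  ultimately show ?case using f(3) by (auto simp: test_functions_def simp del: partials.simps)
qed (use assms in simp)

lemma test_functions_subset: "S \<subseteq> T \<Longrightarrow> test_functions S \<subseteq> test_functions T"
  by (auto simp: test_functions_def)

lemma test_functions_bounded:
  assumes "\<psi> \<in> test_functions S"
  obtains B where "\<And>x. \<bar>\<psi> x\<bar> \<le> B" "0 \<le> B"
proof -
  have "compact (\<psi> ` closure {x. \<psi> x \<noteq> 0})"
    using assms by (intro compact_continuous_image continuous_on_subset[OF smooth_continuous]) (auto simp: test_functions_def)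
  then obtain B where B: "\<And>x. x \<in> closure {x. \<psi> x \<noteq> 0} \<Longrightarrow> \<bar>\<psi> x\<bar> \<le> B"
    by (force dest!: compact_imp_bounded simp: bounded_iff)
  have "\<bar>\<psi> x\<bar> \<le> max B 0" for x
    using B[of x] closure_subset[of "{x. \<psi> x \<noteq> 0}"] by (cases "\<psi> x = 0") (auto simp: max.coboundedI1)
  then show ?thesis using that by (metis max.cobounded2)
qed

lemma test_functionsI:
  assumes "smooth f" "\<And>x. x \<notin> cbox p q \<Longrightarrow> f x = 0" "cbox p q \<subseteq> S"
  shows "f \<in> test_functions S"
proof -
  have "{x. f x \<noteq> 0} \<subseteq> cbox p q" using assms(2) by blast
  then have sub: "closure {x. f x \<noteq> 0} \<subseteq> cbox p q" by (rule closure_minimal[OF _ closed_cbox])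
  then have "compact (closure {x. f x \<noteq> 0})"
    by (metis bounded_cbox bounded_subset closed_closure compact_eq_bounded_closed)
  then show ?thesis using assms(1,3) sub by (auto simp: test_functions_def)
qed

text \<open>A smooth cutoff of the interval from \<open>p\<close> to \<open>q\<close>: it vanishes
  within distance \<open>e\<close> of the end points and outside, and tends to the indicator of the
  open interval as \<open>e\<close> tends to 0.\<close>

definition hat :: "real \<Rightarrow> real \<Rightarrow> real \<Rightarrow> real \<Rightarrow> real" where
  "hat e p q x = flat 1 ((x - p) / e - 1) * flat 1 ((q - x) / e - 1)"

definition hat' :: "real \<Rightarrow> real \<Rightarrow> real \<Rightarrow> real \<Rightarrow> real" where
  "hat' e p q x = (1 / e) * flat [:0, 0, 1:] ((x - p) / e - 1) * flat 1 ((q - x) / e - 1)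
     - flat 1 ((x - p) / e - 1) * ((1 / e) * flat [:0, 0, 1:] ((q - x) / e - 1))"

lemma flat_1: "0 \<le> flat 1 y" "flat 1 y \<le> 1" "0 < y \<Longrightarrow> 0 < flat 1 y" "y \<le> 0 \<Longrightarrow> flat P y = 0"
  by (auto simp: flat_def)

lemma hat_has_derivative: "0 < e \<Longrightarrow> (hat e p q has_real_derivative hat' e p q x) (at x)"
proof -
  assume e: "0 < e"
  have 1: "((\<lambda>x. flat 1 ((x - p) / e - 1)) has_real_derivative flat [:0, 0, 1:] ((x - p) / e - 1) * (1 / e)) (at x)"
    using flat_has_derivative[of 1] e by (intro DERIV_chain2[where f="flat 1"]) (auto intro!: derivative_eq_intros simp: pderiv_1)
  have 2: "((\<lambda>x. flat 1 ((q - x) / e - 1)) has_real_derivative flat [:0, 0, 1:] ((q - x) / e - 1) * (- 1 / e)) (at x)"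
    using flat_has_derivative[of 1] e by (intro DERIV_chain2[where f="flat 1"]) (auto intro!: derivative_eq_intros simp: pderiv_1)
  from DERIV_mult[OF 1 2] show ?thesis
    by (simp add: hat_def[abs_def] hat'_def algebra_simps)
qed

lemma elementary_hat: "elementary (\<lambda>x. hat e p q (x $ k))"
proof -
  have "elementary (\<lambda>x::real^'a. flat 1 ((1 / e) * x $ k + (- p / e - 1)) * flat 1 ((- 1 / e) * x $ k + (q / e - 1)))"
    by (intro elementary.mult elementary.flat)
  then show ?thesis by (simp add: hat_def diff_divide_distrib algebra_simps)
qed

lemma elementary_hat': "elementary (\<lambda>x. hat' e p q (x $ k))"
proof -
  have "elementary (\<lambda>x::real^'a. (1 / e) * flat [:0, 0, 1:] ((1 / e) * x $ k + (- p / e - 1)) * flat 1 ((- 1 / e) * x $ k + (q / e - 1))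
     + (- 1) * (flat 1 ((1 / e) * x $ k + (- p / e - 1)) * ((1 / e) * flat [:0, 0, 1:] ((- 1 / e) * x $ k + (q / e - 1)))))"
    by (intro elementary.mult elementary.flat elementary.add elementary.const)
  then show ?thesis by (simp add: hat'_def diff_divide_distrib algebra_simps)
qed

lemma hat_bounds: "0 \<le> hat e p q x" "hat e p q x \<le> 1"
  by (auto simp: hat_def flat_1 mult_le_one)

lemma hat_zero: "0 < e \<Longrightarrow> x \<le> p + e \<or> q - e \<le> x \<Longrightarrow> hat e p q x = 0"
  by (auto simp: hat_def field_simps flat_1)

lemma hat'_zero: "0 < e \<Longrightarrow> x \<le> p + e \<or> q - e \<le> x \<Longrightarrow> hat' e p q x = 0"
  by (auto simp: hat'_def field_simps flat_1)

lemma hat_pos: "0 < e \<Longrightarrow> p + e < x \<Longrightarrow> x < q - e \<Longrightarrow> 0 < hat e p q x"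
  by (auto simp: hat_def field_simps intro!: mult_pos_pos flat_1)

text \<open>In terms of t = 1/y the left side is (t + t^2) exp(-t). The factor y + 1 stands for the
  distance to an end point of the interval in units of \<open>e\<close>.\<close>

lemma flat_bound: "0 < y \<Longrightarrow> (y + 1) * flat [:0, 0, 1:] y \<le> 3"
proof -
  assume y: "0 < y"
  define t where "t = 1 / y"
  have t: "0 < t" using y by (simp add: t_def)
  have "t + t\<^sup>2 \<le> 3 * exp t"
    using exp_lower_Taylor_quadratic[of t] t zero_le_power2[of t] by linarith
  then have "(t + t\<^sup>2) * exp (- t) \<le> 3" by (simp add: exp_minus field_simps)
  moreover have "(y + 1) * flat [:0, 0, 1:] y = (t + t\<^sup>2) * exp (- t)"
    using y by (simp add: flat_def t_def power2_eq_square field_simps)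
  ultimately show ?thesis by simp
qed

text \<open>Each of the two summands of \<open>hat'\<close> carries one factor 1/e and the
  derivative of the cutoff at one end point. Bounding \<open>k\<close> by the distance to that end
  point turns the product into the quantity of \<open>flat_bound\<close>, at most
  \<open>3 * L\<close> for each summand.\<close>

lemma hat'_bound:
  assumes e: "0 < e" and k: "\<bar>k\<bar> \<le> L * (x - p)" "\<bar>k\<bar> \<le> L * (q - x)" and x: "p < x" "x < q"
  shows "\<bar>k * hat' e p q x\<bar> \<le> 6 * L"
proof -
  have L: "0 \<le> L" using k(1) x(1) by (smt (verit) zero_le_mult_iff)
  have *: "\<bar>k\<bar> * ((1 / e) * flat [:0, 0, 1:] (z / e - 1)) \<le> 3 * L" if z: "\<bar>k\<bar> \<le> L * z" "0 < z" for z
  proof (cases "z / e - 1 \<le> 0")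
    case True then show ?thesis using L by (simp add: flat_1)
  next
    case False
    let ?y = "z / e - 1"
    have nn: "0 \<le> flat [:0, 0, 1:] ?y" by (auto simp: flat_def)
    have "\<bar>k\<bar> * ((1 / e) * flat [:0, 0, 1:] ?y) \<le> (L * z) * ((1 / e) * flat [:0, 0, 1:] ?y)"
      using z e nn by (intro mult_right_mono) auto
    also have "\<dots> = L * ((?y + 1) * flat [:0, 0, 1:] ?y)" by simp
    also have "\<dots> \<le> L * 3" using flat_bound[of ?y] False L by (intro mult_left_mono) auto
    finally show ?thesis by simp
  qed
  have nn: "0 \<le> flat [:0, 0, 1:] y" for y by (auto simp: flat_def)
  define A where "A = (1 / e) * flat [:0, 0, 1:] ((x - p) / e - 1)"
  define B where "B = (1 / e) * flat [:0, 0, 1:] ((q - x) / e - 1)"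
  define C where "C = flat 1 ((x - p) / e - 1)"
  define D where "D = flat 1 ((q - x) / e - 1)"
  have CD: "0 \<le> C" "C \<le> 1" "0 \<le> D" "D \<le> 1" by (auto simp: C_def D_def flat_1)
  have A: "0 \<le> \<bar>k\<bar> * A" "\<bar>k\<bar> * A \<le> 3 * L" using e nn *[OF k(1)] x by (auto simp: A_def)
  have B: "0 \<le> \<bar>k\<bar> * B" "\<bar>k\<bar> * B \<le> 3 * L" using e nn *[OF k(2)] x by (auto simp: B_def)
  have "(\<bar>k\<bar> * A) * D - C * (\<bar>k\<bar> * B) = \<bar>k\<bar> * hat' e p q x"
    by (simp add: hat'_def A_def B_def C_def D_def algebra_simps)
  then have eq: "\<bar>k * hat' e p q x\<bar> = \<bar>(\<bar>k\<bar> * A) * D - C * (\<bar>k\<bar> * B)\<bar>" by (simp add: abs_mult)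
  have "0 \<le> (\<bar>k\<bar> * A) * D" "(\<bar>k\<bar> * A) * D \<le> 3 * L" "0 \<le> C * (\<bar>k\<bar> * B)" "C * (\<bar>k\<bar> * B) \<le> 3 * L"
    using mult_nonneg_nonneg[OF A(1) CD(3)] mult_left_mono[OF CD(4) A(1)] mult_nonneg_nonneg[OF CD(1) B(1)] mult_right_mono[OF CD(2) B(1)] A B
    by simp_all
  then show ?thesis unfolding eq by linarith
qed

lemma eps_seq: "filterlim (\<lambda>n. (x - p) / (1 / real (Suc n)) - 1) at_top sequentially" if "p < x"
proof -
  have "filterlim (\<lambda>n. (x - p) * real (Suc n)) at_top sequentially"
    by (rule filterlim_tendsto_pos_mult_at_top[OF tendsto_const])
       (use that filterlim_compose[OF filterlim_real_sequentially filterlim_Suc] in simp_all)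
  then have "filterlim (\<lambda>n. -1 + (x - p) * real (Suc n)) at_top sequentially"
    by (rule filterlim_tendsto_add_at_top[OF tendsto_const])
  then show ?thesis by (simp add: algebra_simps)
qed

lemma flat_1_tendsto: "(flat 1 \<longlongrightarrow> 1) at_top"
proof -
  have "((\<lambda>y. exp (- inverse y)) \<longlongrightarrow> exp (- 0)) (at_top::real filter)"
    by (intro tendsto_intros tendsto_inverse_0_at_top filterlim_ident)
  then have "((\<lambda>y. exp (- inverse y)) \<longlongrightarrow> 1) (at_top::real filter)" by simp
  then show ?thesis
    by (rule Lim_transform_eventually) (use eventually_gt_at_top[of 0] in eventually_elim, auto simp: flat_def field_simps)
qed

lemma flat_2_tendsto: "((\<lambda>y. (y + 1) * flat [:0, 0, 1:] y) \<longlongrightarrow> 0) at_top"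
proof -
  have "((\<lambda>y. (inverse y + (inverse y)\<^sup>2) * exp (- inverse y)) \<longlongrightarrow> (0 + 0\<^sup>2) * exp (- 0)) (at_top::real filter)"
    by (intro tendsto_intros tendsto_inverse_0_at_top filterlim_ident)
  then have "((\<lambda>y. (inverse y + (inverse y)\<^sup>2) * exp (- inverse y)) \<longlongrightarrow> 0) (at_top::real filter)" by simp
  then show ?thesis
    by (rule Lim_transform_eventually)
       (use eventually_gt_at_top[of 0] in eventually_elim, auto simp: flat_def field_simps power2_eq_square)
qed

lemma hat_tendsto: "(\<lambda>n. hat (1 / real (Suc n)) p q x) \<longlonglongrightarrow> (if p < x \<and> x < q then 1 else 0)"
proof (cases "p < x \<and> x < q")
  case True
  have "(\<lambda>n. hat (1 / real (Suc n)) p q x) \<longlonglongrightarrow> 1 * 1"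
    unfolding hat_def by (intro tendsto_mult filterlim_compose[OF flat_1_tendsto] eps_seq) (use True in auto)
  with True show ?thesis by simp
next
  case False
  then have "x \<le> p + e \<or> q - e \<le> x" if "0 < e" for e using that by auto
  then have "hat (1 / real (Suc n)) p q x = 0" for n by (intro hat_zero) simp_all
  with False show ?thesis by auto
qed

lemma hat'_tendsto: "(\<lambda>n. hat' (1 / real (Suc n)) p q x) \<longlonglongrightarrow> 0"
proof (cases "p < x \<and> x < q")
  case True
  have *: "(\<lambda>n. (1 / (1 / real (Suc n))) * flat [:0, 0, 1:] (z / (1 / real (Suc n)) - 1)) \<longlonglongrightarrow> 0" if z: "0 < z" for z
  proof -
    let ?y = "\<lambda>n. z / (1 / real (Suc n)) - 1"
    \<comment> \<open>Since \<open>?y n + 1\<close> is z times n + 1, the growing factor n + 1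
      equals \<open>?y n + 1\<close> divided by \<open>z\<close>.\<close>
    have "(\<lambda>n. (1 / z) * ((?y n + 1) * flat [:0, 0, 1:] (?y n))) \<longlonglongrightarrow> (1 / z) * 0"
      using eps_seq[OF z] by (intro tendsto_mult tendsto_const filterlim_compose[OF flat_2_tendsto]) simp
    then show ?thesis using z by simp
  qed
  have 1: "(\<lambda>n. flat 1 (z / (1 / real (Suc n)) - 1)) \<longlonglongrightarrow> 1" if z: "0 < z" for z
    using filterlim_compose[OF flat_1_tendsto eps_seq[OF z]] by simp
  have x: "0 < x - p" "0 < q - x" using True by auto
  have "(\<lambda>n. hat' (1 / real (Suc n)) p q x) \<longlonglongrightarrow> 0 * 1 - 1 * 0"
    unfolding hat'_def
    by (rule tendsto_diff[OF tendsto_mult[OF *[OF x(1)] 1[OF x(2)]] tendsto_mult[OF 1[OF x(1)] *[OF x(2)]]])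
  then show ?thesis by simp
next
  case False
  then have "x \<le> p + e \<or> q - e \<le> x" if "0 < e" for e using that by auto
  then have "hat' (1 / real (Suc n)) p q x = 0" for n by (intro hat'_zero) simp_all
  then show ?thesis by auto
qed

text \<open>If \<open>K\<close> vanishes at both end points, the derivative of the bump function stays bounded as \<open>e\<close>
  tends to 0: the factor \<open>1 / e\<close> in \<open>hat'\<close> occurs only at distance \<open>O(e)\<close> from a root of \<open>K\<close>.\<close>

definition bump :: "real \<Rightarrow> real^'n \<Rightarrow> real^'n \<Rightarrow> real poly \<Rightarrow> 'n \<Rightarrow> real^'n \<Rightarrow> real" where
  "bump e p q K i x = poly K (x $ i) * (\<Prod>k\<in>UNIV. hat e (p $ k) (q $ k) (x $ k))"

definition bump' :: "real \<Rightarrow> real^'n \<Rightarrow> real^'n \<Rightarrow> real poly \<Rightarrow> 'n \<Rightarrow> real^'n \<Rightarrow> real" where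
  "bump' e p q K i x = (poly (pderiv K) (x $ i) * hat e (p $ i) (q $ i) (x $ i) + poly K (x $ i) * hat' e (p $ i) (q $ i) (x $ i))
     * (\<Prod>k\<in>UNIV - {i}. hat e (p $ k) (q $ k) (x $ k))"

lemma elementary_bump: "elementary (bump e p q K i)"
proof -
  have "elementary (\<lambda>x. poly K (x $ i) * (\<Prod>k\<in>UNIV. hat e (p $ k) (q $ k) (x $ k)))"
    by (intro elementary.mult elementary_poly elementary_prod elementary_hat finite)
  then show ?thesis by (simp add: bump_def[abs_def])
qed

lemma elementary_continuous: "elementary f \<Longrightarrow> continuous_on UNIV f"
  by (simp add: elementary_smooth smooth_continuous)

lemma partials_bump:
  fixes i :: "'n::finite"
  assumes e: "0 < e"
  shows "partials [i] (bump e p q K i) = bump' e p q K i"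
proof (rule has_partial_partials)
  show "smooth (bump e p q K i)" by (rule elementary_smooth[OF elementary_bump])
  have c': "continuous_on UNIV (\<lambda>s. hat' e (p $ i) (q $ i) s)"
  proof -
    have "continuous_on UNIV (\<lambda>x::real^'n. hat' e (p $ i) (q $ i) (x $ i))"
      by (rule elementary_continuous[OF elementary_hat'])
    \<comment> \<open>Continuity in one real variable is read off from that on the vector space by
      restriction to the diagonal.\<close>
    moreover have "continuous_on UNIV (\<lambda>s. \<chi> k. s)" by (intro continuous_on_vec_lambda) auto
    ultimately have "continuous_on UNIV (\<lambda>s. hat' e (p $ i) (q $ i) ((\<chi> k. s :: real^'n) $ i))"
      by (rule continuous_on_compose2) auto
    then show ?thesis by simp
  qed
  have c: "continuous_on UNIV (\<lambda>s. hat e (p $ i) (q $ i) s)"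
    using hat_has_derivative[OF e] by (meson DERIV_continuous_on has_field_derivative_at_within)
  have 1: "has_partial i (\<lambda>x. poly K (x $ i) * hat e (p $ i) (q $ i) (x $ i))
     (\<lambda>x. poly (pderiv K) (x $ i) * hat e (p $ i) (q $ i) (x $ i) + poly K (x $ i) * hat' e (p $ i) (q $ i) (x $ i))"
    by (intro has_partial_mult has_partial_coord poly_DERIV hat_has_derivative e c' continuous_on_poly continuous_on_id)
  have 2: "has_partial i (\<lambda>x. \<Prod>k\<in>UNIV - {i}. hat e (p $ k) (q $ k) (x $ k)) (\<lambda>x. 0)"
  proof (rule has_partial_indep)
    show "continuous_on UNIV (\<lambda>x. \<Prod>k\<in>UNIV - {i}. hat e (p $ k) (q $ k) (x $ k))"
      by (intro elementary_continuous elementary_prod elementary_hat finite)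
    show "(\<Prod>k\<in>UNIV - {i}. hat e (p $ k) (q $ k) ((x + t *\<^sub>R axis i 1) $ k)) = (\<Prod>k\<in>UNIV - {i}. hat e (p $ k) (q $ k) (x $ k))" for x t
      by (intro prod.cong) (auto simp: axis_def)
  qed
  have "bump e p q K i = (\<lambda>x. (poly K (x $ i) * hat e (p $ i) (q $ i) (x $ i)) * (\<Prod>k\<in>UNIV - {i}. hat e (p $ k) (q $ k) (x $ k)))"
    by (auto simp: bump_def fun_eq_iff prod.remove[of UNIV i])
  then show "has_partial i (bump e p q K i) (bump' e p q K i)"
    using has_partial_mult[OF 1 2] by (simp add: bump'_def[abs_def])
qed

lemma bump_test_function:
  assumes e: "0 < e" and S: "box p q \<subseteq> S"
  shows "bump e p q K i \<in> test_functions S"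
proof (rule test_functionsI)
  show "smooth (bump e p q K i)" by (rule elementary_smooth[OF elementary_bump])
  show "cbox (\<chi> k. p $ k + e) (\<chi> k. q $ k - e) \<subseteq> S"
  proof
    fix x assume x: "x \<in> cbox (\<chi> k. p $ k + e) (\<chi> k. q $ k - e)"
    have "p $ k < x $ k \<and> x $ k < q $ k" for k
      using x[unfolded mem_box_cart, rule_format, of k] e by simp
    then have "x \<in> box p q" by (simp add: mem_box_cart)
    with S show "x \<in> S" by blast
  qed
  fix x assume "x \<notin> cbox (\<chi> k. p $ k + e) (\<chi> k. q $ k - e)"
  then obtain k where "x $ k \<le> p $ k + e \<or> q $ k - e \<le> x $ k" by (auto simp: mem_box_cart not_le intro: less_imp_le)
  then have "hat e (p $ k) (q $ k) (x $ k) = 0" using hat_zero[OF e] by blast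
  then show "bump e p q K i x = 0" by (auto simp: bump_def)
qed

abbreviation eps :: "nat \<Rightarrow> real" where "eps n \<equiv> 1 / real (Suc n)"

lemma bump_tendsto: "(\<lambda>n. bump (eps n) p q K i x) \<longlonglongrightarrow> (if x \<in> box p q then poly K (x $ i) else 0)"
proof -
  have "(\<lambda>n. bump (eps n) p q K i x) \<longlonglongrightarrow> poly K (x $ i) * (\<Prod>k\<in>UNIV. if p $ k < x $ k \<and> x $ k < q $ k then 1 else 0)"
    unfolding bump_def by (intro tendsto_mult tendsto_const tendsto_prod hat_tendsto)
  moreover have "(\<Prod>k\<in>(UNIV::'a set). if p $ k < x $ k \<and> x $ k < q $ k then 1 else 0) = (if x \<in> box p q then 1 else (0::real))"
    by (auto simp: mem_box_cart)
  ultimately show ?thesis by (simp split: if_splits)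
qed

lemma bump'_tendsto: "(\<lambda>n. bump' (eps n) p q K i x) \<longlonglongrightarrow> (if x \<in> box p q then poly (pderiv K) (x $ i) else 0)"
proof -
  let ?I = "\<lambda>k. if p $ k < x $ k \<and> x $ k < q $ k then 1 else (0::real)"
  have "(\<lambda>n. bump' (eps n) p q K i x) \<longlonglongrightarrow> (poly (pderiv K) (x $ i) * ?I i + poly K (x $ i) * 0) * (\<Prod>k\<in>UNIV - {i}. ?I k)"
    unfolding bump'_def by (intro tendsto_mult tendsto_add tendsto_const tendsto_prod hat_tendsto hat'_tendsto)
  moreover have "(\<Prod>k\<in>UNIV. ?I k) = ?I i * (\<Prod>k\<in>UNIV - {i}. ?I k)" by (rule prod.remove) auto
  moreover have "(\<Prod>k\<in>UNIV. ?I k) = (if x \<in> box p q then 1 else (0::real))"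
    by (auto simp: mem_box_cart)
  ultimately show ?thesis by (auto split: if_splits)
qed

lemma poly_bounded_Icc: obtains B where "0 \<le> B" "\<And>x. l \<le> x \<Longrightarrow> x \<le> u \<Longrightarrow> \<bar>poly K x\<bar> \<le> (B::real)"
proof -
  have "compact (poly K ` {l..u})" by (intro compact_continuous_image continuous_on_poly continuous_on_id) auto
  then obtain B where B: "\<And>x. x \<in> {l..u} \<Longrightarrow> \<bar>poly K x\<bar> \<le> B"
    by (force dest!: compact_imp_bounded simp: bounded_iff)
  \<comment> \<open>The maximum with 0 keeps the bound nonnegative when the interval is
    empty.\<close>
  show ?thesis by (rule that[of "max B 0"]) (use B in \<open>auto simp: max.coboundedI1\<close>)
qed

lemma prod_hat_bounds: "\<bar>\<Prod>k\<in>A. hat e (p $ k) (q $ k) (x $ k)\<bar> \<le> 1"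
  by (auto simp: abs_prod hat_bounds intro!: prod_le_1)

lemma bump_bounded:
  obtains B where "\<And>e x. 0 < e \<Longrightarrow> \<bar>bump e p q K i x\<bar> \<le> B"
proof -
  obtain B where B: "0 \<le> B" "\<And>x. p $ i \<le> x \<Longrightarrow> x \<le> q $ i \<Longrightarrow> \<bar>poly K x\<bar> \<le> B" using poly_bounded_Icc by blast
  have "\<bar>bump e p q K i x\<bar> \<le> B" if e: "0 < e" for e x
  proof (cases "p $ i < x $ i \<and> x $ i < q $ i")
    case True
    then have "\<bar>poly K (x $ i)\<bar> \<le> B" using B by auto
    then have "\<bar>poly K (x $ i)\<bar> * \<bar>\<Prod>k\<in>UNIV. hat e (p $ k) (q $ k) (x $ k)\<bar> \<le> B * 1"
      by (intro mult_mono prod_hat_bounds) (use B in auto)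
    then show ?thesis by (simp add: bump_def abs_mult)
  next
    case False
    then have "hat e (p $ i) (q $ i) (x $ i) = 0" using e by (intro hat_zero) auto
    then have "bump e p q K i x = 0" by (auto simp: bump_def)
    then show ?thesis using B by simp
  qed
  then show ?thesis using that by blast
qed

text \<open>The root is split off as a linear factor, and the cofactor is bounded on the
  interval.\<close>

lemma poly_root_bound:
  fixes c :: real
  assumes "poly K c = 0"
  obtains L where "0 \<le> L" "\<And>x. l \<le> x \<Longrightarrow> x \<le> u \<Longrightarrow> \<bar>poly K x\<bar> \<le> L * \<bar>x - c\<bar>"
proof -
  obtain K' where K': "K = [:- c, 1:] * K'" using assms by (auto simp: poly_eq_0_iff_dvd)
  obtain L where L: "0 \<le> L" "\<And>x. l \<le> x \<Longrightarrow> x \<le> u \<Longrightarrow> \<bar>poly K' x\<bar> \<le> L" using poly_bounded_Icc by blast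
  show ?thesis
  proof (intro that[of L])
    fix x assume "l \<le> x" "x \<le> u"
    with L have "\<bar>x - c\<bar> * \<bar>poly K' x\<bar> \<le> \<bar>x - c\<bar> * L" by (intro mult_left_mono) auto
    moreover have "poly K x = (x - c) * poly K' x" by (simp add: K' algebra_simps)
    ultimately show "\<bar>poly K x\<bar> \<le> L * \<bar>x - c\<bar>" by (simp add: abs_mult mult.commute)
  qed fact
qed

lemma bump'_bounded:
  assumes "poly K (p $ i) = 0" "poly K (q $ i) = 0"
  obtains B where "\<And>e x. 0 < e \<Longrightarrow> \<bar>bump' e p q K i x\<bar> \<le> B"
proof -
  obtain B where B: "0 \<le> B" "\<And>x. p $ i \<le> x \<Longrightarrow> x \<le> q $ i \<Longrightarrow> \<bar>poly (pderiv K) x\<bar> \<le> B" using poly_bounded_Icc by blast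
  obtain L1 where L1: "0 \<le> L1" "\<And>x. p $ i \<le> x \<Longrightarrow> x \<le> q $ i \<Longrightarrow> \<bar>poly K x\<bar> \<le> L1 * \<bar>x - p $ i\<bar>" using poly_root_bound[OF assms(1)] by blast
  obtain L2 where L2: "0 \<le> L2" "\<And>x. p $ i \<le> x \<Longrightarrow> x \<le> q $ i \<Longrightarrow> \<bar>poly K x\<bar> \<le> L2 * \<bar>x - q $ i\<bar>" using poly_root_bound[OF assms(2)] by blast
  define L where "L = L1 + L2"
  have "\<bar>bump' e p q K i x\<bar> \<le> B + 6 * L" if e: "0 < e" for e x
  proof (cases "p $ i < x $ i \<and> x $ i < q $ i")
    case True
    let ?k = "poly K (x $ i)"
    have "\<bar>?k\<bar> \<le> L * (x $ i - p $ i)" 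
    proof -
      have "\<bar>?k\<bar> \<le> L1 * (x $ i - p $ i)" using L1(2)[of "x $ i"] True by simp
      also have "\<dots> \<le> L * (x $ i - p $ i)" using True L1 L2 by (intro mult_right_mono) (auto simp: L_def)
      finally show ?thesis .
    qed
    moreover have "\<bar>?k\<bar> \<le> L * (q $ i - x $ i)" 
    proof -
      have "\<bar>?k\<bar> \<le> L2 * (q $ i - x $ i)" using L2(2)[of "x $ i"] True by simp
      also have "\<dots> \<le> L * (q $ i - x $ i)" using True L1 L2 by (intro mult_right_mono) (auto simp: L_def)
      finally show ?thesis .
    qed
    ultimately have 1: "\<bar>?k * hat' e (p $ i) (q $ i) (x $ i)\<bar> \<le> 6 * L"
      using True by (intro hat'_bound e) auto
    have "\<bar>poly (pderiv K) (x $ i)\<bar> * \<bar>hat e (p $ i) (q $ i) (x $ i)\<bar> \<le> B * 1"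
      using B True hat_bounds[of e "p $ i" "q $ i" "x $ i"] by (intro mult_mono) auto
    then have 2: "\<bar>poly (pderiv K) (x $ i) * hat e (p $ i) (q $ i) (x $ i)\<bar> \<le> B" by (simp add: abs_mult)
    let ?s = "poly (pderiv K) (x $ i) * hat e (p $ i) (q $ i) (x $ i) + ?k * hat' e (p $ i) (q $ i) (x $ i)"
    have "\<bar>?s\<bar> \<le> B + 6 * L" using 1 2 by linarith
    then have "\<bar>?s\<bar> * \<bar>\<Prod>k\<in>UNIV - {i}. hat e (p $ k) (q $ k) (x $ k)\<bar> \<le> (B + 6 * L) * 1"
      by (intro mult_mono prod_hat_bounds) (use B L1 L2 in \<open>auto simp: L_def\<close>)
    then show ?thesis by (simp add: bump'_def abs_mult)
  next
    case False
    then have "hat e (p $ i) (q $ i) (x $ i) = 0" "hat' e (p $ i) (q $ i) (x $ i) = 0" 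
      using e by (auto intro!: hat_zero hat'_zero)
    then have "bump' e p q K i x = 0" by (auto simp: bump'_def)
    then show ?thesis using B L1 L2 by (simp add: L_def)
  qed
  then show ?thesis using that by blast
qed

lemma continuous_measurable_lebesgue_on:
  "continuous_on UNIV (f :: real^'n \<Rightarrow> real) \<Longrightarrow> f \<in> borel_measurable (lebesgue_on S)"
  by (intro measurable_restrict_space1 measurable_completion) (simp add: borel_measurable_continuous_onI)

text \<open>Dominated convergence with the majorant B |f|: the cutoffs are uniformly bounded and
  converge at every point, including the boundary of the box, where the limit is 0.\<close>

lemma bounded_convergence_box:
  fixes f :: "real^'n \<Rightarrow> real"
  assumes S: "S \<in> sets lebesgue" "box p q \<subseteq> S" and f: "integrable (lebesgue_on S) f"
    and c: "\<And>n. continuous_on UNIV (\<psi> n)" and B: "\<And>n x. \<bar>\<psi> n x\<bar> \<le> B"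
    and lim: "\<And>x. (\<lambda>n. \<psi> n x) \<longlonglongrightarrow> (if x \<in> box p q then g x else (0::real))"
  shows "(\<lambda>n. LINT x|lebesgue_on S. \<psi> n x * f x) \<longlonglongrightarrow> (LINT x|lebesgue_on (box p q). g x * f x)"
proof -
  note [measurable] = borel_measurable_integrable[OF f]
  have [measurable]: "\<psi> n \<in> borel_measurable (lebesgue_on S)" for n
    by (rule continuous_measurable_lebesgue_on[OF c])
  have "(\<lambda>n. LINT x|lebesgue_on S. \<psi> n x * f x) \<longlonglongrightarrow> (LINT x|lebesgue_on S. (if x \<in> box p q then g x else 0) * f x)"
  proof (rule integral_dominated_convergence[where w="\<lambda>x. B * \<bar>f x\<bar>"])
    show "(\<lambda>x. (if x \<in> box p q then g x else 0) * f x) \<in> borel_measurable (lebesgue_on S)"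
      by (rule borel_measurable_LIMSEQ_real[where u="\<lambda>n x. \<psi> n x * f x"], rule tendsto_mult[OF lim tendsto_const]) measurable
    show "AE x in lebesgue_on S. (\<lambda>n. \<psi> n x * f x) \<longlonglongrightarrow> (if x \<in> box p q then g x else 0) * f x"
      by (rule AE_I2, rule tendsto_mult[OF lim tendsto_const])
    show "AE x in lebesgue_on S. norm (\<psi> n x * f x) \<le> B * \<bar>f x\<bar>" for n
      by (auto simp: abs_mult intro!: mult_right_mono B)
  qed (use f in auto)
  moreover have "(LINT x|lebesgue_on S. (if x \<in> box p q then g x else 0) * f x) = (LINT x|lebesgue_on S. (if x \<in> box p q then g x * f x else 0))"
    by (intro Bochner_Integration.integral_cong) auto
  ultimately show ?thesis
    using integral_restrict[of "box p q" S "\<lambda>x. g x * f x"] S by simp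
qed

section \<open>Weak derivatives\<close>

text \<open>A derivative of order one in a single direction: the unit into which weak derivatives of
  higher order are decomposed, and from which a diagonal field obtains its divergence.\<close>

definition weak_partial :: "(real^'n) set \<Rightarrow> 'n \<Rightarrow> (real^'n \<Rightarrow> real) \<Rightarrow> (real^'n \<Rightarrow> real) \<Rightarrow> bool" where
  "weak_partial S i f g \<longleftrightarrow> (\<forall>\<psi>\<in>test_functions S.
     (LINT x|lebesgue_on S. partials [i] \<psi> x * f x) = - (LINT x|lebesgue_on S. \<psi> x * g x))"

text \<open>The weak identity is tested with \<open>K\<close> times a cutoff of the box, and the
  cutoff is removed by dominated convergence. Because \<open>K\<close> vanishes on both faces
  perpendicular to the \<open>i\<close>-axis, the derivative of the cutoff stays bounded and
  disappears in the limit; integration by parts over a subbox thus produces no boundary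
  terms.\<close>

lemma weak_partial_box:
  assumes w: "weak_partial S i f g" and f: "integrable (lebesgue_on S) f" and g: "integrable (lebesgue_on S) g"
    and S: "S \<in> sets lebesgue" "box p q \<subseteq> S" and K: "poly K (p $ i) = 0" "poly K (q $ i) = 0"
  shows "(LINT x|lebesgue_on (box p q). poly (pderiv K) (x $ i) * f x) = - (LINT x|lebesgue_on (box p q). poly K (x $ i) * g x)"
proof -
  obtain B where B: "\<And>e x. 0 < e \<Longrightarrow> \<bar>bump e p q K i x\<bar> \<le> B" using bump_bounded by blast
  obtain B' where B': "\<And>e x. 0 < e \<Longrightarrow> \<bar>bump' e p q K i x\<bar> \<le> B'" using bump'_bounded[OF K] by blast
  have e: "0 < eps n" for n by simp
  have 1: "(\<lambda>n. LINT x|lebesgue_on S. bump' (eps n) p q K i x * f x) \<longlonglongrightarrow> (LINT x|lebesgue_on (box p q). poly (pderiv K) (x $ i) * f x)"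
  proof (rule bounded_convergence_box[OF S f _ B'[OF e] bump'_tendsto])
    show "continuous_on UNIV (bump' (eps n) p q K i)" for n
      unfolding partials_bump[OF e, symmetric] by (intro elementary_continuous elementary_partials elementary_bump)
  qed
  have 2: "(\<lambda>n. LINT x|lebesgue_on S. bump (eps n) p q K i x * g x) \<longlonglongrightarrow> (LINT x|lebesgue_on (box p q). poly K (x $ i) * g x)"
    by (rule bounded_convergence_box[OF S g elementary_continuous[OF elementary_bump] B[OF e] bump_tendsto])
  have "(LINT x|lebesgue_on S. bump' (eps n) p q K i x * f x) = - (LINT x|lebesgue_on S. bump (eps n) p q K i x * g x)" for n
    using w[unfolded weak_partial_def, rule_format, OF bump_test_function[OF e[of n] S(2), of K i]]
    unfolding partials_bump[OF e[of n]] .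
  then have "(\<lambda>n. - (LINT x|lebesgue_on S. bump (eps n) p q K i x * g x)) \<longlonglongrightarrow> (LINT x|lebesgue_on (box p q). poly (pderiv K) (x $ i) * f x)"
    using 1 by simp
  with tendsto_minus[OF 2] show ?thesis using LIMSEQ_unique by blast
qed

section \<open>The fundamental lemma of the calculus of variations\<close>

lemma AE_zero_of_box_integrals:
  fixes g :: "real^'n \<Rightarrow> real"
  assumes g: "integrable lborel g" and g0: "(LINT x|lborel. g x) = 0" and 0: "\<And>p q. (LINT x:box p q|lborel. g x) = 0"
  shows "AE x in lborel. g x = 0"
proof (rule sigma_finite_measure.density_zero[OF sigma_finite_lborel g])
  fix A :: "(real^'n) set" assume "A \<in> sets lborel"
  then have A: "A \<in> sets borel" by simp
  let ?G = "range (\<lambda>(a, b). box a b :: (real^'n) set)"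
  have G: "sets borel = sigma_sets UNIV ?G"
    by (simp add: borel_eq_box)
  have si: "set_integrable lborel A g" if "A \<in> sets borel" for A
    unfolding set_integrable_def by (rule integrable_mult_indicator[OF _ g]) (use that in simp)
  show "(LINT x:A|lborel. g x) = 0"
  proof (rule sigma_sets_induct_disjoint[of ?G UNIV A])
    show "?G \<subseteq> Pow UNIV" by simp
    show "Int_stable ?G" by (auto simp: Int_stable_def box_Int_box)
    show "A \<in> sigma_sets UNIV ?G" using A G by simp
    fix B assume "B \<in> ?G" then show "(LINT x:B|lborel. g x) = 0" using 0 by auto
  next
    fix B assume B: "B \<in> sigma_sets UNIV ?G" "(LINT x:B|lborel. g x) = 0"
    have Bs: "B \<in> sets borel" using B(1) unfolding G .
    have "(LINT x:B \<union> (UNIV - B)|lborel. g x) = (LINT x:B|lborel. g x) + (LINT x:UNIV - B|lborel. g x)"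
      by (rule set_integral_Un) (use Bs in \<open>auto intro!: si\<close>)
    moreover have "(LINT x:UNIV|lborel. g x) = 0" using g0 by (simp add: set_lebesgue_integral_def)
    ultimately show "(LINT x:UNIV - B|lborel. g x) = 0" using B(2) by simp
  next
    fix B :: "nat \<Rightarrow> (real^'n) set"
    assume B: "disjoint_family B" "range B \<subseteq> sigma_sets UNIV ?G" "\<And>i. (LINT x:B i|lborel. g x) = 0"
    have Bs: "B i \<in> sets borel" for i using B(2) unfolding G[symmetric] by auto
    have "(LINT x:(\<Union>i. B i)|lborel. g x) = (\<Sum>i. (LINT x:B i|lborel. g x))"
      by (rule lebesgue_integral_countable_add) (use B(1) Bs in \<open>auto simp: disjoint_family_on_def intro!: si\<close>)
    then show "(LINT x:(\<Union>i. B i)|lborel. g x) = 0" using B(3) by simp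
  qed (auto simp: set_lebesgue_integral_def)
qed

text \<open>Cutoffs of a subbox tend to its indicator, so the integral of \<open>f\<close> over
  every subbox is zero. Boxes form an intersection-stable generator of the Borel sets, hence all
  integrals vanish.\<close>

lemma fundamental_lemma_variations:
  fixes f :: "real^'n \<Rightarrow> real"
  assumes f: "integrable (lebesgue_on (box a b)) f"
    and 0: "\<And>\<psi>. \<psi> \<in> test_functions (box a b) \<Longrightarrow> (LINT x|lebesgue_on (box a b). \<psi> x * f x) = 0"
  shows "AE x in lebesgue_on (box a b). f x = 0"
proof -
  let ?S = "box a b"
  have S: "?S \<in> sets lebesgue" by simp
  have sub: "(LINT x|lebesgue_on (box p q). f x) = 0" if pq: "box p q \<subseteq> ?S" for p q
  proof -
    \<comment> \<open>The polynomial factor is the constant 1, so any coordinate may be named as its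
      argument.\<close>
    obtain B where B: "\<And>e x. 0 < e \<Longrightarrow> \<bar>bump e p q 1 undefined x\<bar> \<le> B" using bump_bounded by blast
    have e: "0 < eps n" for n by simp
    have "(\<lambda>n. LINT x|lebesgue_on ?S. bump (eps n) p q 1 undefined x * f x) \<longlonglongrightarrow> (LINT x|lebesgue_on (box p q). poly 1 (x $ undefined) * f x)"
      by (rule bounded_convergence_box[OF S pq f elementary_continuous[OF elementary_bump] B[OF e] bump_tendsto])
    moreover have "(LINT x|lebesgue_on ?S. bump (eps n) p q 1 undefined x * f x) = 0" for n
      by (rule 0[OF bump_test_function[OF e pq]])
    ultimately have "(\<lambda>n. 0) \<longlonglongrightarrow> (LINT x|lebesgue_on (box p q). f x)" by simp
    then show ?thesis using LIMSEQ_unique tendsto_const by blast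
  qed
  let ?f = "\<lambda>x. if x \<in> ?S then f x else 0"
  have fi: "integrable lebesgue ?f" using f by (simp add: Lebesgue_Measure.integrable_restrict_UNIV)
  then have "?f \<in> borel_measurable lebesgue" by simp
  \<comment> \<open>The generator argument runs over Borel sets, so \<open>f\<close>, extended by
    zero, is replaced by a Borel representative.\<close>
  from completion_ex_borel_measurable_real[OF this]
  obtain g where g[measurable]: "g \<in> borel_measurable lborel" and fg: "AE x in lborel. ?f x = g x" by blast
  have fg': "AE x in lebesgue. ?f x = g x" by (rule AE_completion[OF fg])
  have gi: "integrable lborel g"
  proof -
    have "integrable lebesgue g" by (rule integrable_cong_AE_imp[OF fi]) (use fg' in \<open>auto intro: measurable_completion elim: eventually_mono\<close>)
    then show ?thesis by (simp add: integrable_completion)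
  qed
  have int: "(LINT x:A|lborel. g x) = (LINT x|lebesgue_on (A \<inter> ?S). f x)" if A[measurable]: "A \<in> sets borel" for A
  proof -
    have "(LINT x:A|lborel. g x) = (LINT x|lebesgue. indicator A x *\<^sub>R g x)"
      unfolding set_lebesgue_integral_def by (rule integral_completion[symmetric]) measurable
    also have "\<dots> = (LINT x|lebesgue. (if x \<in> A \<inter> ?S then f x else 0))"
    proof (rule integral_cong_AE)
      show "(\<lambda>x. if x \<in> A \<inter> ?S then f x else 0) \<in> borel_measurable lebesgue"
      proof -
        have "(\<lambda>x. if x \<in> A \<inter> ?S then f x else 0) = (\<lambda>x. indicator A x * ?f x)" by (auto simp: indicator_def)
        moreover have "(\<lambda>x. indicator A x * ?f x) \<in> borel_measurable lebesgue"
          using fi A by (intro borel_measurable_times borel_measurable_indicator) auto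
        ultimately show ?thesis by simp
      qed
      show "AE x in lebesgue. indicator A x *\<^sub>R g x = (if x \<in> A \<inter> ?S then f x else 0)"
        using fg' by eventually_elim (auto simp: indicator_def)
      show "(\<lambda>x. indicator A x *\<^sub>R g x) \<in> borel_measurable lebesgue" by (intro measurable_completion) measurable
    qed
    also have "\<dots> = (LINT x|lebesgue_on (A \<inter> ?S). f x)"
      by (rule Lebesgue_Measure.integral_restrict_UNIV) (use A in auto)
    finally show ?thesis .
  qed
  have "AE x in lborel. g x = 0"
  proof (rule AE_zero_of_box_integrals[OF gi])
    show "(LINT x|lborel. g x) = 0"
      using int[of UNIV] sub[of a b] by (simp add: set_lebesgue_integral_def)
    fix p q :: "real^'n"
    have "box p q \<inter> ?S = box (\<chi> k. max (p $ k) (a $ k)) (\<chi> k. min (q $ k) (b $ k))"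
      by (auto simp: mem_box_cart)
    then show "(LINT x:box p q|lborel. g x) = 0" using int[of "box p q"] sub by (metis Int_lower2 box_borel)
  qed
  then have "AE x in lebesgue. g x = 0" by (rule AE_completion)
  with fg' have "AE x in lebesgue. x \<in> ?S \<longrightarrow> f x = 0" by eventually_elim auto
  then show ?thesis by (simp add: AE_restrict_space_iff)
qed

section \<open>Classical derivatives as weak derivatives, and symmetry of second derivatives\<close>

lemma face_integral_zero:
  assumes "\<And>x. (\<And>k. k \<in> I \<Longrightarrow> x $ k = c $ k) \<Longrightarrow> f x = 0"
  shows "face_integral h p I c f = 0"
proof -
  have "face_integral h p I c f = face_integral h p I c (\<lambda>x. 0)"
    by (rule face_integral_cong) (rule assms)
  then show ?thesis by (simp add: face_integral_def)
qed

lemma test_function_outside: "\<psi> \<in> test_functions S \<Longrightarrow> x \<notin> S \<Longrightarrow> \<psi> x = 0"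
  using closure_subset[of "{x. \<psi> x \<noteq> 0}"] by (auto simp: test_functions_def)

text \<open>On a cube that contains \<open>S\<close> with a margin, the product of the test function
  and \<open>f\<close> vanishes on the faces. Gauss's theorem in direction \<open>i\<close> then
  gives 0 for the integral of the derivative of the product.\<close>

lemma weak_partial_of_partial:
  fixes f :: "real^'n \<Rightarrow> real"
  assumes f: "has_partial i f f'" and S: "bounded S" "S \<in> sets lebesgue"
  shows "weak_partial S i f f'"
  unfolding weak_partial_def
proof
  fix \<psi> assume \<psi>: "\<psi> \<in> test_functions S"
  have \<psi>s: "smooth \<psi>" using \<psi> by (simp add: test_functions_def)
  have p\<psi>: "has_partial i \<psi> (partials [i] \<psi>)" by (rule smooth_has_partial[OF \<psi>s])
  have \<psi>': "partials [i] \<psi> \<in> test_functions S" by (rule test_functions_partials[OF \<psi>])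
  let ?F = "\<lambda>x. \<psi> x * f x" and ?F' = "\<lambda>x. partials [i] \<psi> x * f x + \<psi> x * f' x"
  have F: "has_partial i ?F ?F'" by (rule has_partial_mult[OF p\<psi> f])
  obtain R where R: "\<And>x. x \<in> S \<Longrightarrow> norm x \<le> R" "0 < R" using S(1) by (meson bounded_pos)
  \<comment> \<open>The cube between -(R + 1) and R + 1 leaves a margin of 1 around \<open>S\<close>
    in every coordinate.\<close>
  define p :: "real^'n" where "p = (\<chi> k. - (R + 1))"
  define h where "h = 2 * (R + 1)"
  have h: "0 \<le> h" using R by (simp add: h_def)
  have abs: "\<bar>x $ k\<bar> \<le> R" if "x \<in> S" for x k using component_le_norm_cart[of x k] R(1)[OF that] by linarith
  have "x \<in> cell h p" if "x \<in> S" for x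
  proof -
    have "p $ k \<le> x $ k \<and> x $ k \<le> (\<chi> i. p $ i + h) $ k" for k
      using abs[OF that, of k] by (auto simp: p_def h_def)
    then show ?thesis by (simp add: cell_def mem_box_cart)
  qed
  then have sub: "S \<subseteq> cell h p" by auto
  have "(LINT x|lebesgue_on (cell h p). ?F' x) = face_integral h p {} 0 ?F'"
    using F by (intro face_integral_empty[symmetric]) (simp add: has_partial_def)
  also have "\<dots> = face_integral h p {i} (upd 0 i (p $ i + h)) ?F - face_integral h p {i} (upd 0 i (p $ i)) ?F"
    by (rule face_integral_partial[OF F h]) simp
  also have "face_integral h p {i} (upd 0 i (p $ i + h)) ?F = 0"
  proof (rule face_integral_zero)
    fix x :: "real^'n" assume "\<And>k. k \<in> {i} \<Longrightarrow> x $ k = upd 0 i (p $ i + h) $ k"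
    then have "x $ i = R + 1" by (simp add: p_def h_def)
    then have "x \<notin> S" using abs[of x i] by auto
    then show "\<psi> x * f x = 0" using test_function_outside[OF \<psi>] by simp
  qed
  also have "face_integral h p {i} (upd 0 i (p $ i)) ?F = 0"
  proof (rule face_integral_zero)
    fix x :: "real^'n" assume "\<And>k. k \<in> {i} \<Longrightarrow> x $ k = upd 0 i (p $ i) $ k"
    then have "x $ i = - (R + 1)" by (simp add: p_def)
    then have "x \<notin> S" using abs[of x i] R(2) by auto
    then show "\<psi> x * f x = 0" using test_function_outside[OF \<psi>] by simp
  qed
  finally have 0: "(LINT x|lebesgue_on (cell h p). ?F' x) = 0" by simp
  have "(LINT x|lebesgue_on (cell h p). ?F' x) = (LINT x|lebesgue_on (cell h p). (if x \<in> S then ?F' x else 0))"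
    by (intro Bochner_Integration.integral_cong) (auto simp: test_function_outside[OF \<psi>] test_function_outside[OF \<psi>'] simp del: partials.simps)
  also have "\<dots> = (LINT x|lebesgue_on S. ?F' x)" by (rule integral_restrict[OF sub S(2)]) simp
  also have "\<dots> = (LINT x|lebesgue_on S. partials [i] \<psi> x * f x) + (LINT x|lebesgue_on S. \<psi> x * f' x)"
  proof (rule Bochner_Integration.integral_add)
    have c: "continuous_on UNIV f" "continuous_on UNIV f'" "continuous_on UNIV \<psi>" "continuous_on UNIV (partials [i] \<psi>)"
      using f p\<psi> by (auto simp: has_partial_def)
    show "integrable (lebesgue_on S) (\<lambda>x. partials [i] \<psi> x * f x)"
      by (intro L2_mult_integrable L2_continuous c S)
    show "integrable (lebesgue_on S) (\<lambda>x. \<psi> x * f' x)"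
      by (intro L2_mult_integrable L2_continuous c S)
  qed
  finally show "(LINT x|lebesgue_on S. partials [i] \<psi> x * f x) = - (LINT x|lebesgue_on S. \<psi> x * f' x)"
    using 0 by simp
qed

lemma integral_ocell_pos:
  fixes g :: "real^'n \<Rightarrow> real"
  assumes c: "continuous_on UNIV g" and g: "0 < g x0"
  obtains h where "0 < h" "0 < (LINT x|lebesgue_on (ocell h x0). g x)"
proof -
  have "open {x. g x0 / 2 < g x}" using c by (intro open_Collect_less) auto
  moreover have "x0 \<in> {x. g x0 / 2 < g x}" using g by simp
  ultimately obtain e where e: "0 < e" "ball x0 e \<subseteq> {x. g x0 / 2 < g x}" by (meson openE)
  \<comment> \<open>The l1 distance of a point of the cube from its corner is at most n h, which is
    less than \<open>e\<close>.\<close>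
  define h where "h = e / real (CARD('n) + 1)"
  have h: "0 < h" using e by (simp add: h_def)
  have sub: "g x0 / 2 \<le> g x" if x: "x \<in> ocell h x0" for x
  proof -
    have "norm (x - x0) \<le> (\<Sum>k\<in>UNIV. \<bar>(x - x0) $ k\<bar>)" by (rule norm_le_l1_cart)
    also have "\<dots> \<le> (\<Sum>k\<in>(UNIV::'n set). h)"
    proof (rule sum_mono)
      fix k show "\<bar>(x - x0) $ k\<bar> \<le> h" using x[unfolded mem_ocell, rule_format, of k] by auto
    qed
    also have "\<dots> < e" using e by (simp add: h_def field_simps)
    finally have "x \<in> ball x0 e" by (simp add: dist_norm norm_minus_commute)
    then show ?thesis using e by auto
  qed
  interpret finite_measure "lebesgue_on (ocell h x0)" by (rule finite_measure_lebesgue_on) simp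
  have "(LINT x|lebesgue_on (ocell h x0). g x0 / 2) \<le> (LINT x|lebesgue_on (ocell h x0). g x)"
  proof (rule integral_mono)
    show "integrable (lebesgue_on (ocell h x0)) g"
      by (rule L2_integrable[OF L2_continuous[OF c]]) (auto simp: ocell_def)
  qed (use sub in auto)
  moreover have "(LINT x|lebesgue_on (ocell h x0). g x0 / 2) = g x0 / 2 * h ^ CARD('n)"
    using measure_ocell[of h x0] h by (simp add: measure_restrict_space)
  moreover have "0 < g x0 / 2 * h ^ CARD('n)" using h g by simp
  ultimately show ?thesis using that[OF h] by linarith
qed

lemma continuous_zero_of_ocell_integrals:
  fixes g :: "real^'n \<Rightarrow> real"
  assumes c: "continuous_on UNIV g" and 0: "\<And>h p. 0 < h \<Longrightarrow> (LINT x|lebesgue_on (ocell h p). g x) = 0"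
  shows "g x = 0"
proof (rule ccontr)
  assume "g x \<noteq> 0"
  then consider "0 < g x" | "0 < - g x" by linarith
  then show False
  proof cases
    case 1
    from integral_ocell_pos[OF c 1] obtain h where "0 < h" "0 < (LINT x|lebesgue_on (ocell h x). g x)" .
    with 0[of h x] show ?thesis by simp
  next
    case 2
    have "continuous_on UNIV (\<lambda>x. - g x)" using c by (intro continuous_intros)
    from integral_ocell_pos[OF this 2] obtain h where "0 < h" "0 < (LINT x|lebesgue_on (ocell h x). - g x)" .
    with 0[of h x] show ?thesis by simp
  qed
qed

lemma ocell_integral_continuous:
  assumes "continuous_on UNIV f"
  shows "(LINT x|lebesgue_on (ocell h p). f x) = face_integral h p {} c f"
  using face_integral_empty[OF assms, of h p c] cell_ocell(3)[of h p f] by simp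

text \<open>Over every cell, the integral of either mixed derivative is the same alternating sum of
  integrals over four faces of codimension two. Continuous functions with equal integrals over all
  cells coincide.\<close>

lemma smooth_partials_swap:
  assumes f: "smooth f"
  shows "partials [i, j] f = partials [j, i] f"
proof (cases "i = j")
  case False
  have sm: "smooth (partials xs f)" for xs by (rule smooth_partials[OF f])
  have cont: "continuous_on UNIV (partials xs f)" for xs by (rule smooth_continuous[OF sm])
  have hp: "has_partial k (partials xs f) (partials (k # xs) f)" for k xs
    using smooth_has_partial[OF sm[of xs], of k] by simp
  have eq: "(LINT x|lebesgue_on (ocell h p). partials [k, l] f x) = 
      face_integral h p {k, l} (upd (upd 0 k (p $ k + h)) l (p $ l + h)) f - face_integral h p {k, l} (upd (upd 0 k (p $ k + h)) l (p $ l)) f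
     - (face_integral h p {k, l} (upd (upd 0 k (p $ k)) l (p $ l + h)) f - face_integral h p {k, l} (upd (upd 0 k (p $ k)) l (p $ l)) f)"
    if h: "0 < h" and kl: "k \<noteq> l" for h p k l
  proof -
    have "(LINT x|lebesgue_on (ocell h p). partials [k, l] f x) = face_integral h p {} 0 (partials [k, l] f)"
      by (rule ocell_integral_continuous[OF cont])
    also have "\<dots> = face_integral h p {k} (upd 0 k (p $ k + h)) (partials [l] f) - face_integral h p {k} (upd 0 k (p $ k)) (partials [l] f)"
      by (rule face_integral_partial[OF hp]) (use h in auto)
    finally have 1: "(LINT x|lebesgue_on (ocell h p). partials [k, l] f x) = face_integral h p {k} (upd 0 k (p $ k + h)) (partials [l] f) - face_integral h p {k} (upd 0 k (p $ k)) (partials [l] f)" .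
    have 2: "face_integral h p {k} (upd 0 k s) (partials [l] f) = 
       face_integral h p (insert l {k}) (upd (upd 0 k s) l (p $ l + h)) f - face_integral h p (insert l {k}) (upd (upd 0 k s) l (p $ l)) f" for s
      using face_integral_partial[OF hp[of l "[]", unfolded partials.simps(1)], of h "{k}" p "upd 0 k s"] h kl by simp
    show ?thesis unfolding 1 2 by (simp add: insert_commute)
  qed
  have upd: "upd (upd 0 j s) i t = upd (upd 0 i t) j s" for s t using False by (auto simp: vec_eq_iff)
  have "partials [i, j] f x - partials [j, i] f x = 0" for x
  proof (rule continuous_zero_of_ocell_integrals[where g="\<lambda>x. partials [i, j] f x - partials [j, i] f x"])
    show "continuous_on UNIV (\<lambda>x. partials [i, j] f x - partials [j, i] f x)"
      using cont by (intro continuous_intros)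
    fix h :: real and p assume h: "0 < h"
    have int: "integrable (lebesgue_on (ocell h p)) (partials xs f)" for xs
      by (rule L2_integrable[OF L2_continuous[OF cont]]) (auto simp: ocell_def)
    show "(LINT x|lebesgue_on (ocell h p). partials [i, j] f x - partials [j, i] f x) = 0"
      unfolding Bochner_Integration.integral_diff[OF int int] eq[OF h False] eq[OF h False[symmetric]] upd
      by (simp add: insert_commute)
  qed
  then show ?thesis by (auto simp: fun_eq_iff)
qed simp

text \<open>The outermost derivative is moved first and becomes the innermost one on \<phi>; this is
  why the list is reversed.\<close>

lemma smooth_partials_ibp:
  assumes \<phi>: "smooth \<phi>" and \<psi>: "\<psi> \<in> test_functions S" and S: "bounded S" "S \<in> sets lebesgue"
  shows "(LINT x|lebesgue_on S. partials ys \<psi> x * \<phi> x) = (-1) ^ length ys * (LINT x|lebesgue_on S. \<psi> x * partials (rev ys) \<phi> x)"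
  using \<phi>
proof (induction ys arbitrary: \<phi>)
  case (Cons y ys)
  have "weak_partial S y \<phi> (partials [y] \<phi>)"
    by (rule weak_partial_of_partial[OF smooth_has_partial[OF Cons.prems] S])
  from this[unfolded weak_partial_def, rule_format, OF test_functions_partials[OF \<psi>, of ys]]
  have "(LINT x|lebesgue_on S. partials (y # ys) \<psi> x * \<phi> x) = - (LINT x|lebesgue_on S. partials ys \<psi> x * partials [y] \<phi> x)"
    by simp
  also have "\<dots> = - ((-1) ^ length ys * (LINT x|lebesgue_on S. \<psi> x * partials (rev ys) (partials [y] \<phi>) x))"
    by (subst Cons.IH[OF smooth_partials[OF Cons.prems]]) simp
  finally show ?case by (simp add: partials_append del: partials.simps)
qed simp

section \<open>Multi-indices and Sobolev norms\<close>

lemma sum_count_list_UNIV: "(\<Sum>i\<in>(UNIV::'n::finite set). count_list xs i) = length xs"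
  by (rule sum_count_set) auto

lemma count_list_eq_iff_mset: "count_list xs = count_list ys \<longleftrightarrow> mset xs = mset ys"
  by (simp add: multiset_eq_iff fun_eq_iff count_mset)

lemma ex_count_list: "\<exists>xs. count_list xs = (\<alpha> :: 'n::finite \<Rightarrow> nat)"
proof -
  have "count (Abs_multiset \<alpha>) = \<alpha>" by (rule count_Abs_multiset) simp
  moreover obtain xs where "mset xs = Abs_multiset \<alpha>" using ex_mset by blast
  ultimately show ?thesis by (metis count_mset ext)
qed

text \<open>Order two is the order in which the approximants behind a trace converge, so derivatives
  of smooth functions are compared with weak ones up to this order.\<close>

lemma smooth_partials_mset:
  assumes "smooth f" "mset xs = mset ys" "length xs \<le> 2"
  shows "partials xs f = partials ys f"
proof -
  have len: "length ys = length xs" using assms(2) by (metis size_mset)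
  consider "xs = []" | x where "xs = [x]" | x x' where "xs = [x, x']"
  proof (cases xs)
    case (Cons x xs')
    then show ?thesis using assms(3) that by (cases xs'; cases "tl xs'") auto
  qed (use that in auto)
  then show ?thesis
  proof cases
    case 3
    then obtain y y' where ys: "ys = [y, y']" using len by (auto simp: length_Suc_conv)
    have "{#x, x'#} = {#y, y'#}" using assms(2) 3 ys by simp
    then have "(x = y \<and> x' = y') \<or> (x = y' \<and> x' = y)" by (auto simp: add_eq_conv_ex)
    then show ?thesis using 3 ys smooth_partials_swap[OF assms(1), of x x'] by (auto simp del: partials.simps)
  qed (use assms len in \<open>auto simp: length_Suc_conv\<close>)
qed

lemma smooth_has_weak_deriv:
  fixes \<phi> :: "real^'n \<Rightarrow> real"
  assumes \<phi>: "smooth \<phi>" and xs: "length xs \<le> 2" and S: "bounded S" "S \<in> sets lebesgue"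
  shows "has_weak_deriv S (count_list xs) \<phi> (partials xs \<phi>)"
  unfolding has_weak_deriv_def
proof (intro ballI allI impI)
  fix \<psi> ys assume \<psi>: "\<psi> \<in> test_functions S" and ys: "\<forall>i. count_list ys i = count_list xs i"
  have m: "mset ys = mset xs" using ys by (simp add: count_list_eq_iff_mset[symmetric] fun_eq_iff)
  then have len: "length ys = length xs" by (metis size_mset)
  have "partials (rev ys) \<phi> = partials xs \<phi>"
    by (rule smooth_partials_mset[OF \<phi>]) (use m len xs in auto)
  then show "(LINT x|lebesgue_on S. partials ys \<psi> x *\<^sub>R \<phi> x) = (-1) ^ (\<Sum>i\<in>UNIV. count_list xs i) *\<^sub>R (LINT x|lebesgue_on S. \<psi> x *\<^sub>R partials xs \<phi> x)"
    using smooth_partials_ibp[OF \<phi> \<psi> S, of ys] by (simp add: sum_count_list_UNIV len)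
qed

lemma test_function_measurable: "\<psi> \<in> test_functions S \<Longrightarrow> \<psi> \<in> borel_measurable (lebesgue_on T)"
  by (rule continuous_measurable_lebesgue_on) (auto simp: test_functions_def intro: smooth_continuous)

lemma test_function_scaleR_L2:
  assumes "\<psi> \<in> test_functions S" "f \<in> L2 T"
  shows "(\<lambda>x. \<psi> x *\<^sub>R f x) \<in> L2 T"
proof -
  obtain B where "\<And>x. \<bar>\<psi> x\<bar> \<le> B" using test_functions_bounded[OF assms(1)] by blast
  then show ?thesis by (intro L2_scaleR_bounded[OF assms(2) test_function_measurable[OF assms(1)]]) auto
qed

lemma test_function_integrable:
  assumes "\<psi> \<in> test_functions S" "f \<in> L2 T" "T \<in> lmeasurable"
  shows "integrable (lebesgue_on T) (\<lambda>x. \<psi> x *\<^sub>R f x)"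
  by (rule L2_integrable[OF test_function_scaleR_L2[OF assms(1,2)] assms(3)])

lemma has_weak_deriv_diff:
  fixes u v :: "real^'n \<Rightarrow> 'c::euclidean_space"
  assumes u: "has_weak_deriv S \<alpha> u g" and v: "has_weak_deriv S \<alpha> v g'"
    and L2: "u \<in> L2 S" "v \<in> L2 S" "g \<in> L2 S" "g' \<in> L2 S" and S: "S \<in> lmeasurable"
  shows "has_weak_deriv S \<alpha> (\<lambda>x. u x - v x) (\<lambda>x. g x - g' x)"
  unfolding has_weak_deriv_def
proof (intro ballI allI impI)
  fix \<psi> xs assume \<psi>: "\<psi> \<in> test_functions S" and xs: "\<forall>i. count_list xs i = \<alpha> i"
  note int = test_function_integrable[OF \<psi> _ S] test_function_integrable[OF test_functions_partials[OF \<psi>] _ S]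
  show "(LINT x|lebesgue_on S. partials xs \<psi> x *\<^sub>R (u x - v x)) = (-1) ^ (\<Sum>i\<in>UNIV. \<alpha> i) *\<^sub>R (LINT x|lebesgue_on S. \<psi> x *\<^sub>R (g x - g' x))"
    using u[unfolded has_weak_deriv_def, rule_format, OF \<psi>, of xs] v[unfolded has_weak_deriv_def, rule_format, OF \<psi>, of xs] xs
    by (simp add: scaleR_diff_right int L2 )
qed

lemma has_weak_deriv_unique:
  fixes u :: "real^'n \<Rightarrow> real"
  assumes g: "has_weak_deriv (box a b) \<alpha> u g" and g': "has_weak_deriv (box a b) \<alpha> u g'"
    and L2: "g \<in> L2 (box a b)" "g' \<in> L2 (box a b)"
  shows "AE x in lebesgue_on (box a b). g x = g' x"
proof -
  obtain xs where xs: "count_list xs = \<alpha>" using ex_count_list by blast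
  have "AE x in lebesgue_on (box a b). g x - g' x = 0"
  proof (rule fundamental_lemma_variations)
    show "integrable (lebesgue_on (box a b)) (\<lambda>x. g x - g' x)"
      by (rule L2_integrable[OF L2_diff[OF L2]]) simp
    fix \<psi> assume \<psi>: "\<psi> \<in> test_functions (box a b)"
    have "(LINT x|lebesgue_on (box a b). \<psi> x * g x) = (LINT x|lebesgue_on (box a b). \<psi> x * g' x)"
      using g[unfolded has_weak_deriv_def, rule_format, OF \<psi>, of xs] g'[unfolded has_weak_deriv_def, rule_format, OF \<psi>, of xs] xs by simp
    then show "(LINT x|lebesgue_on (box a b). \<psi> x * (g x - g' x)) = 0"
      using test_function_integrable[OF \<psi> L2(1)] test_function_integrable[OF \<psi> L2(2)] by (simp add: right_diff_distrib)
  qed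
  then show ?thesis by simp
qed

lemma L2_norm_real: "(L2_norm S (f :: _ \<Rightarrow> real))\<^sup>2 = sq S f"
  using sq_nonneg[of S f] by (simp add: L2_norm_def L2_inner_def sq_def power2_eq_square)

lemma sq_cong_AE:
  assumes "f \<in> L2 S" "g \<in> L2 S" "AE x in lebesgue_on S. f x = g x"
  shows "sq S f = sq S g"
  unfolding sq_def
proof (rule integral_cong_AE)
  show "AE x in lebesgue_on S. (f x)\<^sup>2 = (g x)\<^sup>2" using assms(3) by eventually_elim simp
qed (use assms(1,2)[THEN L2_sq_integrable] in auto)

lemma finite_multiindices: "finite {\<alpha>::'n::finite \<Rightarrow> nat. (\<Sum>i\<in>UNIV. \<alpha> i) \<le> k}"
proof (rule finite_subset)
  show "{\<alpha>::'n \<Rightarrow> nat. (\<Sum>i\<in>UNIV. \<alpha> i) \<le> k} \<subseteq> (\<Pi>\<^sub>E i\<in>UNIV. {..k})"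
  proof
    fix \<alpha> :: "'n \<Rightarrow> nat" assume "\<alpha> \<in> {\<alpha>. (\<Sum>i\<in>UNIV. \<alpha> i) \<le> k}"
    then have "\<alpha> i \<le> k" for i using member_le_sum[of i UNIV \<alpha>] by simp
    then show "\<alpha> \<in> (\<Pi>\<^sub>E i\<in>UNIV. {..k})" by (auto simp: PiE_iff)
  qed
qed (auto intro!: finite_PiE)

lemma weak_deriv_exists:
  assumes "g \<in> L2 S" "has_weak_deriv S \<alpha> u g"
  shows "weak_deriv S \<alpha> u \<in> L2 S" "has_weak_deriv S \<alpha> u (weak_deriv S \<alpha> u)"
  using someI[of "\<lambda>g. g \<in> L2 S \<and> has_weak_deriv S \<alpha> u g" g] assms by (auto simp: weak_deriv_def)

lemma sobolev_weak_deriv: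
  assumes "u \<in> sobolev k S" "length xs \<le> k"
  shows "weak_deriv S (count_list xs) u \<in> L2 S" "has_weak_deriv S (count_list xs) u (weak_deriv S (count_list xs) u)"
proof -
  have "\<forall>\<alpha>. (\<Sum>i\<in>UNIV. \<alpha> i) \<le> k \<longrightarrow> (\<exists>g\<in>L2 S. has_weak_deriv S \<alpha> u g)"
    using assms(1) by (simp add: sobolev_def)
  from this[rule_format, of "count_list xs"] assms(2)
  obtain g where "g \<in> L2 S" "has_weak_deriv S (count_list xs) u g" by (auto simp: sum_count_list_UNIV)
  from weak_deriv_exists[OF this] show "weak_deriv S (count_list xs) u \<in> L2 S" "has_weak_deriv S (count_list xs) u (weak_deriv S (count_list xs) u)" .
qed

lemma sobolev_norm_ge:
  assumes "length xs \<le> k"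
  shows "(L2_norm S (weak_deriv S (count_list xs) u))\<^sup>2 \<le> (sobolev_norm k S u)\<^sup>2"
proof -
  have "(L2_norm S (weak_deriv S (count_list xs) u))\<^sup>2 \<le> (\<Sum>\<alpha>\<in>{\<alpha>. (\<Sum>i\<in>UNIV. \<alpha> i) \<le> k}. (L2_norm S (weak_deriv S \<alpha> u))\<^sup>2)"
    by (rule member_le_sum[where f="\<lambda>\<alpha>. (L2_norm S (weak_deriv S \<alpha> u))\<^sup>2"]) (use assms in \<open>auto simp: sum_count_list_UNIV finite_multiindices\<close>)
  then show ?thesis by (simp add: sobolev_norm_def sum_nonneg)
qed

text \<open>The weak derivative that enters the Sobolev norm is an unspecified choice, but by
  uniqueness almost everywhere it equals the difference of the two derivatives. A single summand of
  the norm then gives the bound.\<close>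

lemma sq_weak_deriv_smooth_diff:
  assumes \<phi>: "smooth \<phi>" and u: "u \<in> L2 (box a b)" and D: "D \<in> L2 (box a b)" "has_weak_deriv (box a b) (count_list xs) u D"
    and xs: "length xs \<le> 2"
  shows "sq (box a b) (\<lambda>x. partials xs \<phi> x - D x) \<le> (sobolev_norm 2 (box a b) (\<lambda>x. \<phi> x - u x))\<^sup>2"
proof -
  let ?S = "box a b"
  have L: "\<phi> \<in> L2 ?S" "partials xs \<phi> \<in> L2 ?S" 
    by (rule L2_continuous[OF smooth_continuous[OF \<phi>]] L2_continuous[OF smooth_continuous[OF smooth_partials[OF \<phi>]]]; simp)+
  have w: "has_weak_deriv ?S (count_list xs) (\<lambda>x. \<phi> x - u x) (\<lambda>x. partials xs \<phi> x - D x)"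
    by (rule has_weak_deriv_diff[OF smooth_has_weak_deriv[OF \<phi> xs] D(2) L(1) u L(2) D(1)]) auto
  have l: "(\<lambda>x. partials xs \<phi> x - D x) \<in> L2 ?S" using L D by auto
  note w' = weak_deriv_exists[OF l w]
  have "sq ?S (\<lambda>x. partials xs \<phi> x - D x) = sq ?S (weak_deriv ?S (count_list xs) (\<lambda>x. \<phi> x - u x))"
    by (rule sq_cong_AE[OF l w'(1) has_weak_deriv_unique[OF w w'(2) l w'(1)]])
  then show ?thesis using sobolev_norm_ge[OF xs, of ?S "\<lambda>x. \<phi> x - u x"] by (simp add: L2_norm_real)
qed

section \<open>Traces\<close>

text \<open>Indexing by lists instead of multi-indices lets \<open>D (i # xs)\<close> be read as the
  derivative of \<open>D xs\<close> in direction \<open>i\<close>. The equation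
  \<open>D [] = u\<close> is meant literally, not almost everywhere.\<close>

definition weak_derivs :: "(real^'n) set \<Rightarrow> nat \<Rightarrow> (real^'n \<Rightarrow> real) \<Rightarrow> ('n list \<Rightarrow> real^'n \<Rightarrow> real) \<Rightarrow> bool" where
  "weak_derivs S k u D \<longleftrightarrow> D [] = u \<and>
     (\<forall>xs. length xs \<le> k \<longrightarrow> D xs \<in> L2 S \<and> has_weak_deriv S (count_list xs) u (D xs))"

lemma weak_derivs_mono: "weak_derivs S k u D \<Longrightarrow> l \<le> k \<Longrightarrow> weak_derivs S l u D"
  by (simp add: weak_derivs_def)

lemma weak_derivs_L2: "weak_derivs S k u D \<Longrightarrow> length xs \<le> k \<Longrightarrow> D xs \<in> L2 S"
  by (simp add: weak_derivs_def)

lemma weak_derivs_weak_partial: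
  assumes D: "weak_derivs S k u D" and xs: "length xs < k"
  shows "weak_partial S i (D xs) (D (i # xs))"
  unfolding weak_partial_def
proof
  fix \<psi> assume \<psi>: "\<psi> \<in> test_functions S"
  have 1: "has_weak_deriv S (count_list xs) u (D xs)" "has_weak_deriv S (count_list (i # xs)) u (D (i # xs))"
    using D xs by (auto simp: weak_derivs_def simp del: count_list.simps)
  \<comment> \<open>The weak derivative may be tested with any list having the right counts;
    appending \<open>i\<close> at the end puts that derivative innermost, next to the test
    function.\<close>
  have c: "\<forall>k. count_list (xs @ [i]) k = count_list (i # xs) k" by simp
  have "(-1) ^ length xs * (LINT x|lebesgue_on S. partials [i] \<psi> x * D xs x) = (LINT x|lebesgue_on S. partials xs (partials [i] \<psi>) x * u x)"
    using 1(1)[unfolded has_weak_deriv_def, rule_format, OF test_functions_partials[OF \<psi>, of "[i]"], of xs]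
    by (simp add: sum_count_list_UNIV)
  also have "\<dots> = (-1) ^ length (i # xs) * (LINT x|lebesgue_on S. \<psi> x * D (i # xs) x)"
    using 1(2)[unfolded has_weak_deriv_def, rule_format, OF \<psi>, of "xs @ [i]"] c
    unfolding sum_count_list_UNIV partials_append by simp
  finally have "(-1) ^ length xs * ((LINT x|lebesgue_on S. partials [i] \<psi> x * D xs x) + (LINT x|lebesgue_on S. \<psi> x * D (i # xs) x)) = 0"
    by (simp add: distrib_left)
  then show "(LINT x|lebesgue_on S. partials [i] \<psi> x * D xs x) = - (LINT x|lebesgue_on S. \<psi> x * D (i # xs) x)"
    by (simp add: eq_neg_iff_add_eq_0)
qed

text \<open>The partial derivatives along the axes serve the face integrals; the total derivative
  serves the chain rule along oblique segments in the Poincare inequality.\<close>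

definition C1 :: "(real^'n \<Rightarrow> real) \<Rightarrow> ('n \<Rightarrow> real^'n \<Rightarrow> real) \<Rightarrow> bool" where
  "C1 g g' \<longleftrightarrow> (\<forall>i. has_partial i g (g' i)) \<and> (\<forall>x. (g has_derivative (\<lambda>v. \<Sum>i\<in>UNIV. g' i x * v $ i)) (at x))"

lemma smooth_C1:
  assumes "smooth (f :: real^'n \<Rightarrow> real)"
  shows "C1 f (\<lambda>i. partials [i] f)"
proof -
  have "(f has_derivative (\<lambda>v. \<Sum>i\<in>UNIV. partials [i] f x * v $ i)) (at x)" for x
  proof -
    have d: "f differentiable (at x)" by (rule smooth_differentiable[OF assms])
    then have "(f has_derivative frechet_derivative f (at x)) (at x)" by (simp add: frechet_derivative_works)
    moreover have "frechet_derivative f (at x) v = (\<Sum>i\<in>UNIV. partials [i] f x * v $ i)" for v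
    proof -
      have l: "linear (frechet_derivative f (at x))" by (rule linear_frechet_derivative[OF d])
      have "v = (\<Sum>i\<in>UNIV. v $ i *\<^sub>R axis i 1)"
        by (auto simp: vec_eq_iff axis_def if_distrib cong: if_cong)
      then have "frechet_derivative f (at x) v = frechet_derivative f (at x) (\<Sum>i\<in>UNIV. v $ i *\<^sub>R axis i 1)" by simp
      then show ?thesis by (simp add: linear_sum[OF l] linear_cmul[OF l] mult.commute)
    qed
    ultimately show ?thesis by (rule has_derivative_eq_rhs[OF _ ext])
  qed
  then show ?thesis using smooth_has_partial[OF assms] by (simp add: C1_def)
qed

text \<open>The hypothesis \<open>has_trace_integral\<close> supplies the approximating functions, so that no density
  theorem for Sobolev spaces is needed.\<close>

definition C1_limit :: "(real^'n) set \<Rightarrow> (real^'n \<Rightarrow> real) \<Rightarrow> ('n \<Rightarrow> real^'n \<Rightarrow> real) \<Rightarrow> bool" where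
  "C1_limit S f F \<longleftrightarrow> f \<in> L2 S \<and> (\<forall>i. F i \<in> L2 S) \<and>
     (\<exists>g g'. (\<forall>k::nat. C1 (g k) (g' k)) \<and> (\<lambda>k. sq S (\<lambda>x. g k x - f x)) \<longlonglongrightarrow> 0 \<and>
        (\<forall>i. (\<lambda>k. sq S (\<lambda>x. g' k i x - F i x)) \<longlonglongrightarrow> 0))"

lemma trace_integral_approx:
  assumes tr: "has_trace_integral (box a b) h p I c u m" and D: "weak_derivs (box a b) 2 u D"
  obtains \<phi> where "\<forall>k. smooth (\<phi> k)"
    "\<forall>xs. length xs \<le> 2 \<longrightarrow> (\<lambda>k. sq (box a b) (\<lambda>x. partials xs (\<phi> k) x - D xs x)) \<longlonglongrightarrow> 0"
    "(\<lambda>k. face_integral h p I c (\<phi> k)) \<longlonglongrightarrow> m"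
proof -
  obtain \<phi> where \<phi>: "\<forall>k. smooth (\<phi> k)" "(\<lambda>k. sobolev_norm 2 (box a b) (\<lambda>x. \<phi> k x - u x)) \<longlonglongrightarrow> 0"
    "(\<lambda>k. face_integral h p I c (\<phi> k)) \<longlonglongrightarrow> m"
    using tr unfolding has_trace_integral_def by blast
  have "(\<lambda>k. sq (box a b) (\<lambda>x. partials xs (\<phi> k) x - D xs x)) \<longlonglongrightarrow> 0" if xs: "length xs \<le> 2" for xs
  proof (rule Lim_null_comparison)
    show "(\<lambda>k. (sobolev_norm 2 (box a b) (\<lambda>x. \<phi> k x - u x))\<^sup>2) \<longlonglongrightarrow> 0"
      using tendsto_power[OF \<phi>(2), of 2] by simp
    have "D [] \<in> L2 (box a b)" "D [] = u" using D by (auto simp: weak_derivs_def)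
    then have u: "u \<in> L2 (box a b)" by simp
    have "sq (box a b) (\<lambda>x. partials xs (\<phi> k) x - D xs x) \<le> (sobolev_norm 2 (box a b) (\<lambda>x. \<phi> k x - u x))\<^sup>2" for k
      by (rule sq_weak_deriv_smooth_diff) (use \<phi> D xs u in \<open>auto simp: weak_derivs_def\<close>)
    then show "\<forall>\<^sub>F k in sequentially. norm (sq (box a b) (\<lambda>x. partials xs (\<phi> k) x - D xs x)) \<le> (sobolev_norm 2 (box a b) (\<lambda>x. \<phi> k x - u x))\<^sup>2"
      by simp
  qed
  then show ?thesis using that[of \<phi>] \<phi> by blast
qed

lemma C1_limitI:
  fixes g :: "nat \<Rightarrow> real^'n \<Rightarrow> real"
  assumes "f \<in> L2 S" "\<And>i. F i \<in> L2 S" "\<And>k. C1 (g k) (g' k)"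
    "(\<lambda>k. sq S (\<lambda>x. g k x - f x)) \<longlonglongrightarrow> 0" "\<And>i. (\<lambda>k. sq S (\<lambda>x. g' k i x - F i x)) \<longlonglongrightarrow> 0"
  shows "C1_limit S f F"
  unfolding C1_limit_def using assms by blast

text \<open>A sequence that converges in H^2 approximates \<open>u\<close> together with its
  gradient, and its first derivatives approximate each \<open>D [j]\<close> together with the
  gradient of \<open>D [j]\<close>. The Poincare inequality thus becomes available at both
  orders.\<close>

lemma trace_integral_C1_limit:
  assumes tr: "has_trace_integral (box a b) h p I c u m" and D: "weak_derivs (box a b) 2 u D"
  shows "C1_limit (box a b) u (\<lambda>i. D [i])" "C1_limit (box a b) (D [j]) (\<lambda>i. D [i, j])"
proof -
  from trace_integral_approx[OF tr D] obtain \<phi> where \<phi>': "\<forall>k. smooth (\<phi> k)"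
    "\<forall>xs. length xs \<le> 2 \<longrightarrow> (\<lambda>k. sq (box a b) (\<lambda>x. partials xs (\<phi> k) x - D xs x)) \<longlonglongrightarrow> 0"
    "(\<lambda>k. face_integral h p I c (\<phi> k)) \<longlonglongrightarrow> m" by blast
  note \<phi> = \<phi>'[rule_format]
  have u: "D [] = u" using D by (simp add: weak_derivs_def)
  have l: "D [] \<in> L2 (box a b)" "D [i] \<in> L2 (box a b)" "D [i, j] \<in> L2 (box a b)" for i j
    using weak_derivs_L2[OF D] by auto
  show "C1_limit (box a b) u (\<lambda>i. D [i])"
  proof (rule C1_limitI[where g=\<phi> and g'="\<lambda>k i. partials [i] (\<phi> k)"])
    show "(\<lambda>k. sq (box a b) (\<lambda>x. \<phi> k x - u x)) \<longlonglongrightarrow> 0" using \<phi>(2)[of "[]"] by (simp add: u)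
    show "(\<lambda>k. sq (box a b) (\<lambda>x. partials [i] (\<phi> k) x - D [i] x)) \<longlonglongrightarrow> 0" for i by (rule \<phi>(2)) simp
    show "u \<in> L2 (box a b)" using l(1) u by simp
  qed (rule l smooth_C1 \<phi>(1))+
  have "C1 (partials [j] (\<phi> k)) (\<lambda>i. partials [i, j] (\<phi> k))" for k
    using smooth_C1[OF smooth_partials[OF \<phi>(1)[of k], of "[j]"]] by (simp add: partials_append del: partials.simps)
  then show "C1_limit (box a b) (D [j]) (\<lambda>i. D [i, j])"
    by (rule C1_limitI[where g="\<lambda>k. partials [j] (\<phi> k)" and g'="\<lambda>k i. partials [i, j] (\<phi> k)", OF l(2) l(3)])
       (rule \<phi>(2), simp)+
qed

section \<open>Traces as integrals over the cell\<close>

lemma trace1: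
  assumes F: "has_partial i F F'" and h: "0 < h" and c: "c $ i \<in> {p $ i, p $ i + h}"
  shows "h * face_integral h p {i} c F = (LINT x|lebesgue_on (ocell h p). F x + (x $ i - (2 * p $ i + h - c $ i)) * F' x)"
proof -
  have "continuous_on UNIV (\<lambda>x. F x + (x $ i - (2 * p $ i + h - c $ i)) * F' x)"
    using F by (auto simp: has_partial_def intro!: continuous_intros)
  from ocell_integral_continuous[OF this, of h p c] face_integral_trace[OF F h _ c, of "{}"] show ?thesis by simp
qed

text \<open>The face of codimension two is reached in two steps through the face perpendicular to
  the \<open>j\<close>-axis: one affine weight opens the direction \<open>i\<close>, a second one
  the direction \<open>j\<close>.\<close>

lemma trace2:
  assumes F: "has_partial i F Fi" "has_partial j F Fj" "has_partial j Fi Fij" and h: "0 < h" and ij: "i \<noteq> j"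
    and c: "c $ i \<in> {p $ i, p $ i + h}" "c $ j \<in> {p $ j, p $ j + h}"
  shows "h\<^sup>2 * face_integral h p {i, j} c F = (LINT x|lebesgue_on (ocell h p).
    F x + (x $ i - (2 * p $ i + h - c $ i)) * Fi x + (x $ j - (2 * p $ j + h - c $ j)) * (Fj x + (x $ i - (2 * p $ i + h - c $ i)) * Fij x))"
proof -
  have 1: "h * face_integral h p {i, j} c F = face_integral h p {j} c (\<lambda>x. F x + (x $ i - (2 * p $ i + h - c $ i)) * Fi x)"
    by (rule face_integral_trace[OF F(1) h _ c(1)]) (use ij in simp)
  have "has_partial j (\<lambda>x. x $ i - (2 * p $ i + h - c $ i)) (\<lambda>x. 0)"
    using ij by (intro has_partial_indep continuous_intros) (simp add: axis_def)
  from has_partial_add[OF F(2) has_partial_mult[OF this F(3)]]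
  have "has_partial j (\<lambda>x. F x + (x $ i - (2 * p $ i + h - c $ i)) * Fi x) (\<lambda>x. Fj x + (x $ i - (2 * p $ i + h - c $ i)) * Fij x)"
    by simp
  note 2 = trace1[OF this h c(2)]
  have "h\<^sup>2 * face_integral h p {i, j} c F = h * (h * face_integral h p {i, j} c F)" by (simp add: power2_eq_square)
  then show ?thesis unfolding 1 2 .
qed

text \<open>The identity for smooth functions is continuous in the H^2 norm. Its right side contains
  only weak derivatives inside the cell, so a trace condition can enter L2 estimates.\<close>

lemma trace_formula1:
  assumes tr: "has_trace_integral (box a b) h p {i} c u m" and D: "weak_derivs (box a b) 2 u D"
    and h: "0 < h" and c: "c $ i \<in> {p $ i, p $ i + h}" and sub: "ocell h p \<subseteq> box a b"
  shows "h * m = (LINT x|lebesgue_on (ocell h p). u x + (x $ i - (2 * p $ i + h - c $ i)) * D [i] x)"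
proof -
  let ?K = "ocell h p" and ?S = "box a b"
  let ?\<theta> = "\<lambda>x. x $ i - (2 * p $ i + h - c $ i)"
  from trace_integral_approx[OF tr D] obtain \<phi> where \<phi>': "\<forall>k. smooth (\<phi> k)"
    "\<forall>xs. length xs \<le> 2 \<longrightarrow> (\<lambda>k. sq ?S (\<lambda>x. partials xs (\<phi> k) x - D xs x)) \<longlonglongrightarrow> 0"
    "(\<lambda>k. face_integral h p {i} c (\<phi> k)) \<longlonglongrightarrow> m" by blast
  note \<phi> = \<phi>'[rule_format]
  have u: "D [] = u" using D by (simp add: weak_derivs_def)
  have bdd: "bounded ?K" by (simp add: ocell_def)
  have DS: "D xs \<in> L2 ?S" if "length xs \<le> 2" for xs using weak_derivs_L2[OF D that] .
  have DK: "D xs \<in> L2 ?K" if "length xs \<le> 2" for xs using DS[OF that] sub by (rule L2_subset) auto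
  have pc: "continuous_on UNIV (partials xs (\<phi> k))" for xs k by (rule smooth_continuous[OF smooth_partials[OF \<phi>(1)]])
  have pS: "partials xs (\<phi> k) \<in> L2 ?S" for xs k by (rule L2_continuous[OF pc]) auto
  have pK: "partials xs (\<phi> k) \<in> L2 ?K" for xs k by (rule L2_continuous[OF pc bdd]) auto
  have \<theta>: "?\<theta> \<in> L2 ?K" by (rule L2_continuous[OF _ bdd]) (auto intro!: continuous_intros)
  have lim: "(\<lambda>k. LINT x|lebesgue_on ?K. partials xs (\<phi> k) x * \<theta> x) \<longlonglongrightarrow> (LINT x|lebesgue_on ?K. D xs x * \<theta> x)"
    if "length xs \<le> 2" "\<theta> \<in> L2 ?K" for xs \<theta>
  proof (rule sq_tendsto_integral[OF pK DK[OF that(1)] that(2)])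
    show "(\<lambda>k. sq ?K (\<lambda>x. partials xs (\<phi> k) x - D xs x)) \<longlonglongrightarrow> 0"
      by (rule tendsto_sandwich[OF _ _ tendsto_const \<phi>(2)[OF that(1)]])
         (auto intro!: always_eventually sq_mono_set[OF L2_diff[OF pS DS[OF that(1)]] sub])
  qed
  have eq: "h * face_integral h p {i} c (\<phi> k) = (LINT x|lebesgue_on ?K. partials [] (\<phi> k) x * 1) + (LINT x|lebesgue_on ?K. partials [i] (\<phi> k) x * ?\<theta> x)" for k
  proof -
    have "h * face_integral h p {i} c (\<phi> k) = (LINT x|lebesgue_on ?K. partials [] (\<phi> k) x * 1 + partials [i] (\<phi> k) x * ?\<theta> x)"
      using trace1[OF smooth_has_partial[OF \<phi>(1)[of k]] h c] by (simp add: mult.commute)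
    also have "\<dots> = (LINT x|lebesgue_on ?K. partials [] (\<phi> k) x * 1) + (LINT x|lebesgue_on ?K. partials [i] (\<phi> k) x * ?\<theta> x)"
      by (intro Bochner_Integration.integral_add L2_mult_integrable pK \<theta>) auto
    finally show ?thesis .
  qed
  have "(\<lambda>k. h * face_integral h p {i} c (\<phi> k)) \<longlonglongrightarrow> (LINT x|lebesgue_on ?K. D [] x * 1) + (LINT x|lebesgue_on ?K. D [i] x * ?\<theta> x)"
    unfolding eq by (intro tendsto_add lim \<theta>) auto
  then have "h * m = (LINT x|lebesgue_on ?K. D [] x * 1) + (LINT x|lebesgue_on ?K. D [i] x * ?\<theta> x)"
    using LIMSEQ_unique tendsto_mult[OF tendsto_const \<phi>(3)] by blast
  also have "\<dots> = (LINT x|lebesgue_on ?K. D [] x * 1 + D [i] x * ?\<theta> x)"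
    by (intro Bochner_Integration.integral_add[symmetric] L2_mult_integrable DK \<theta>) auto
  finally show ?thesis by (simp add: u mult.commute)
qed

text \<open>The product of both weights multiplies the mixed derivative; a trace on a face of
  codimension two is where a second derivative is consumed.\<close>

lemma trace_formula2:
  assumes tr: "has_trace_integral (box a b) h p {i, j} c u m" and D: "weak_derivs (box a b) 2 u D"
    and h: "0 < h" and ij: "i \<noteq> j" and c: "c $ i \<in> {p $ i, p $ i + h}" "c $ j \<in> {p $ j, p $ j + h}"
    and sub: "ocell h p \<subseteq> box a b"
  shows "h\<^sup>2 * m = (LINT x|lebesgue_on (ocell h p).
    u x + (x $ i - (2 * p $ i + h - c $ i)) * D [i] x + (x $ j - (2 * p $ j + h - c $ j)) * (D [j] x + (x $ i - (2 * p $ i + h - c $ i)) * D [j, i] x))"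
proof -
  let ?K = "ocell h p" and ?S = "box a b"
  let ?\<theta> = "\<lambda>k x. x $ k - (2 * p $ k + h - c $ k)"
  from trace_integral_approx[OF tr D] obtain \<phi> where \<phi>': "\<forall>k. smooth (\<phi> k)"
    "\<forall>xs. length xs \<le> 2 \<longrightarrow> (\<lambda>k. sq ?S (\<lambda>x. partials xs (\<phi> k) x - D xs x)) \<longlonglongrightarrow> 0"
    "(\<lambda>k. face_integral h p {i, j} c (\<phi> k)) \<longlonglongrightarrow> m" by blast
  note \<phi> = \<phi>'[rule_format]
  have u: "D [] = u" using D by (simp add: weak_derivs_def)
  have bdd: "bounded ?K" by (simp add: ocell_def)
  have DS: "D xs \<in> L2 ?S" if "length xs \<le> 2" for xs using weak_derivs_L2[OF D that] .
  have DK: "D xs \<in> L2 ?K" if "length xs \<le> 2" for xs using DS[OF that] sub by (rule L2_subset) auto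
  have pc: "continuous_on UNIV (partials xs (\<phi> k))" for xs k by (rule smooth_continuous[OF smooth_partials[OF \<phi>(1)]])
  have pS: "partials xs (\<phi> k) \<in> L2 ?S" for xs k by (rule L2_continuous[OF pc]) auto
  have pK: "partials xs (\<phi> k) \<in> L2 ?K" for xs k by (rule L2_continuous[OF pc bdd]) auto
  have \<theta>: "?\<theta> k \<in> L2 ?K" for k by (rule L2_continuous[OF _ bdd]) (auto intro!: continuous_intros)
  have \<theta>2: "(\<lambda>x. ?\<theta> j x * ?\<theta> i x) \<in> L2 ?K" by (rule L2_continuous[OF _ bdd]) (auto intro!: continuous_intros)
  have lim: "(\<lambda>k. LINT x|lebesgue_on ?K. partials xs (\<phi> k) x * \<theta> x) \<longlonglongrightarrow> (LINT x|lebesgue_on ?K. D xs x * \<theta> x)"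
    if "length xs \<le> 2" "\<theta> \<in> L2 ?K" for xs \<theta>
  proof (rule sq_tendsto_integral[OF pK DK[OF that(1)] that(2)])
    show "(\<lambda>k. sq ?K (\<lambda>x. partials xs (\<phi> k) x - D xs x)) \<longlonglongrightarrow> 0"
      by (rule tendsto_sandwich[OF _ _ tendsto_const \<phi>(2)[OF that(1)]])
         (auto intro!: always_eventually sq_mono_set[OF L2_diff[OF pS DS[OF that(1)]] sub])
  qed
  have split: "(LINT x|lebesgue_on ?K. F0 x + ?\<theta> i x * F1 x + ?\<theta> j x * (F2 x + ?\<theta> i x * F3 x)) =
      (LINT x|lebesgue_on ?K. F0 x * 1) + (LINT x|lebesgue_on ?K. F1 x * ?\<theta> i x) + (LINT x|lebesgue_on ?K. F2 x * ?\<theta> j x)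
     + (LINT x|lebesgue_on ?K. F3 x * (?\<theta> j x * ?\<theta> i x))"
    if F: "F0 \<in> L2 ?K" "F1 \<in> L2 ?K" "F2 \<in> L2 ?K" "F3 \<in> L2 ?K" for F0 F1 F2 F3
  proof -
    have i: "integrable (lebesgue_on ?K) (\<lambda>x. F0 x * 1)" "integrable (lebesgue_on ?K) (\<lambda>x. F1 x * ?\<theta> i x)"
      "integrable (lebesgue_on ?K) (\<lambda>x. F2 x * ?\<theta> j x)" "integrable (lebesgue_on ?K) (\<lambda>x. F3 x * (?\<theta> j x * ?\<theta> i x))"
      by (intro L2_mult_integrable F \<theta> \<theta>2 L2_const ocell_lmeasurable)+
    have "(LINT x|lebesgue_on ?K. F0 x + ?\<theta> i x * F1 x + ?\<theta> j x * (F2 x + ?\<theta> i x * F3 x)) =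
       (LINT x|lebesgue_on ?K. F0 x * 1 + F1 x * ?\<theta> i x + F2 x * ?\<theta> j x + F3 x * (?\<theta> j x * ?\<theta> i x))"
      by (intro Bochner_Integration.integral_cong) (auto simp: algebra_simps)
    also have "\<dots> = (LINT x|lebesgue_on ?K. F0 x * 1) + (LINT x|lebesgue_on ?K. F1 x * ?\<theta> i x) + (LINT x|lebesgue_on ?K. F2 x * ?\<theta> j x)
     + (LINT x|lebesgue_on ?K. F3 x * (?\<theta> j x * ?\<theta> i x))"
      by (simp only: Bochner_Integration.integral_add Bochner_Integration.integrable_add i)
    finally show ?thesis .
  qed
  have hp: "has_partial l (\<phi> k) (partials [l] (\<phi> k))" "has_partial l (partials [i] (\<phi> k)) (partials [l, i] (\<phi> k))" for k l
    using smooth_has_partial[OF \<phi>(1)[of k]] smooth_has_partial[OF smooth_partials[OF \<phi>(1)[of k], of "[i]"]] 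
    by (simp_all add: partials_append del: partials.simps)
  have "(\<lambda>k. h\<^sup>2 * face_integral h p {i, j} c (\<phi> k)) \<longlonglongrightarrow> (LINT x|lebesgue_on ?K. D [] x * 1) + (LINT x|lebesgue_on ?K. D [i] x * ?\<theta> i x)
     + (LINT x|lebesgue_on ?K. D [j] x * ?\<theta> j x) + (LINT x|lebesgue_on ?K. D [j, i] x * (?\<theta> j x * ?\<theta> i x))"
    unfolding trace2[OF hp(1) hp(1) hp(2) h ij c] split[OF pK[of "[]", unfolded partials.simps(1)] pK pK pK]
  proof (intro tendsto_add)
    show "(\<lambda>k. LINT x|lebesgue_on ?K. \<phi> k x * 1) \<longlonglongrightarrow> (LINT x|lebesgue_on ?K. D [] x * 1)"
      using lim[of "[]" "\<lambda>x. 1"] by simp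
  qed (rule lim; simp add: \<theta> \<theta>2)+
  then have "h\<^sup>2 * m = (LINT x|lebesgue_on ?K. D [] x * 1) + (LINT x|lebesgue_on ?K. D [i] x * ?\<theta> i x)
     + (LINT x|lebesgue_on ?K. D [j] x * ?\<theta> j x) + (LINT x|lebesgue_on ?K. D [j, i] x * (?\<theta> j x * ?\<theta> i x))"
    using LIMSEQ_unique tendsto_mult[OF tendsto_const \<phi>(3)] by blast
  also have "\<dots> = (LINT x|lebesgue_on ?K. D [] x + ?\<theta> i x * D [i] x + ?\<theta> j x * (D [j] x + ?\<theta> i x * D [j, i] x))"
    by (rule split[symmetric]) (auto intro!: DK)
  finally show ?thesis by (simp add: u)
qed

section \<open>Mean values over a cell\<close>

text \<open>The difference of the two sides is the measure of \<open>S\<close> times the squared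
  distance from \<open>c\<close> to the mean.\<close>

lemma sq_shift:
  assumes f: "f \<in> L2 S" and S: "S \<in> lmeasurable" and \<mu>: "0 < measure lebesgue S"
  shows "sq S (\<lambda>x. f x - (LINT x|lebesgue_on S. f x) / measure lebesgue S) \<le> sq S (\<lambda>x. f x - c)"
proof -
  define m where "m = (LINT x|lebesgue_on S. f x) / measure lebesgue S"
  have fi: "integrable (lebesgue_on S) f" by (rule L2_integrable[OF f S])
  have 1: "sq S (\<lambda>x. f x - c) = sq S f - 2 * c * (m * measure lebesgue S) + c\<^sup>2 * measure lebesgue S" for c
  proof -
    interpret finite_measure "lebesgue_on S" by (rule finite_measure_lebesgue_on[OF S])
    have "sq S (\<lambda>x. f x - c) = (LINT x|lebesgue_on S. (f x)\<^sup>2 - 2 * c * f x + c\<^sup>2)"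
      unfolding sq_def by (intro Bochner_Integration.integral_cong) (auto simp: power2_diff)
    also have "\<dots> = sq S f - 2 * c * (LINT x|lebesgue_on S. f x) + c\<^sup>2 * measure lebesgue S"
      using fi L2_sq_integrable[OF f] S by (simp add: sq_def measure_restrict_space fmeasurableD)
    finally show ?thesis using \<mu> by (simp add: m_def)
  qed
  have "sq S (\<lambda>x. f x - c) - sq S (\<lambda>x. f x - m) = measure lebesgue S * (m - c)\<^sup>2"
    unfolding 1 by (simp add: power2_eq_square algebra_simps)
  moreover have "0 \<le> measure lebesgue S * (m - c)\<^sup>2" by simp
  ultimately have "sq S (\<lambda>x. f x - m) \<le> sq S (\<lambda>x. f x - c)" by linarith
  then show ?thesis by (simp add: m_def)
qed

section \<open>The Poincare inequality on a cube\<close>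

lemma set_integral_nonneg':
  "(\<And>x. 0 \<le> f x) \<Longrightarrow> 0 \<le> (LINT x:A|M. f x :: real)"
  by (simp add: set_lebesgue_integral_def)

text \<open>The increment is the integral of the directional derivative over the segment. Its square
  is estimated by Jensen's inequality on the unit interval and by Cauchy-Schwarz in the components
  of the gradient.\<close>

lemma C1_line_bound:
  assumes f: "C1 f f'"
  shows "(f y - f x)\<^sup>2 \<le> (norm (y - x))\<^sup>2 * (LINT t:{0..1}|lborel. (\<Sum>i\<in>UNIV. (f' i (x + t *\<^sub>R (y - x)))\<^sup>2))"
proof -
  let ?z = "\<lambda>t. x + t *\<^sub>R (y - x)"
  define g where "g t = (\<Sum>i\<in>UNIV. f' i (?z t) * (y - x) $ i)" for t
  define G where "G t = (\<Sum>i\<in>UNIV. (f' i (?z t))\<^sup>2)" for t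
  have cf: "continuous_on UNIV (f' i)" for i using f by (auto simp: C1_def has_partial_def)
  have cfz: "continuous_on UNIV (\<lambda>t. f' i (?z t))" for i
    by (rule continuous_on_compose2[OF cf]) (auto intro!: continuous_intros)
  have cg: "continuous_on UNIV g" and cG: "continuous_on UNIV G"
    unfolding g_def G_def by (intro continuous_intros cfz)+
  have si: "set_integrable lborel {0..1} r" if "continuous_on UNIV r" for r :: "real \<Rightarrow> real"
    unfolding set_integrable_def
    by (rule borel_integrable_compact[OF compact_Icc continuous_on_subset[OF that]]) simp
  have FTC: "(LINT t:{0..1}|lborel. g t) = f y - f x"
  proof -
    have "(LINT t:{0..1}|lborel. g t) = f (?z 1) - f (?z 0)"
      unfolding set_lebesgue_integral_def
    proof (rule integral_FTC_Icc)
      show "continuous_on {0..1} g" using cg by (rule continuous_on_subset) simp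
      fix t
      have "(f has_derivative (\<lambda>v. \<Sum>i\<in>UNIV. f' i (?z t) * v $ i)) (at (?z t))" using f by (simp add: C1_def)
      moreover have "(?z has_vector_derivative (y - x)) (at t)" by (auto intro!: derivative_eq_intros)
      ultimately have "((\<lambda>t. f (?z t)) has_vector_derivative g t) (at t)"
        using vector_derivative_diff_chain_within[of ?z "y - x" t UNIV f "\<lambda>v. \<Sum>i\<in>UNIV. f' i (?z t) * v $ i"]
          has_derivative_at_withinI unfolding comp_def g_def by blast
      then show "((\<lambda>t. f (?z t)) has_vector_derivative g t) (at t within {0..1})"
        by (rule has_vector_derivative_at_within)
    qed simp
    then show ?thesis by simp
  qed
  \<comment> \<open>Jensen's inequality is obtained from the variance of \<open>g\<close> over the
    unit interval, which is nonnegative.\<close>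
  define m where "m = (LINT t:{0..1}|lborel. g t)"
  have "0 \<le> (LINT t:{0..1}|lborel. (g t - m)\<^sup>2)" by (rule set_integral_nonneg') simp
  also have "\<dots> = (LINT t:{0..1}|lborel. (g t)\<^sup>2 - 2 * m * g t + m\<^sup>2)"
    by (simp add: power2_diff algebra_simps)
  also have "\<dots> = (LINT t:{0..1}|lborel. (g t)\<^sup>2) - 2 * m * (LINT t:{0..1}|lborel. g t) + (LINT t:{0..1::real}|lborel. m\<^sup>2)"
    by (subst set_integral_add set_integral_diff; (intro set_integral_add set_integral_diff si continuous_intros cg)?)+ simp
  also have "(LINT t:{0..1::real}|lborel. m\<^sup>2) = m\<^sup>2" by (simp add: set_lebesgue_integral_def)
  also have "(LINT t:{0..1}|lborel. (g t)\<^sup>2) - 2 * m * (LINT t:{0..1}|lborel. g t) + m\<^sup>2 = (LINT t:{0..1}|lborel. (g t)\<^sup>2) - m\<^sup>2"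
    by (simp add: m_def power2_eq_square)
  finally have "m\<^sup>2 \<le> (LINT t:{0..1}|lborel. (g t)\<^sup>2)" by simp
  also have "\<dots> \<le> (LINT t:{0..1}|lborel. (norm (y - x))\<^sup>2 * G t)"
  proof (rule set_integral_mono)
    fix t
    have "(g t)\<^sup>2 \<le> (\<Sum>i\<in>UNIV. (f' i (?z t))\<^sup>2) * (\<Sum>i\<in>UNIV. ((y - x) $ i)\<^sup>2)"
      unfolding g_def by (rule Cauchy_Schwarz_ineq_sum)
    also have "(\<Sum>i\<in>UNIV. ((y - x) $ i)\<^sup>2) = (norm (y - x))\<^sup>2"
      by (simp add: norm_vec_def L2_set_def sum_nonneg)
    finally show "(g t)\<^sup>2 \<le> (norm (y - x))\<^sup>2 * G t" by (simp add: G_def mult.commute)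
  qed (intro si continuous_intros cg cG)+
  finally show ?thesis unfolding m_def FTC by (simp add: G_def)
qed

text \<open>The substitution has Jacobian c^n, whose inverse is at most 2^n; this is the origin of
  the power of two in the Poincare constant.\<close>

lemma nn_integral_affine_le:
  fixes g :: "real^'n \<Rightarrow> ennreal"
  assumes [measurable]: "g \<in> borel_measurable borel" and c: "1 / 2 \<le> c"
  shows "(\<integral>\<^sup>+y. g (s + c *\<^sub>R y) \<partial>lborel) \<le> 2 ^ CARD('n) * (\<integral>\<^sup>+y. g y \<partial>lborel)"
proof -
  have c0: "c \<noteq> 0" "0 < c" using c by auto
  have "(\<integral>\<^sup>+y. g y \<partial>lborel) = (\<integral>\<^sup>+y. g y \<partial>density (distr lborel borel (\<lambda>x. s + c *\<^sub>R x)) (\<lambda>_. \<bar>c\<bar> ^ DIM(real^'n)))"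
    using lborel_affine[OF c0(1), of s] by metis
  also have "\<dots> = (\<integral>\<^sup>+y. ennreal (\<bar>c\<bar> ^ DIM(real^'n)) * g (s + c *\<^sub>R y) \<partial>lborel)"
    by (subst nn_integral_density) (auto simp: nn_integral_distr)
  also have "\<dots> = ennreal (c ^ CARD('n)) * (\<integral>\<^sup>+y. g (s + c *\<^sub>R y) \<partial>lborel)"
    using c0 by (subst nn_integral_cmult) auto
  finally have eq: "(\<integral>\<^sup>+y. g y \<partial>lborel) = ennreal (c ^ CARD('n)) * (\<integral>\<^sup>+y. g (s + c *\<^sub>R y) \<partial>lborel)" .
  have "1 \<le> (2 * c) ^ CARD('n)" using c by (intro one_le_power) simp
  then have "1 \<le> ennreal ((2 * c) ^ CARD('n))" by (simp add: ennreal_ge_1)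
  then have "1 * (\<integral>\<^sup>+y. g (s + c *\<^sub>R y) \<partial>lborel) \<le> ennreal ((2 * c) ^ CARD('n)) * (\<integral>\<^sup>+y. g (s + c *\<^sub>R y) \<partial>lborel)"
    by (rule mult_right_mono) simp
  also have "ennreal ((2 * c) ^ CARD('n)) = 2 ^ CARD('n) * ennreal (c ^ CARD('n))"
    using c0 by (simp add: power_mult_distrib ennreal_mult ennreal_power[symmetric])
  finally show ?thesis unfolding eq by (simp add: mult.assoc)
qed

lemma ocell_convex_comb:
  assumes "x \<in> ocell h p" "y \<in> ocell h p" "0 \<le> t" "t \<le> 1"
  shows "x + t *\<^sub>R (y - x) \<in> ocell h p"
proof -
  have "(1 - t) *\<^sub>R x + t *\<^sub>R y \<in> ocell h p"
    using convex_box(2)[of p "\<chi> i. p $ i + h"] assms unfolding ocell_def convex_alt by blast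
  then show ?thesis by (simp add: algebra_simps)
qed

text \<open>The deviation from the mean is at most the deviation from any single value
  \<open>f x\<close>. Averaging over \<open>x\<close> leaves a double integral of (f y - f x)^2,
  which is bounded along the segment from \<open>x\<close> to \<open>y\<close>; there |y - x|^2 is
  at most n h^2. The intermediate point is substituted for whichever end point has weight at least
  1/2, which keeps the Jacobian away from 0.\<close>

lemma poincare_C1:
  fixes f :: "real^'n \<Rightarrow> real"
  assumes f: "C1 f f'" and h: "0 < h"
  shows "sq (ocell h p) (\<lambda>x. f x - (LINT x|lebesgue_on (ocell h p). f x) / h ^ CARD('n))
    \<le> real CARD('n) * 2 ^ CARD('n) * h\<^sup>2 * (\<Sum>i\<in>UNIV. sq (ocell h p) (f' i))"
proof -
  let ?K = "ocell h p" and ?n = "CARD('n)"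
  have mu: "measure lebesgue ?K = h ^ ?n" using measure_ocell[of h p] h by simp
  have cf: "continuous_on UNIV f" "\<And>i. continuous_on UNIV (f' i)" using f by (auto simp: C1_def has_partial_def)
  have bdd: "bounded ?K" by (simp add: ocell_def)
  have K[measurable]: "?K \<in> sets borel" by (simp add: ocell_def)
  have [measurable]: "f \<in> borel_measurable borel" using cf(1) by (rule borel_measurable_continuous_onI)
  define G where "G z = (\<Sum>i\<in>UNIV. (f' i z)\<^sup>2)" for z
  have cG: "continuous_on UNIV G" unfolding G_def by (intro continuous_intros cf)
  have [measurable]: "G \<in> borel_measurable borel" using cG by (rule borel_measurable_continuous_onI)
  have G0: "0 \<le> G z" for z by (simp add: G_def sum_nonneg)
  define N where "N = real ?n * h\<^sup>2"
  have N0: "0 \<le> N" by (simp add: N_def)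
  have to_nn: "ennreal (LINT x|lebesgue_on ?K. r x) = (\<integral>\<^sup>+x. ennreal (r x) * indicator ?K x \<partial>lborel)"
    if r: "continuous_on UNIV r" "\<And>x. 0 \<le> r x" for r
  proof -
    have [measurable]: "r \<in> borel_measurable borel" using r(1) by (rule borel_measurable_continuous_onI)
    have "integrable (lebesgue_on ?K) r" by (rule L2_integrable[OF L2_continuous[OF r(1) bdd]]) auto
    then have i: "integrable lborel (\<lambda>x. indicator ?K x *\<^sub>R r x)"
      by (simp add: integrable_restrict_space integrable_completion)
    have "(LINT x|lebesgue_on ?K. r x) = (LINT x|lborel. indicator ?K x *\<^sub>R r x)"
      by (simp add: integral_lebesgue_on_continuous[OF r(1) K] set_lebesgue_integral_def)
    also have "ennreal \<dots> = (\<integral>\<^sup>+x. ennreal (indicator ?K x *\<^sub>R r x) \<partial>lborel)"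
      by (rule nn_integral_eq_integral[symmetric, OF i]) (simp add: r)
    also have "\<dots> = (\<integral>\<^sup>+x. ennreal (r x) * indicator ?K x \<partial>lborel)"
      by (intro nn_integral_cong) (auto simp: indicator_def)
    finally show ?thesis .
  qed
  define I where "I = (\<integral>\<^sup>+x. ennreal (G x) * indicator ?K x \<partial>lborel)"
  have I: "I = ennreal (\<Sum>i\<in>UNIV. sq ?K (f' i))"
  proof -
    have "(LINT x|lebesgue_on ?K. G x) = (\<Sum>i\<in>UNIV. sq ?K (f' i))"
      unfolding G_def sq_def
      by (rule Bochner_Integration.integral_sum) (auto intro!: L2_sq_integrable L2_continuous cf bdd)
    then show ?thesis unfolding I_def by (simp add: to_nn[OF cG G0, symmetric])
  qed
  define s where "s = sq ?K (\<lambda>x. f x - (LINT x|lebesgue_on ?K. f x) / h ^ ?n)"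
  have s1: "ennreal s \<le> (\<integral>\<^sup>+y. ennreal ((f y - f x)\<^sup>2) * indicator ?K y \<partial>lborel)" for x
  proof -
    have "s \<le> sq ?K (\<lambda>y. f y - f x)" unfolding s_def mu[symmetric]
      by (rule sq_shift) (use mu h in \<open>auto intro!: L2_continuous cf bdd\<close>)
    then have "ennreal s \<le> ennreal (LINT y|lebesgue_on ?K. (f y - f x)\<^sup>2)" unfolding sq_def by (rule ennreal_leI)
    also have "\<dots> = (\<integral>\<^sup>+y. ennreal ((f y - f x)\<^sup>2) * indicator ?K y \<partial>lborel)"
      by (rule to_nn) (auto intro!: continuous_intros cf)
    finally show ?thesis .
  qed
  \<comment> \<open>With extended nonnegative values the three integrations can be exchanged freely;
    the indicators encode the two copies of the cell and the segment parameter.\<close>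
  define H where "H x y t = ennreal (N * G (x + t *\<^sub>R (y - x))) * indicator ?K x * indicator ?K y * indicator {0..1::real} t" for x y t
  have line: "ennreal ((f y - f x)\<^sup>2) * indicator ?K x * indicator ?K y \<le> (\<integral>\<^sup>+t. H x y t \<partial>lborel)" for x y
  proof (cases "x \<in> ?K \<and> y \<in> ?K")
    case True
    have "(norm (y - x))\<^sup>2 = (\<Sum>i\<in>UNIV. ((y - x) $ i)\<^sup>2)" by (simp add: norm_vec_def L2_set_def sum_nonneg)
    also have "\<dots> \<le> (\<Sum>i\<in>(UNIV::'n set). h\<^sup>2)"
    proof (rule sum_mono)
      fix i
      have "\<bar>(y - x) $ i\<bar> \<le> \<bar>h\<bar>" using True h unfolding mem_ocell by (auto simp: abs_le_iff dest!: spec[of _ i])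
      then show "((y - x) $ i)\<^sup>2 \<le> h\<^sup>2" by (simp add: abs_le_square_iff)
    qed
    finally have n: "(norm (y - x))\<^sup>2 \<le> N" by (simp add: N_def)
    let ?G = "\<lambda>t. G (x + t *\<^sub>R (y - x))"
    have c: "continuous_on UNIV ?G" by (rule continuous_on_compose2[OF cG]) (auto intro!: continuous_intros)
    have si: "integrable lborel (\<lambda>t. indicator {0..1} t *\<^sub>R (N * ?G t))"
      by (rule borel_integrable_compact[OF compact_Icc]) (intro continuous_intros continuous_on_subset[OF c], simp)
    have "(f y - f x)\<^sup>2 \<le> (norm (y - x))\<^sup>2 * (LINT t:{0..1}|lborel. ?G t)"
      using C1_line_bound[OF f, of y x] by (simp add: G_def)
    also have "\<dots> \<le> N * (LINT t:{0..1}|lborel. ?G t)"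
      by (intro mult_right_mono n set_integral_nonneg' G0)
    also have "\<dots> = (LINT t|lborel. indicator {0..1} t *\<^sub>R (N * ?G t))"
      by (simp add: set_lebesgue_integral_def integral_mult_right_zero[symmetric] mult.left_commute del: integral_mult_right_zero)
    finally have "ennreal ((f y - f x)\<^sup>2) \<le> ennreal (LINT t|lborel. indicator {0..1} t *\<^sub>R (N * ?G t))" by (rule ennreal_leI)
    also have "\<dots> = (\<integral>\<^sup>+t. ennreal (indicator {0..1} t *\<^sub>R (N * ?G t)) \<partial>lborel)"
      by (rule nn_integral_eq_integral[symmetric, OF si]) (simp add: G0 N0)
    also have "\<dots> = (\<integral>\<^sup>+t. H x y t \<partial>lborel)"
      by (intro nn_integral_cong) (use True in \<open>auto simp: H_def indicator_def\<close>)
    finally show ?thesis using True by simp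
  qed auto
  have emK: "emeasure lborel ?K = ennreal (h ^ ?n)"
  proof -
    have "emeasure lborel ?K = ennreal (measure lborel ?K)"
      using emeasure_lborel_box_finite[of p "\<chi> i. p $ i + h"]
      by (intro emeasure_eq_ennreal_measure) (auto simp: ocell_def)
    then show ?thesis using mu by (simp add: ocell_def)
  qed
  have t_bound: "(\<integral>\<^sup>+x. (\<integral>\<^sup>+y. H x y t \<partial>lborel) \<partial>lborel) \<le> ennreal N * 2 ^ ?n * I * ennreal (h ^ ?n) * indicator {0..1::real} t" for t
  proof (cases "0 \<le> t \<and> t \<le> 1")
    case True
    have emu: "(\<integral>\<^sup>+x. indicator ?K x \<partial>lborel) = ennreal (h ^ ?n)" using emK by simp
    have Hle: "H x y t \<le> ennreal N * (ennreal (G (x + t *\<^sub>R (y - x))) * indicator ?K (x + t *\<^sub>R (y - x))) * indicator ?K x"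
      "H x y t \<le> ennreal N * (ennreal (G (x + t *\<^sub>R (y - x))) * indicator ?K (x + t *\<^sub>R (y - x))) * indicator ?K y" for x y
      using ocell_convex_comb[of x h p y t] True G0 N0
      by (auto simp: H_def indicator_def ennreal_mult)
    have gm: "(\<lambda>z. ennreal (G z) * indicator ?K z) \<in> borel_measurable borel" by measurable
    show ?thesis
    proof (cases "1 / 2 \<le> t")
      \<comment> \<open>For t at least 1/2 the intermediate point is the new variable in place of
        \<open>y\<close>, with \<open>x\<close> held fixed.\<close>
      case t: True
      have "(\<integral>\<^sup>+y. H x y t \<partial>lborel) \<le> ennreal N * (2 ^ ?n * I) * indicator ?K x" for x
      proof -
        have "(\<integral>\<^sup>+y. H x y t \<partial>lborel) \<le> (\<integral>\<^sup>+y. ennreal N * (ennreal (G (x + t *\<^sub>R (y - x))) * indicator ?K (x + t *\<^sub>R (y - x))) * indicator ?K x \<partial>lborel)"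
          by (intro nn_integral_mono Hle)
        also have "\<dots> = ennreal N * (\<integral>\<^sup>+y. (ennreal (G (x + t *\<^sub>R (y - x))) * indicator ?K (x + t *\<^sub>R (y - x))) \<partial>lborel) * indicator ?K x"
          by (simp add: nn_integral_cmult nn_integral_multc)
        also have "\<dots> \<le> ennreal N * (2 ^ ?n * I) * indicator ?K x"
          using nn_integral_affine_le[OF gm t, of "(1 - t) *\<^sub>R x"]
          by (intro mult_left_mono mult_right_mono) (simp_all add: I_def algebra_simps)
        finally show ?thesis .
      qed
      then have "(\<integral>\<^sup>+x. (\<integral>\<^sup>+y. H x y t \<partial>lborel) \<partial>lborel) \<le> (\<integral>\<^sup>+x. ennreal N * (2 ^ ?n * I) * indicator ?K x \<partial>lborel)"
        by (intro nn_integral_mono)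
      also have "\<dots> = ennreal N * (2 ^ ?n * I) * ennreal (h ^ ?n)"
        by (subst nn_integral_cmult) (auto simp: emu)
      finally show ?thesis using True by (simp add: mult.assoc)
    next
      \<comment> \<open>For t below 1/2 the weight 1 - t of \<open>x\<close> exceeds 1/2, and the
        roles of \<open>x\<close> and \<open>y\<close> are exchanged.\<close>
      case False
      then have t: "1 / 2 \<le> 1 - t" by simp
      have "(\<integral>\<^sup>+x. H x y t \<partial>lborel) \<le> ennreal N * (2 ^ ?n * I) * indicator ?K y" for y
      proof -
        have "(\<integral>\<^sup>+x. H x y t \<partial>lborel) \<le> (\<integral>\<^sup>+x. ennreal N * (ennreal (G (x + t *\<^sub>R (y - x))) * indicator ?K (x + t *\<^sub>R (y - x))) * indicator ?K y \<partial>lborel)"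
          by (intro nn_integral_mono Hle)
        also have "\<dots> = ennreal N * (\<integral>\<^sup>+x. (ennreal (G (x + t *\<^sub>R (y - x))) * indicator ?K (x + t *\<^sub>R (y - x))) \<partial>lborel) * indicator ?K y"
          by (simp add: nn_integral_cmult nn_integral_multc)
        also have "\<dots> \<le> ennreal N * (2 ^ ?n * I) * indicator ?K y"
          using nn_integral_affine_le[OF gm t, of "t *\<^sub>R y"]
          by (intro mult_left_mono mult_right_mono) (simp_all add: I_def algebra_simps)
        finally show ?thesis .
      qed
      then have "(\<integral>\<^sup>+y. (\<integral>\<^sup>+x. H x y t \<partial>lborel) \<partial>lborel) \<le> (\<integral>\<^sup>+y. ennreal N * (2 ^ ?n * I) * indicator ?K y \<partial>lborel)"
        by (intro nn_integral_mono)
      also have "\<dots> = ennreal N * (2 ^ ?n * I) * ennreal (h ^ ?n)"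
        by (subst nn_integral_cmult) (auto simp: emu)
      also have "(\<integral>\<^sup>+y. (\<integral>\<^sup>+x. H x y t \<partial>lborel) \<partial>lborel) = (\<integral>\<^sup>+x. (\<integral>\<^sup>+y. H x y t \<partial>lborel) \<partial>lborel)"
        by (rule lborel_pair.Fubini') (unfold H_def, measurable)
      finally show ?thesis using True by (simp add: mult.assoc)
    qed
  next
    case False
    then have "H x y t = 0" for x y by (auto simp: H_def)
    then show ?thesis by simp
  qed
  have "ennreal s * ennreal (h ^ ?n) = (\<integral>\<^sup>+x. ennreal s * indicator ?K x \<partial>lborel)"
    using emK by (subst nn_integral_cmult) auto
  also have "\<dots> \<le> (\<integral>\<^sup>+x. (\<integral>\<^sup>+y. (\<integral>\<^sup>+t. H x y t \<partial>lborel) \<partial>lborel) \<partial>lborel)"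
  proof (intro nn_integral_mono)
    fix x
    have "ennreal s * indicator ?K x \<le> (\<integral>\<^sup>+y. ennreal ((f y - f x)\<^sup>2) * indicator ?K y \<partial>lborel) * indicator ?K x"
      by (intro mult_right_mono s1) simp
    also have "\<dots> = (\<integral>\<^sup>+y. ennreal ((f y - f x)\<^sup>2) * indicator ?K x * indicator ?K y \<partial>lborel)"
      by (subst nn_integral_multc[symmetric]) (auto simp: mult_ac)
    also have "\<dots> \<le> (\<integral>\<^sup>+y. (\<integral>\<^sup>+t. H x y t \<partial>lborel) \<partial>lborel)"
      by (intro nn_integral_mono line)
    finally show "ennreal s * indicator ?K x \<le> (\<integral>\<^sup>+y. (\<integral>\<^sup>+t. H x y t \<partial>lborel) \<partial>lborel)" .
  qed
  also have "\<dots> = (\<integral>\<^sup>+x. (\<integral>\<^sup>+t. (\<integral>\<^sup>+y. H x y t \<partial>lborel) \<partial>lborel) \<partial>lborel)"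
    by (intro nn_integral_cong lborel_pair.Fubini') (unfold H_def, measurable)
  also have "\<dots> = (\<integral>\<^sup>+t. (\<integral>\<^sup>+x. (\<integral>\<^sup>+y. H x y t \<partial>lborel) \<partial>lborel) \<partial>lborel)"
    by (rule lborel_pair.Fubini') (unfold H_def, measurable)
  also have "\<dots> \<le> (\<integral>\<^sup>+t. ennreal N * 2 ^ ?n * I * ennreal (h ^ ?n) * indicator {0..1::real} t \<partial>lborel)"
    by (intro nn_integral_mono t_bound)
  also have "\<dots> = ennreal N * 2 ^ ?n * I * ennreal (h ^ ?n)"
    by (subst nn_integral_cmult) auto
  also have "\<dots> = ennreal (N * 2 ^ ?n * (\<Sum>i\<in>UNIV. sq ?K (f' i)) * h ^ ?n)"
    unfolding I using N0 h by (simp add: ennreal_mult sum_nonneg ennreal_power[symmetric])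
  finally have "ennreal (s * h ^ ?n) \<le> ennreal (N * 2 ^ ?n * (\<Sum>i\<in>UNIV. sq ?K (f' i)) * h ^ ?n)"
    using h by (simp add: ennreal_mult s_def)
  then have "s * h ^ ?n \<le> N * 2 ^ ?n * (\<Sum>i\<in>UNIV. sq ?K (f' i)) * h ^ ?n"
    using N0 h by (subst (asm) ennreal_le_iff) (auto intro!: mult_nonneg_nonneg sum_nonneg)
  then have "s \<le> N * 2 ^ ?n * (\<Sum>i\<in>UNIV. sq ?K (f' i))" using h by simp
  then show ?thesis by (simp add: s_def N_def mult_ac)
qed

definition avg :: "real \<Rightarrow> real^'n \<Rightarrow> (real^'n \<Rightarrow> real) \<Rightarrow> real" where
  "avg h p f = (LINT x|lebesgue_on (ocell h p). f x) / h ^ CARD('n)"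

lemma ocell_bounded [simp]: "bounded (ocell h p)" by (simp add: ocell_def)

lemma sq_avg_le:
  assumes "f \<in> L2 (ocell h p)" "0 < h"
  shows "sq (ocell h p) (\<lambda>x. f x - avg h p f) \<le> sq (ocell h p) (\<lambda>x. f x - c)"
  using sq_shift[OF assms(1), of c] measure_ocell[of h p] assms(2) by (simp add: avg_def)

lemma C1_L2: "C1 g g' \<Longrightarrow> bounded S \<Longrightarrow> S \<in> sets lebesgue \<Longrightarrow> g \<in> L2 S"
  "C1 g g' \<Longrightarrow> bounded S \<Longrightarrow> S \<in> sets lebesgue \<Longrightarrow> g' i \<in> L2 S"
  by (auto simp: C1_def has_partial_def intro: L2_continuous)

text \<open>Four times the constant for C1 functions: one factor 2 comes from splitting the function
  into approximant and remainder, the other from splitting the gradient in the same way.\<close>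

abbreviation poinc :: "'n::finite itself \<Rightarrow> real" where
  "poinc _ \<equiv> 4 * real CARD('n) * 2 ^ CARD('n)"

lemma avg_diff_fun:
  assumes "f \<in> L2 (ocell h p)" "g \<in> L2 (ocell h p)"
  shows "avg h p (\<lambda>x. f x - g x) = avg h p f - avg h p g"
  using L2_integrable[OF assms(1)] L2_integrable[OF assms(2)] by (simp add: avg_def diff_divide_distrib)

lemma poincare:
  fixes f :: "real^'n \<Rightarrow> real"
  assumes f: "C1_limit S f F" and h: "0 < h" and S: "ocell h p \<subseteq> S" "S \<in> sets lebesgue" "bounded S"
  shows "sq (ocell h p) (\<lambda>x. f x - avg h p f) \<le> poinc TYPE('n) * h\<^sup>2 * (\<Sum>i\<in>UNIV. sq (ocell h p) (F i))"
proof -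
  let ?K = "ocell h p"
  define P where "P = real CARD('n) * 2 ^ CARD('n) * h\<^sup>2"
  have P0: "0 \<le> P" by (simp add: P_def)
  from f obtain g g' where g: "\<forall>k::nat. C1 (g k) (g' k)" "(\<lambda>k. sq S (\<lambda>x. g k x - f x)) \<longlonglongrightarrow> 0"
        "\<forall>i. (\<lambda>k. sq S (\<lambda>x. g' k i x - F i x)) \<longlonglongrightarrow> 0" and fS: "f \<in> L2 S" "\<forall>i. F i \<in> L2 S"
    unfolding C1_limit_def by blast
  have gS: "g k \<in> L2 S" "g' k i \<in> L2 S" for k i using g(1) C1_L2 S by blast+
  have K: "?K \<in> sets lebesgue" by simp
  have fK: "f \<in> L2 ?K" "F i \<in> L2 ?K" "g k \<in> L2 ?K" "g' k i \<in> L2 ?K" for i k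
    using L2_subset[OF _ S(1) K S(2)] fS(1) fS(2)[rule_format] gS by blast+
  define r where "r k x = f x - g k x" for k x
  have rK: "r k \<in> L2 ?K" for k unfolding r_def by (intro L2_diff fK)
  have r0: "sq ?K (r k) \<le> sq S (\<lambda>x. g k x - f x)" for k
  proof -
    have "sq ?K (r k) = sq ?K (\<lambda>x. - (g k x - f x))" by (simp add: r_def[abs_def])
    also have "\<dots> = sq ?K (\<lambda>x. g k x - f x)" by (rule sq_uminus)
    also have "\<dots> \<le> sq S (\<lambda>x. g k x - f x)" by (intro sq_mono_set L2_diff gS fS(1) S K)
    finally show ?thesis .
  qed
  have le: "sq ?K (\<lambda>x. f x - avg h p f) \<le> 2 * sq S (\<lambda>x. g k x - f x) + 2 * (P * (\<Sum>i\<in>UNIV. 2 * sq S (\<lambda>x. g' k i x - F i x) + 2 * sq ?K (F i)))" for k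
  proof -
    have "avg h p f = avg h p (r k) + avg h p (g k)"
      using avg_diff_fun[OF fK(1) fK(3)[of k]] by (simp add: r_def[abs_def])
    then have "(\<lambda>x. f x - avg h p f) = (\<lambda>x. (r k x - avg h p (r k)) + (g k x - avg h p (g k)))"
      by (simp add: r_def fun_eq_iff)
    then have "sq ?K (\<lambda>x. f x - avg h p f) \<le> 2 * sq ?K (\<lambda>x. r k x - avg h p (r k)) + 2 * sq ?K (\<lambda>x. g k x - avg h p (g k))"
      using sq_add_le[OF L2_diff[OF rK L2_const[OF ocell_lmeasurable]] L2_diff[OF fK(3) L2_const[OF ocell_lmeasurable]],
          of k "avg h p (r k)" k "avg h p (g k)"] by simp
    moreover have "sq ?K (\<lambda>x. r k x - avg h p (r k)) \<le> sq S (\<lambda>x. g k x - f x)"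
      using sq_avg_le[OF rK h, of k 0] r0[of k] by simp
    moreover have "sq ?K (\<lambda>x. g k x - avg h p (g k)) \<le> P * (\<Sum>i\<in>UNIV. sq ?K (g' k i))"
      using poincare_C1[OF g(1)[rule_format] h, of p k] by (simp add: avg_def P_def)
    moreover have "sq ?K (g' k i) \<le> 2 * sq S (\<lambda>x. g' k i x - F i x) + 2 * sq ?K (F i)" for i
    proof -
      have "sq ?K (g' k i) \<le> 2 * sq ?K (\<lambda>x. g' k i x - F i x) + 2 * sq ?K (F i)"
        using sq_add_le[OF L2_diff[OF fK(4)[of k i] fK(2)[of i]] fK(2)[of i]] by simp
      moreover have "sq ?K (\<lambda>x. g' k i x - F i x) \<le> sq S (\<lambda>x. g' k i x - F i x)"
        using fS by (intro sq_mono_set L2_diff gS S K) auto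
      ultimately show ?thesis by linarith
    qed
    then have "P * (\<Sum>i\<in>UNIV. sq ?K (g' k i)) \<le> P * (\<Sum>i\<in>UNIV. 2 * sq S (\<lambda>x. g' k i x - F i x) + 2 * sq ?K (F i))"
      by (intro mult_left_mono sum_mono P0)
    ultimately show ?thesis by linarith
  qed
  have "(\<lambda>k. 2 * sq S (\<lambda>x. g k x - f x) + 2 * (P * (\<Sum>i\<in>UNIV. 2 * sq S (\<lambda>x. g' k i x - F i x) + 2 * sq ?K (F i))))
     \<longlonglongrightarrow> 2 * 0 + 2 * (P * (\<Sum>i\<in>UNIV. 2 * 0 + 2 * sq ?K (F i)))"
    by (intro tendsto_intros g(2) g(3)[rule_format])
  then have "sq ?K (\<lambda>x. f x - avg h p f) \<le> 2 * 0 + 2 * (P * (\<Sum>i\<in>UNIV. 2 * 0 + 2 * sq ?K (F i)))"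
    using le by (intro LIMSEQ_le_const) auto
  then show ?thesis by (simp add: P_def sum_distrib_left[symmetric] mult_ac)
qed

section \<open>Means over neighbouring cells\<close>

lemma face_integral_cong_corner:
  assumes "\<And>k. k \<notin> I \<Longrightarrow> p $ k = q $ k"
  shows "face_integral h p I c f = face_integral h q I c f"
proof -
  have "(\<Pi>\<^sub>E k\<in>-I. {p $ k .. p $ k + h}) = (\<Pi>\<^sub>E k\<in>-I. {q $ k .. q $ k + h})"
    by (rule PiE_cong) (simp add: assms)
  then show ?thesis by (simp add: face_integral_def)
qed

text \<open>For the approximants, the integral over the common face is computed from either cell
  with the weight that vanishes on the opposite face: at p_j from below and at p_j + 2h from above.
  The face integral cancels before the limit is taken, so only cell integrals of \<open>f\<close>
  and \<open>F j\<close> remain.\<close>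

lemma integral_cell_difference:
  assumes f: "C1_limit S f F" and h: "0 < h" and q: "q = upd p j (p $ j + h)"
    and S: "ocell h p \<subseteq> S" "ocell h q \<subseteq> S" "S \<in> sets lebesgue" "bounded S"
  shows "(LINT x|lebesgue_on (ocell h q). f x) - (LINT x|lebesgue_on (ocell h p). f x) =
    (LINT x|lebesgue_on (ocell h p). F j x * (x $ j - p $ j)) - (LINT x|lebesgue_on (ocell h q). F j x * (x $ j - (p $ j + 2 * h)))"
proof -
  from f obtain g g' where g: "\<forall>k::nat. C1 (g k) (g' k)" "(\<lambda>k. sq S (\<lambda>x. g k x - f x)) \<longlonglongrightarrow> 0"
        "\<forall>i. (\<lambda>k. sq S (\<lambda>x. g' k i x - F i x)) \<longlonglongrightarrow> 0" and fS: "f \<in> L2 S" "\<forall>i. F i \<in> L2 S"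
    unfolding C1_limit_def by blast
  have gS: "g k \<in> L2 S" "g' k i \<in> L2 S" for k i using g(1) C1_L2 S by blast+
  define \<theta> where "\<theta> t x = x $ j - t" for t :: real and x :: "real^'a"
  have \<theta>: "\<theta> t \<in> L2 (ocell h r)" for t r 
    unfolding \<theta>_def by (intro L2_continuous) (auto intro!: continuous_intros)
  have lim: "(\<lambda>k. (LINT x|lebesgue_on (ocell h r). g k x * 1) + (LINT x|lebesgue_on (ocell h r). g' k j x * \<theta> t x))
     \<longlonglongrightarrow> (LINT x|lebesgue_on (ocell h r). f x * 1) + (LINT x|lebesgue_on (ocell h r). F j x * \<theta> t x)"
    if r: "ocell h r \<subseteq> S" for r t
  proof (intro tendsto_add sq_tendsto_integral)
    note sub = L2_subset[OF _ r ocell_sets_lebesgue S(3)]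
    show "g k \<in> L2 (ocell h r)" "g' k j \<in> L2 (ocell h r)" "f \<in> L2 (ocell h r)" "F j \<in> L2 (ocell h r)" for k
      using sub gS fS(1) fS(2)[rule_format] by blast+
    show "(\<lambda>x. 1) \<in> L2 (ocell h r)" "\<theta> t \<in> L2 (ocell h r)" by (auto intro: \<theta>)
    show "(\<lambda>k. sq (ocell h r) (\<lambda>x. g k x - f x)) \<longlonglongrightarrow> 0"
      by (rule tendsto_sandwich[OF _ _ tendsto_const g(2)])
         (auto intro!: always_eventually sq_mono_set L2_diff gS fS r S)
    show "(\<lambda>k. sq (ocell h r) (\<lambda>x. g' k j x - F j x)) \<longlonglongrightarrow> 0"
      using fS by (intro tendsto_sandwich[OF _ _ tendsto_const g(3)[rule_format, of j]])
         (auto intro!: always_eventually sq_mono_set L2_diff gS r S)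
  qed
  have tr: "(LINT x|lebesgue_on (ocell h r). g k x * 1) + (LINT x|lebesgue_on (ocell h r). g' k j x * \<theta> (2 * r $ j + h - c $ j) x) = h * face_integral h r {j} c (g k)"
    if c: "c $ j \<in> {r $ j, r $ j + h}" for r c k
  proof -
    have hp: "has_partial j (g k) (g' k j)" using g(1) by (simp add: C1_def)
    have gK: "g k \<in> L2 (ocell h r)" "g' k j \<in> L2 (ocell h r)" using g(1) C1_L2[of "g k" "g' k"] by auto
    have "h * face_integral h r {j} c (g k) = (LINT x|lebesgue_on (ocell h r). g k x * 1 + g' k j x * \<theta> (2 * r $ j + h - c $ j) x)"
      using trace1[OF hp h c] by (simp add: \<theta>_def mult.commute)
    then show ?thesis using L2_mult_integrable[OF gK(2) \<theta>] L2_integrable[OF gK(1)] by simp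
  qed
  define c where "c = q"
  have cj: "c $ j = p $ j + h" "q $ j = p $ j + h" by (simp_all add: c_def q)
  have "h * face_integral h p {j} c (g k) = h * face_integral h q {j} c (g k)" for k
    using face_integral_cong_corner[of "{j}" p q h c "g k"] by (simp add: q)
  then have eq: "(LINT x|lebesgue_on (ocell h p). g k x * 1) + (LINT x|lebesgue_on (ocell h p). g' k j x * \<theta> (p $ j) x)
      = (LINT x|lebesgue_on (ocell h q). g k x * 1) + (LINT x|lebesgue_on (ocell h q). g' k j x * \<theta> (p $ j + 2 * h) x)" for k
    using tr[of c p k] tr[of c q k] cj by simp
  have "(LINT x|lebesgue_on (ocell h p). f x * 1) + (LINT x|lebesgue_on (ocell h p). F j x * \<theta> (p $ j) x)
      = (LINT x|lebesgue_on (ocell h q). f x * 1) + (LINT x|lebesgue_on (ocell h q). F j x * \<theta> (p $ j + 2 * h) x)"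
    using lim[OF S(1), of "p $ j", unfolded eq] lim[OF S(2), of "p $ j + 2 * h"] LIMSEQ_unique by blast
  then show ?thesis by (simp add: \<theta>_def)
qed

lemma weighted_integral_bound:
  fixes p :: "real^'n"
  assumes "f \<in> L2 (ocell h p)" "w \<in> L2 (ocell h p)" "0 < h" "\<And>x. x \<in> ocell h p \<Longrightarrow> \<bar>w x\<bar> \<le> B"
  shows "(LINT x|lebesgue_on (ocell h p). f x * w x)\<^sup>2 \<le> B\<^sup>2 * h ^ CARD('n) * sq (ocell h p) f"
proof -
  have "(LINT x|lebesgue_on (ocell h p). f x * w x)\<^sup>2 \<le> sq (ocell h p) f * sq (ocell h p) w"
    by (rule L2_Cauchy_Schwarz[OF assms(1,2)])
  also have "\<dots> \<le> sq (ocell h p) f * (B\<^sup>2 * h ^ CARD('n))"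
    using sq_bounded[OF assms(2) ocell_lmeasurable assms(4)] measure_ocell[of h p] assms(3)
    by (intro mult_left_mono) auto
  finally show ?thesis by (simp add: mult_ac)
qed

text \<open>The weights in \<open>integral_cell_difference\<close> are at most \<open>h\<close>.
  Squares of means are multiplied by the volume of a cell, so that sums over cells become squared L2
  norms.\<close>

lemma avg_difference_bound:
  fixes f :: "real^'n \<Rightarrow> real"
  assumes f: "C1_limit S f F" and h: "0 < h" and q: "q = upd p j (p $ j + h)"
    and S: "ocell h p \<subseteq> S" "ocell h q \<subseteq> S" "S \<in> sets lebesgue" "bounded S"
  shows "h ^ CARD('n) * (avg h q f - avg h p f)\<^sup>2 \<le> 2 * h\<^sup>2 * (sq (ocell h p) (F j) + sq (ocell h q) (F j))"
proof -
  have F: "F j \<in> L2 S" using f by (simp add: C1_limit_def)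
  have FK: "F j \<in> L2 (ocell h p)" "F j \<in> L2 (ocell h q)" using L2_subset[OF F] S by auto
  let ?A = "LINT x|lebesgue_on (ocell h p). F j x * (x $ j - p $ j)" and ?B = "LINT x|lebesgue_on (ocell h q). F j x * (x $ j - (p $ j + 2 * h))"
  have w: "(\<lambda>x. x $ j - t) \<in> L2 (ocell h r)" for t r by (intro L2_continuous) (auto intro!: continuous_intros)
  have A: "?A\<^sup>2 \<le> h\<^sup>2 * h ^ CARD('n) * sq (ocell h p) (F j)"
  proof (rule weighted_integral_bound[OF FK(1) w h])
    fix x assume "x \<in> ocell h p" then show "\<bar>x $ j - p $ j\<bar> \<le> h" unfolding mem_ocell by (auto dest!: spec[of _ j])
  qed
  have B: "?B\<^sup>2 \<le> h\<^sup>2 * h ^ CARD('n) * sq (ocell h q) (F j)"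
  proof (rule weighted_integral_bound[OF FK(2) w h])
    fix x assume "x \<in> ocell h q" then show "\<bar>x $ j - (p $ j + 2 * h)\<bar> \<le> h" unfolding mem_ocell by (auto simp: q dest!: spec[of _ j])
  qed
  have "h ^ CARD('n) * (h ^ CARD('n) * (avg h q f - avg h p f)\<^sup>2) = (?A - ?B)\<^sup>2"
    using integral_cell_difference[OF f h q S] h
    by (simp add: avg_def diff_divide_distrib[symmetric] power_divide power2_eq_square)
  also have "\<dots> \<le> 2 * ?A\<^sup>2 + 2 * ?B\<^sup>2"
    using zero_le_power2[of "?A + ?B"] unfolding power2_sum power2_diff by linarith
  also have "\<dots> \<le> h ^ CARD('n) * (2 * h\<^sup>2 * (sq (ocell h p) (F j) + sq (ocell h q) (F j)))"
    using A B by (simp add: algebra_simps)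
  finally show ?thesis using h by (simp add: mult_le_cancel_left_pos)
qed

section \<open>Moments of polynomials over a cell\<close>

lemma integral_partial_zero:
  assumes F: "has_partial k F F'" and h: "0 < h"
    and 0: "\<And>x. x $ k = p $ k \<or> x $ k = p $ k + h \<Longrightarrow> F x = 0"
  shows "(LINT x|lebesgue_on (ocell h p). F' x) = 0"
proof -
  have "(LINT x|lebesgue_on (ocell h p). F' x) = face_integral h p {} 0 F'"
    using F by (intro ocell_integral_continuous) (simp add: has_partial_def)
  also have "\<dots> = face_integral h p {k} (upd 0 k (p $ k + h)) F - face_integral h p {k} (upd 0 k (p $ k)) F"
    by (rule face_integral_partial[OF F]) (use h in auto)
  finally have 1: "(LINT x|lebesgue_on (ocell h p). F' x) = face_integral h p {k} (upd 0 k (p $ k + h)) F - face_integral h p {k} (upd 0 k (p $ k)) F" .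
  have "face_integral h p {k} (upd 0 k s) F = 0" if "s = p $ k \<or> s = p $ k + h" for s
  proof (rule face_integral_zero)
    fix x :: "real^'a" assume "\<And>l. l \<in> {k} \<Longrightarrow> x $ l = upd 0 k s $ l"
    then have "x $ k = s" by simp
    with that show "F x = 0" by (intro 0) auto
  qed
  then show ?thesis unfolding 1 by simp
qed

lemma integral_coordinate:
  fixes p :: "real^'n"
  assumes \<Phi>: "\<And>s. (\<Phi> has_real_derivative \<phi> s) (at s)" and c: "continuous_on UNIV \<phi>" and h: "0 < h"
  shows "(LINT x|lebesgue_on (ocell h p). \<phi> (x $ k)) = h ^ (CARD('n) - 1) * (\<Phi> (p $ k + h) - \<Phi> (p $ k))"
proof -
  have F: "has_partial k (\<lambda>x::real^'n. \<Phi> (x $ k)) (\<lambda>x. \<phi> (x $ k))" by (rule has_partial_coord[OF \<Phi> c])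
  have f: "face_integral h p {k} (upd 0 k s) (\<lambda>x::real^'n. \<Phi> (x $ k)) = h ^ (CARD('n) - 1) * \<Phi> s" for s
  proof -
    have "face_integral h p {k} (upd 0 k s) (\<lambda>x::real^'n. \<Phi> (x $ k)) = face_integral h p {k} (upd 0 k s) (\<lambda>x. \<Phi> s)"
      by (rule face_integral_cong) simp
    then show ?thesis using h by (simp add: face_integral_const)
  qed
  have "(LINT x|lebesgue_on (ocell h p). \<phi> (x $ k)) = face_integral h p {} 0 (\<lambda>x::real^'n. \<phi> (x $ k))"
    using F by (intro ocell_integral_continuous) (simp add: has_partial_def)
  also have "\<dots> = face_integral h p {k} (upd 0 k (p $ k + h)) (\<lambda>x. \<Phi> (x $ k)) - face_integral h p {k} (upd 0 k (p $ k)) (\<lambda>x. \<Phi> (x $ k))"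
    by (rule face_integral_partial[OF F]) (use h in auto)
  finally show ?thesis by (simp add: f right_diff_distrib)
qed

text \<open>The centred coordinate is the derivative of a quadratic that vanishes on both faces.
  This orthogonality hides the affine part of the interpolation error from stress entries that do
  not vary with \<open>x $ k\<close>.\<close>

lemma integral_centered_indep:
  fixes g :: "real^'n \<Rightarrow> real"
  assumes g: "\<And>x t. g (x + t *\<^sub>R axis k 1) = g x" "continuous_on UNIV g" and h: "0 < h"
  shows "(LINT x|lebesgue_on (ocell h p). (x $ k - (p $ k + h / 2)) * g x) = 0"
proof -
  have "has_partial k (\<lambda>x::real^'n. ((x $ k - (p $ k + h / 2))\<^sup>2 - h\<^sup>2 / 4) / 2) (\<lambda>x. x $ k - (p $ k + h / 2))"
    by (rule has_partial_coord[where f="\<lambda>s. ((s - (p $ k + h / 2))\<^sup>2 - h\<^sup>2 / 4) / 2" and f'="\<lambda>s. s - (p $ k + h / 2)"])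
       (auto intro!: derivative_eq_intros continuous_intros)
  from has_partial_mult[OF this has_partial_indep[OF g]]
  have "has_partial k (\<lambda>x. (((x $ k - (p $ k + h / 2))\<^sup>2 - h\<^sup>2 / 4) / 2) * g x) (\<lambda>x. (x $ k - (p $ k + h / 2)) * g x)"
    by simp
  then show ?thesis
    by (rule integral_partial_zero[OF _ h]) (auto simp: power2_eq_square field_simps)
qed

lemma integral_const_ocell: "0 < h \<Longrightarrow> (LINT x|lebesgue_on (ocell h (p::real^'n)). c) = c * h ^ CARD('n)"
  using measure_ocell[of h p] by (simp add: measure_restrict_space)

lemma integral_centered: "0 < h \<Longrightarrow> (LINT x|lebesgue_on (ocell h p). x $ k - (p $ k + h / 2)) = 0"
  using integral_centered_indep[of "\<lambda>x. 1" k h p] by simp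

lemma integral_centered_square:
  fixes p :: "real^'n"
  assumes "0 < h"
  shows "(LINT x|lebesgue_on (ocell h p). (x $ k - (p $ k + h / 2))\<^sup>2) = h ^ CARD('n) * h\<^sup>2 / 12"
proof -
  have n: "h ^ CARD('n) = h * h ^ (CARD('n) - 1)" by (simp add: power_eq_if)
  have "(LINT x|lebesgue_on (ocell h p). (x $ k - (p $ k + h / 2))\<^sup>2) = h ^ (CARD('n) - 1) *
    ((p $ k + h - (p $ k + h / 2)) ^ 3 / 3 - (p $ k - (p $ k + h / 2)) ^ 3 / 3)"
    by (rule integral_coordinate[where \<phi>="\<lambda>s. (s - (p $ k + h / 2))\<^sup>2" and \<Phi>="\<lambda>s. (s - (p $ k + h / 2)) ^ 3 / 3"])
       (use assms in \<open>auto intro!: derivative_eq_intros continuous_intros\<close>)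
  also have "\<dots> = h ^ CARD('n) * h\<^sup>2 / 12"
    unfolding n by (simp add: power2_eq_square power3_eq_cube field_simps)
  finally show ?thesis .
qed

section \<open>Interpolation on a cell\<close>

lemma C1_limit_diff:
  assumes f: "C1_limit S f F" and g: "C1 g g'" and S: "bounded S" "S \<in> sets lebesgue"
  shows "C1_limit S (\<lambda>x. f x - g x) (\<lambda>i x. F i x - g' i x)"
proof -
  from f obtain r r' where r: "\<forall>k::nat. C1 (r k) (r' k)" "(\<lambda>k. sq S (\<lambda>x. r k x - f x)) \<longlonglongrightarrow> 0"
        "\<forall>i. (\<lambda>k. sq S (\<lambda>x. r' k i x - F i x)) \<longlonglongrightarrow> 0" and fS: "f \<in> L2 S" "\<forall>i. F i \<in> L2 S"
    unfolding C1_limit_def by blast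
  have gS: "g \<in> L2 S" "\<And>i. g' i \<in> L2 S" using g C1_L2 S by blast+
  show ?thesis
  proof (rule C1_limitI[where g="\<lambda>k x. r k x - g x" and g'="\<lambda>k i x. r' k i x - g' i x"])
    show "(\<lambda>x. f x - g x) \<in> L2 S" "\<And>i. (\<lambda>x. F i x - g' i x) \<in> L2 S" using fS gS by auto
    show "(\<lambda>k. sq S (\<lambda>x. r k x - g x - (f x - g x))) \<longlonglongrightarrow> 0" using r(2) by simp
    show "(\<lambda>k. sq S (\<lambda>x. r' k i x - g' i x - (F i x - g' i x))) \<longlonglongrightarrow> 0" for i using r(3) by simp
    show "C1 (\<lambda>x. r k x - g x) (\<lambda>i x. r' k i x - g' i x)" for k
    proof -
      have rk: "C1 (r k) (r' k)" using r(1) by simp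
      have "has_partial i (\<lambda>x. r k x - g x) (\<lambda>x. r' k i x - g' i x)" for i
        using rk g by (auto simp: C1_def has_partial_def intro!: continuous_intros DERIV_diff)
      moreover have "((\<lambda>x. r k x - g x) has_derivative (\<lambda>v. \<Sum>i\<in>UNIV. (r' k i x - g' i x) * v $ i)) (at x)" for x
      proof -
        have "((\<lambda>x. r k x - g x) has_derivative (\<lambda>v. (\<Sum>i\<in>UNIV. r' k i x * v $ i) - (\<Sum>i\<in>UNIV. g' i x * v $ i))) (at x)"
          using rk g by (intro has_derivative_diff) (auto simp: C1_def)
        then show ?thesis by (simp add: left_diff_distrib sum_subtractf)
      qed
      ultimately show ?thesis by (simp add: C1_def)
    qed
  qed
qed

text \<open>The variable runs over [-1, 1] and the hypotheses are mean zero and the two end values.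
  They bound \<alpha> and \<beta> by y and \<epsilon> by 3y/2.\<close>

lemma quadratic_bound:
  fixes y :: real
  assumes "\<alpha> + \<epsilon> / 3 = 0" "\<bar>\<alpha> + \<beta> + \<epsilon>\<bar> \<le> y" "\<bar>\<alpha> - \<beta> + \<epsilon>\<bar> \<le> y" "\<bar>t\<bar> \<le> 1"
  shows "\<bar>\<alpha> + \<beta> * t + \<epsilon> * t\<^sup>2\<bar> \<le> 4 * y"
proof -
  have b: "\<bar>\<alpha>\<bar> \<le> y" "\<bar>\<beta>\<bar> \<le> y" "\<bar>\<epsilon>\<bar> \<le> 3 / 2 * y" using assms(1-3) by linarith+
  have "\<bar>\<beta> * t\<bar> \<le> y * 1" unfolding abs_mult using b assms(4) by (intro mult_mono) auto
  moreover have "\<bar>\<epsilon> * t\<^sup>2\<bar> \<le> 3 / 2 * y * 1"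
    unfolding abs_mult using b assms(4) by (intro mult_mono) (auto simp: abs_square_le_1)
  ultimately show ?thesis using b by linarith
qed

text \<open>The four hypotheses bound the values at the corners of a square; each coefficient is a
  signed average of these values.\<close>

lemma bilinear_bound:
  fixes y :: real
  assumes "\<bar>\<alpha> + \<beta> + \<gamma> + \<delta>\<bar> \<le> y" "\<bar>\<alpha> + \<beta> - \<gamma> - \<delta>\<bar> \<le> y" "\<bar>\<alpha> - \<beta> + \<gamma> - \<delta>\<bar> \<le> y" "\<bar>\<alpha> - \<beta> - \<gamma> + \<delta>\<bar> \<le> y"
    and st: "\<bar>s\<bar> \<le> 1" "\<bar>t\<bar> \<le> 1"
  shows "\<bar>\<alpha> + \<beta> * s + \<gamma> * t + \<delta> * (s * t)\<bar> \<le> 4 * y"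
proof -
  have b: "\<bar>\<alpha>\<bar> \<le> y" "\<bar>\<beta>\<bar> \<le> y" "\<bar>\<gamma>\<bar> \<le> y" "\<bar>\<delta>\<bar> \<le> y" using assms(1-4) by linarith+
  have "\<bar>\<beta> * s\<bar> \<le> y * 1" "\<bar>\<gamma> * t\<bar> \<le> y * 1" unfolding abs_mult by (rule mult_mono; use b st in simp)+
  moreover have "\<bar>s * t\<bar> \<le> 1 * 1" unfolding abs_mult using st by (intro mult_mono) auto
  then have "\<bar>\<delta> * (s * t)\<bar> \<le> y * 1" unfolding abs_mult[of \<delta>] using b by (intro mult_mono) auto
  ultimately show ?thesis using b by linarith
qed

text \<open>Chosen to dominate both interpolation constants at once: 66 and 64 times
  \<open>poinc\<close> squared and \<open>poinc\<close> for diagonal entries, and 130, 256 and 128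
  times \<open>poinc\<close> squared, \<open>poinc\<close> and 1 for off-diagonal ones.\<close>

abbreviation cint :: "'n::finite itself \<Rightarrow> real" where
  "cint _ \<equiv> 300 * ((poinc TYPE('n))\<^sup>2 + poinc TYPE('n) + 1)"

text \<open>The setting for one entry of \<sigma> on one cell. The assumptions \<open>lim0\<close>
  and \<open>lim1\<close> supply the Poincare inequality for the function and for each first
  derivative.\<close>

locale h2_cell =
  fixes a b :: "real^'n" and u D h p
  assumes D: "weak_derivs (box a b) 2 u D"
    and lim0: "C1_limit (box a b) u (\<lambda>i. D [i])"
    and lim1: "\<And>j. C1_limit (box a b) (D [j]) (\<lambda>i. D [i, j])"
    and h: "0 < h" and sub: "ocell h p \<subseteq> box a b"
begin

abbreviation "K \<equiv> ocell h p"
abbreviation "m k \<equiv> p $ k + h / 2"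
abbreviation "c0 \<equiv> avg h p u"
abbreviation "g k \<equiv> avg h p (D [k])"

text \<open>The affine function with the same mean and the same mean gradient as \<open>u\<close>;
  \<open>V2\<close> is the squared seminorm of the second derivatives on the cell.\<close>

definition "lin x = c0 + (\<Sum>k\<in>UNIV. g k * (x $ k - m k))"
definition "V2 = (\<Sum>j\<in>UNIV. \<Sum>i\<in>UNIV. sq K (D [i, j]))"

lemma DK: "length xs \<le> 2 \<Longrightarrow> D xs \<in> L2 K"
  by (rule L2_subset[OF weak_derivs_L2[OF D] sub]) auto

lemma uK: "u \<in> L2 K"
  using DK[of "[]"] D by (simp add: weak_derivs_def)

lemma contK: "continuous_on UNIV f \<Longrightarrow> f \<in> L2 K" for f :: "real^'n \<Rightarrow> real"
  by (rule L2_continuous) auto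

lemma lin_C1: "C1 lin (\<lambda>k x. g k)"
proof -
  have "(lin has_derivative (\<lambda>v. \<Sum>k\<in>UNIV. g k * v $ k)) (at x)" for x
    unfolding lin_def by (auto intro!: derivative_eq_intros bounded_linear.has_derivative[OF bounded_linear_vec_nth])
  then have d: "lin differentiable (at x)" "frechet_derivative lin (at x) = (\<lambda>v. \<Sum>k\<in>UNIV. g k * v $ k)" 
    and d': "(lin has_derivative (\<lambda>v. \<Sum>k\<in>UNIV. g k * v $ k)) (at x)" for x
    by (auto simp: differentiable_def frechet_derivative_at[symmetric])
  have "((\<lambda>t. lin (x + t *\<^sub>R axis i 1)) has_real_derivative g i) (at 0)" for x i
    using differentiable_axis_derivative[OF d(1), of x i] 
    by (simp add: d(2) axis_def if_distrib cong: if_cong)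
  moreover have "continuous_on UNIV lin" unfolding lin_def by (intro continuous_intros)
  ultimately show ?thesis using d' by (auto simp: C1_def has_partial_def)
qed

lemma lin_cont: "continuous_on UNIV lin" unfolding lin_def by (intro continuous_intros)

lemma integral_lin: "(LINT x|lebesgue_on K. lin x) = c0 * h ^ CARD('n)"
proof -
  have i: "integrable (lebesgue_on K) (\<lambda>x. g k * (x $ k - m k))" for k
    by (rule L2_integrable[OF contK]) (auto intro!: continuous_intros)
  have "(LINT x|lebesgue_on K. (\<Sum>k\<in>UNIV. g k * (x $ k - m k))) = (\<Sum>k\<in>UNIV. LINT x|lebesgue_on K. g k * (x $ k - m k))"
    by (rule Bochner_Integration.integral_sum) (rule i)
  also have "\<dots> = 0" by (simp only: integral_mult_right_zero integral_centered[OF h]) simp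
  finally have 0: "(LINT x|lebesgue_on K. (\<Sum>k\<in>UNIV. g k * (x $ k - m k))) = 0" .
  have "(LINT x|lebesgue_on K. lin x) = (LINT x|lebesgue_on K. c0) + (LINT x|lebesgue_on K. (\<Sum>k\<in>UNIV. g k * (x $ k - m k)))"
    unfolding lin_def
  proof (rule Bochner_Integration.integral_add)
    show "integrable (lebesgue_on K) (\<lambda>x. c0)" by (rule L2_integrable) auto
    show "integrable (lebesgue_on K) (\<lambda>x. \<Sum>k\<in>UNIV. g k * (x $ k - m k))" by (intro Bochner_Integration.integrable_sum i)
  qed
  then show ?thesis unfolding 0 integral_const_ocell[OF h] by simp
qed

lemma integral_u: "(LINT x|lebesgue_on K. u x) = c0 * h ^ CARD('n)" using h by (simp add: avg_def)

lemma V2_nonneg: "0 \<le> V2" by (simp add: V2_def sum_nonneg)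

lemma sum_gradient_error: "(\<Sum>k\<in>UNIV. sq K (\<lambda>x. D [k] x - g k)) \<le> poinc TYPE('n) * h\<^sup>2 * V2"
proof -
  have "(\<Sum>k\<in>UNIV. sq K (\<lambda>x. D [k] x - g k)) \<le> (\<Sum>k\<in>UNIV. poinc TYPE('n) * h\<^sup>2 * (\<Sum>i\<in>UNIV. sq K (D [i, k])))"
    by (intro sum_mono poincare[OF lim1 h sub]) auto
  then show ?thesis by (simp add: V2_def sum_distrib_left)
qed

lemma gradient_error: "sq K (\<lambda>x. D [k] x - g k) \<le> poinc TYPE('n) * h\<^sup>2 * V2"
  using sum_gradient_error member_le_sum[of k UNIV "\<lambda>k. sq K (\<lambda>x. D [k] x - g k)"] by simp

text \<open>Poincare is applied twice: \<open>u - lin\<close> has mean zero, and so has each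
  component of its gradient. Each application gains \<open>h ^ 2\<close>.\<close>

lemma lin_error: "sq K (\<lambda>x. u x - lin x) \<le> (poinc TYPE('n))\<^sup>2 * h ^ 4 * V2"
proof -
  have "avg h p (\<lambda>x. u x - lin x) = 0"
    using avg_diff_fun[OF uK contK[OF lin_cont]] integral_lin h by (simp add: avg_def)
  then have "sq K (\<lambda>x. u x - lin x) \<le> poinc TYPE('n) * h\<^sup>2 * (\<Sum>k\<in>UNIV. sq K (\<lambda>x. D [k] x - g k))"
    using poincare[OF C1_limit_diff[OF lim0 lin_C1] h sub] by simp
  also have "\<dots> \<le> poinc TYPE('n) * h\<^sup>2 * (poinc TYPE('n) * h\<^sup>2 * V2)" by (intro mult_left_mono sum_gradient_error) auto
  finally show ?thesis by (simp add: power2_eq_square eval_nat_numeral mult_ac)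
qed

lemma theta_bound: "t = p $ k \<or> t = p $ k + h \<Longrightarrow> x \<in> K \<Longrightarrow> \<bar>x $ k - t\<bar> \<le> h"
  unfolding mem_ocell by (auto dest!: spec[of _ k])

lemma sq_theta:
  assumes "t = p $ k \<or> t = p $ k + h" "f \<in> L2 K"
  shows "(\<lambda>x. (x $ k - t) * f x) \<in> L2 K" "sq K (\<lambda>x. (x $ k - t) * f x) \<le> h\<^sup>2 * sq K f"
proof -
  have th: "(\<lambda>x. x $ k - t) \<in> borel_measurable (lebesgue_on K)"
    by (intro continuous_measurable_lebesgue_on continuous_intros)
  show L: "(\<lambda>x. (x $ k - t) * f x) \<in> L2 K"
    using L2_scaleR_bounded[OF assms(2) th, of h] theta_bound[OF assms(1)] by auto
  have "sq K (\<lambda>x. (x $ k - t) * f x) \<le> (LINT x|lebesgue_on K. h\<^sup>2 * (f x)\<^sup>2)"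
    unfolding sq_def
  proof (rule integral_mono)
    show "integrable (lebesgue_on K) (\<lambda>x. ((x $ k - t) * f x)\<^sup>2)" by (rule L2_sq_integrable[OF L])
    show "integrable (lebesgue_on K) (\<lambda>x. h\<^sup>2 * (f x)\<^sup>2)" using L2_sq_integrable[OF assms(2)] by simp
    fix x assume "x \<in> space (lebesgue_on K)"
    then have "\<bar>x $ k - t\<bar> \<le> \<bar>h\<bar>" using theta_bound[OF assms(1)] h by auto
    then have "(x $ k - t)\<^sup>2 \<le> h\<^sup>2" by (simp add: abs_le_square_iff)
    then show "((x $ k - t) * f x)\<^sup>2 \<le> h\<^sup>2 * (f x)\<^sup>2" by (simp add: power_mult_distrib mult_right_mono)
  qed
  then show "sq K (\<lambda>x. (x $ k - t) * f x) \<le> h\<^sup>2 * sq K f" by (simp add: sq_def)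
qed

lemma integral_square_bound:
  assumes "f \<in> L2 K" "h ^ CARD('n) * \<delta> = (LINT x|lebesgue_on K. f x)"
  shows "h ^ CARD('n) * \<delta>\<^sup>2 \<le> sq K f"
proof -
  have "h ^ CARD('n) * (h ^ CARD('n) * \<delta>\<^sup>2) = (LINT x|lebesgue_on K. f x)\<^sup>2" unfolding assms(2)[symmetric] by (simp add: power2_eq_square)
  also have "\<dots> \<le> h ^ CARD('n) * sq K f" using integral_L2_square_le[OF assms(1)] measure_ocell[of h p] h by simp
  finally show ?thesis using h by (simp add: mult_le_cancel_left_pos)
qed

lemma sup_to_sq:
  assumes "continuous_on UNIV d" "\<And>x. x \<in> K \<Longrightarrow> \<bar>d x\<bar> \<le> 4 * y" "h ^ CARD('n) * y\<^sup>2 = Y"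
  shows "sq K d \<le> 16 * Y"
proof -
  have "sq K d \<le> (4 * y)\<^sup>2 * measure lebesgue K"
    by (rule sq_bounded[OF contK[OF assms(1)] ocell_lmeasurable assms(2)])
  also have "\<dots> = 16 * Y" using measure_ocell[of h p] h assms(3) by (simp add: power_mult_distrib mult.commute)
  finally show ?thesis .
qed

lemma abs_sqrt_bound:
  assumes "h ^ CARD('n) * \<delta>\<^sup>2 \<le> Y"
  shows "\<bar>\<delta>\<bar> \<le> sqrt (Y / h ^ CARD('n))"
proof -
  have "\<delta>\<^sup>2 \<le> Y / h ^ CARD('n)" using assms h by (simp add: field_simps)
  then show ?thesis by (metis real_sqrt_abs real_sqrt_le_mono)
qed

lemma sqrt_eq: "0 \<le> Y \<Longrightarrow> h ^ CARD('n) * (sqrt (Y / h ^ CARD('n)))\<^sup>2 = Y"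
  using h by simp


text \<open>The difference of \<open>q\<close> and the part of \<open>lin\<close> that varies with
  \<open>x $ i\<close> is a quadratic fixed by its mean and two face values. The mean is zero, and
  the face values are given by the trace formula applied to \<open>u - lin\<close>. The remaining
  variables of \<open>lin\<close> are invisible to \<open>q\<close> and stay behind as the explicit
  sum.\<close>

lemma diagonal_interpolation:
  assumes q: "\<And>x. q x = A + B * (x $ i - m i) + E * (x $ i - m i)\<^sup>2"
    and tr: "\<And>c. c $ i \<in> {p $ i, p $ i + h} \<Longrightarrow> has_trace_integral (box a b) h p {i} c u (face_integral h p {i} c q)"
    and mean: "(LINT x|lebesgue_on K. q x) = (LINT x|lebesgue_on K. u x)"
  shows "sq K (\<lambda>x. q x - u x + (\<Sum>k\<in>UNIV - {i}. g k * (x $ k - m k))) \<le> cint TYPE('n) * h ^ 4 * V2"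
proof -
  define X where "X = sq K (\<lambda>x. u x - lin x)"
  define Z where "Z = sq K (\<lambda>x. D [i] x - g i)"
  define Y where "Y = 2 * X + 2 * h\<^sup>2 * Z"
  have n: "h ^ CARD('n) = h * h ^ (CARD('n) - 1)" by (simp add: power_eq_if)
  have e: "(\<lambda>x. u x - lin x) \<in> L2 K" "(\<lambda>x. D [i] x - g i) \<in> L2 K"
    by (intro L2_diff uK DK contK[OF lin_cont] L2_const; simp)+
  \<comment> \<open>The value of that quadratic on one of the two faces is the cell mean of
    \<open>u - lin\<close> plus a weighted gradient error, both already known to be small.\<close>
  have corner: "h ^ CARD('n) * (A + B * s + E * s\<^sup>2 - c0 - g i * s)\<^sup>2 \<le> Y" if s: "s = h / 2 \<or> s = - (h / 2)" for s
  proof -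
    define c where "c = upd 0 i (m i + s)"
    have ci: "c $ i = m i + s" "c $ i \<in> {p $ i, p $ i + h}" using s by (auto simp: c_def)
    \<comment> \<open>The coordinate of the face opposite to \<open>c\<close>; hence the mean of the
      weight \<open>x $ i - t\<close> is \<open>s\<close>.\<close>
    define t where "t = 2 * p $ i + h - c $ i"
    have t: "t = p $ i \<or> t = p $ i + h" "m i - t = s" using s by (auto simp: t_def c_def)
    have "face_integral h p {i} c q = face_integral h p {i} c (\<lambda>x. A + B * s + E * s\<^sup>2)"
      by (rule face_integral_cong) (simp add: q ci)
    then have fq: "h * face_integral h p {i} c q = h ^ CARD('n) * (A + B * s + E * s\<^sup>2)"
      using h by (simp add: face_integral_const n)
    have 1: "h ^ CARD('n) * (A + B * s + E * s\<^sup>2) = (LINT x|lebesgue_on K. u x + (x $ i - t) * D [i] x)"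
      using trace_formula1[OF tr[OF ci(2)] D h ci(2) sub] unfolding fq t_def .
    have th: "(\<lambda>x. x $ i - t) \<in> L2 K" by (rule contK) (intro continuous_intros)
    have iu: "integrable (lebesgue_on K) u" "integrable (lebesgue_on K) (\<lambda>x. (x $ i - t) * D [i] x)"
      "integrable (lebesgue_on K) lin" "integrable (lebesgue_on K) (\<lambda>x. (x $ i - t) * g i)"
      by (auto intro!: L2_integrable[OF uK] L2_integrable[OF contK] L2_mult_integrable[OF th] DK lin_cont continuous_intros)
    have 2: "(LINT x|lebesgue_on K. (x $ i - t) * g i) = h ^ CARD('n) * (g i * s)"
    proof -
      have "(LINT x|lebesgue_on K. x $ i - t) = (LINT x|lebesgue_on K. (x $ i - m i) + s)"
        by (intro Bochner_Integration.integral_cong) (use t in auto)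
      also have "\<dots> = (LINT x|lebesgue_on K. x $ i - m i) + (LINT x|lebesgue_on K. s)"
        by (rule Bochner_Integration.integral_add; rule L2_integrable[OF contK]) (auto intro!: continuous_intros)
      also have "\<dots> = s * h ^ CARD('n)" by (simp only: integral_centered[OF h] integral_const_ocell[OF h] add_0)
      finally show ?thesis by simp
    qed
    have "(LINT x|lebesgue_on K. (u x - lin x) + (x $ i - t) * (D [i] x - g i)) =
       (LINT x|lebesgue_on K. (u x + (x $ i - t) * D [i] x) - (lin x + (x $ i - t) * g i))"
      by (intro Bochner_Integration.integral_cong) (auto simp: algebra_simps)
    also have "\<dots> = h ^ CARD('n) * (A + B * s + E * s\<^sup>2) - (c0 * h ^ CARD('n) + h ^ CARD('n) * (g i * s))"
      unfolding 1 using iu by (simp only: Bochner_Integration.integral_diff Bochner_Integration.integral_add Bochner_Integration.integrable_add 2 integral_lin)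
    finally have "h ^ CARD('n) * (A + B * s + E * s\<^sup>2 - c0 - g i * s) = (LINT x|lebesgue_on K. (u x - lin x) + (x $ i - t) * (D [i] x - g i))"
      by (simp add: algebra_simps)
    then have "h ^ CARD('n) * (A + B * s + E * s\<^sup>2 - c0 - g i * s)\<^sup>2 \<le> sq K (\<lambda>x. (u x - lin x) + (x $ i - t) * (D [i] x - g i))"
      by (intro integral_square_bound L2_add e sq_theta t)
    also have "\<dots> \<le> 2 * X + 2 * sq K (\<lambda>x. (x $ i - t) * (D [i] x - g i))"
      unfolding X_def by (intro sq_add_le e sq_theta t)
    also have "\<dots> \<le> Y" using sq_theta(2)[OF t(1) e(2)] by (simp add: Y_def Z_def)
    finally show ?thesis .
  qed
  have Y0: "0 \<le> Y" using h by (simp add: Y_def X_def Z_def)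
  define y where "y = sqrt (Y / h ^ CARD('n))"
  \<comment> \<open>Coefficients in the rescaled variable with range [-1, 1], ready for
    \<open>quadratic_bound\<close>.\<close>
  define \<alpha> where "\<alpha> = A - c0"
  define \<beta> where "\<beta> = (B - g i) * h / 2"
  define \<epsilon> where "\<epsilon> = E * h\<^sup>2 / 4"
  have "\<bar>\<alpha> + \<beta> + \<epsilon>\<bar> \<le> y"
  proof -
    have "\<alpha> + \<beta> + \<epsilon> = A + B * (h / 2) + E * (h / 2)\<^sup>2 - c0 - g i * (h / 2)"
      by (simp add: \<alpha>_def \<beta>_def \<epsilon>_def power2_eq_square field_simps)
    then show ?thesis using abs_sqrt_bound[OF corner[of "h / 2"]] by (simp add: y_def)
  qed
  moreover have "\<bar>\<alpha> - \<beta> + \<epsilon>\<bar> \<le> y"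
  proof -
    have "\<alpha> - \<beta> + \<epsilon> = A + B * (- (h / 2)) + E * (- (h / 2))\<^sup>2 - c0 - g i * (- (h / 2))"
      by (simp add: \<alpha>_def \<beta>_def \<epsilon>_def power2_eq_square field_simps)
    then show ?thesis using abs_sqrt_bound[OF corner[of "- (h / 2)"]] by (simp add: y_def)
  qed
  moreover have "\<alpha> + \<epsilon> / 3 = 0"
  proof -
    have i: "integrable (lebesgue_on K) (\<lambda>x. A)" "integrable (lebesgue_on K) (\<lambda>x. B * (x $ i - m i))" "integrable (lebesgue_on K) (\<lambda>x. E * (x $ i - m i)\<^sup>2)"
      by (rule L2_integrable[OF contK]; intro continuous_intros ocell_lmeasurable)+
    have "(LINT x|lebesgue_on K. q x) = A * h ^ CARD('n) + B * 0 + E * (h ^ CARD('n) * h\<^sup>2 / 12)"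
      unfolding q using i by (simp only: Bochner_Integration.integral_add Bochner_Integration.integrable_add integral_mult_right_zero
        integral_centered[OF h] integral_centered_square[OF h] integral_const_ocell[OF h])
    then have "h ^ CARD('n) * (A + E * h\<^sup>2 / 12 - c0) = 0" using mean integral_u by (simp add: algebra_simps)
    then show ?thesis using h by (simp add: \<alpha>_def \<epsilon>_def)
  qed
  ultimately have quad: "\<bar>\<alpha> + \<beta> * t + \<epsilon> * t\<^sup>2\<bar> \<le> 4 * y" if "\<bar>t\<bar> \<le> 1" for t using quadratic_bound that by blast
  define d where "d x = q x - (c0 + g i * (x $ i - m i))" for x
  have cd: "continuous_on UNIV d" unfolding d_def q by (intro continuous_intros)
  have sd: "sq K d \<le> 16 * Y"
  proof (rule sup_to_sq[OF cd])
    show "h ^ CARD('n) * y\<^sup>2 = Y" unfolding y_def by (rule sqrt_eq[OF Y0])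
    fix x assume x: "x \<in> K"
    define t where "t = (x $ i - m i) / (h / 2)"
    have "\<bar>x $ i - m i\<bar> \<le> h / 2" using x[unfolded mem_ocell, rule_format, of i] by linarith
    then have "\<bar>t\<bar> \<le> 1" unfolding t_def abs_divide using h by (simp add: divide_le_eq)
    moreover have xt: "x $ i - m i = t * (h / 2)" using h by (simp add: t_def)
    moreover have "d x = \<alpha> + \<beta> * t + \<epsilon> * t\<^sup>2"
      unfolding d_def q xt by (simp add: \<alpha>_def \<beta>_def \<epsilon>_def power2_eq_square field_simps)
    ultimately show "\<bar>d x\<bar> \<le> 4 * y" using quad by simp
  qed
  have "(\<lambda>x. q x - u x + (\<Sum>k\<in>UNIV - {i}. g k * (x $ k - m k))) = (\<lambda>x. d x - (u x - lin x))"
    by (simp add: d_def lin_def fun_eq_iff sum.remove[of UNIV i])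
  then have "sq K (\<lambda>x. q x - u x + (\<Sum>k\<in>UNIV - {i}. g k * (x $ k - m k))) \<le> 2 * sq K d + 2 * X"
    unfolding X_def using sq_diff_le[OF contK[OF cd] e(1)] by simp
  also have "\<dots> \<le> 66 * X + 64 * (h\<^sup>2 * Z)" using sd by (simp add: Y_def)
  also have "\<dots> \<le> 66 * ((poinc TYPE('n))\<^sup>2 * h ^ 4 * V2) + 64 * (h\<^sup>2 * (poinc TYPE('n) * h\<^sup>2 * V2))"
    unfolding X_def Z_def by (intro add_mono mult_left_mono lin_error gradient_error) auto
  also have "\<dots> = (66 * (poinc TYPE('n))\<^sup>2 + 64 * poinc TYPE('n)) * (h ^ 4 * V2)" by (simp add: algebra_simps power2_eq_square eval_nat_numeral)
  also have "\<dots> \<le> cint TYPE('n) * (h ^ 4 * V2)"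
    using V2_nonneg zero_le_power2[of "poinc TYPE('n)"] by (intro mult_right_mono) auto
  finally show ?thesis by (simp add: mult.assoc)
qed

text \<open>Here the difference is bilinear in \<open>x $ i\<close> and \<open>x $ j\<close> and
  fixed by four values. The trace formula adds the mixed derivative \<open>D [j, i]\<close>, which
  is bounded directly by \<open>V2\<close> because both weights together already give
  \<open>h ^ 2\<close>.\<close>

lemma offdiagonal_interpolation:
  assumes ij: "i \<noteq> j"
    and q: "\<And>x. q x = A + B * (x $ i - m i) + E * (x $ j - m j) + G * ((x $ i - m i) * (x $ j - m j))"
    and tr: "\<And>c. c $ i \<in> {p $ i, p $ i + h} \<Longrightarrow> c $ j \<in> {p $ j, p $ j + h} \<Longrightarrow>
       \<exists>M. has_trace_integral (box a b) h p {i, j} c u M \<and> (\<forall>x\<in>face h p {i, j} c. q x = M / h ^ (CARD('n) - 2))"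
  shows "sq K (\<lambda>x. q x - u x + (\<Sum>k\<in>UNIV - {i, j}. g k * (x $ k - m k))) \<le> cint TYPE('n) * h ^ 4 * V2"
proof -
  define X where "X = sq K (\<lambda>x. u x - lin x)"
  define Z where "Z k = sq K (\<lambda>x. D [k] x - g k)" for k
  define W where "W = sq K (D [j, i])"
  define Y where "Y = 4 * X + 4 * (h\<^sup>2 * Z i) + 4 * (h\<^sup>2 * Z j) + 4 * (h ^ 4 * W)"
  have card2: "2 \<le> CARD('n)"
  proof -
    have "card {i, j} \<le> CARD('n)" by (rule card_mono) auto
    with ij show ?thesis by simp
  qed
  then have n: "h ^ CARD('n) = h\<^sup>2 * h ^ (CARD('n) - 2)" by (metis le_add_diff_inverse power_add)
  have e: "(\<lambda>x. u x - lin x) \<in> L2 K" "(\<lambda>x. D [k] x - g k) \<in> L2 K" for k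
    by (intro L2_diff uK DK contK[OF lin_cont] L2_const; simp)+
  have corner: "h ^ CARD('n) * (A + B * s + E * r + G * (s * r) - c0 - g i * s - g j * r)\<^sup>2 \<le> Y"
    if s: "s = h / 2 \<or> s = - (h / 2)" and r: "r = h / 2 \<or> r = - (h / 2)" for s r
  proof -
    define c :: "real^'n" where "c = (\<chi> k. if k = i then m i + s else if k = j then m j + r else m k)"
    have ci: "c $ i = m i + s" "c $ i \<in> {p $ i, p $ i + h}" "c $ j = m j + r" "c $ j \<in> {p $ j, p $ j + h}"
      using s r ij by (auto simp: c_def)
    define t where "t = 2 * p $ i + h - c $ i"
    define t' where "t' = 2 * p $ j + h - c $ j"
    have t: "t = p $ i \<or> t = p $ i + h" "m i - t = s" and t': "t' = p $ j \<or> t' = p $ j + h" "m j - t' = r"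
      using s r ci by (auto simp: t_def t'_def)
    obtain M where M: "has_trace_integral (box a b) h p {i, j} c u M" "\<forall>x\<in>face h p {i, j} c. q x = M / h ^ (CARD('n) - 2)"
      using tr[OF ci(2,4)] by blast
    \<comment> \<open>The point \<open>c\<close> is the centre of the face; as \<open>q\<close> is
      constant there, this one point determines the trace integral \<open>M\<close>.\<close>
    have "c \<in> face h p {i, j} c"
      using s r h by (auto simp: face_def cell_def mem_box_cart c_def)
    then have "M = h ^ (CARD('n) - 2) * q c" using M(2) h by simp
    then have Mq: "h\<^sup>2 * M = h ^ CARD('n) * (A + B * s + E * r + G * (s * r))"
      using ci by (simp add: q n)
    let ?th = "\<lambda>x. x $ i - t" and ?th' = "\<lambda>x. x $ j - t'"
    have 1: "h ^ CARD('n) * (A + B * s + E * r + G * (s * r)) = (LINT x|lebesgue_on K. u x + ?th x * D [i] x + ?th' x * (D [j] x + ?th x * D [j, i] x))"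
      using trace_formula2[OF M(1) D h ij ci(2,4) sub] unfolding Mq t_def t'_def .
    have th: "?th \<in> L2 K" "?th' \<in> L2 K" by (rule contK, intro continuous_intros)+
    have Lth: "(\<lambda>x. ?th' x * (?th x * D [j, i] x)) \<in> L2 K" by (intro sq_theta t t' DK) simp
    have lin2: "(LINT x|lebesgue_on K. (x $ k - v) * g k) = h ^ CARD('n) * (g k * w)" if "m k - v = w" for k v w
    proof -
      have "(LINT x|lebesgue_on K. x $ k - v) = (LINT x|lebesgue_on K. (x $ k - m k) + w)"
        by (intro Bochner_Integration.integral_cong) (use that in auto)
      also have "\<dots> = (LINT x|lebesgue_on K. x $ k - m k) + (LINT x|lebesgue_on K. w)"
        by (rule Bochner_Integration.integral_add; rule L2_integrable[OF contK]) (auto intro!: continuous_intros)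
      also have "\<dots> = w * h ^ CARD('n)" by (simp only: integral_centered[OF h] integral_const_ocell[OF h] add_0)
      finally show ?thesis by simp
    qed
    have i1: "integrable (lebesgue_on K) (\<lambda>x. u x + ?th x * D [i] x + ?th' x * (D [j] x + ?th x * D [j, i] x))"
      unfolding distrib_left
      by (intro Bochner_Integration.integrable_add L2_integrable[OF uK] L2_mult_integrable[OF th(1)] L2_mult_integrable[OF th(2)] L2_integrable[OF Lth] DK ocell_lmeasurable) auto
    have i2: "integrable (lebesgue_on K) lin" "integrable (lebesgue_on K) (\<lambda>x. ?th x * g i)" "integrable (lebesgue_on K) (\<lambda>x. ?th' x * g j)"
      by (auto intro!: L2_integrable[OF contK] lin_cont continuous_intros)
    let ?w = "\<lambda>x. ((u x - lin x) + ?th x * (D [i] x - g i)) + (?th' x * (D [j] x - g j) + ?th' x * (?th x * D [j, i] x))"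
    have "(LINT x|lebesgue_on K. ?w x) =
       (LINT x|lebesgue_on K. (u x + ?th x * D [i] x + ?th' x * (D [j] x + ?th x * D [j, i] x)) - (lin x + ?th x * g i + ?th' x * g j))"
      by (intro Bochner_Integration.integral_cong) (auto simp: algebra_simps)
    also have "\<dots> = (LINT x|lebesgue_on K. u x + ?th x * D [i] x + ?th' x * (D [j] x + ?th x * D [j, i] x)) - (LINT x|lebesgue_on K. lin x + ?th x * g i + ?th' x * g j)"
      by (rule Bochner_Integration.integral_diff[OF i1]) (intro Bochner_Integration.integrable_add i2)
    also have "\<dots> = h ^ CARD('n) * (A + B * s + E * r + G * (s * r)) - (c0 * h ^ CARD('n) + h ^ CARD('n) * (g i * s) + h ^ CARD('n) * (g j * r))"
      unfolding 1[symmetric] using i2 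
      by (simp only: Bochner_Integration.integral_add Bochner_Integration.integrable_add lin2[OF t(2)] lin2[OF t'(2)] integral_lin)
    finally have eq: "h ^ CARD('n) * (A + B * s + E * r + G * (s * r) - c0 - g i * s - g j * r) = (LINT x|lebesgue_on K. ?w x)"
      by (simp add: algebra_simps)
    have L: "(\<lambda>x. ?th x * (D [i] x - g i)) \<in> L2 K" "(\<lambda>x. ?th' x * (D [j] x - g j)) \<in> L2 K"
      by (intro sq_theta t t' e)+
    have "h ^ CARD('n) * (A + B * s + E * r + G * (s * r) - c0 - g i * s - g j * r)\<^sup>2 \<le> sq K ?w"
      by (rule integral_square_bound[OF _ eq]) (intro L2_add e L Lth)
    also have "\<dots> \<le> 2 * sq K (\<lambda>x. (u x - lin x) + ?th x * (D [i] x - g i)) + 2 * sq K (\<lambda>x. ?th' x * (D [j] x - g j) + ?th' x * (?th x * D [j, i] x))"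
      by (intro sq_add_le L2_add e L Lth)
    also have "\<dots> \<le> 2 * (2 * X + 2 * sq K (\<lambda>x. ?th x * (D [i] x - g i))) + 2 * (2 * sq K (\<lambda>x. ?th' x * (D [j] x - g j)) + 2 * sq K (\<lambda>x. ?th' x * (?th x * D [j, i] x)))"
      unfolding X_def by (intro add_mono mult_left_mono sq_add_le e L Lth) auto
    also have "\<dots> \<le> 2 * (2 * X + 2 * (h\<^sup>2 * Z i)) + 2 * (2 * (h\<^sup>2 * Z j) + 2 * (h\<^sup>2 * (h\<^sup>2 * W)))"
    proof -
      have "sq K (\<lambda>x. ?th' x * (?th x * D [j, i] x)) \<le> h\<^sup>2 * sq K (\<lambda>x. ?th x * D [j, i] x)"
        by (intro sq_theta t t' DK) simp
      also have "\<dots> \<le> h\<^sup>2 * (h\<^sup>2 * W)" unfolding W_def by (intro mult_left_mono sq_theta t DK) auto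
      finally show ?thesis using sq_theta(2)[OF t(1) e(2)[of i]] sq_theta(2)[OF t'(1) e(2)[of j]] by (simp add: Z_def)
    qed
    also have "\<dots> = Y" by (simp add: Y_def eval_nat_numeral)
    finally show ?thesis .
  qed
  have Y0: "0 \<le> Y" using h by (simp add: Y_def X_def Z_def W_def)
  define y where "y = sqrt (Y / h ^ CARD('n))"
  define \<alpha> where "\<alpha> = A - c0"
  define \<beta> where "\<beta> = (B - g i) * h / 2"
  define \<gamma> where "\<gamma> = (E - g j) * h / 2"
  define \<delta> where "\<delta> = G * h\<^sup>2 / 4"
  have cor: "\<bar>\<alpha> + \<beta> * \<sigma> + \<gamma> * \<tau> + \<delta> * (\<sigma> * \<tau>)\<bar> \<le> y" if "\<sigma> = 1 \<or> \<sigma> = -1" "\<tau> = 1 \<or> \<tau> = -1" for \<sigma> \<tau>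
  proof -
    have "\<alpha> + \<beta> * \<sigma> + \<gamma> * \<tau> + \<delta> * (\<sigma> * \<tau>) = A + B * (\<sigma> * (h / 2)) + E * (\<tau> * (h / 2)) + G * ((\<sigma> * (h / 2)) * (\<tau> * (h / 2))) - c0 - g i * (\<sigma> * (h / 2)) - g j * (\<tau> * (h / 2))"
      by (simp add: \<alpha>_def \<beta>_def \<gamma>_def \<delta>_def power2_eq_square field_simps)
    then show ?thesis using abs_sqrt_bound[OF corner[of "\<sigma> * (h / 2)" "\<tau> * (h / 2)"]] that by (auto simp: y_def)
  qed
  have bil: "\<bar>\<alpha> + \<beta> * s + \<gamma> * t + \<delta> * (s * t)\<bar> \<le> 4 * y" if "\<bar>s\<bar> \<le> 1" "\<bar>t\<bar> \<le> 1" for s t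
    using cor[of 1 1] cor[of 1 "-1"] cor[of "-1" 1] cor[of "-1" "-1"] that by (intro bilinear_bound) simp_all
  define d where "d x = q x - (c0 + g i * (x $ i - m i) + g j * (x $ j - m j))" for x
  have cd: "continuous_on UNIV d" unfolding d_def q by (intro continuous_intros)
  have sd: "sq K d \<le> 16 * Y"
  proof (rule sup_to_sq[OF cd])
    show "h ^ CARD('n) * y\<^sup>2 = Y" unfolding y_def by (rule sqrt_eq[OF Y0])
    fix x assume x: "x \<in> K"
    define t where "t k = (x $ k - m k) / (h / 2)" for k
    have "\<bar>x $ k - m k\<bar> \<le> h / 2" for k using x[unfolded mem_ocell, rule_format, of k] by linarith
    then have "\<bar>t k\<bar> \<le> 1" for k unfolding t_def abs_divide using h by (simp add: divide_le_eq)
    moreover have xt: "x $ k - m k = t k * (h / 2)" for k using h by (simp add: t_def)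
    moreover have "d x = \<alpha> + \<beta> * t i + \<gamma> * t j + \<delta> * (t i * t j)"
      unfolding d_def q xt by (simp add: \<alpha>_def \<beta>_def \<gamma>_def \<delta>_def power2_eq_square field_simps)
    ultimately show "\<bar>d x\<bar> \<le> 4 * y" using bil by simp
  qed
  have "(\<Sum>k\<in>UNIV. g k * (x $ k - m k)) = g i * (x $ i - m i) + (g j * (x $ j - m j) + (\<Sum>k\<in>UNIV - {i, j}. g k * (x $ k - m k)))" for x
  proof -
    have "UNIV - {i, j} = UNIV - {i} - {j}" by auto
    then show ?thesis using sum.remove[of UNIV i "\<lambda>k. g k * (x $ k - m k)"] sum.remove[of "UNIV - {i}" j "\<lambda>k. g k * (x $ k - m k)"] ij by simp
  qed
  then have "(\<lambda>x. q x - u x + (\<Sum>k\<in>UNIV - {i, j}. g k * (x $ k - m k))) = (\<lambda>x. d x - (u x - lin x))"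
    by (simp add: d_def lin_def fun_eq_iff)
  then have "sq K (\<lambda>x. q x - u x + (\<Sum>k\<in>UNIV - {i, j}. g k * (x $ k - m k))) \<le> 2 * sq K d + 2 * X"
    unfolding X_def using sq_diff_le[OF contK[OF cd] e(1)] by simp
  also have "\<dots> \<le> 130 * X + 128 * (h\<^sup>2 * Z i) + 128 * (h\<^sup>2 * Z j) + 128 * (h ^ 4 * W)" using sd by (simp add: Y_def)
  also have "\<dots> \<le> 130 * ((poinc TYPE('n))\<^sup>2 * h ^ 4 * V2) + 128 * (h\<^sup>2 * (poinc TYPE('n) * h\<^sup>2 * V2)) + 128 * (h\<^sup>2 * (poinc TYPE('n) * h\<^sup>2 * V2)) + 128 * (h ^ 4 * V2)"
  proof -
    have "W \<le> (\<Sum>k\<in>UNIV. sq K (D [k, i]))" unfolding W_def by (rule member_le_sum) auto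
    also have "\<dots> \<le> V2" unfolding V2_def by (rule member_le_sum[of i UNIV "\<lambda>l. \<Sum>k\<in>UNIV. sq K (D [k, l])"]) (auto intro: sum_nonneg)
    finally have "W \<le> V2" .
    then show ?thesis
      unfolding X_def Z_def by (intro add_mono mult_left_mono lin_error gradient_error) auto
  qed
  also have "\<dots> = (130 * (poinc TYPE('n))\<^sup>2 + 256 * poinc TYPE('n) + 128) * (h ^ 4 * V2)" by (simp add: algebra_simps power2_eq_square eval_nat_numeral)
  also have "\<dots> \<le> cint TYPE('n) * (h ^ 4 * V2)"
    using V2_nonneg zero_le_power2[of "poinc TYPE('n)"] by (intro mult_right_mono) auto
  finally show ?thesis by (simp add: mult.assoc)
qed

end

section \<open>The mesh\<close>

text \<open>Cells are numbered by index vectors with \<open>M i\<close> cells in direction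
  \<open>i\<close>, so that neighbours and columns are obtained by updating a single index.\<close>

locale mesh =
  fixes a b :: "real^'n" and h :: real and M :: "'n \<Rightarrow> nat"
  assumes h: "0 < h" and M: "\<And>i. b $ i - a $ i = real (M i) * h" and Mpos: "\<And>i. 0 < M i"
begin

abbreviation "\<Omega> \<equiv> box a b"

definition crn :: "('n \<Rightarrow> nat) \<Rightarrow> real^'n" where "crn z = (\<chi> k. a $ k + real (z k) * h)"

definition Z :: "('n \<Rightarrow> nat) set" where "Z = {z. \<forall>k. z k < M k}"

abbreviation "K z \<equiv> ocell h (crn z)"

lemma crn_nth [simp]: "crn z $ k = a $ k + real (z k) * h" by (simp add: crn_def)

lemma finite_Z [simp]: "finite Z"
proof -
  have "Z = (\<Pi>\<^sub>E k\<in>UNIV. {..<M k})" by (auto simp: Z_def PiE_iff)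
  then show ?thesis by (simp add: finite_PiE)
qed

lemma crn_upper: "z k < M k \<Longrightarrow> crn z $ k + h \<le> b $ k"
proof -
  assume "z k < M k"
  then have "(real (z k) + 1) * h \<le> real (M k) * h" using h by (intro mult_right_mono) auto
  then show ?thesis using M[of k] by (simp add: algebra_simps)
qed

lemma K_subset: "z \<in> Z \<Longrightarrow> K z \<subseteq> \<Omega>"
proof
  fix x assume z: "z \<in> Z" and x: "x \<in> K z"
  have "a $ k < x $ k \<and> x $ k < b $ k" for k
  proof -
    have "crn z $ k < x $ k" "x $ k < crn z $ k + h" using x unfolding mem_ocell by auto
    moreover have "a $ k \<le> crn z $ k" using h by simp
    moreover have "crn z $ k + h \<le> b $ k" using z by (intro crn_upper) (simp add: Z_def)
    ultimately show ?thesis by linarith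
  qed
  then show "x \<in> \<Omega>" by (simp add: mem_box_cart)
qed

lemma K_coord_unique:
  assumes "x \<in> K z" "crn w $ k \<le> x $ k" "x $ k \<le> crn w $ k + h"
  shows "w k = z k"
proof -
  have "a $ k + real (z k) * h < x $ k" "x $ k < a $ k + real (z k) * h + h" using assms(1) unfolding mem_ocell by auto
  then have "real (w k) * h < real (z k + 1) * h" "real (z k) * h < real (w k + 1) * h"
    using assms(2,3) by (auto simp: algebra_simps)
  then have "w k < z k + 1" "z k < w k + 1" using h by (simp_all only: mult_less_cancel_right_pos of_nat_less_iff)
  then show ?thesis by simp
qed

lemma K_disjoint: "disjoint_family_on K Z"
  unfolding disjoint_family_on_def
proof (intro ballI impI, rule ccontr)
  fix z w assume "z \<noteq> w" "K z \<inter> K w \<noteq> {}"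
  then obtain x where x: "x \<in> K z" "x \<in> K w" by blast
  have "w k = z k" for k by (rule K_coord_unique[OF x(1)]) (use x(2)[unfolded mem_ocell, rule_format, of k] in simp_all)
  then show False using \<open>z \<noteq> w\<close> by auto
qed

text \<open>A point of the domain off the grid hyperplanes lies in the cell found by rounding its
  scaled coordinates down; there are finitely many hyperplanes.\<close>

lemma K_cover_null: "\<Omega> - (\<Union>z\<in>Z. K z) \<in> null_sets lebesgue"
proof -
  let ?H = "\<Union>k\<in>UNIV. \<Union>l\<in>{..M k}. {x. x $ k = a $ k + real l * h}"
  have pl: "negligible {x::real^'n. x $ k = c}" for k c
  proof -
    have "axis k (1::real) \<in> (Basis :: (real^'n) set)" by (auto simp: Basis_vec_def)
    from negligible_standard_hyperplane[OF this, of c] show ?thesis by (simp add: inner_axis)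
  qed
  have "negligible (\<Union>l\<in>{..M k}. {x. x $ k = a $ k + real l * h})" for k
    by (rule negligible_Union) (auto intro: pl)
  then have H: "negligible ?H" by (intro negligible_Union) auto
  have "\<Omega> - (\<Union>z\<in>Z. K z) \<subseteq> ?H"
  proof
    fix x assume x: "x \<in> \<Omega> - (\<Union>z\<in>Z. K z)"
    show "x \<in> ?H"
    proof (rule ccontr)
      assume nH: "x \<notin> ?H"
      define z where "z k = nat \<lfloor>(x $ k - a $ k) / h\<rfloor>" for k
      have zk: "crn z $ k < x $ k \<and> x $ k < crn z $ k + h \<and> z k < M k" for k
      proof -
        have xk: "a $ k < x $ k" "x $ k < b $ k" using x by (auto simp: mem_box_cart)
        let ?y = "(x $ k - a $ k) / h"
        have y: "0 \<le> ?y" "?y < real (M k)" using xk M[of k] h by (auto simp: divide_less_eq)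
        then have rz: "real (z k) = of_int \<lfloor>?y\<rfloor>" by (simp add: z_def)
        have lt: "z k < M k"
        proof -
          have "real (z k) \<le> ?y" unfolding rz by linarith
          then show ?thesis using y(2) by linarith
        qed
        have "real (z k) \<le> ?y" "?y < real (z k) + 1" unfolding rz by linarith+
        then have "real (z k) * h \<le> x $ k - a $ k" "x $ k - a $ k < (real (z k) + 1) * h"
          using h by (auto simp: field_simps)
        moreover have "x $ k \<noteq> a $ k + real (z k) * h"
        proof
          assume "x $ k = a $ k + real (z k) * h"
          moreover have "z k \<in> {..M k}" using lt by simp
          ultimately show False using nH by blast
        qed
        ultimately show ?thesis using lt by (auto simp: algebra_simps)
      qed
      then have "x \<in> K z" "z \<in> Z" by (auto simp: mem_ocell Z_def)
      then show False using x by blast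
    qed
  qed
  then have "negligible (\<Omega> - (\<Union>z\<in>Z. K z))" by (rule negligible_subset[OF H])
  then show ?thesis by (simp add: negligible_iff_null_sets)
qed

lemma integral_mesh:
  fixes f :: "real^'n \<Rightarrow> real"
  assumes f: "integrable (lebesgue_on \<Omega>) f"
  shows "(LINT x|lebesgue_on \<Omega>. f x) = (\<Sum>z\<in>Z. LINT x|lebesgue_on (K z). f x)"
proof -
  let ?U = "\<Union>z\<in>Z. K z"
  have U: "?U \<in> sets lebesgue" "?U \<subseteq> \<Omega>" using K_subset by (auto intro!: sets.finite_UN)
  have "(LINT x|lebesgue_on \<Omega>. f x) = (LINT x|lebesgue_on ?U. f x)"
    by (rule lebesgue_on_null_diff(3)[OF U(1) _ U(2) K_cover_null]) simp
  also have "\<dots> = (LINT x:?U|lebesgue. f x)" using U by (simp add: integral_restrict_space set_lebesgue_integral_def)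
  also have "\<dots> = (\<Sum>z\<in>Z. LINT x:K z|lebesgue. f x)"
  proof (rule set_integral_finite_Union[OF finite_Z K_disjoint])
    fix z assume "z \<in> Z"
    have "integrable (lebesgue_on (K z)) f" by (rule integrable_lebesgue_on_subset[OF f K_subset[OF \<open>z \<in> Z\<close>]]) auto
    then show "set_integrable lebesgue (K z) f" by (simp add: set_integrable_def integrable_restrict_space)
  qed simp
  also have "\<dots> = (\<Sum>z\<in>Z. LINT x|lebesgue_on (K z). f x)"
    by (simp add: integral_restrict_space set_lebesgue_integral_def)
  finally show ?thesis .
qed

lemma sq_mesh: "f \<in> L2 \<Omega> \<Longrightarrow> sq \<Omega> f = (\<Sum>z\<in>Z. sq (K z) f)"
  unfolding sq_def by (rule integral_mesh) (rule L2_sq_integrable)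

lemma mesh_corners: "mesh_corners a b h = crn ` Z"
proof
  show "crn ` Z \<subseteq> mesh_corners a b h" using crn_upper by (auto simp: mesh_corners_def Z_def)
  show "mesh_corners a b h \<subseteq> crn ` Z"
  proof
    fix p assume p: "p \<in> mesh_corners a b h"
    then have "\<forall>i. \<exists>k::nat. p $ i = a $ i + real k * h" by (auto simp: mesh_corners_def)
    then obtain z :: "'n \<Rightarrow> nat" where z: "\<And>i. p $ i = a $ i + real (z i) * h" by metis
    then have pz: "p = crn z" by (simp add: vec_eq_iff)
    have "z i < M i" for i
    proof -
      have "p $ i + h \<le> b $ i" using p by (auto simp: mesh_corners_def)
      then have "real (z i + 1) * h \<le> real (M i) * h" using M[of i] z[of i] by (simp add: algebra_simps)
      then show ?thesis using h by (simp add: mult_le_cancel_right_pos)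
    qed
    then show "p \<in> crn ` Z" using pz by (auto simp: Z_def)
  qed
qed

lemma crn_Suc: "crn (z(j := Suc (z j))) = upd (crn z) j (crn z $ j + h)"
  by (auto simp: vec_eq_iff crn_def algebra_simps)

text \<open>One representative, the lowest cell, of every column in direction \<open>j\<close>. Sums
  over the mesh can then be taken column by column.\<close>

definition base :: "'n \<Rightarrow> ('n \<Rightarrow> nat) set" where "base j = {z \<in> Z. z j = 0}"

lemma sum_columns: "(\<Sum>z\<in>Z. f z) = (\<Sum>z\<in>base j. \<Sum>l<M j. f (z(j := l)))"
proof -
  have "(\<Sum>z\<in>base j. \<Sum>l<M j. f (z(j := l))) = (\<Sum>(z, l)\<in>base j \<times> {..<M j}. f (z(j := l)))"
    by (rule sum.cartesian_product)
  also have "\<dots> = (\<Sum>z\<in>Z. f z)"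
    by (rule sum.reindex_bij_witness[where i="\<lambda>z. (z(j := 0), z j)" and j="\<lambda>(z, l). z(j := l)"])
       (use Mpos in \<open>auto simp: base_def Z_def fun_eq_iff\<close>)
  finally show ?thesis by simp
qed

lemma base_col: "z \<in> base j \<Longrightarrow> l < M j \<Longrightarrow> z(j := l) \<in> Z"
  by (auto simp: base_def Z_def)

end

section \<open>The weak divergence by components\<close>

lemma integral_vec_nth:
  fixes f :: "'a \<Rightarrow> 'c::euclidean_space^'m"
  assumes "integrable N f"
  shows "(LINT x|N. f x) $ i = (LINT x|N. f x $ i)"
  using integral_bounded_linear[OF bounded_linear_vec_nth assms, of i] by simp

lemma has_weak_div_iff:
  fixes \<tau> :: "real^'n \<Rightarrow> real^'n^'n"
  assumes \<tau>: "\<tau> \<in> L2 S" and w: "w \<in> L2 S" and S: "S \<in> lmeasurable"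
  shows "has_weak_div S \<tau> w \<longleftrightarrow> (\<forall>\<psi>\<in>test_functions S. \<forall>i.
     (\<Sum>j\<in>UNIV. LINT x|lebesgue_on S. partials [j] \<psi> x * \<tau> x $ i $ j) = - (LINT x|lebesgue_on S. \<psi> x * w x $ i))"
  unfolding has_weak_div_def
proof (rule ball_cong[OF refl])
  fix \<psi> assume \<psi>: "\<psi> \<in> test_functions S"
  have iw: "integrable (lebesgue_on S) (\<lambda>x. \<psi> x *\<^sub>R w x)" by (rule test_function_integrable[OF \<psi> w S])
  have \<tau>ij: "(\<lambda>x. \<tau> x $ i $ j) \<in> L2 S" for i j using \<tau> by auto
  have L: "(\<lambda>x. partials [j] \<psi> x * \<tau> x $ i $ j) \<in> L2 S" for i j
    using test_function_scaleR_L2[OF test_functions_partials[OF \<psi>] \<tau>ij, of "[j]" i j] by simp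
  have comp: "(\<tau> x *v (\<chi> j. partials [j] \<psi> x)) $ i = (\<Sum>j\<in>UNIV. partials [j] \<psi> x * \<tau> x $ i $ j)" for x i
    by (simp add: matrix_vector_mult_def mult.commute)
  have i\<tau>: "integrable (lebesgue_on S) (\<lambda>x. \<tau> x *v (\<chi> j. partials [j] \<psi> x))"
    by (rule L2_integrable[OF L2_vecI S]) (unfold comp, intro L2_sum L)
  have iL: "integrable (lebesgue_on S) (\<lambda>x. partials [j] \<psi> x * \<tau> x $ i $ j)" for i j
    by (rule L2_integrable[OF L S])
  have "((LINT x|lebesgue_on S. \<tau> x *v (\<chi> j. partials [j] \<psi> x)) = - (LINT x|lebesgue_on S. \<psi> x *\<^sub>R w x)) \<longleftrightarrow>
     (\<forall>i. (LINT x|lebesgue_on S. (\<Sum>j\<in>UNIV. partials [j] \<psi> x * \<tau> x $ i $ j)) = - (LINT x|lebesgue_on S. \<psi> x * w x $ i))"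
    unfolding vec_eq_iff vector_uminus_component integral_vec_nth[OF i\<tau>] integral_vec_nth[OF iw] comp by simp
  also have "\<dots> \<longleftrightarrow> (\<forall>i. (\<Sum>j\<in>UNIV. LINT x|lebesgue_on S. partials [j] \<psi> x * \<tau> x $ i $ j) = - (LINT x|lebesgue_on S. \<psi> x * w x $ i))"
    by (subst Bochner_Integration.integral_sum) (use iL in auto)
  finally show "((LINT x|lebesgue_on S. \<tau> x *v (\<chi> j. partials [j] \<psi> x)) = - (LINT x|lebesgue_on S. \<psi> x *\<^sub>R w x)) \<longleftrightarrow>
     (\<forall>i. (\<Sum>j\<in>UNIV. LINT x|lebesgue_on S. partials [j] \<psi> x * \<tau> x $ i $ j) = - (LINT x|lebesgue_on S. \<psi> x * w x $ i))" .
qed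

lemma has_weak_divD:
  fixes \<tau> :: "real^'n \<Rightarrow> real^'n^'n"
  assumes "has_weak_div S \<tau> w" "\<tau> \<in> L2 S" "w \<in> L2 S" "S \<in> lmeasurable" "\<psi> \<in> test_functions S"
  shows "(\<Sum>j\<in>UNIV. LINT x|lebesgue_on S. partials [j] \<psi> x * \<tau> x $ i $ j) = - (LINT x|lebesgue_on S. \<psi> x * w x $ i)"
  using assms has_weak_div_iff by blast

lemma has_weak_div_unique:
  fixes \<tau> :: "real^'n \<Rightarrow> real^'n^'n"
  assumes 1: "has_weak_div (box a b) \<tau> w" and 2: "has_weak_div (box a b) \<tau> w'"
    and L: "\<tau> \<in> L2 (box a b)" "w \<in> L2 (box a b)" "w' \<in> L2 (box a b)"
  shows "AE x in lebesgue_on (box a b). w x = w' x"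
proof -
  have "AE x in lebesgue_on (box a b). w x $ i - w' x $ i = 0" for i
  proof (rule fundamental_lemma_variations)
    have Li: "(\<lambda>x. w x $ i) \<in> L2 (box a b)" "(\<lambda>x. w' x $ i) \<in> L2 (box a b)" using L by auto
    show "integrable (lebesgue_on (box a b)) (\<lambda>x. w x $ i - w' x $ i)"
      by (rule L2_integrable[OF L2_diff[OF Li]]) simp
    fix \<psi> assume \<psi>: "\<psi> \<in> test_functions (box a b)"
    have "(LINT x|lebesgue_on (box a b). \<psi> x * w x $ i) = (LINT x|lebesgue_on (box a b). \<psi> x * w' x $ i)"
      using has_weak_divD[OF 1 L(1,2) _ \<psi>, of i] has_weak_divD[OF 2 L(1,3) _ \<psi>, of i] by simp
    then show "(LINT x|lebesgue_on (box a b). \<psi> x * (w x $ i - w' x $ i)) = 0"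
      using test_function_integrable[OF \<psi> Li(1)] test_function_integrable[OF \<psi> Li(2)] by (simp add: right_diff_distrib)
  qed
  then have "AE x in lebesgue_on (box a b). \<forall>i. w x $ i - w' x $ i = 0"
    by (simp add: AE_all_countable)
  then show ?thesis by eventually_elim (simp add: vec_eq_iff)
qed

lemma has_weak_div_lincomb:
  fixes \<tau> \<tau>' :: "real^'n \<Rightarrow> real^'n^'n"
  assumes 1: "has_weak_div S \<tau> w" and 2: "has_weak_div S \<tau>' w'" and S: "S \<in> lmeasurable"
    and L: "\<tau> \<in> L2 S" "w \<in> L2 S" "\<tau>' \<in> L2 S" "w' \<in> L2 S"
  shows "has_weak_div S (\<lambda>x. \<tau> x - \<tau>' x) (\<lambda>x. w x - w' x)"
proof -
  have "(\<Sum>j\<in>UNIV. LINT x|lebesgue_on S. partials [j] \<psi> x * (\<tau> x - \<tau>' x) $ i $ j) = - (LINT x|lebesgue_on S. \<psi> x * (w x - w' x) $ i)"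
    if \<psi>: "\<psi> \<in> test_functions S" for \<psi> i
  proof -
    have c: "(\<lambda>x. \<tau> x $ i $ j) \<in> L2 S" "(\<lambda>x. \<tau>' x $ i $ j) \<in> L2 S" "(\<lambda>x. w x $ i) \<in> L2 S" "(\<lambda>x. w' x $ i) \<in> L2 S" for j using L by auto
    have i: "integrable (lebesgue_on S) (\<lambda>x. partials [j] \<psi> x * \<tau> x $ i $ j)" "integrable (lebesgue_on S) (\<lambda>x. partials [j] \<psi> x * \<tau>' x $ i $ j)"
      "integrable (lebesgue_on S) (\<lambda>x. \<psi> x * w x $ i)" "integrable (lebesgue_on S) (\<lambda>x. \<psi> x * w' x $ i)" for j
      using test_function_integrable[OF test_functions_partials[OF \<psi>] c(1)[of j] S, of "[j]"] test_function_integrable[OF test_functions_partials[OF \<psi>] c(2)[of j] S, of "[j]"]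
        test_function_integrable[OF \<psi> c(3) S] test_function_integrable[OF \<psi> c(4) S] by simp_all
    show ?thesis
      using has_weak_divD[OF 1 L(1,2) S \<psi>, of i] has_weak_divD[OF 2 L(3,4) S \<psi>, of i]
      by (simp only: vector_minus_component right_diff_distrib Bochner_Integration.integral_diff i sum_subtractf)
  qed
  moreover have "(\<lambda>x. \<tau> x - \<tau>' x) \<in> L2 S" "(\<lambda>x. w x - w' x) \<in> L2 S" using L by auto
  ultimately show ?thesis using has_weak_div_iff S by blast
qed

lemma weak_div_exists:
  assumes "w \<in> L2 S" "has_weak_div S \<tau> w"
  shows "weak_div S \<tau> \<in> L2 S" "has_weak_div S \<tau> (weak_div S \<tau>)"
  using someI[of "\<lambda>w. w \<in> L2 S \<and> has_weak_div S \<tau> w" w] assms by (auto simp: weak_div_def)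

lemma Hdiv_symD:
  assumes "\<tau> \<in> Hdiv_sym S"
  shows "\<tau> \<in> L2 S" "weak_div S \<tau> \<in> L2 S" "has_weak_div S \<tau> (weak_div S \<tau>)" "AE x in lebesgue_on S. transpose (\<tau> x) = \<tau> x"
proof -
  obtain w where w: "w \<in> L2 S" "has_weak_div S \<tau> w" using assms by (auto simp: Hdiv_sym_def)
  show "\<tau> \<in> L2 S" "AE x in lebesgue_on S. transpose (\<tau> x) = \<tau> x" using assms by (auto simp: Hdiv_sym_def)
  show "weak_div S \<tau> \<in> L2 S" "has_weak_div S \<tau> (weak_div S \<tau>)" by (rule weak_div_exists[OF w])+
qed

text \<open>Differentiating the entry \<open>i j\<close> in \<open>x $ j\<close> leaves an affine
  function of \<open>x $ i\<close> alone, for diagonal and off-diagonal entries alike. This is why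
  the divergence of a discrete stress has its pieces in \<open>V_local\<close>.\<close>

lemma Sigma_local_partials:
  assumes q: "q \<in> Sigma_local"
  obtains \<alpha> \<beta> :: "'n::finite \<Rightarrow> 'n \<Rightarrow> real"
  where "\<forall>i j. has_partial j (\<lambda>x. q x $ i $ j) (\<lambda>x. \<alpha> i j + \<beta> i j * x $ i)"
proof -
  have "\<exists>\<alpha> \<beta>. has_partial j (\<lambda>x. q x $ i $ j) (\<lambda>x. \<alpha> + \<beta> * x $ i)" for i j
  proof (cases "i = j")
    case True
    obtain c0 c1 c2 where c: "\<And>x. q x $ i $ i = c0 + c1 * x $ i + c2 * (x $ i)\<^sup>2"
      using q unfolding Sigma_local_def by blast
    have "has_partial i (\<lambda>x::real^'n. c0 + c1 * x $ i + c2 * (x $ i)\<^sup>2) (\<lambda>x. c1 + (2 * c2) * x $ i)"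
      by (rule has_partial_coord[where f="\<lambda>s. c0 + c1 * s + c2 * s\<^sup>2" and f'="\<lambda>s. c1 + (2 * c2) * s"])
         (auto intro!: derivative_eq_intros continuous_intros)
    then have "has_partial i (\<lambda>x. q x $ i $ i) (\<lambda>x. c1 + (2 * c2) * x $ i)" by (simp only: c)
    then show ?thesis unfolding True by blast
  next
    case False
    obtain c0 c1 c2 c3 where c: "\<And>x. q x $ i $ j = c0 + c1 * x $ i + c2 * x $ j + c3 * (x $ i * x $ j)"
      using q False unfolding Sigma_local_def by blast
    have "has_partial j (\<lambda>x::real^'n. c0 + c1 * x $ i) (\<lambda>x. 0)"
      using False by (intro has_partial_indep continuous_intros) (simp add: axis_def)
    moreover have "has_partial j (\<lambda>x::real^'n. c2 + c3 * x $ i) (\<lambda>x. 0)"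
      using False by (intro has_partial_indep continuous_intros) (simp add: axis_def)
    moreover have "has_partial j (\<lambda>x::real^'n. x $ j) (\<lambda>x. 1)"
      by (rule has_partial_coord[where f="\<lambda>s. s" and f'="\<lambda>s. 1"]) auto
    ultimately have "has_partial j (\<lambda>x::real^'n. (c0 + c1 * x $ i) + (c2 + c3 * x $ i) * x $ j) (\<lambda>x. 0 + (0 * x $ j + (c2 + c3 * x $ i) * 1))"
      by (intro has_partial_add has_partial_mult)
    moreover have "(\<lambda>x. q x $ i $ j) = (\<lambda>x. (c0 + c1 * x $ i) + (c2 + c3 * x $ i) * x $ j)"
      by (simp add: c algebra_simps)
    ultimately show ?thesis by auto
  qed
  then have "\<forall>i j. \<exists>c. has_partial j (\<lambda>x. q x $ i $ j) (\<lambda>x. fst c + snd c * x $ i)" by simp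
  then obtain F where F: "\<forall>i j. has_partial j (\<lambda>x. q x $ i $ j) (\<lambda>x. fst (F i j) + snd (F i j) * x $ i)" by metis
  show ?thesis by (rule that[of "\<lambda>i j. fst (F i j)" "\<lambda>i j. snd (F i j)"]) (use F in blast)
qed

lemma integral_restrict_test:
  assumes "\<psi> \<in> test_functions T" "T \<subseteq> S" "T \<in> sets lebesgue" "S \<in> sets lebesgue"
  shows "(LINT x|lebesgue_on S. \<psi> x * f x) = (LINT x|lebesgue_on T. \<psi> x * f x :: real)"
proof -
  have "(LINT x|lebesgue_on S. \<psi> x * f x) = (LINT x|lebesgue_on S. (if x \<in> T then \<psi> x * f x else 0))"
    by (intro Bochner_Integration.integral_cong) (auto simp: test_function_outside[OF assms(1)])
  then show ?thesis using integral_restrict[OF assms(2-4), of "\<lambda>x. \<psi> x * f x"] by simp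
qed

text \<open>A test function supported in the cell sees only the local representative, whose
  classical derivatives are weak ones; the fundamental lemma on the cell identifies the two
  divergences.\<close>

lemma weak_div_local:
  fixes \<tau> q :: "real^'n \<Rightarrow> real^'n^'n"
  assumes w: "has_weak_div S \<tau> w" and L: "\<tau> \<in> L2 S" "w \<in> L2 S" and S: "S \<in> lmeasurable" and sub: "ocell h p \<subseteq> S"
    and q: "AE x in lebesgue_on (ocell h p). \<tau> x = q x"
    and d: "\<And>i j. has_partial j (\<lambda>x. q x $ i $ j) (d i j)"
  shows "AE x in lebesgue_on (ocell h p). \<forall>i. w x $ i = (\<Sum>j\<in>UNIV. d i j x)"
proof -
  let ?K = "ocell h p"
  have S': "S \<in> sets lebesgue" using S by (simp add: fmeasurableD)
  have dK: "d i j \<in> L2 ?K" and qK: "(\<lambda>x. q x $ i $ j) \<in> L2 ?K" for i j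
    using d[where i=i and j=j] by (auto simp: has_partial_def intro!: L2_continuous)
  have wK: "(\<lambda>x. w x $ i) \<in> L2 ?K" for i using L2_subset[OF L(2) sub _ S'] by auto
  have \<tau>K: "(\<lambda>x. \<tau> x $ i $ j) \<in> L2 ?K" for i j using L2_subset[OF L(1) sub _ S'] by auto
  have "AE x in lebesgue_on ?K. w x $ i - (\<Sum>j\<in>UNIV. d i j x) = 0" for i
    unfolding ocell_def
  proof (rule fundamental_lemma_variations)
    let ?B = "box p (\<chi> i. p $ i + h)"
    have B: "?B = ?K" by (simp add: ocell_def)
    show "integrable (lebesgue_on ?B) (\<lambda>x. w x $ i - (\<Sum>j\<in>UNIV. d i j x))"
      unfolding B by (rule L2_integrable[OF L2_diff[OF wK L2_sum]]) (auto intro: dK)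
    fix \<psi> assume "\<psi> \<in> test_functions ?B"
    then have \<psi>: "\<psi> \<in> test_functions ?K" by (simp add: B)
    then have \<psi>S: "\<psi> \<in> test_functions S" using test_functions_subset[OF sub] by blast
    have "(LINT x|lebesgue_on S. partials [j] \<psi> x * \<tau> x $ i $ j) = - (LINT x|lebesgue_on ?K. \<psi> x * d i j x)" for j
    proof -
      have "(LINT x|lebesgue_on S. partials [j] \<psi> x * \<tau> x $ i $ j) = (LINT x|lebesgue_on ?K. partials [j] \<psi> x * \<tau> x $ i $ j)"
        by (rule integral_restrict_test[OF test_functions_partials[OF \<psi>] sub _ S']) simp
      also have "\<dots> = (LINT x|lebesgue_on ?K. partials [j] \<psi> x * q x $ i $ j)"
      proof (rule integral_cong_AE)
        show "AE x in lebesgue_on ?K. partials [j] \<psi> x * \<tau> x $ i $ j = partials [j] \<psi> x * q x $ i $ j"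
          using q by eventually_elim simp
      qed (intro borel_measurable_times test_function_measurable[OF test_functions_partials[OF \<psi>]] L2D(1) \<tau>K qK)+
      also have "\<dots> = - (LINT x|lebesgue_on ?K. \<psi> x * d i j x)"
        using weak_partial_of_partial[OF d[of j i], of ?K] \<psi> by (simp add: weak_partial_def)
      finally show ?thesis .
    qed
    then have "(\<Sum>j\<in>UNIV. LINT x|lebesgue_on ?K. \<psi> x * d i j x) = (LINT x|lebesgue_on S. \<psi> x * w x $ i)"
      using has_weak_divD[OF w L S \<psi>S, of i] by (simp add: sum_negf)
    also have "\<dots> = (LINT x|lebesgue_on ?K. \<psi> x * w x $ i)"
      by (rule integral_restrict_test[OF \<psi> sub _ S']) simp
    finally have eq: "(\<Sum>j\<in>UNIV. LINT x|lebesgue_on ?K. \<psi> x * d i j x) = (LINT x|lebesgue_on ?K. \<psi> x * w x $ i)" .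
    have i: "integrable (lebesgue_on ?K) (\<lambda>x. \<psi> x * d i j x)" "integrable (lebesgue_on ?K) (\<lambda>x. \<psi> x * w x $ i)" for j
      using test_function_integrable[OF \<psi> dK[of i j]] test_function_integrable[OF \<psi> wK[of i]] by simp_all
    show "(LINT x|lebesgue_on ?B. \<psi> x * (w x $ i - (\<Sum>j\<in>UNIV. d i j x))) = 0"
      unfolding B right_diff_distrib sum_distrib_left
        Bochner_Integration.integral_diff[OF i(2) Bochner_Integration.integrable_sum[OF i(1)]] Bochner_Integration.integral_sum[OF i(1)] eq
      by simp
  qed
  then have "AE x in lebesgue_on ?K. \<forall>i. w x $ i - (\<Sum>j\<in>UNIV. d i j x) = 0" by (simp add: AE_all_countable)
  then show ?thesis by eventually_elim simp
qed

section \<open>Consistency of the divergence on a cell\<close>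

context h2_cell
begin

lemma int_mult: "f \<in> L2 K \<Longrightarrow> f' \<in> L2 K \<Longrightarrow> integrable (lebesgue_on K) (\<lambda>x. f x * f' x :: real)"
  by (rule L2_mult_integrable)

lemma int_L2: "f \<in> L2 K \<Longrightarrow> integrable (lebesgue_on K) (f :: _ \<Rightarrow> real)"
  by (rule L2_integrable) auto

text \<open>The trace conditions together with the mean condition say that the error of the
  derivative is orthogonal to both affine weights vanishing on one of the faces. These two span the
  affine functions of \<open>x $ i\<close>, so diagonal entries cause no error in the
  divergence.\<close>

lemma diagonal_div_consistency:
  assumes q: "has_partial i q dq"
    and tr: "\<And>c. c $ i \<in> {p $ i, p $ i + h} \<Longrightarrow> has_trace_integral (box a b) h p {i} c u (face_integral h p {i} c q)"
    and mean: "(LINT x|lebesgue_on K. q x) = (LINT x|lebesgue_on K. u x)"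
  shows "(LINT x|lebesgue_on K. (D [i] x - dq x) * (\<alpha> + \<beta> * (x $ i - m i))) = 0"
proof -
  have qK: "q \<in> L2 K" "dq \<in> L2 K" using q by (auto simp: has_partial_def intro: contK)
  have DiK: "D [i] \<in> L2 K" by (rule DK) simp
  have e: "(LINT x|lebesgue_on K. u x) + (LINT x|lebesgue_on K. (x $ i - t) * D [i] x) = (LINT x|lebesgue_on K. q x) + (LINT x|lebesgue_on K. (x $ i - t) * dq x)"
    if t: "t = p $ i \<or> t = p $ i + h" for t
  proof -
    define c where "c = upd 0 i (2 * p $ i + h - t)"
    have ci: "c $ i \<in> {p $ i, p $ i + h}" "2 * p $ i + h - c $ i = t" using t by (auto simp: c_def)
    have th: "(\<lambda>x. x $ i - t) \<in> L2 K" by (rule contK) (intro continuous_intros)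
    have "(LINT x|lebesgue_on K. u x + (x $ i - t) * D [i] x) = (LINT x|lebesgue_on K. q x + (x $ i - t) * dq x)"
      using trace_formula1[OF tr[OF ci(1)] D h ci(1) sub] trace1[OF q h ci(1)] unfolding ci(2) by simp
    then show ?thesis
      by (simp add: int_L2[OF uK] int_L2[OF qK(1)] int_mult[OF th DiK] int_mult[OF th qK(2)])
  qed
  define r where "r x = D [i] x - dq x" for x
  have rK: "r \<in> L2 K" unfolding r_def by (intro L2_diff DiK qK)
  have f: "(LINT x|lebesgue_on K. (x $ i - t) * r x) = 0" if t: "t = p $ i \<or> t = p $ i + h" for t
  proof -
    have th: "(\<lambda>x. x $ i - t) \<in> L2 K" by (rule contK) (intro continuous_intros)
    show ?thesis using e[OF t] mean unfolding r_def right_diff_distrib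
      by (simp add: int_mult[OF th DiK] int_mult[OF th qK(2)])
  qed
  \<comment> \<open>The affine weight is expanded in the two weights that vanish on the lower and on
    the upper face.\<close>
  have "(LINT x|lebesgue_on K. r x * (\<alpha> + \<beta> * (x $ i - m i))) =
      (LINT x|lebesgue_on K. (\<alpha> / h + \<beta> / 2) * ((x $ i - p $ i) * r x) + (\<beta> / 2 - \<alpha> / h) * ((x $ i - (p $ i + h)) * r x))"
    by (intro Bochner_Integration.integral_cong) (use h in \<open>auto simp: field_simps\<close>)
  also have "\<dots> = (LINT x|lebesgue_on K. (\<alpha> / h + \<beta> / 2) * ((x $ i - p $ i) * r x)) + (LINT x|lebesgue_on K. (\<beta> / 2 - \<alpha> / h) * ((x $ i - (p $ i + h)) * r x))"
    by (rule Bochner_Integration.integral_add; intro Bochner_Integration.integrable_mult_right int_mult rK contK continuous_intros)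
  also have "\<dots> = 0" by (simp add: f)
  finally show ?thesis by (simp add: r_def)
qed

lemma centered_poly:
  "poly (pcompose Q [:- m i, 1:]) x = poly Q (x - m i)" "poly (pderiv (pcompose Q [:- m i, 1:])) x = poly (pderiv Q) (x - m i)"
  by (simp_all add: poly_pcompose pderiv_pcompose pderiv_pCons algebra_simps)

text \<open>An instance of \<open>weak_partial_box\<close>, with the polynomial shifted so that it
  is written in the centred coordinate.\<close>

lemma weak_ibp:
  assumes w: "weak_partial (box a b) i f f'" and f: "f \<in> L2 (box a b)" and f': "f' \<in> L2 (box a b)"
    and Q: "poly Q (h / 2) = 0" "poly Q (- (h / 2)) = 0"
  shows "(LINT x|lebesgue_on K. poly (pderiv Q) (x $ i - m i) * f x) = - (LINT x|lebesgue_on K. poly Q (x $ i - m i) * f' x)"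
proof -
  have "(LINT x|lebesgue_on (box p (\<chi> i. p $ i + h)). poly (pderiv (pcompose Q [:- m i, 1:])) (x $ i) * f x)
     = - (LINT x|lebesgue_on (box p (\<chi> i. p $ i + h)). poly (pcompose Q [:- m i, 1:]) (x $ i) * f' x)"
  proof (rule weak_partial_box[OF w])
    show "integrable (lebesgue_on (box a b)) f" "integrable (lebesgue_on (box a b)) f'" using f f' by (auto intro: L2_integrable)
    show "box p (\<chi> i. p $ i + h) \<subseteq> box a b" using sub by (simp add: ocell_def)
    show "poly (pcompose Q [:- m i, 1:]) (p $ i) = 0" "poly (pcompose Q [:- m i, 1:]) ((\<chi> i. p $ i + h) $ i) = 0"
      unfolding centered_poly using Q by (simp_all add: field_simps)
  qed simp
  then show ?thesis unfolding centered_poly ocell_def .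
qed

lemma classical_ibp:
  assumes F: "has_partial i f f'" and Q: "poly Q (h / 2) = 0" "poly Q (- (h / 2)) = 0"
  shows "(LINT x|lebesgue_on K. poly (pderiv Q) (x $ i - m i) * f x) = - (LINT x|lebesgue_on K. poly Q (x $ i - m i) * f' x)"
proof -
  have c: "continuous_on UNIV f" "continuous_on UNIV f'" using F by (auto simp: has_partial_def)
  have d: "((\<lambda>s. poly Q (s - m i)) has_real_derivative poly (pderiv Q) (s - m i)) (at s)" for s
  proof -
    have "((\<lambda>s. s - m i) has_real_derivative 1) (at s)" by (auto intro!: derivative_eq_intros)
    from DERIV_chain2[where f="poly Q" and g="\<lambda>s. s - m i", OF poly_DERIV this] show ?thesis by simp
  qed
  have "has_partial i (\<lambda>x. poly Q (x $ i - m i) * f x) (\<lambda>x. poly (pderiv Q) (x $ i - m i) * f x + poly Q (x $ i - m i) * f' x)"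
    by (rule has_partial_mult[OF has_partial_coord[where f="\<lambda>s. poly Q (s - m i)" and f'="\<lambda>s. poly (pderiv Q) (s - m i)"] F])
       (auto intro: d intro!: continuous_intros)
  then have "(LINT x|lebesgue_on K. poly (pderiv Q) (x $ i - m i) * f x + poly Q (x $ i - m i) * f' x) = 0"
    by (rule integral_partial_zero[OF _ h]) (use Q in \<open>auto simp: field_simps\<close>)
  moreover have "integrable (lebesgue_on K) (\<lambda>x. poly (pderiv Q) (x $ i - m i) * f x)" "integrable (lebesgue_on K) (\<lambda>x. poly Q (x $ i - m i) * f' x)"
    by (intro int_mult contK continuous_intros c)+
  ultimately show ?thesis by simp
qed

lemma sq_affine:
  "sq K (\<lambda>x. \<alpha> + \<beta> * (x $ i - m i)) = h ^ CARD('n) * (\<alpha>\<^sup>2 + \<beta>\<^sup>2 * h\<^sup>2 / 12)"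
proof -
  have i: "integrable (lebesgue_on K) (\<lambda>x. \<alpha>\<^sup>2)" "integrable (lebesgue_on K) (\<lambda>x. (2 * \<alpha> * \<beta>) * (x $ i - m i))" 
    "integrable (lebesgue_on K) (\<lambda>x. \<beta>\<^sup>2 * (x $ i - m i)\<^sup>2)"
    by (rule int_L2[OF contK]; intro continuous_intros)+
  have "sq K (\<lambda>x. \<alpha> + \<beta> * (x $ i - m i)) = (LINT x|lebesgue_on K. \<alpha>\<^sup>2 + (2 * \<alpha> * \<beta>) * (x $ i - m i) + \<beta>\<^sup>2 * (x $ i - m i)\<^sup>2)"
    unfolding sq_def by (intro Bochner_Integration.integral_cong) (auto simp: power2_eq_square algebra_simps)
  also have "\<dots> = \<alpha>\<^sup>2 * h ^ CARD('n) + (2 * \<alpha> * \<beta>) * 0 + \<beta>\<^sup>2 * (h ^ CARD('n) * h\<^sup>2 / 12)"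
    using i by (simp only: Bochner_Integration.integral_add Bochner_Integration.integrable_add integral_mult_right_zero
        integral_centered[OF h] integral_centered_square[OF h] integral_const_ocell[OF h])
  finally show ?thesis by (simp add: algebra_simps)
qed

text \<open>The four trace conditions become integrals of the error and its derivatives. Taking
  differences over opposite faces eliminates the error and its derivative in \<open>x $ i\<close>,
  and leaves statements about the mixed derivative. Integration by parts in \<open>x $ i\<close>
  then reaches the third derivative with a weight of size \<open>h ^ 2\<close>.\<close>

lemma offdiagonal_div_consistency:
  assumes D3: "weak_derivs (box a b) 3 u D" and ij: "i \<noteq> j"
    and q: "\<And>x. q x = A + B * (x $ i - m i) + E * (x $ j - m j) + G * ((x $ i - m i) * (x $ j - m j))"
    and tr: "\<And>c. c $ i \<in> {p $ i, p $ i + h} \<Longrightarrow> c $ j \<in> {p $ j, p $ j + h} \<Longrightarrow>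
       \<exists>M. has_trace_integral (box a b) h p {i, j} c u M \<and> (\<forall>x\<in>face h p {i, j} c. q x = M / h ^ (CARD('n) - 2))"
    and s: "0 < s"
  shows "(LINT x|lebesgue_on K. (D [j] x - (E + G * (x $ i - m i))) * (\<alpha> + \<beta> * (x $ i - m i)))
     \<le> s * h ^ 4 * sq K (D [i, i, j]) + sq K (\<lambda>x. \<alpha> + \<beta> * (x $ i - m i)) / s"
proof -
  let ?i = "\<lambda>x::real^'n. x $ i - m i" and ?j = "\<lambda>x::real^'n. x $ j - m j"
  have hp: "has_partial k (\<lambda>x::real^'n. x $ k - m k) (\<lambda>x. 1)" for k
    by (rule has_partial_coord[where f="\<lambda>s. s - m k" and f'="\<lambda>s. 1"]) (auto intro!: derivative_eq_intros)
  have hpc: "has_partial k (\<lambda>x::real^'n. c) (\<lambda>x. 0)" for k c by (rule has_partial_indep) auto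
  have hp0: "has_partial k (\<lambda>x::real^'n. x $ l - m l) (\<lambda>x. 0)" if "k \<noteq> l" for k l
    using that by (intro has_partial_indep continuous_intros) (simp add: axis_def)
  have qi: "has_partial i q (\<lambda>x. B + G * ?j x)"
  proof -
    have "has_partial i (\<lambda>x. A + B * ?i x + E * ?j x + G * (?i x * ?j x)) (\<lambda>x. 0 + (0 * ?i x + B * 1) + (0 * ?j x + E * 0) + (0 * (?i x * ?j x) + G * (1 * ?j x + ?i x * 0)))"
      using ij by (intro has_partial_add has_partial_mult hp hp0 hpc) auto
    then show ?thesis by (simp add: q[abs_def])
  qed
  have qj: "has_partial j q (\<lambda>x. E + G * ?i x)"
  proof -
    have "has_partial j (\<lambda>x. A + B * ?i x + E * ?j x + G * (?i x * ?j x)) (\<lambda>x. 0 + (0 * ?i x + B * 0) + (0 * ?j x + E * 1) + (0 * (?i x * ?j x) + G * (0 * ?j x + ?i x * 1)))"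
      using ij by (intro has_partial_add has_partial_mult hp hp0 hpc) auto
    then show ?thesis by (simp add: q[abs_def])
  qed
  have qji: "has_partial i (\<lambda>x. E + G * ?i x) (\<lambda>x. G)"
  proof -
    have "has_partial i (\<lambda>x. E + G * ?i x) (\<lambda>x. 0 + (0 * ?i x + G * 1))"
      by (intro has_partial_add has_partial_mult hp hpc)
    then show ?thesis by simp
  qed
  have card2: "2 \<le> CARD('n)"
  proof -
    have "card {i, j} \<le> CARD('n)" by (rule card_mono) auto
    with ij show ?thesis by simp
  qed
  have cq: "continuous_on UNIV q" using qi by (simp add: has_partial_def)
  \<comment> \<open>Four errors: of the derivative in \<open>j\<close>, of the mixed derivative, of
    the derivative in \<open>i\<close>, and of the function. The goal concerns only the
    first.\<close>
  define r where "r x = D [j] x - (E + G * ?i x)" for x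
  define r2 where "r2 x = D [i, j] x - G" for x
  define r1 where "r1 x = D [i] x - (B + G * ?j x)" for x
  define r0 where "r0 x = u x - q x" for x
  have rK: "r \<in> L2 K" "r2 \<in> L2 K" "r1 \<in> L2 K" "r0 \<in> L2 K"
    unfolding r_def r2_def r1_def r0_def by (intro L2_diff DK uK contK continuous_intros cq; simp)+
  have E0: "(LINT x|lebesgue_on K. r0 x + (x $ j - t') * r x + (x $ i - t) * (r1 x + (x $ j - t') * r2 x)) = 0"
    if t: "t = p $ i \<or> t = p $ i + h" and t': "t' = p $ j \<or> t' = p $ j + h" for t t'
  proof -
    define c :: "real^'n" where "c = (\<chi> k. if k = i then 2 * p $ i + h - t else if k = j then 2 * p $ j + h - t' else m k)"
    have ci: "c $ i \<in> {p $ i, p $ i + h}" "c $ j \<in> {p $ j, p $ j + h}" "2 * p $ i + h - c $ i = t" "2 * p $ j + h - c $ j = t'"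
      using t t' ij by (auto simp: c_def)
    obtain N where N: "has_trace_integral (box a b) h p {i, j} c u N" "\<forall>x\<in>face h p {i, j} c. q x = N / h ^ (CARD('n) - 2)"
      using tr[OF ci(1,2)] by blast
    have "c \<in> face h p {i, j} c"
      using t t' h by (auto simp: face_def cell_def mem_box_cart c_def)
    then have Nq: "N = q c * h ^ (CARD('n) - 2)" using N(2) h by simp
    have fq: "face_integral h p {j, i} c q = N"
    proof -
      have "face_integral h p {j, i} c q = face_integral h p {j, i} c (\<lambda>x. q c)"
        by (rule face_integral_cong) (simp add: q)
      then show ?thesis using h ij by (simp add: face_integral_const Nq numeral_2_eq_2)
    qed
    have N': "has_trace_integral (box a b) h p {j, i} c u N" using N(1) by (simp add: insert_commute)
    have eq: "(LINT x|lebesgue_on K. u x + (x $ j - t') * D [j] x + (x $ i - t) * (D [i] x + (x $ j - t') * D [i, j] x)) =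
      (LINT x|lebesgue_on K. q x + (x $ j - t') * (E + G * ?i x) + (x $ i - t) * ((B + G * ?j x) + (x $ j - t') * G))"
      using trace_formula2[OF N' D h ij[symmetric] ci(2,1) sub] trace2[OF qj qi qji h ij[symmetric] ci(2,1)] unfolding ci(3,4) fq by simp
    have th: "(\<lambda>x. x $ i - t) \<in> L2 K" "(\<lambda>x. x $ j - t') \<in> L2 K" by (rule contK, intro continuous_intros)+
    have L: "(\<lambda>x. (x $ i - t) * ((x $ j - t') * D [i, j] x)) \<in> L2 K" by (intro sq_theta t t' DK) simp
    have i1: "integrable (lebesgue_on K) (\<lambda>x. u x + (x $ j - t') * D [j] x + (x $ i - t) * (D [i] x + (x $ j - t') * D [i, j] x))"
      unfolding distrib_left
      by (intro Bochner_Integration.integrable_add int_L2[OF uK] int_mult th int_L2[OF L] DK; simp)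
    have i2: "integrable (lebesgue_on K) (\<lambda>x. q x + (x $ j - t') * (E + G * ?i x) + (x $ i - t) * ((B + G * ?j x) + (x $ j - t') * G))"
      by (intro int_L2 contK continuous_intros cq)
    have "(LINT x|lebesgue_on K. r0 x + (x $ j - t') * r x + (x $ i - t) * (r1 x + (x $ j - t') * r2 x)) =
      (LINT x|lebesgue_on K. (u x + (x $ j - t') * D [j] x + (x $ i - t) * (D [i] x + (x $ j - t') * D [i, j] x)) - 
       (q x + (x $ j - t') * (E + G * ?i x) + (x $ i - t) * ((B + G * ?j x) + (x $ j - t') * G)))"
      by (intro Bochner_Integration.integral_cong) (auto simp: r0_def r_def r1_def r2_def algebra_simps)
    also have "\<dots> = 0" unfolding Bochner_Integration.integral_diff[OF i1 i2] eq by simp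
    finally show ?thesis .
  qed
  have th: "(\<lambda>x. x $ k - t) \<in> L2 K" for k t by (rule contK) (intro continuous_intros)
  have ir: "integrable (lebesgue_on K) r" "integrable (lebesgue_on K) r2" using rK by (auto intro: int_L2)
  have itr2: "integrable (lebesgue_on K) (\<lambda>x. (x $ i - t) * r2 x)" for t by (intro int_mult th rK)
  \<comment> \<open>Subtracting the identities for the two faces perpendicular to the
    \<open>j\<close>-axis cancels \<open>r0\<close> and \<open>r1\<close>; the weights differ by the
    constant \<open>h\<close>.\<close>
  have E1: "(LINT x|lebesgue_on K. r x) + (LINT x|lebesgue_on K. (x $ i - t) * r2 x) = 0" if t: "t = p $ i \<or> t = p $ i + h" for t
  proof -
    have ii: "integrable (lebesgue_on K) (\<lambda>x. r0 x + (x $ j - t') * r x + (x $ i - t) * (r1 x + (x $ j - t') * r2 x))"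
      if t': "t' = p $ j \<or> t' = p $ j + h" for t'
      unfolding distrib_left
      by (intro Bochner_Integration.integrable_add int_L2[OF rK(4)] int_mult th rK int_L2[OF sq_theta(1)[OF t sq_theta(1)[OF t' rK(2)]]])
    have "(LINT x|lebesgue_on K. h * (r x + (x $ i - t) * r2 x)) = 
      (LINT x|lebesgue_on K. (r0 x + (x $ j - p $ j) * r x + (x $ i - t) * (r1 x + (x $ j - p $ j) * r2 x))
      - (r0 x + (x $ j - (p $ j + h)) * r x + (x $ i - t) * (r1 x + (x $ j - (p $ j + h)) * r2 x)))"
      by (intro Bochner_Integration.integral_cong) (auto simp: algebra_simps)
    also have "\<dots> = 0" by (subst Bochner_Integration.integral_diff) (use E0[OF t] ii in auto)
    finally have "(LINT x|lebesgue_on K. r x + (x $ i - t) * r2 x) = 0" using h by simp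
    then show ?thesis by (simp add: ir itr2)
  qed
  \<comment> \<open>The same subtraction in direction \<open>i\<close>: the error of the mixed
    derivative has mean zero.\<close>
  have "h * (LINT x|lebesgue_on K. r2 x) = (LINT x|lebesgue_on K. (x $ i - p $ i) * r2 x - (x $ i - (p $ i + h)) * r2 x)"
    by (simp add: left_diff_distrib[symmetric])
  also have "\<dots> = 0" by (subst Bochner_Integration.integral_diff) (use E1[of "p $ i"] E1[of "p $ i + h"] itr2 in simp_all)
  finally have R2: "(LINT x|lebesgue_on K. r2 x) = 0" using h by simp
  have R: "(LINT x|lebesgue_on K. r x) = - (LINT x|lebesgue_on K. ?i x * r2 x)"
  proof -
    have "(LINT x|lebesgue_on K. ?i x * r2 x) = (LINT x|lebesgue_on K. (x $ i - p $ i) * r2 x - (h / 2) * r2 x)"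
      by (intro Bochner_Integration.integral_cong) (auto simp: algebra_simps)
    also have "\<dots> = (LINT x|lebesgue_on K. (x $ i - p $ i) * r2 x)" using R2 itr2[of "p $ i"] ir by simp
    finally show ?thesis using E1[of "p $ i"] by simp
  qed
  \<comment> \<open>The primitive of \<open>y\<close> that vanishes at both ends of the centred
    interval.\<close>
  define \<kappa> where "\<kappa> = [: - h\<^sup>2 / 8, 0, 1 / 2 :]"
  have \<kappa>: "poly \<kappa> (h / 2) = 0" "poly \<kappa> (- (h / 2)) = 0" "\<And>y. poly (pderiv \<kappa>) y = y" "\<And>y. poly \<kappa> y = y\<^sup>2 / 2 - h\<^sup>2 / 8"
    by (simp_all add: \<kappa>_def pderiv_pCons power2_eq_square field_simps)
  have D3L: "D [j] \<in> L2 (box a b)" "D [i, j] \<in> L2 (box a b)" "D [i, i, j] \<in> L2 (box a b)"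
    using weak_derivs_L2[OF D3] by auto
  have wp: "weak_partial (box a b) i (D [j]) (D [i, j])" "weak_partial (box a b) i (D [i, j]) (D [i, i, j])"
    using weak_derivs_weak_partial[OF D3, of "[j]" i] weak_derivs_weak_partial[OF D3, of "[i, j]" i] by auto
  have c\<kappa>: "(\<lambda>x. poly \<kappa> (?i x)) \<in> L2 K" by (intro contK continuous_intros)
  have S1: "(LINT x|lebesgue_on K. ?i x * r x) = - (LINT x|lebesgue_on K. poly \<kappa> (?i x) * r2 x)"
  proof -
    have "(LINT x|lebesgue_on K. ?i x * r x) = (LINT x|lebesgue_on K. ?i x * D [j] x) - (LINT x|lebesgue_on K. ?i x * (E + G * ?i x))"
      unfolding r_def right_diff_distrib[of "_ - _"]
      by (rule Bochner_Integration.integral_diff) (intro int_mult th DK contK continuous_intros; simp)+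
    also have "\<dots> = - (LINT x|lebesgue_on K. poly \<kappa> (?i x) * D [i, j] x) + (LINT x|lebesgue_on K. poly \<kappa> (?i x) * G)"
      using weak_ibp[OF wp(1) D3L(1,2) \<kappa>(1,2)] classical_ibp[OF qji \<kappa>(1,2)] by (simp add: \<kappa>(3))
    also have "\<dots> = - (LINT x|lebesgue_on K. poly \<kappa> (?i x) * D [i, j] x - poly \<kappa> (?i x) * G)"
    proof -
      have "integrable (lebesgue_on K) (\<lambda>x. poly \<kappa> (?i x) * D [i, j] x)" "integrable (lebesgue_on K) (\<lambda>x. poly \<kappa> (?i x) * G)"
        by (intro int_mult c\<kappa> DK contK continuous_intros; simp)+
      then show ?thesis by (simp only: Bochner_Integration.integral_diff minus_diff_eq uminus_add_conv_diff)
    qed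
    finally show ?thesis by (simp add: r2_def right_diff_distrib)
  qed
  \<comment> \<open>The primitive, vanishing at both ends, of the weight that multiplies
    \<open>r2\<close> once its mean has been removed.\<close>
  define T where "T = [: - \<alpha> * h\<^sup>2 / 8, - \<beta> * h\<^sup>2 / 24, \<alpha> / 2, \<beta> / 6 :]"
  have T: "poly T (h / 2) = 0" "poly T (- (h / 2)) = 0" "\<And>y. poly (pderiv T) y = \<alpha> * y + \<beta> * (y\<^sup>2 / 2 - h\<^sup>2 / 24)"
    "\<And>y. poly T y = \<alpha> * (y\<^sup>2 / 2 - h\<^sup>2 / 8) + \<beta> * (y * (y\<^sup>2 / 6 - h\<^sup>2 / 24))"
    by (simp_all add: T_def pderiv_pCons power2_eq_square field_simps)
  have cT: "(\<lambda>x. poly T (?i x)) \<in> L2 K" "(\<lambda>x. poly (pderiv T) (?i x)) \<in> L2 K" by (intro contK continuous_intros)+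
  have mT: "(LINT x|lebesgue_on K. poly (pderiv T) (?i x)) = 0"
    using classical_ibp[OF hpc[of i 1] T(1,2)] by simp
  have "(LINT x|lebesgue_on K. r x * (\<alpha> + \<beta> * ?i x)) = (LINT x|lebesgue_on K. \<alpha> * r x + \<beta> * (?i x * r x))"
    by (intro Bochner_Integration.integral_cong) (auto simp: algebra_simps)
  also have "\<dots> = \<alpha> * (LINT x|lebesgue_on K. r x) + \<beta> * (LINT x|lebesgue_on K. ?i x * r x)"
    using ir int_mult[OF th rK(1)] by simp
  \<comment> \<open>The last term is zero because \<open>r2\<close> has mean zero. It is added to
    give the total weight mean zero, so that a primitive can vanish at both ends.\<close>
  also have "\<dots> = - (\<alpha> * (LINT x|lebesgue_on K. ?i x * r2 x) + \<beta> * (LINT x|lebesgue_on K. poly \<kappa> (?i x) * r2 x) + (\<beta> * h\<^sup>2 / 12) * (LINT x|lebesgue_on K. r2 x))"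
    unfolding R S1 R2 by simp
  also have "\<dots> = - (LINT x|lebesgue_on K. \<alpha> * (?i x * r2 x) + \<beta> * (poly \<kappa> (?i x) * r2 x) + (\<beta> * h\<^sup>2 / 12) * r2 x)"
    using ir int_mult[OF th rK(2)] int_mult[OF c\<kappa> rK(2)] by simp
  also have "\<dots> = - (LINT x|lebesgue_on K. poly (pderiv T) (?i x) * D [i, j] x - G * poly (pderiv T) (?i x))"
    by (intro arg_cong[where f=uminus] Bochner_Integration.integral_cong) (auto simp: T(3) \<kappa>(4) r2_def field_simps)
  also have "\<dots> = - (LINT x|lebesgue_on K. poly (pderiv T) (?i x) * D [i, j] x)"
    using int_mult[OF cT(2) DK[of "[i, j]"]] int_L2[OF cT(2)] mT by simp
  also have "\<dots> = (LINT x|lebesgue_on K. D [i, i, j] x * poly T (?i x))"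
    using weak_ibp[OF wp(2) D3L(2,3) T(1,2)] by (simp add: mult.commute)
  also have "\<dots> \<le> (s * h ^ 4) * sq K (D [i, i, j]) + sq K (\<lambda>x. poly T (?i x)) / (s * h ^ 4)"
  proof (rule L2_Young[OF _ cT(1)])
    show "D [i, i, j] \<in> L2 K" using L2_subset[OF D3L(3) sub] by simp
    show "0 < s * h ^ 4" using s h by simp
  qed
  also have "sq K (\<lambda>x. poly T (?i x)) / (s * h ^ 4) \<le> sq K (\<lambda>x. \<alpha> + \<beta> * ?i x) / s"
  proof -
    have Tb: "\<bar>poly T y\<bar> \<le> h\<^sup>2 / 8 * (\<bar>\<alpha>\<bar> + \<bar>\<beta>\<bar> * h)" if y: "\<bar>y\<bar> \<le> h / 2" for y
    proof -
      have y2: "y\<^sup>2 \<le> h\<^sup>2 / 4" "0 \<le> y\<^sup>2"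
        using power_mono[OF y, of 2] by (simp_all add: power_divide)
      have "\<bar>y\<^sup>2 / 2 - h\<^sup>2 / 8\<bar> \<le> h\<^sup>2 / 8" using y2 by (simp add: abs_le_iff)
      then have 1: "\<bar>\<alpha> * (y\<^sup>2 / 2 - h\<^sup>2 / 8)\<bar> \<le> \<bar>\<alpha>\<bar> * (h\<^sup>2 / 8)" unfolding abs_mult by (intro mult_left_mono) auto
      have "\<bar>y\<^sup>2 / 6 - h\<^sup>2 / 24\<bar> \<le> h\<^sup>2 / 8" using y2 by linarith
      moreover have "\<bar>y\<bar> \<le> h" using y h by simp
      ultimately have "\<bar>y\<bar> * \<bar>y\<^sup>2 / 6 - h\<^sup>2 / 24\<bar> \<le> h * (h\<^sup>2 / 8)" using h by (intro mult_mono) auto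
      then have 2: "\<bar>\<beta> * (y * (y\<^sup>2 / 6 - h\<^sup>2 / 24))\<bar> \<le> \<bar>\<beta>\<bar> * (h * (h\<^sup>2 / 8))" unfolding abs_mult by (intro mult_left_mono) auto
      show ?thesis unfolding T(4) using 1 2 abs_triangle_ineq[of "\<alpha> * (y\<^sup>2 / 2 - h\<^sup>2 / 8)" "\<beta> * (y * (y\<^sup>2 / 6 - h\<^sup>2 / 24))"]
        by (simp add: algebra_simps)
    qed
    have "sq K (\<lambda>x. poly T (?i x)) \<le> (h\<^sup>2 / 8 * (\<bar>\<alpha>\<bar> + \<bar>\<beta>\<bar> * h))\<^sup>2 * measure lebesgue K"
    proof (rule sq_bounded[OF cT(1)])
      fix x assume x: "x \<in> K"
      have "\<bar>?i x\<bar> \<le> h / 2" using x[unfolded mem_ocell, rule_format, of i] by linarith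
      then show "\<bar>poly T (?i x)\<bar> \<le> h\<^sup>2 / 8 * (\<bar>\<alpha>\<bar> + \<bar>\<beta>\<bar> * h)" by (rule Tb)
    qed simp
    also have "\<dots> = h ^ 4 / 64 * (\<bar>\<alpha>\<bar> + \<bar>\<beta>\<bar> * h)\<^sup>2 * h ^ CARD('n)"
      using measure_ocell[of h p] h by (simp add: power_mult_distrib power_divide eval_nat_numeral)
    \<comment> \<open>A square of two terms costs the factor 2; the 12 compensates the divisor in
      \<open>sq_affine\<close>. The product 24 stays below 64.\<close>
    also have "\<dots> \<le> h ^ 4 / 64 * (12 * 2 * (\<alpha>\<^sup>2 + \<beta>\<^sup>2 * h\<^sup>2 / 12)) * h ^ CARD('n)"
    proof -
      have "(\<bar>\<alpha>\<bar> + \<bar>\<beta>\<bar> * h)\<^sup>2 \<le> 2 * \<bar>\<alpha>\<bar>\<^sup>2 + 2 * (\<bar>\<beta>\<bar> * h)\<^sup>2"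
        using sum_squares_bound[of "\<bar>\<alpha>\<bar>" "\<bar>\<beta>\<bar> * h"] unfolding power2_sum by linarith
      also have "\<dots> \<le> 12 * 2 * (\<alpha>\<^sup>2 + \<beta>\<^sup>2 * h\<^sup>2 / 12)" by (simp add: power_mult_distrib)
      finally show ?thesis using h by (intro mult_right_mono mult_left_mono) auto
    qed
    also have "\<dots> \<le> h ^ 4 * sq K (\<lambda>x. \<alpha> + \<beta> * ?i x)"
      unfolding sq_affine using h by (simp add: field_simps)
    finally show ?thesis using s h by (simp add: divide_le_eq field_simps)
  qed
  finally show ?thesis by (simp add: r_def)
qed

end

text \<open>Positivity on the middle half of the face in each free coordinate suffices, since that
  part has positive measure. It guarantees that a bump function detects a jump across a
  face.\<close>

lemma face_integral_pos:
  fixes f :: "real^'n \<Rightarrow> real"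
  assumes c: "continuous_on UNIV f" and h: "0 < h" and nn: "\<And>x. 0 \<le> f x"
    and pos: "\<And>x. (\<forall>k\<in>I. x $ k = c $ k) \<Longrightarrow> (\<forall>k\<in>-I. p $ k + h / 4 < x $ k \<and> x $ k < p $ k + 3 * h / 4) \<Longrightarrow> 0 < f x"
  shows "0 < face_integral h p I c f"
proof -
  interpret product_sigma_finite "\<lambda>k::'n. lborel :: real measure" by standard
  let ?P = "\<Pi>\<^sub>M k\<in>-I. (lborel::real measure)"
  let ?A = "\<Pi>\<^sub>E k\<in>-I. {p $ k .. p $ k + h}" and ?B = "\<Pi>\<^sub>E k\<in>-I. {p $ k + h / 4 <..< p $ k + 3 * h / 4}"
  let ?F = "\<lambda>y. indicator ?A y *\<^sub>R f (\<chi> k. if k \<in> I then c $ k else y k)"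
  have int: "integrable ?P ?F"
    using face_integrable[OF c, of h I p] h unfolding set_integrable_def by simp
  have fi: "face_integral h p I c f = integral\<^sup>L ?P ?F" by (simp add: face_integral_def set_lebesgue_integral_def)
  have "0 \<le> integral\<^sup>L ?P ?F" by (simp add: nn)
  moreover have "integral\<^sup>L ?P ?F \<noteq> 0"
  proof
    assume "integral\<^sup>L ?P ?F = 0"
    then have "AE y in ?P. ?F y = 0" using integral_nonneg_eq_0_iff_AE[OF int] nn by simp
    then have "AE y in ?P. y \<notin> ?B"
    proof eventually_elim
      fix y assume 0: "?F y = 0"
      show "y \<notin> ?B"
      proof
        assume y: "y \<in> ?B"
        then have "y k \<in> {p $ k .. p $ k + h}" if "k \<in> -I" for k
          using that h PiE_mem[OF y, of k] by (simp add: field_simps)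
        then have "y \<in> ?A" using y by (simp add: PiE_iff)
        moreover have "0 < f (\<chi> k. if k \<in> I then c $ k else y k)"
          by (rule pos) (use y in \<open>auto simp: PiE_iff\<close>)
        ultimately show False using 0 by simp
      qed
    qed
    moreover have "?B \<in> sets ?P" by (rule sets_PiM_I_finite) auto
    ultimately have "?B \<in> null_sets ?P" using AE_iff_null_sets by blast
    then have "emeasure ?P ?B = 0" by auto
    moreover have "emeasure ?P ?B = (\<Prod>k\<in>-I. ennreal (h / 2))"
      using h by (subst emeasure_PiM) (auto simp: field_simps)
    ultimately show False using h by simp
  qed
  ultimately show ?thesis using fi by simp
qed

section \<open>The discrete spaces\<close>

lemma Sigma_local_diff:
  assumes "q \<in> Sigma_local" "q' \<in> Sigma_local"
  shows "(\<lambda>x. q x - q' x) \<in> Sigma_local"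
proof -
  have "\<exists>c0 c1 c2. \<forall>x. (q x - q' x) $ i $ i = c0 + c1 * x $ i + c2 * (x $ i)\<^sup>2" for i
  proof -
    obtain c0 c1 c2 where 1: "\<forall>x. q x $ i $ i = c0 + c1 * x $ i + c2 * (x $ i)\<^sup>2"
      using assms(1) unfolding Sigma_local_def by blast
    obtain d0 d1 d2 where "\<forall>x. q' x $ i $ i = d0 + d1 * x $ i + d2 * (x $ i)\<^sup>2"
      using assms(2) unfolding Sigma_local_def by blast
    with 1 have "\<forall>x. (q x - q' x) $ i $ i = (c0 - d0) + (c1 - d1) * x $ i + (c2 - d2) * (x $ i)\<^sup>2"
      by (simp add: algebra_simps)
    then show ?thesis by (intro exI)
  qed
  moreover have "\<exists>c0 c1 c2 c3. \<forall>x. (q x - q' x) $ i $ j = c0 + c1 * x $ i + c2 * x $ j + c3 * (x $ i * x $ j)" if ij: "i \<noteq> j" for i j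
  proof -
    obtain c0 c1 c2 c3 where 1: "\<forall>x. q x $ i $ j = c0 + c1 * x $ i + c2 * x $ j + c3 * (x $ i * x $ j)"
      using assms(1) ij unfolding Sigma_local_def by blast
    obtain d0 d1 d2 d3 where "\<forall>x. q' x $ i $ j = d0 + d1 * x $ i + d2 * x $ j + d3 * (x $ i * x $ j)"
      using assms(2) ij unfolding Sigma_local_def by blast
    with 1 have "\<forall>x. (q x - q' x) $ i $ j = (c0 - d0) + (c1 - d1) * x $ i + (c2 - d2) * x $ j + (c3 - d3) * (x $ i * x $ j)"
      by (simp add: algebra_simps)
    then show ?thesis by (intro exI)
  qed
  moreover have "\<forall>x. transpose (q x - q' x) = q x - q' x"
    using assms by (auto simp: Sigma_local_def transpose_def vec_eq_iff)
  ultimately show ?thesis by (simp add: Sigma_local_def)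
qed

lemma V_local_diff:
  assumes "q \<in> V_local" "q' \<in> V_local"
  shows "(\<lambda>x. q x - q' x) \<in> V_local"
proof -
  have "\<exists>c0 c1. \<forall>x. (q x - q' x) $ i = c0 + c1 * x $ i" for i
  proof -
    obtain c0 c1 where 1: "\<forall>x. q x $ i = c0 + c1 * x $ i"
      using assms(1) unfolding V_local_def by blast
    obtain d0 d1 where "\<forall>x. q' x $ i = d0 + d1 * x $ i"
      using assms(2) unfolding V_local_def by blast
    with 1 have "\<forall>x. (q x - q' x) $ i = (c0 - d0) + (c1 - d1) * x $ i" by (simp add: algebra_simps)
    then show ?thesis by (intro exI)
  qed
  then show ?thesis by (simp add: V_local_def)
qed

context mesh
begin

lemma AE_cell_iff: "(AE x in lebesgue_on (cell h p). Q x) \<longleftrightarrow> (AE x in lebesgue_on (ocell h p). Q x)"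
proof
  assume "AE x in lebesgue_on (cell h p). Q x"
  then show "AE x in lebesgue_on (ocell h p). Q x"
    by (rule AE_lebesgue_on_subset[OF ocell_sets_lebesgue cell_sets_lebesgue ocell_subset_cell])
next
  assume "AE x in lebesgue_on (ocell h p). Q x"
  then have "AE x in lebesgue. x \<in> ocell h p \<longrightarrow> Q x" by (simp add: AE_restrict_space_iff)
  moreover have "AE x in lebesgue. x \<notin> cell h p - ocell h p" by (rule AE_not_in[OF cell_diff_ocell])
  ultimately have "AE x in lebesgue. x \<in> cell h p \<longrightarrow> Q x" by eventually_elim blast
  then show "AE x in lebesgue_on (cell h p). Q x" by (simp add: AE_restrict_space_iff)
qed

lemma Sigma_h_iff: "\<tau> \<in> Sigma_h a b h \<longleftrightarrow> \<tau> \<in> Hdiv_sym \<Omega> \<and>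
    (\<exists>q. \<forall>z\<in>Z. q z \<in> Sigma_local \<and> (AE x in lebesgue_on (K z). \<tau> x = q z x))"
proof -
  have "\<tau> \<in> Sigma_h a b h \<longleftrightarrow> \<tau> \<in> Hdiv_sym \<Omega> \<and> (\<forall>z\<in>Z. \<exists>q. q \<in> Sigma_local \<and> (AE x in lebesgue_on (K z). \<tau> x = q x))"
    unfolding Sigma_h_def mesh_corners by (simp add: AE_cell_iff Bex_def)
  also have "\<dots> \<longleftrightarrow> \<tau> \<in> Hdiv_sym \<Omega> \<and> (\<exists>q. \<forall>z\<in>Z. q z \<in> Sigma_local \<and> (AE x in lebesgue_on (K z). \<tau> x = q z x))"
    by (simp add: bchoice_iff)
  finally show ?thesis .
qed

lemma V_h_iff: "v \<in> V_h a b h \<longleftrightarrow> v \<in> L2 \<Omega> \<and>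
    (\<exists>q. \<forall>z\<in>Z. q z \<in> V_local \<and> (AE x in lebesgue_on (K z). v x = q z x))"
proof -
  have "v \<in> V_h a b h \<longleftrightarrow> v \<in> L2 \<Omega> \<and> (\<forall>z\<in>Z. \<exists>q. q \<in> V_local \<and> (AE x in lebesgue_on (K z). v x = q x))"
    unfolding V_h_def mesh_corners by (simp add: AE_cell_iff Bex_def)
  also have "\<dots> \<longleftrightarrow> v \<in> L2 \<Omega> \<and> (\<exists>q. \<forall>z\<in>Z. q z \<in> V_local \<and> (AE x in lebesgue_on (K z). v x = q z x))"
    by (simp add: bchoice_iff)
  finally show ?thesis .
qed

lemma V_h_diff:
  assumes "v \<in> V_h a b h" "w \<in> V_h a b h"
  shows "(\<lambda>x. v x - w x) \<in> V_h a b h"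
proof -
  obtain q q' where q: "\<forall>z\<in>Z. q z \<in> V_local \<and> (AE x in lebesgue_on (K z). v x = q z x)"
    "\<forall>z\<in>Z. q' z \<in> V_local \<and> (AE x in lebesgue_on (K z). w x = q' z x)" and L: "v \<in> L2 \<Omega>" "w \<in> L2 \<Omega>"
    using assms unfolding V_h_iff by blast
  have "(\<lambda>x. q z x - q' z x) \<in> V_local \<and> (AE x in lebesgue_on (K z). v x - w x = q z x - q' z x)" if z: "z \<in> Z" for z
  proof
    show "(\<lambda>x. q z x - q' z x) \<in> V_local" using q z by (intro V_local_diff) auto
    have "AE x in lebesgue_on (K z). v x = q z x" "AE x in lebesgue_on (K z). w x = q' z x" using q z by auto
    then show "AE x in lebesgue_on (K z). v x - w x = q z x - q' z x" by eventually_elim simp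
  qed
  then show ?thesis unfolding V_h_iff using L2_diff[OF L] by (intro conjI exI[of _ "\<lambda>z x. q z x - q' z x"]) auto
qed

lemma Hdiv_sym_diff:
  assumes "\<tau> \<in> Hdiv_sym \<Omega>" "\<tau>' \<in> Hdiv_sym \<Omega>"
  shows "(\<lambda>x. \<tau> x - \<tau>' x) \<in> Hdiv_sym \<Omega>"
    "AE x in lebesgue_on \<Omega>. weak_div \<Omega> (\<lambda>x. \<tau> x - \<tau>' x) x = weak_div \<Omega> \<tau> x - weak_div \<Omega> \<tau>' x"
proof -
  note 1 = Hdiv_symD[OF assms(1)] and 2 = Hdiv_symD[OF assms(2)]
  have w: "has_weak_div \<Omega> (\<lambda>x. \<tau> x - \<tau>' x) (\<lambda>x. weak_div \<Omega> \<tau> x - weak_div \<Omega> \<tau>' x)"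
    using 1 2 by (intro has_weak_div_lincomb) auto
  have L: "(\<lambda>x. weak_div \<Omega> \<tau> x - weak_div \<Omega> \<tau>' x) \<in> L2 \<Omega>" "(\<lambda>x. \<tau> x - \<tau>' x) \<in> L2 \<Omega>" using 1 2 by auto
  have "AE x in lebesgue_on \<Omega>. transpose (\<tau> x - \<tau>' x) = \<tau> x - \<tau>' x"
    using 1(4) 2(4) by eventually_elim (simp add: transpose_def vec_eq_iff)
  then show "(\<lambda>x. \<tau> x - \<tau>' x) \<in> Hdiv_sym \<Omega>" using w L by (auto simp: Hdiv_sym_def)
  show "AE x in lebesgue_on \<Omega>. weak_div \<Omega> (\<lambda>x. \<tau> x - \<tau>' x) x = weak_div \<Omega> \<tau> x - weak_div \<Omega> \<tau>' x"
    by (rule has_weak_div_unique[OF weak_div_exists(2)[OF L(1) w] w L(2) weak_div_exists(1)[OF L(1) w] L(1)])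
qed

lemma Sigma_h_diff:
  assumes "\<tau> \<in> Sigma_h a b h" "\<tau>' \<in> Sigma_h a b h"
  shows "(\<lambda>x. \<tau> x - \<tau>' x) \<in> Sigma_h a b h"
proof -
  obtain q q' where q: "\<forall>z\<in>Z. q z \<in> Sigma_local \<and> (AE x in lebesgue_on (K z). \<tau> x = q z x)"
    "\<forall>z\<in>Z. q' z \<in> Sigma_local \<and> (AE x in lebesgue_on (K z). \<tau>' x = q' z x)" and L: "\<tau> \<in> Hdiv_sym \<Omega>" "\<tau>' \<in> Hdiv_sym \<Omega>"
    using assms unfolding Sigma_h_iff by blast
  have "(\<lambda>x. q z x - q' z x) \<in> Sigma_local \<and> (AE x in lebesgue_on (K z). \<tau> x - \<tau>' x = q z x - q' z x)" if z: "z \<in> Z" for z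
  proof
    show "(\<lambda>x. q z x - q' z x) \<in> Sigma_local" using q z by (intro Sigma_local_diff) auto
    have "AE x in lebesgue_on (K z). \<tau> x = q z x" "AE x in lebesgue_on (K z). \<tau>' x = q' z x" using q z by auto
    then show "AE x in lebesgue_on (K z). \<tau> x - \<tau>' x = q z x - q' z x" by eventually_elim simp
  qed
  then show ?thesis unfolding Sigma_h_iff using Hdiv_sym_diff(1)[OF L] by (intro conjI exI[of _ "\<lambda>z x. q z x - q' z x"]) auto
qed

lemma weak_div_piece:
  assumes \<tau>: "\<tau> \<in> Hdiv_sym \<Omega>" and z: "z \<in> Z" and q: "AE x in lebesgue_on (K z). \<tau> x = q x"
    and d: "\<And>i j. has_partial j (\<lambda>x. q x $ i $ j) (d i j)"
  shows "AE x in lebesgue_on (K z). \<forall>i. weak_div \<Omega> \<tau> x $ i = (\<Sum>j\<in>UNIV. d i j x)"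
  using Hdiv_symD[OF \<tau>] by (intro weak_div_local[OF _ _ _ _ K_subset[OF z] q d]) auto

text \<open>The divergence of a discrete stress is an admissible discrete displacement, so the
  divergence error may be used as a test function against itself.\<close>

lemma weak_div_V_h:
  assumes "\<tau> \<in> Sigma_h a b h"
  shows "weak_div \<Omega> \<tau> \<in> V_h a b h"
proof -
  obtain q where q: "\<forall>z\<in>Z. q z \<in> Sigma_local \<and> (AE x in lebesgue_on (K z). \<tau> x = q z x)" and \<tau>: "\<tau> \<in> Hdiv_sym \<Omega>"
    using assms unfolding Sigma_h_iff by blast
  have "\<exists>v. v \<in> V_local \<and> (AE x in lebesgue_on (K z). weak_div \<Omega> \<tau> x = v x)" if z: "z \<in> Z" for z
  proof -
    have "q z \<in> Sigma_local" using q z by blast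
    from Sigma_local_partials[OF this] obtain \<alpha> \<beta> where d': "\<forall>i j. has_partial j (\<lambda>x. q z x $ i $ j) (\<lambda>x. \<alpha> i j + \<beta> i j * x $ i)" by blast
    note d = d'[rule_format]
    let ?v = "\<lambda>x. \<chi> i. (\<Sum>j\<in>UNIV. \<alpha> i j) + (\<Sum>j\<in>UNIV. \<beta> i j) * x $ i"
    have "AE x in lebesgue_on (K z). \<forall>i. weak_div \<Omega> \<tau> x $ i = (\<Sum>j\<in>UNIV. \<alpha> i j + \<beta> i j * x $ i)"
      using q z by (intro weak_div_piece[OF \<tau> z _ d]) auto
    then have "AE x in lebesgue_on (K z). weak_div \<Omega> \<tau> x = ?v x"
      by eventually_elim (simp add: vec_eq_iff sum.distrib sum_distrib_right)
    moreover have "?v \<in> V_local"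
    proof -
      have "\<forall>x. ?v x $ i = (\<Sum>j\<in>UNIV. \<alpha> i j) + (\<Sum>j\<in>UNIV. \<beta> i j) * x $ i" for i by simp
      then show ?thesis unfolding V_local_def by blast
    qed
    ultimately show ?thesis by (intro exI[of _ ?v] conjI)
  qed
  then have "\<exists>v. \<forall>z\<in>Z. v z \<in> V_local \<and> (AE x in lebesgue_on (K z). weak_div \<Omega> \<tau> x = v z x)"
    by (intro bchoice ballI)
  then show ?thesis unfolding V_h_iff using Hdiv_symD(2)[OF \<tau>] by (intro conjI)
qed

text \<open>The weak divergence is tested with a bump function supported in the union of the two
  cells. By Gauss's theorem only the common face contributes, once from each side with opposite
  signs. The entry \<open>j j\<close> is constant on that face and the bump function has a positive
  integral over it, so the two values agree.\<close>

lemma normal_continuity: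
  assumes \<tau>: "\<tau> \<in> Hdiv_sym \<Omega>" and z: "z \<in> Z" "z(j := Suc (z j)) \<in> Z"
    and q: "q \<in> Sigma_local" "AE x in lebesgue_on (K z). \<tau> x = q x"
    and q': "q' \<in> Sigma_local" "AE x in lebesgue_on (K (z(j := Suc (z j)))). \<tau> x = q' x"
    and x: "x $ j = crn z $ j + h"
  shows "q x $ j $ j = q' x $ j $ j"
proof -
  define z' where "z' = z(j := Suc (z j))"
  define p where "p = crn z"
  define p' where "p' = crn z'"
  have p': "p' = upd p j (p $ j + h)" unfolding p'_def p_def z'_def by (rule crn_Suc)
  \<comment> \<open>The upper corner of the box formed by the two cells and their common
    face.\<close>
  define r where "r = (\<chi> k. if k = j then p $ k + 2 * h else p $ k + h)"
  define \<psi> where "\<psi> = bump (h / 4) p r 1 j"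
  have e: "0 < h / 4" using h by simp
  have \<psi>r: "\<psi> \<in> test_functions (box p r)" unfolding \<psi>_def by (rule bump_test_function[OF e]) simp
  have boxK: "w = z \<or> w = z'" if x: "x \<in> box p r" "x \<in> K w" for x w
  proof -
    have "z k = w k" if "k \<noteq> j" for k
    proof (rule K_coord_unique[OF x(2)])
      show "crn z $ k \<le> x $ k" "x $ k \<le> crn z $ k + h"
        using x(1) that unfolding mem_box_cart r_def p_def by (auto dest!: spec[of _ k])
    qed
    moreover have "z j = w j \<or> z' j = w j"
    proof (cases "x $ j \<le> crn z $ j + h")
      case True
      have "crn z $ j \<le> x $ j" using x(1)[unfolded mem_box_cart, rule_format, of j] by (simp add: p_def)
      then show ?thesis using K_coord_unique[OF x(2) _ True] by blast
    next
      case False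
      have "x $ j < crn z $ j + 2 * h" using x(1)[unfolded mem_box_cart, rule_format, of j] by (simp add: p_def r_def)
      moreover have "crn z' $ j = crn z $ j + h" using p' by (simp add: p_def p'_def del: crn_nth)
      ultimately show ?thesis using K_coord_unique[OF x(2), of z' j] False by (simp del: crn_nth)
    qed
    moreover have "z' k = z k" if "k \<noteq> j" for k using that by (simp add: z'_def)
    ultimately have "(\<forall>k. w k = z k) \<or> (\<forall>k. w k = z' k)" by metis
    then show ?thesis by (auto simp: fun_eq_iff)
  qed
  have sub: "box p r \<subseteq> \<Omega>"
  proof
    fix x assume x: "x \<in> box p r"
    have "a $ k < x $ k \<and> x $ k < b $ k" for k
    proof -
      have 1: "a $ k \<le> p $ k" using h by (simp add: p_def)
      have "crn z $ k + h \<le> b $ k" "crn z' $ k + h \<le> b $ k" using z by (auto intro!: crn_upper simp: z'_def Z_def simp del: crn_nth)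
      then have "r $ k \<le> b $ k" using p' by (auto simp: r_def p_def[symmetric] p'_def[symmetric] simp del: crn_nth split: if_splits)
      then show ?thesis using 1 x[unfolded mem_box_cart, rule_format, of k] by linarith
    qed
    then show "x \<in> \<Omega>" by (simp add: mem_box_cart)
  qed
  have \<psi>: "\<psi> \<in> test_functions \<Omega>" using \<psi>r test_functions_subset[OF sub] by blast
  have \<psi>s: "smooth \<psi>" using \<psi> by (simp add: test_functions_def)
  have zz': "z \<noteq> z'" by (auto simp: z'_def fun_eq_iff)
  have two: "(LINT x|lebesgue_on \<Omega>. \<phi> x * f x) = (LINT x|lebesgue_on (K z). \<phi> x * f x) + (LINT x|lebesgue_on (K z'). \<phi> x * f x)"
    if \<phi>: "\<phi> \<in> test_functions (box p r)" and f: "f \<in> L2 \<Omega>" for \<phi> f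
  proof -
    have "\<phi> \<in> test_functions \<Omega>" using \<phi> test_functions_subset[OF sub] by blast
    from test_function_integrable[OF this f] have "integrable (lebesgue_on \<Omega>) (\<lambda>x. \<phi> x * f x)" by simp
    then have "(LINT x|lebesgue_on \<Omega>. \<phi> x * f x) = (\<Sum>w\<in>Z. LINT x|lebesgue_on (K w). \<phi> x * f x)" by (rule integral_mesh)
    also have "\<dots> = (\<Sum>w\<in>{z, z'}. LINT x|lebesgue_on (K w). \<phi> x * f x)"
    proof (rule sum.mono_neutral_right)
      show "\<forall>w\<in>Z - {z, z'}. (LINT x|lebesgue_on (K w). \<phi> x * f x) = 0"
      proof
        fix w assume w: "w \<in> Z - {z, z'}"
        have "(LINT x|lebesgue_on (K w). \<phi> x * f x) = (LINT x|lebesgue_on (K w). 0)"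
        proof (rule Bochner_Integration.integral_cong[OF refl])
          fix x assume "x \<in> space (lebesgue_on (K w))"
          then have "x \<notin> box p r" using boxK[of x w] w by auto
          then show "\<phi> x * f x = 0" using test_function_outside[OF \<phi>] by simp
        qed
        then show "(LINT x|lebesgue_on (K w). \<phi> x * f x) = 0" by simp
      qed
    qed (use z z'_def in auto)
    finally show ?thesis using zz' by simp
  qed
  have L: "(\<lambda>x. \<tau> x $ i $ k) \<in> L2 \<Omega>" "(\<lambda>x. weak_div \<Omega> \<tau> x $ i) \<in> L2 \<Omega>" for i k using Hdiv_symD(1,2)[OF \<tau>] by auto
  \<comment> \<open>On one cell the weak divergence is the classical one of the local polynomial, so
    the sum of both integrals reduces to faces.\<close>
  have cellpart: "(\<Sum>k\<in>UNIV. LINT x|lebesgue_on (K w). partials [k] \<psi> x * \<tau> x $ j $ k) + (LINT x|lebesgue_on (K w). \<psi> x * weak_div \<Omega> \<tau> x $ j)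
      = face_integral h (crn w) {j} (upd 0 j (crn w $ j + h)) (\<lambda>x. \<psi> x * s x $ j $ j) - face_integral h (crn w) {j} (upd 0 j (crn w $ j)) (\<lambda>x. \<psi> x * s x $ j $ j)"
    if w: "w \<in> Z" "w = z \<or> w = z'" and s: "s \<in> Sigma_local" "AE x in lebesgue_on (K w). \<tau> x = s x" for w s
  proof -
    from Sigma_local_partials[OF s(1)] obtain \<alpha> \<beta> where d0: "\<forall>i j. has_partial j (\<lambda>x. s x $ i $ j) (\<lambda>x. \<alpha> i j + \<beta> i j * x $ i)" by blast
    note d = d0[rule_format]
    define d' where "d' k x = \<alpha> j k + \<beta> j k * x $ j" for k x
    have d'': "has_partial k (\<lambda>x. s x $ j $ k) (d' k)" for k using d[of k j] by (simp add: d'_def[abs_def])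
    have cs: "continuous_on UNIV (\<lambda>x. s x $ j $ k)" "continuous_on UNIV (d' k)" for k using d''[of k] by (auto simp: has_partial_def)
    have c\<psi>: "continuous_on UNIV \<psi>" "continuous_on UNIV (partials [k] \<psi>)" for k
      by (rule smooth_continuous[OF \<psi>s] smooth_continuous[OF smooth_partials[OF \<psi>s]])+
    have LK: "f \<in> L2 (K w)" if "continuous_on UNIV f" for f :: "real^'n \<Rightarrow> real" by (rule L2_continuous[OF that]) auto
    have LKw: "(\<lambda>x. \<tau> x $ i $ k) \<in> L2 (K w)" "(\<lambda>x. weak_div \<Omega> \<tau> x $ i) \<in> L2 (K w)" for i k
      using L2_subset[OF L(1) K_subset[OF w(1)]] L2_subset[OF L(2) K_subset[OF w(1)]] by auto
    have i: "integrable (lebesgue_on (K w)) (\<lambda>x. partials [k] \<psi> x * s x $ j $ k)" "integrable (lebesgue_on (K w)) (\<lambda>x. \<psi> x * d' k x)" for k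
      by (intro L2_mult_integrable LK c\<psi> cs)+
    have "AE x in lebesgue_on (K w). \<forall>i. weak_div \<Omega> \<tau> x $ i = (\<Sum>k\<in>UNIV. \<alpha> i k + \<beta> i k * x $ i)"
      by (rule weak_div_piece[OF \<tau> w(1) s(2) d])
    then have wd: "AE x in lebesgue_on (K w). weak_div \<Omega> \<tau> x $ j = (\<Sum>k\<in>UNIV. d' k x)"
      by eventually_elim (simp add: d'_def)
    have 1: "(LINT x|lebesgue_on (K w). \<psi> x * weak_div \<Omega> \<tau> x $ j) = (\<Sum>k\<in>UNIV. LINT x|lebesgue_on (K w). \<psi> x * d' k x)"
    proof -
      have "(LINT x|lebesgue_on (K w). \<psi> x * weak_div \<Omega> \<tau> x $ j) = (LINT x|lebesgue_on (K w). (\<Sum>k\<in>UNIV. \<psi> x * d' k x))"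
      proof (rule integral_cong_AE)
        show "AE x in lebesgue_on (K w). \<psi> x * weak_div \<Omega> \<tau> x $ j = (\<Sum>k\<in>UNIV. \<psi> x * d' k x)"
          using wd by eventually_elim (simp add: sum_distrib_left)
      qed (intro borel_measurable_times borel_measurable_sum L2D(1) LK LKw c\<psi> cs)+
      then show ?thesis by (simp add: Bochner_Integration.integral_sum[OF i(2)])
    qed
    have 2: "(LINT x|lebesgue_on (K w). partials [k] \<psi> x * \<tau> x $ j $ k) = (LINT x|lebesgue_on (K w). partials [k] \<psi> x * s x $ j $ k)" for k
    proof (rule integral_cong_AE)
      show "AE x in lebesgue_on (K w). partials [k] \<psi> x * \<tau> x $ j $ k = partials [k] \<psi> x * s x $ j $ k"
        using s(2) by eventually_elim simp
    qed (intro borel_measurable_times L2D(1) LK LKw c\<psi> cs)+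
    have 3: "(LINT x|lebesgue_on (K w). partials [k] \<psi> x * s x $ j $ k) + (LINT x|lebesgue_on (K w). \<psi> x * d' k x)
      = face_integral h (crn w) {k} (upd 0 k (crn w $ k + h)) (\<lambda>x. \<psi> x * s x $ j $ k) - face_integral h (crn w) {k} (upd 0 k (crn w $ k)) (\<lambda>x. \<psi> x * s x $ j $ k)" for k
    proof -
      have hp: "has_partial k (\<lambda>x. \<psi> x * s x $ j $ k) (\<lambda>x. partials [k] \<psi> x * s x $ j $ k + \<psi> x * d' k x)"
        by (rule has_partial_mult[OF smooth_has_partial[OF \<psi>s] d''])
      have "(LINT x|lebesgue_on (K w). partials [k] \<psi> x * s x $ j $ k) + (LINT x|lebesgue_on (K w). \<psi> x * d' k x)
          = (LINT x|lebesgue_on (K w). partials [k] \<psi> x * s x $ j $ k + \<psi> x * d' k x)" using i by simp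
      also have "\<dots> = face_integral h (crn w) {} 0 (\<lambda>x. partials [k] \<psi> x * s x $ j $ k + \<psi> x * d' k x)"
        using hp by (intro ocell_integral_continuous) (simp add: has_partial_def)
      also have "\<dots> = face_integral h (crn w) {k} (upd 0 k (crn w $ k + h)) (\<lambda>x. \<psi> x * s x $ j $ k) - face_integral h (crn w) {k} (upd 0 k (crn w $ k)) (\<lambda>x. \<psi> x * s x $ j $ k)"
        by (rule face_integral_partial[OF hp]) (use h in auto)
      finally show ?thesis .
    qed
    \<comment> \<open>Faces perpendicular to the other axes lie on the boundary of the surrounding
      box, where \<open>\<psi>\<close> is zero.\<close>
    have 4: "face_integral h (crn w) {k} (upd 0 k t) (\<lambda>x. \<psi> x * s x $ j $ k) = 0" if k: "k \<noteq> j" "t = crn w $ k \<or> t = crn w $ k + h" for k t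
    proof (rule face_integral_zero)
      fix x assume "\<And>l. l \<in> {k} \<Longrightarrow> x $ l = upd 0 k t $ l"
      then have xk: "x $ k = t" by simp
      have "crn w $ k = p $ k" using w(2) k(1) by (auto simp: p_def z'_def)
      then have "x \<notin> box p r" using xk k by (auto simp: mem_box_cart r_def intro!: exI[of _ k])
      then show "\<psi> x * s x $ j $ k = 0" using test_function_outside[OF \<psi>r] by simp
    qed
    have "(\<Sum>k\<in>UNIV. LINT x|lebesgue_on (K w). partials [k] \<psi> x * \<tau> x $ j $ k) + (LINT x|lebesgue_on (K w). \<psi> x * weak_div \<Omega> \<tau> x $ j)
      = (\<Sum>k\<in>UNIV. face_integral h (crn w) {k} (upd 0 k (crn w $ k + h)) (\<lambda>x. \<psi> x * s x $ j $ k) - face_integral h (crn w) {k} (upd 0 k (crn w $ k)) (\<lambda>x. \<psi> x * s x $ j $ k))"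
      unfolding 1 2 3[symmetric] by (simp add: sum.distrib)
    also have "\<dots> = (\<Sum>k\<in>{j}. face_integral h (crn w) {k} (upd 0 k (crn w $ k + h)) (\<lambda>x. \<psi> x * s x $ j $ k) - face_integral h (crn w) {k} (upd 0 k (crn w $ k)) (\<lambda>x. \<psi> x * s x $ j $ k))"
      by (rule sum.mono_neutral_right) (use 4 in auto)
    finally show ?thesis by simp
  qed
  obtain c0 c1 c2 where c: "\<And>x. q x $ j $ j = c0 + c1 * x $ j + c2 * (x $ j)\<^sup>2" using q(1) unfolding Sigma_local_def by blast
  obtain d0 d1 d2 where d: "\<And>x. q' x $ j $ j = d0 + d1 * x $ j + d2 * (x $ j)\<^sup>2" using q'(1) unfolding Sigma_local_def by blast
  have outer: "face_integral h (crn w) {j} (upd 0 j t) (\<lambda>x. \<psi> x * s x $ j $ j) = 0" if "t = p $ j \<or> t = r $ j" for w t and s :: "real^'n \<Rightarrow> real^'n^'n"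
  proof (rule face_integral_zero)
    fix x assume "\<And>l. l \<in> {j} \<Longrightarrow> x $ l = upd 0 j t $ l"
    then have "x $ j = t" by simp
    then have "x \<notin> box p r" using that by (auto simp: mem_box_cart intro!: exI[of _ j])
    then show "\<psi> x * s x $ j $ j = 0" using test_function_outside[OF \<psi>r] by simp
  qed
  let ?f = "p $ j + h"
  define F where "F = face_integral h p {j} (upd 0 j ?f) \<psi>"
  have inner: "face_integral h p {j} (upd 0 j ?f) (\<lambda>y. \<psi> y * s y $ j $ j) = s x $ j $ j * F" if s: "\<And>y. y $ j = ?f \<Longrightarrow> s y $ j $ j = s x $ j $ j" for s :: "real^'n \<Rightarrow> real^'n^'n"
    unfolding F_def face_integral_mult[symmetric] by (rule face_integral_cong) (simp add: s mult.commute)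
  have xj: "x $ j = ?f" using x by (simp add: p_def)
  have cp': "face_integral h p' {j} (upd 0 j ?f) f = face_integral h p {j} (upd 0 j ?f) f" for f
    by (rule face_integral_cong_corner) (simp add: p')
  have p'j: "p' $ j = ?f" "p' $ j + h = r $ j" by (simp_all add: p' r_def)
  have zZ: "z' \<in> Z" using z z'_def by simp
  have A1: "(\<Sum>k\<in>UNIV. LINT x|lebesgue_on (K z). partials [k] \<psi> x * \<tau> x $ j $ k) + (LINT x|lebesgue_on (K z). \<psi> x * weak_div \<Omega> \<tau> x $ j) = q x $ j $ j * F"
    unfolding p_def[symmetric] using cellpart[OF z(1) disjI1[OF refl] q, folded p_def] outer[of "p $ j" z q, folded p_def] inner[of q] c xj by simp
  have A2: "(\<Sum>k\<in>UNIV. LINT x|lebesgue_on (K z'). partials [k] \<psi> x * \<tau> x $ j $ k) + (LINT x|lebesgue_on (K z'). \<psi> x * weak_div \<Omega> \<tau> x $ j) = - (q' x $ j $ j * F)"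
    unfolding p'_def[symmetric] using cellpart[OF zZ disjI2[OF refl] q'[folded z'_def], folded p'_def, unfolded p'j(2), unfolded p'j(1) cp']
      outer[of "r $ j" z' q', folded p'_def] inner[of q'] d xj by simp
  have "(\<Sum>k\<in>UNIV. LINT x|lebesgue_on \<Omega>. partials [k] \<psi> x * \<tau> x $ j $ k) + (LINT x|lebesgue_on \<Omega>. \<psi> x * weak_div \<Omega> \<tau> x $ j) = 0"
    using has_weak_divD[OF Hdiv_symD(3)[OF \<tau>] Hdiv_symD(1,2)[OF \<tau>] _ \<psi>, of j] by simp
  then have "q x $ j $ j * F - q' x $ j $ j * F = 0"
    using A1 A2 unfolding two[OF test_functions_partials[OF \<psi>r] L(1)] two[OF \<psi>r L(2)] sum.distrib by linarith
  \<comment> \<open>The width \<open>h / 4\<close> of the cutoff leaves the bump function positive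
    on the middle half of the common face.\<close>
  moreover have "0 < F" unfolding F_def
  proof (rule face_integral_pos[OF smooth_continuous[OF \<psi>s] h])
    show "0 \<le> \<psi> x" for x by (auto simp: \<psi>_def bump_def intro!: prod_nonneg hat_bounds)
    fix x assume "\<forall>k\<in>{j}. x $ k = upd 0 j ?f $ k" and o: "\<forall>k\<in>-{j}. p $ k + h / 4 < x $ k \<and> x $ k < p $ k + 3 * h / 4"
    then have xj: "x $ j = ?f" by simp
    have "0 < hat (h / 4) (p $ k) (r $ k) (x $ k)" for k
    proof (cases "k = j")
      case True then show ?thesis using xj h by (intro hat_pos) (auto simp: r_def)
    next
      case False then show ?thesis using o[rule_format, of k] h by (intro hat_pos) (simp_all add: r_def)
    qed
    then show "0 < \<psi> x" by (auto simp: \<psi>_def bump_def intro!: prod_pos)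
  qed
  ultimately show ?thesis by (simp add: left_diff_distrib[symmetric])
qed

end

section \<open>Summation by parts along a column\<close>

lemma sum_square_le: "(\<Sum>l<m. f l)\<^sup>2 \<le> real m * (\<Sum>l<m. (f l :: real)\<^sup>2)"
  using Cauchy_Schwarz_ineq_sum[of "\<lambda>_. 1" f "{..<m}"] by simp

lemma square_add_le: "(x + y)\<^sup>2 \<le> 2 * x\<^sup>2 + 2 * (y :: real)\<^sup>2"
  using sum_squares_bound[of x y] unfolding power2_sum by linarith

text \<open>A discrete trace inequality: the value at \<open>e\<close> is compared with every value
  of the column through the increments, and the squares are averaged. For a column of L/h cells the
  factor 1/m of the average is proportional to \<open>h\<close>.\<close>

lemma endpoint_square_bound:
  fixes G :: "nat \<Rightarrow> real"
  assumes e: "e < m"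
  shows "(G e)\<^sup>2 \<le> 2 / real m * (\<Sum>l<m. (G l)\<^sup>2) + 2 * real m * (\<Sum>l<m - 1. (G (Suc l) - G l)\<^sup>2)"
proof -
  let ?S = "\<Sum>l<m - 1. (G (Suc l) - G l)\<^sup>2"
  have diff: "\<bar>G k - G l\<bar> \<le> (\<Sum>l<m - 1. \<bar>G (Suc l) - G l\<bar>)" if "l \<le> k" "k < m" for k l
  proof -
    have "G k - G l = (\<Sum>i=l..<k. G (Suc i) - G i)" using sum_Suc_diff'[OF that(1), of G] by simp
    then have "\<bar>G k - G l\<bar> \<le> (\<Sum>i=l..<k. \<bar>G (Suc i) - G i\<bar>)" by simp
    also have "\<dots> \<le> (\<Sum>i<m - 1. \<bar>G (Suc i) - G i\<bar>)" by (rule sum_mono2) (use that in auto)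
    finally show ?thesis .
  qed
  have each: "(G e)\<^sup>2 \<le> 2 * (G l)\<^sup>2 + 2 * (real m * ?S)" if l: "l < m" for l
  proof -
    have "\<bar>G e - G l\<bar> \<le> (\<Sum>l<m - 1. \<bar>G (Suc l) - G l\<bar>)"
      using diff[of l e] diff[of e l] e l by (cases "l \<le> e") (auto simp: abs_minus_commute)
    then have "(G e - G l)\<^sup>2 \<le> (\<Sum>l<m - 1. \<bar>G (Suc l) - G l\<bar>)\<^sup>2" by (metis abs_ge_zero power2_abs power_mono)
    also have "\<dots> \<le> real (m - 1) * (\<Sum>l<m - 1. \<bar>G (Suc l) - G l\<bar>\<^sup>2)" by (rule sum_square_le)
    also have "\<dots> \<le> real m * ?S" by (simp add: mult_right_mono sum_nonneg)
    finally have "(G e - G l)\<^sup>2 \<le> real m * ?S" .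
    then show ?thesis using square_add_le[of "G l" "G e - G l"] by simp
  qed
  have m: "0 < real m" using e by simp
  have "real m * (G e)\<^sup>2 = (\<Sum>l<m. (G e)\<^sup>2)" by simp
  also have "\<dots> \<le> (\<Sum>l<m. 2 * (G l)\<^sup>2 + 2 * (real m * ?S))" by (rule sum_mono) (use each in simp)
  also have "\<dots> = real m * (2 / real m * (\<Sum>l<m. (G l)\<^sup>2) + 2 * real m * ?S)"
    using m by (simp add: sum.distrib sum_distrib_left[symmetric] field_simps)
  finally show ?thesis using m by (simp only: mult_le_cancel_left_pos)
qed

text \<open>Abel summation leaves two end terms and the increments of \<open>G\<close>. Each
  \<open>T l\<close> then occurs in exactly one product, so Young's inequality costs its square
  once. The end terms account for 4/m and 4m, the interior increments for the added 1.\<close>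

lemma abel_bound:
  fixes G T :: "nat \<Rightarrow> real"
  assumes m: "0 < m" and s: "0 < s" and k: "0 < k"
  shows "k * (\<Sum>l<m. G l * (T (Suc l) - T l)) \<le>
     s * k\<^sup>2 * (4 / real m * (\<Sum>l<m. (G l)\<^sup>2) + (4 * real m + 1) * (\<Sum>l<m - 1. (G (Suc l) - G l)\<^sup>2)) + (\<Sum>l\<le>m. (T l)\<^sup>2) / s"
proof -
  obtain m' where m': "m = Suc m'" using m gr0_implies_Suc by blast
  have abel: "(\<Sum>l<Suc r. G l * (T (Suc l) - T l)) = G r * T (Suc r) - G 0 * T 0 - (\<Sum>l<r. (G (Suc l) - G l) * T (Suc l))" for r
    by (induction r) (simp_all add: algebra_simps)
  have y: "k * (x * t) \<le> s * k\<^sup>2 * x\<^sup>2 + t\<^sup>2 / s" for x t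
  proof -
    have "0 \<le> (s * (k * x) - t)\<^sup>2 + (s * (k * x))\<^sup>2 + t\<^sup>2" by simp
    then have "s * (k * (x * t)) \<le> s * (s * k\<^sup>2 * x\<^sup>2 + t\<^sup>2 / s)"
      using s by (simp add: power2_eq_square algebra_simps)
    then show ?thesis using s by (simp only: mult_le_cancel_left_pos)
  qed
  let ?Y = "\<Sum>l<m - 1. (G (Suc l) - G l)\<^sup>2" and ?X = "\<Sum>l<m. (G l)\<^sup>2"
  have "k * (\<Sum>l<m. G l * (T (Suc l) - T l)) = k * (G m' * T m) + k * ((- G 0) * T 0) + (\<Sum>l<m'. k * ((- (G (Suc l) - G l)) * T (Suc l)))"
    unfolding m' abel by (simp add: algebra_simps sum_distrib_left sum_subtractf sum_negf)
  also have "\<dots> \<le> (s * k\<^sup>2 * (G m')\<^sup>2 + (T m)\<^sup>2 / s) + (s * k\<^sup>2 * (- G 0)\<^sup>2 + (T 0)\<^sup>2 / s) + (\<Sum>l<m'. s * k\<^sup>2 * (- (G (Suc l) - G l))\<^sup>2 + (T (Suc l))\<^sup>2 / s)"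
    by (intro add_mono y sum_mono)
  also have "\<dots> = s * k\<^sup>2 * ((G m')\<^sup>2 + (G 0)\<^sup>2 + ?Y) + ((T m)\<^sup>2 + ((T 0)\<^sup>2 + (\<Sum>l<m'. (T (Suc l))\<^sup>2))) / s"
    unfolding power2_minus m' by (simp add: sum.distrib sum_distrib_left sum_divide_distrib add_divide_distrib algebra_simps)
  also have "(T 0)\<^sup>2 + (\<Sum>l<m'. (T (Suc l))\<^sup>2) = (\<Sum>l<m. (T l)\<^sup>2)"
    unfolding m' by (simp only: sum.lessThan_Suc_shift)
  also have "(T m)\<^sup>2 + (\<Sum>l<m. (T l)\<^sup>2) = (\<Sum>l\<le>m. (T l)\<^sup>2)"
    by (simp add: lessThan_Suc_atMost[symmetric])
  also have "s * k\<^sup>2 * ((G m')\<^sup>2 + (G 0)\<^sup>2 + ?Y) \<le> s * k\<^sup>2 * (4 / real m * ?X + (4 * real m + 1) * ?Y)"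
  proof (rule mult_left_mono)
    have "(G m')\<^sup>2 \<le> 2 / real m * ?X + 2 * real m * ?Y" "(G 0)\<^sup>2 \<le> 2 / real m * ?X + 2 * real m * ?Y"
      by (rule endpoint_square_bound; simp add: m')+
    then show "(G m')\<^sup>2 + (G 0)\<^sup>2 + ?Y \<le> 4 / real m * ?X + (4 * real m + 1) * ?Y" by (simp add: algebra_simps)
  qed (use s in simp)
  finally show ?thesis by simp
qed

lemma sq_quadratic:
  fixes p :: "real^'n"
  assumes h: "0 < h"
  shows "sq (ocell h p) (\<lambda>x. A + B * (x $ i - (p $ i + h / 2)) + E * (x $ i - (p $ i + h / 2))\<^sup>2)
    = h ^ CARD('n) * (A\<^sup>2 + (B\<^sup>2 + 2 * A * E) * h\<^sup>2 / 12 + E\<^sup>2 * h ^ 4 / 80)"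
proof -
  define m where "m = p $ i + h / 2"
  have n: "h ^ CARD('n) = h * h ^ (CARD('n) - 1)" by (simp add: power_eq_if)
  have "sq (ocell h p) (\<lambda>x. A + B * (x $ i - m) + E * (x $ i - m)\<^sup>2) = h ^ (CARD('n) - 1) *
    ((A\<^sup>2 * (p $ i + h - m) + A * B * (p $ i + h - m)\<^sup>2 + (B\<^sup>2 + 2 * A * E) * (p $ i + h - m) ^ 3 / 3 + B * E * (p $ i + h - m) ^ 4 / 2 + E\<^sup>2 * (p $ i + h - m) ^ 5 / 5)
     - (A\<^sup>2 * (p $ i - m) + A * B * (p $ i - m)\<^sup>2 + (B\<^sup>2 + 2 * A * E) * (p $ i - m) ^ 3 / 3 + B * E * (p $ i - m) ^ 4 / 2 + E\<^sup>2 * (p $ i - m) ^ 5 / 5))"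
    unfolding sq_def
  proof (rule integral_coordinate[where \<phi>="\<lambda>s. (A + B * (s - m) + E * (s - m)\<^sup>2)\<^sup>2"
        and \<Phi>="\<lambda>s. A\<^sup>2 * (s - m) + A * B * (s - m)\<^sup>2 + (B\<^sup>2 + 2 * A * E) * (s - m) ^ 3 / 3 + B * E * (s - m) ^ 4 / 2 + E\<^sup>2 * (s - m) ^ 5 / 5", OF _ _ h])
    show "((\<lambda>s. A\<^sup>2 * (s - m) + A * B * (s - m)\<^sup>2 + (B\<^sup>2 + 2 * A * E) * (s - m) ^ 3 / 3 + B * E * (s - m) ^ 4 / 2 + E\<^sup>2 * (s - m) ^ 5 / 5)
       has_real_derivative (A + B * (s - m) + E * (s - m)\<^sup>2)\<^sup>2) (at s)" for s
      by (auto intro!: derivative_eq_intros) (simp add: power2_eq_square eval_nat_numeral field_simps)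
  qed (intro continuous_intros)
  moreover have "p $ i + h - m = h / 2" "p $ i - m = - (h / 2)" by (simp_all add: m_def field_simps)
  moreover have "((A\<^sup>2 * t + A * B * t\<^sup>2 + (B\<^sup>2 + 2 * A * E) * t ^ 3 / 3 + B * E * t ^ 4 / 2 + E\<^sup>2 * t ^ 5 / 5)
     - (A\<^sup>2 * (- t) + A * B * (- t)\<^sup>2 + (B\<^sup>2 + 2 * A * E) * (- t) ^ 3 / 3 + B * E * (- t) ^ 4 / 2 + E\<^sup>2 * (- t) ^ 5 / 5))
    = 2 * t * (A\<^sup>2 + (B\<^sup>2 + 2 * A * E) * (2 * t)\<^sup>2 / 12 + E\<^sup>2 * (2 * t) ^ 4 / 80)" for t
    by (simp add: power2_eq_square eval_nat_numeral field_simps)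
  note this[of "h / 2"]
  ultimately show ?thesis unfolding m_def[symmetric] n by simp
qed

text \<open>In the Legendre basis of the rescaled interval the coefficients are A + e/3, b and 2e/3,
  and the mean square is the sum of their squares with weights 1, 1/3 and 1/5. The end value is the
  sum of these coefficients, so Cauchy-Schwarz gives 1 + 3 + 5 = 9.\<close>

lemma quadratic_end_bound:
  fixes A B E h :: real
  assumes "t = h / 2 \<or> t = - (h / 2)"
  shows "(A + B * t + E * t\<^sup>2)\<^sup>2 \<le> 9 * (A\<^sup>2 + (B\<^sup>2 + 2 * A * E) * h\<^sup>2 / 12 + E\<^sup>2 * h ^ 4 / 80)"
proof -
  define e where "e = E * h\<^sup>2 / 4"
  define b where "b = B * t"
  have t2: "t\<^sup>2 = h\<^sup>2 / 4" using assms by (auto simp: power2_eq_square)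
  have b2: "b\<^sup>2 = B\<^sup>2 * h\<^sup>2 / 4" using t2 by (simp add: b_def power_mult_distrib)
  have e2: "e\<^sup>2 = E\<^sup>2 * h ^ 4 / 16" by (simp add: e_def power_mult_distrib power_divide power2_eq_square eval_nat_numeral)
  have "A + B * t + E * t\<^sup>2 = A + b + e" using t2 by (simp add: b_def e_def)
  moreover have "A\<^sup>2 + (B\<^sup>2 + 2 * A * E) * h\<^sup>2 / 12 + E\<^sup>2 * h ^ 4 / 80 = A\<^sup>2 + b\<^sup>2 / 3 + 2 * A * e / 3 + e\<^sup>2 / 5"
    unfolding b2 e2 by (simp add: e_def field_simps)
  moreover have "(A + b + e)\<^sup>2 \<le> 9 * (A\<^sup>2 + b\<^sup>2 / 3 + 2 * A * e / 3 + e\<^sup>2 / 5)"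
  proof -
    have p: "A\<^sup>2 + b\<^sup>2 / 3 + 2 * A * e / 3 + e\<^sup>2 / 5 = (A + e / 3)\<^sup>2 + b\<^sup>2 / 3 + (2 * e / 3)\<^sup>2 / 5"
      by (simp add: power2_eq_square field_simps)
    have cs: "(x + y + z)\<^sup>2 \<le> 9 * (x\<^sup>2 + y\<^sup>2 / 3 + z\<^sup>2 / 5)" for x y z :: real
    proof -
      \<comment> \<open>The defect in the weighted Cauchy-Schwarz inequality, written as a sum of
        squares.\<close>
      have "9 * (x\<^sup>2 + y\<^sup>2 / 3 + z\<^sup>2 / 5) - (x + y + z)\<^sup>2 = (3 * x - y)\<^sup>2 / 3 + (5 * x - z)\<^sup>2 / 5 + (5 * y - 3 * z)\<^sup>2 / 15"
        by (simp add: power2_eq_square field_simps)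
      moreover have "0 \<le> (3 * x - y)\<^sup>2 / 3 + (5 * x - z)\<^sup>2 / 5 + (5 * y - 3 * z)\<^sup>2 / 15" by simp
      ultimately show ?thesis by linarith
    qed
    show ?thesis using cs[of "A + e / 3" b "2 * e / 3"] unfolding p by (simp add: algebra_simps)
  qed
  ultimately show ?thesis by (simp only:)
qed

context mesh
begin

text \<open>In the application \<open>f\<close> is a first derivative of an entry of \<sigma>. On a
  cell \<open>h * B z\<close> is the increment of the entry \<open>j j\<close> of \<tau> from the
  lower to the upper face, since the even part cancels. Neighbouring cells share these face values,
  so each column in direction \<open>j\<close> gives a sum to which \<open>abel_bound\<close>
  applies with \<open>h\<close> as its factor.\<close>

lemma cross_term:
  assumes f: "C1_limit \<Omega> f F" and \<tau>: "\<tau> \<in> Hdiv_sym \<Omega>"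
    and q: "\<And>z. z \<in> Z \<Longrightarrow> q z \<in> Sigma_local" "\<And>z. z \<in> Z \<Longrightarrow> AE x in lebesgue_on (K z). \<tau> x = q z x"
    and c: "\<And>z x. z \<in> Z \<Longrightarrow> q z x $ j $ j = A z + B z * (x $ j - (crn z $ j + h / 2)) + E z * (x $ j - (crn z $ j + h / 2))\<^sup>2"
    and s: "0 < s" and L: "L = b $ j - a $ j"
  shows "(\<Sum>z\<in>Z. h ^ CARD('n) * (avg h (crn z) f * (h\<^sup>2 * B z))) \<le>
     s * h ^ 3 * (4 / L + 20 * L) * (sq \<Omega> f + sq \<Omega> (F j)) + 18 * sq \<Omega> (\<lambda>x. \<tau> x $ j $ j) / s"
proof -
  let ?m = "M j"
  have L': "L = real ?m * h" using L M[of j] by simp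
  have m: "0 < ?m" by (rule Mpos)
  have Lpos: "0 < L" using L' m h by simp
  have hL: "h \<le> L" using m h unfolding L' by simp
  have hn: "0 < h ^ CARD('n)" using h by simp
  have fL: "f \<in> L2 \<Omega>" "F j \<in> L2 \<Omega>" using f by (auto simp: C1_limit_def)
  have \<tau>L: "(\<lambda>x. \<tau> x $ j $ j) \<in> L2 \<Omega>" using Hdiv_symD(1)[OF \<tau>] by auto
  define top where "top z = A z + B z * (h / 2) + E z * (h / 2)\<^sup>2" for z
  define bot where "bot z = A z + B z * (- (h / 2)) + E z * (- (h / 2))\<^sup>2" for z
  define W where "W z = sq (K z) (\<lambda>x. \<tau> x $ j $ j)" for z
  have Wtop: "h ^ CARD('n) * (top z)\<^sup>2 \<le> 9 * W z" "h ^ CARD('n) * (bot z)\<^sup>2 \<le> 9 * W z" if z: "z \<in> Z" for z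
  proof -
    have "W z = sq (K z) (\<lambda>x. q z x $ j $ j)"
      unfolding W_def
    proof (rule sq_cong_AE)
      show "(\<lambda>x. \<tau> x $ j $ j) \<in> L2 (K z)" using L2_subset[OF \<tau>L K_subset[OF z]] by simp
      show "(\<lambda>x. q z x $ j $ j) \<in> L2 (K z)" unfolding c[OF z] by (intro L2_continuous continuous_intros) auto
      show "AE x in lebesgue_on (K z). \<tau> x $ j $ j = q z x $ j $ j" using q(2)[OF z] by eventually_elim simp
    qed
    then have W: "W z = h ^ CARD('n) * ((A z)\<^sup>2 + ((B z)\<^sup>2 + 2 * A z * E z) * h\<^sup>2 / 12 + (E z)\<^sup>2 * h ^ 4 / 80)"
      unfolding c[OF z] sq_quadratic[OF h] .
    show "h ^ CARD('n) * (top z)\<^sup>2 \<le> 9 * W z"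
      using mult_left_mono[OF quadratic_end_bound[of "h / 2" h "A z" "B z" "E z"], of "h ^ CARD('n)"] hn unfolding W top_def by simp
    show "h ^ CARD('n) * (bot z)\<^sup>2 \<le> 9 * W z"
      using mult_left_mono[OF quadratic_end_bound[of "- (h / 2)" h "A z" "B z" "E z"], of "h ^ CARD('n)"] hn unfolding W bot_def by simp
  qed
  have jump: "top z = bot (z(j := Suc (z j)))" if z: "z \<in> Z" "z(j := Suc (z j)) \<in> Z" for z
  proof -
    define x where "x = upd 0 j (crn z $ j + h)"
    let ?z' = "z(j := Suc (z j))"
    have xj: "x $ j = crn z $ j + h" "crn ?z' $ j = crn z $ j + h" by (simp_all add: x_def algebra_simps)
    have "q z x $ j $ j = q ?z' x $ j $ j"
      by (rule normal_continuity[OF \<tau> z q(1)[OF z(1)] q(2)[OF z(1)] q(1)[OF z(2)] q(2)[OF z(2)] xj(1)])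
    then show ?thesis unfolding c[OF z(1)] c[OF z(2)] xj top_def bot_def by simp
  qed
  have col: "(\<Sum>l<?m. h ^ CARD('n) * (avg h (crn (z(j := l))) f * (h\<^sup>2 * B (z(j := l))))) \<le>
     s * h ^ 3 * (4 / L + 20 * L) * (\<Sum>l<?m. sq (K (z(j := l))) f + sq (K (z(j := l))) (F j)) + 18 * (\<Sum>l<?m. W (z(j := l))) / s"
    if z: "z \<in> base j" for z
  proof -
    let ?z = "\<lambda>l. z(j := l)"
    define G where "G l = avg h (crn (?z l)) f" for l
    \<comment> \<open>The value on the face number \<open>l\<close> of the column: the lower face of
      the cell \<open>l\<close>, except for the topmost face, which belongs to the last
      cell.\<close>
    define T where "T l = (if l < ?m then bot (?z l) else top (?z (l - 1)))" for l
    have zZ: "?z l \<in> Z" if "l < ?m" for l using base_col[OF z that] .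
    have TB: "T (Suc l) - T l = h * B (?z l)" if l: "l < ?m" for l
    proof -
      have "T (Suc l) = top (?z l)"
      proof (cases "Suc l < ?m")
        case True
        have "(?z l)(j := Suc ((?z l) j)) = ?z (Suc l)" by (auto simp: fun_eq_iff)
        then show ?thesis using jump[of "?z l"] zZ[OF l] zZ[OF True] True by (simp add: T_def)
      next
        case False then show ?thesis by (simp add: T_def)
      qed
      then show ?thesis using l by (simp add: T_def top_def bot_def)
    qed
    \<comment> \<open>The constant 9 of an end value is doubled, because the topmost face is counted
      in addition to all lower faces.\<close>
    have Tb: "h ^ CARD('n) * (\<Sum>l\<le>?m. (T l)\<^sup>2) \<le> 18 * (\<Sum>l<?m. W (?z l))"
    proof -
      have "(\<Sum>l\<le>?m. (T l)\<^sup>2) = (\<Sum>l<?m. (T l)\<^sup>2) + (T ?m)\<^sup>2" by (simp add: lessThan_Suc_atMost[symmetric])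
      moreover have "h ^ CARD('n) * (\<Sum>l<?m. (T l)\<^sup>2) \<le> 9 * (\<Sum>l<?m. W (?z l))"
        unfolding sum_distrib_left by (intro sum_mono) (use Wtop(2)[OF zZ] in \<open>auto simp: T_def\<close>)
      moreover have "h ^ CARD('n) * (T ?m)\<^sup>2 \<le> 9 * W (?z (?m - 1))"
        using Wtop(1)[OF zZ, of "?m - 1"] m by (simp add: T_def)
      moreover have "W (?z (?m - 1)) \<le> (\<Sum>l<?m. W (?z l))"
        by (rule member_le_sum[of "?m - 1" _ "\<lambda>l. W (?z l)"]) (use m in \<open>auto simp: W_def\<close>)
      ultimately show ?thesis by (simp add: distrib_left)
    qed
    have X: "h ^ CARD('n) * (\<Sum>l<?m. (G l)\<^sup>2) \<le> (\<Sum>l<?m. sq (K (?z l)) f)"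
      unfolding sum_distrib_left
    proof (rule sum_mono)
      fix l assume "l \<in> {..<?m}"
      then have fK: "f \<in> L2 (K (?z l))" using L2_subset[OF fL(1) K_subset[OF zZ]] by simp
      have "h ^ CARD('n) * (h ^ CARD('n) * (G l)\<^sup>2) = (LINT x|lebesgue_on (K (?z l)). f x)\<^sup>2"
        using h by (simp add: G_def avg_def power_divide power2_eq_square)
      also have "\<dots> \<le> h ^ CARD('n) * sq (K (?z l)) f"
        using integral_L2_square_le[OF fK] measure_ocell[of h "crn (?z l)"] h by simp
      finally show "h ^ CARD('n) * (G l)\<^sup>2 \<le> sq (K (?z l)) f" using hn by (simp only: mult_le_cancel_left_pos)
    qed
    let ?FF = "\<Sum>l<?m. sq (K (?z l)) (F j)"
    \<comment> \<open>Every cell takes part in at most two differences, which doubles the constant 2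
      of \<open>avg_difference_bound\<close>.\<close>
    have Y: "h ^ CARD('n) * (\<Sum>l<?m - 1. (G (Suc l) - G l)\<^sup>2) \<le> 4 * h\<^sup>2 * ?FF"
    proof -
      have "h ^ CARD('n) * (\<Sum>l<?m - 1. (G (Suc l) - G l)\<^sup>2) \<le> (\<Sum>l<?m - 1. 2 * h\<^sup>2 * (sq (K (?z l)) (F j) + sq (K (?z (Suc l))) (F j)))"
        unfolding sum_distrib_left
      proof (rule sum_mono)
        fix l assume "l \<in> {..<?m - 1}"
        then have l: "l < ?m" "Suc l < ?m" by auto
        have "crn (?z (Suc l)) = upd (crn (?z l)) j (crn (?z l) $ j + h)"
          using crn_Suc[of "?z l" j] by simp
        from avg_difference_bound[OF f h this K_subset[OF zZ[OF l(1)]] K_subset[OF zZ[OF l(2)]]]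
        show "h ^ CARD('n) * (G (Suc l) - G l)\<^sup>2 \<le> 2 * h\<^sup>2 * (sq (K (?z l)) (F j) + sq (K (?z (Suc l))) (F j))"
          by (simp add: G_def)
      qed
      also have "\<dots> = 2 * h\<^sup>2 * ((\<Sum>l<?m - 1. sq (K (?z l)) (F j)) + (\<Sum>l<?m - 1. sq (K (?z (Suc l))) (F j)))"
        by (simp add: sum_distrib_left[symmetric] sum.distrib)
      also have "\<dots> \<le> 2 * h\<^sup>2 * (?FF + ?FF)"
      proof (intro mult_left_mono add_mono)
        show "(\<Sum>l<?m - 1. sq (K (?z l)) (F j)) \<le> ?FF" by (rule sum_mono2) auto
        have "(\<Sum>l<?m - 1. sq (K (?z (Suc l))) (F j)) = (\<Sum>l\<in>Suc ` {..<?m - 1}. sq (K (?z l)) (F j))"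
          by (subst sum.reindex) auto
        also have "\<dots> \<le> ?FF" by (rule sum_mono2) auto
        finally show "(\<Sum>l<?m - 1. sq (K (?z (Suc l))) (F j)) \<le> ?FF" .
      qed (use h in auto)
      finally show ?thesis by simp
    qed
    have "(\<Sum>l<?m. h ^ CARD('n) * (G l * (h\<^sup>2 * B (?z l)))) = h ^ CARD('n) * (h * (\<Sum>l<?m. G l * (T (Suc l) - T l)))"
      unfolding sum_distrib_left by (intro sum.cong refl) (simp add: TB power2_eq_square)
    also have "\<dots> \<le> h ^ CARD('n) * (s * h\<^sup>2 * (4 / real ?m * (\<Sum>l<?m. (G l)\<^sup>2) + (4 * real ?m + 1) * (\<Sum>l<?m - 1. (G (Suc l) - G l)\<^sup>2)) + (\<Sum>l\<le>?m. (T l)\<^sup>2) / s)"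
      by (intro mult_left_mono abel_bound m s h) (use h in simp)
    also have "\<dots> = s * h\<^sup>2 * (4 / real ?m * (h ^ CARD('n) * (\<Sum>l<?m. (G l)\<^sup>2)) + (4 * real ?m + 1) * (h ^ CARD('n) * (\<Sum>l<?m - 1. (G (Suc l) - G l)\<^sup>2))) + (h ^ CARD('n) * (\<Sum>l\<le>?m. (T l)\<^sup>2)) / s"
      by (simp add: algebra_simps)
    also have "\<dots> \<le> s * h\<^sup>2 * (4 / real ?m * (\<Sum>l<?m. sq (K (?z l)) f) + (4 * real ?m + 1) * (4 * h\<^sup>2 * ?FF)) + (18 * (\<Sum>l<?m. W (?z l))) / s"
      using s h by (intro add_mono mult_left_mono divide_right_mono X Y Tb) auto
    also have "\<dots> \<le> s * h ^ 3 * (4 / L + 20 * L) * (\<Sum>l<?m. sq (K (?z l)) f + sq (K (?z l)) (F j)) + 18 * (\<Sum>l<?m. W (?z l)) / s"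
    proof -
      let ?XX = "\<Sum>l<?m. sq (K (?z l)) f"
      have X0: "0 \<le> ?XX" "0 \<le> ?FF" by (auto intro: sum_nonneg)
      \<comment> \<open>The boundary terms: the reciprocal of the number of cells is
        \<open>h / L\<close>.\<close>
      have 1: "4 / real ?m * ?XX \<le> h * (4 / L * ?XX)"
        using m h by (simp add: L')
      \<comment> \<open>The increments: the number of cells times \<open>h\<close> is
        \<open>L\<close>, so of the two powers of \<open>h\<close> one is spent and one
        remains.\<close>
      have "(4 * real ?m + 1) * (4 * h\<^sup>2) \<le> (5 * real ?m) * (4 * h\<^sup>2)" using m by (intro mult_right_mono) auto
      also have "\<dots> = h * (20 * L)" by (simp add: L' power2_eq_square)
      finally have "(4 * real ?m + 1) * (4 * h\<^sup>2) * ?FF \<le> h * (20 * L) * ?FF" using X0 by (rule_tac mult_right_mono)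
      then have 2: "(4 * real ?m + 1) * (4 * h\<^sup>2 * ?FF) \<le> h * (20 * L * ?FF)" by (simp add: mult.assoc)
      have "4 / real ?m * ?XX + (4 * real ?m + 1) * (4 * h\<^sup>2 * ?FF) \<le> h * (4 / L * ?XX + 20 * L * ?FF)"
        unfolding distrib_left[of h] by (rule add_mono[OF 1 2])
      also have "\<dots> \<le> h * ((4 / L + 20 * L) * (?XX + ?FF))"
      proof -
        have "0 \<le> 4 / L * ?FF" "0 \<le> 20 * L * ?XX" using X0 Lpos by auto
        then have "4 / L * ?XX + 20 * L * ?FF \<le> (4 / L + 20 * L) * (?XX + ?FF)" by (simp add: algebra_simps)
        then show ?thesis using h by (intro mult_left_mono) auto
      qed
      finally have "s * h\<^sup>2 * (4 / real ?m * ?XX + (4 * real ?m + 1) * (4 * h\<^sup>2 * ?FF)) \<le> s * h\<^sup>2 * (h * ((4 / L + 20 * L) * (?XX + ?FF)))"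
        using s h by (intro mult_left_mono) auto
      then show ?thesis by (simp add: sum.distrib power2_eq_square power3_eq_cube mult_ac)
    qed
    finally show ?thesis by (simp add: G_def)
  qed
  have "(\<Sum>z\<in>Z. h ^ CARD('n) * (avg h (crn z) f * (h\<^sup>2 * B z))) \<le>
     (\<Sum>z\<in>base j. s * h ^ 3 * (4 / L + 20 * L) * (\<Sum>l<?m. sq (K (z(j := l))) f + sq (K (z(j := l))) (F j)) + 18 * (\<Sum>l<?m. W (z(j := l))) / s)"
    unfolding sum_columns[where j=j] by (rule sum_mono) (rule col)
  also have "\<dots> = s * h ^ 3 * (4 / L + 20 * L) * (\<Sum>z\<in>Z. sq (K z) f + sq (K z) (F j)) + 18 * (\<Sum>z\<in>Z. W z) / s"
    unfolding sum_columns[where j=j] by (simp only: sum.distrib sum_distrib_left[symmetric] sum_divide_distrib[symmetric])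
  also have "\<dots> = s * h ^ 3 * (4 / L + 20 * L) * (sq \<Omega> f + sq \<Omega> (F j)) + 18 * sq \<Omega> (\<lambda>x. \<tau> x $ j $ j) / s"
    by (simp add: sq_mesh[OF fL(1)] sq_mesh[OF fL(2)] sq_mesh[OF \<tau>L] W_def sum.distrib)
  finally show ?thesis .
qed

end

section \<open>Discrete stability\<close>

context mesh
begin

lemma K_unique: "x \<in> K z \<Longrightarrow> x \<in> K w \<Longrightarrow> w = z"
proof
  fix k assume x: "x \<in> K z" "x \<in> K w"
  then have "crn w $ k \<le> x $ k" "x $ k \<le> crn w $ k + h" using x(2)[unfolded mem_ocell, rule_format, of k] by auto
  then show "w k = z k" by (rule K_coord_unique[OF x(1)])
qed

text \<open>Glues one function per cell; on the cell boundaries, a null set, the value is 0.\<close>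

definition patch :: "(('n \<Rightarrow> nat) \<Rightarrow> real^'n \<Rightarrow> real) \<Rightarrow> real^'n \<Rightarrow> real" where
  "patch Q x = (\<Sum>z\<in>Z. if x \<in> K z then Q z x else 0)"

lemma patch_eq: "z \<in> Z \<Longrightarrow> x \<in> K z \<Longrightarrow> patch Q x = Q z x"
proof -
  assume z: "z \<in> Z" and x: "x \<in> K z"
  have "patch Q x = (\<Sum>w\<in>Z. if w = z then Q z x else 0)"
    unfolding patch_def
  proof (rule sum.cong[OF refl])
    fix w
    show "(if x \<in> K w then Q w x else 0) = (if w = z then Q z x else 0)"
    proof (cases "w = z")
      case False
      then have "x \<notin> K w" using K_unique[OF x] by blast
      with False show ?thesis by simp
    qed (use x in simp)
  qed
  then show ?thesis using z by simp
qed

lemma patch_L2: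
  assumes "\<And>z. z \<in> Z \<Longrightarrow> continuous_on UNIV (Q z)"
  shows "patch Q \<in> L2 \<Omega>"
  unfolding patch_def
proof (rule L2_sum)
  fix z assume z: "z \<in> Z"
  have L: "Q z \<in> L2 \<Omega>" by (intro L2_continuous assms z) auto
  have "(\<lambda>x. indicator (K z) x * Q z x) \<in> borel_measurable (lebesgue_on \<Omega>)"
    by (intro borel_measurable_times L2D(1)[OF L] borel_measurable_indicator')
      (use K_subset[OF z] in \<open>simp add: sets_restrict_space_iff Int_absorb2 Int_absorb1 Collect_conj_eq\<close>)
  moreover have "(\<lambda>x. indicator (K z) x * Q z x) = (\<lambda>x. if x \<in> K z then Q z x else 0)" by (auto simp: fun_eq_iff)
  ultimately show "(\<lambda>x. if x \<in> K z then Q z x else 0) \<in> L2 \<Omega>"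
    by (intro L2_dominated[OF L, of _ 1]) auto
qed

text \<open>If \<alpha> holds the cell means of a component of the prescribed divergence, this is
  the value of its primitive on the lower face of the cell \<open>z\<close>, starting from 0 at the
  bottom of the column.\<close>

definition colsum :: "'n \<Rightarrow> (('n \<Rightarrow> nat) \<Rightarrow> real) \<Rightarrow> ('n \<Rightarrow> nat) \<Rightarrow> real" where
  "colsum i \<alpha> z = (\<Sum>l<z i. h * \<alpha> (z(i := l)))"

text \<open>Integrating a piecewise affine function along the columns in direction \<open>i\<close>; the quadratic part
  vanishes at both ends of a cell, so that the pieces match across the faces.\<close>

definition prim :: "'n \<Rightarrow> (('n \<Rightarrow> nat) \<Rightarrow> real) \<Rightarrow> (('n \<Rightarrow> nat) \<Rightarrow> real) \<Rightarrow> ('n \<Rightarrow> nat) \<Rightarrow> real^'n \<Rightarrow> real" where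
  "prim i \<alpha> \<beta> z x = colsum i \<alpha> z + \<alpha> z * (x $ i - crn z $ i)
     + \<beta> z / 2 * ((x $ i - (crn z $ i + h / 2))\<^sup>2 - h\<^sup>2 / 4)"

lemma has_partial_prim: "has_partial i (prim i \<alpha> \<beta> z) (\<lambda>x. \<alpha> z + \<beta> z * (x $ i - (crn z $ i + h / 2)))"
  unfolding prim_def
  by (rule has_partial_coord[where f="\<lambda>s. colsum i \<alpha> z + \<alpha> z * (s - crn z $ i) + \<beta> z / 2 * ((s - (crn z $ i + h / 2))\<^sup>2 - h\<^sup>2 / 4)"
      and f'="\<lambda>s. \<alpha> z + \<beta> z * (s - (crn z $ i + h / 2))"])
    (auto intro!: derivative_eq_intros continuous_intros)

lemma continuous_prim: "continuous_on UNIV (prim i \<alpha> \<beta> z)"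
  using has_partial_prim[of i \<alpha> \<beta> z] by (simp add: has_partial_def)

text \<open>Gauss's theorem on each cell leaves terms on the lower and the upper face, which
  telescope along a column. At the bottom the column sum is empty, and at the top the test function
  vanishes.\<close>

lemma prim_patch_weak_partial:
  assumes v: "v \<in> L2 \<Omega>" and ae: "\<And>z. z \<in> Z \<Longrightarrow> AE x in lebesgue_on (K z). v x = \<alpha> z + \<beta> z * (x $ i - (crn z $ i + h / 2))"
  shows "weak_partial \<Omega> i (patch (prim i \<alpha> \<beta>)) v"
  unfolding weak_partial_def
proof
  fix \<psi> assume \<psi>: "\<psi> \<in> test_functions \<Omega>"
  let ?T = "patch (prim i \<alpha> \<beta>)" and ?\<psi>' = "partials [i] \<psi>"
  have T: "?T \<in> L2 \<Omega>" by (rule patch_L2) (rule continuous_prim)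
  have sm: "has_partial i \<psi> ?\<psi>'" using \<psi> smooth_has_partial[of \<psi> i] unfolding test_functions_def by blast
  note int = test_function_integrable[OF \<psi> v, simplified] test_function_integrable[OF test_functions_partials[OF \<psi>, of "[i]"] T, simplified]
  \<comment> \<open>The face term at level \<open>l\<close> of the column through \<open>z\<close>;
    it is the same seen from the cell below and from the cell above.\<close>
  define H where "H z l = colsum i \<alpha> (z(i := l)) * face_integral h (crn z) {i} (upd 0 i (a $ i + real l * h)) \<psi>" for z l
  have cell: "(LINT x|lebesgue_on (K z). ?\<psi>' x * ?T x + \<psi> x * v x) = H z (Suc (z i)) - H z (z i)" if z: "z \<in> Z" for z
  proof -
    let ?d = "\<lambda>x. \<alpha> z + \<beta> z * (x $ i - (crn z $ i + h / 2))"
    note p = has_partial_mult[OF sm has_partial_prim[of i \<alpha> \<beta> z]]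
    have cont: "continuous_on UNIV (\<lambda>x. ?\<psi>' x * prim i \<alpha> \<beta> z x + \<psi> x * ?d x)" using p by (simp only: has_partial_def)
    have "(LINT x|lebesgue_on (K z). ?\<psi>' x * ?T x + \<psi> x * v x) = (LINT x|lebesgue_on (K z). ?\<psi>' x * prim i \<alpha> \<beta> z x + \<psi> x * ?d x)"
    proof (rule integral_cong_AE)
      show "(\<lambda>x. ?\<psi>' x * ?T x + \<psi> x * v x) \<in> borel_measurable (lebesgue_on (K z))"
        using int[THEN integrable_lebesgue_on_subset, OF K_subset[OF z]] by auto
      show "(\<lambda>x. ?\<psi>' x * prim i \<alpha> \<beta> z x + \<psi> x * ?d x) \<in> borel_measurable (lebesgue_on (K z))"
        by (rule continuous_measurable_lebesgue_on[OF cont])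
      have "AE x in lebesgue_on (K z). x \<in> K z" by (rule AE_I2) simp
      then show "AE x in lebesgue_on (K z). ?\<psi>' x * ?T x + \<psi> x * v x = ?\<psi>' x * prim i \<alpha> \<beta> z x + \<psi> x * ?d x"
        using ae[OF z] by eventually_elim (simp only: patch_eq[OF z])
    qed
    also have "\<dots> = face_integral h (crn z) {} 0 (\<lambda>x. ?\<psi>' x * prim i \<alpha> \<beta> z x + \<psi> x * ?d x)"
      by (rule ocell_integral_continuous[OF cont])
    also have "\<dots> = face_integral h (crn z) {i} (upd 0 i (crn z $ i + h)) (\<lambda>x. \<psi> x * prim i \<alpha> \<beta> z x)
        - face_integral h (crn z) {i} (upd 0 i (crn z $ i)) (\<lambda>x. \<psi> x * prim i \<alpha> \<beta> z x)"
      by (rule face_integral_partial[OF p]) (use h in auto)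
    also have "face_integral h (crn z) {i} (upd 0 i (crn z $ i + h)) (\<lambda>x. \<psi> x * prim i \<alpha> \<beta> z x) = H z (Suc (z i))"
    proof -
      have "face_integral h (crn z) {i} (upd 0 i (crn z $ i + h)) (\<lambda>x. \<psi> x * prim i \<alpha> \<beta> z x)
        = face_integral h (crn z) {i} (upd 0 i (crn z $ i + h)) (\<lambda>x. colsum i \<alpha> (z(i := Suc (z i))) * \<psi> x)"
      proof (rule face_integral_cong)
        fix x :: "real^'n" assume "\<And>k. k \<in> {i} \<Longrightarrow> x $ k = upd 0 i (crn z $ i + h) $ k"
        then have "x $ i = crn z $ i + h" by simp
        then have "prim i \<alpha> \<beta> z x = colsum i \<alpha> (z(i := Suc (z i)))"
          by (simp add: prim_def colsum_def power2_eq_square field_simps)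
        then show "\<psi> x * prim i \<alpha> \<beta> z x = colsum i \<alpha> (z(i := Suc (z i))) * \<psi> x" by simp
      qed
      moreover have "crn z $ i + h = a $ i + real (Suc (z i)) * h" by (simp add: algebra_simps)
      ultimately show ?thesis by (simp only: face_integral_mult H_def)
    qed
    also have "face_integral h (crn z) {i} (upd 0 i (crn z $ i)) (\<lambda>x. \<psi> x * prim i \<alpha> \<beta> z x) = H z (z i)"
    proof -
      have "face_integral h (crn z) {i} (upd 0 i (crn z $ i)) (\<lambda>x. \<psi> x * prim i \<alpha> \<beta> z x)
        = face_integral h (crn z) {i} (upd 0 i (crn z $ i)) (\<lambda>x. colsum i \<alpha> (z(i := z i)) * \<psi> x)"
      proof (rule face_integral_cong)
        fix x :: "real^'n" assume "\<And>k. k \<in> {i} \<Longrightarrow> x $ k = upd 0 i (crn z $ i) $ k"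
        then have "x $ i = crn z $ i" by simp
        then have "prim i \<alpha> \<beta> z x = colsum i \<alpha> (z(i := z i))"
          by (simp add: prim_def power2_eq_square field_simps)
        then show "\<psi> x * prim i \<alpha> \<beta> z x = colsum i \<alpha> (z(i := z i)) * \<psi> x" by simp
      qed
      then show ?thesis by (simp only: face_integral_mult H_def crn_nth)
    qed
    finally show ?thesis .
  qed
  have col: "(\<Sum>l<M i. H (z(i := l)) (Suc ((z(i := l)) i)) - H (z(i := l)) ((z(i := l)) i)) = 0" for z
  proof -
    have Heq: "H (z(i := l)) r = H z r" for l r
      unfolding H_def by (simp, intro disjI2 face_integral_cong_corner) auto
    have "(\<Sum>l<M i. H (z(i := l)) (Suc ((z(i := l)) i)) - H (z(i := l)) ((z(i := l)) i)) = (\<Sum>l<M i. H z (Suc l) - H z l)"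
      by (simp add: Heq)
    also have "\<dots> = H z (M i) - H z 0" by (rule sum_lessThan_telescope)
    also have "H z 0 = 0" by (simp add: H_def colsum_def)
    also have "H z (M i) = 0"
    proof -
      have e: "a $ i + real (M i) * h = b $ i" using M[of i] by simp
      have "face_integral h (crn z) {i} (upd 0 i (a $ i + real (M i) * h)) \<psi> = 0"
      proof (intro face_integral_zero test_function_outside[OF \<psi>] notI)
        fix x :: "real^'n" assume x: "\<And>k. k \<in> {i} \<Longrightarrow> x $ k = upd 0 i (a $ i + real (M i) * h) $ k" and xO: "x \<in> \<Omega>"
        have "x $ i < b $ i" using xO by (simp add: mem_box_cart)
        moreover have "x $ i = b $ i" using x[of i] e by simp
        ultimately show False by simp
      qed
      then show ?thesis by (simp add: H_def)
    qed
    finally show ?thesis by (simp only: diff_self)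
  qed
  have "(LINT x|lebesgue_on \<Omega>. ?\<psi>' x * ?T x) + (LINT x|lebesgue_on \<Omega>. \<psi> x * v x) = (LINT x|lebesgue_on \<Omega>. ?\<psi>' x * ?T x + \<psi> x * v x)"
    using int by simp
  also have "\<dots> = (\<Sum>z\<in>Z. LINT x|lebesgue_on (K z). ?\<psi>' x * ?T x + \<psi> x * v x)"
    using int by (intro integral_mesh) simp
  also have "\<dots> = (\<Sum>z\<in>Z. H z (Suc (z i)) - H z (z i))" by (rule sum.cong[OF refl cell])
  also have "\<dots> = 0" unfolding sum_columns[where j=i] col by (simp only: sum.neutral_const)
  finally show "(LINT x|lebesgue_on \<Omega>. ?\<psi>' x * ?T x) = - (LINT x|lebesgue_on \<Omega>. \<psi> x * v x)" by simp
qed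

text \<open>On a cell the primitive consists of the column sum, a linear and a quadratic part.
  Cauchy-Schwarz along the column bounds the first by the squared edge of the domain, and
  \<open>h\<close> is at most that edge. Three squares cost a factor 3, which is needed for the
  column sum and for the local parts, hence 6.\<close>

lemma prim_patch_bound:
  assumes v: "v \<in> L2 \<Omega>" and ae: "\<And>z. z \<in> Z \<Longrightarrow> AE x in lebesgue_on (K z). v x = \<alpha> z + \<beta> z * (x $ i - (crn z $ i + h / 2))"
  shows "sq \<Omega> (patch (prim i \<alpha> \<beta>)) \<le> 6 * (b $ i - a $ i)\<^sup>2 * sq \<Omega> v"
proof -
  let ?T = "patch (prim i \<alpha> \<beta>)" and ?A = "colsum i \<alpha>" and ?n = "h ^ CARD('n)"
  define L where "L = b $ i - a $ i"
  have L: "L = real (M i) * h" using M[of i] by (simp add: L_def)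
  have hL: "h \<le> L" using h Mpos[of i] by (simp add: L)
  then have h2: "h\<^sup>2 \<le> L\<^sup>2" using h by (intro power_mono) auto
  have T: "?T \<in> L2 \<Omega>" by (rule patch_L2) (rule continuous_prim)
  have vK: "sq (K z) v = ?n * ((\<alpha> z)\<^sup>2 + (\<beta> z)\<^sup>2 * h\<^sup>2 / 12)" if z: "z \<in> Z" for z
  proof -
    have "sq (K z) v = sq (K z) (\<lambda>x. \<alpha> z + \<beta> z * (x $ i - (crn z $ i + h / 2)) + 0 * (x $ i - (crn z $ i + h / 2))\<^sup>2)"
    proof (rule sq_cong_AE)
      show "v \<in> L2 (K z)" using L2_subset[OF v K_subset[OF z]] by simp
      show "(\<lambda>x. \<alpha> z + \<beta> z * (x $ i - (crn z $ i + h / 2)) + 0 * (x $ i - (crn z $ i + h / 2))\<^sup>2) \<in> L2 (K z)"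
        by (intro L2_continuous continuous_intros) auto
    qed (use ae[OF z] in simp)
    then show ?thesis unfolding sq_quadratic[OF h] by simp
  qed
  have TK: "sq (K z) ?T \<le> ?n * (3 * (?A z)\<^sup>2 + 3 * (L\<^sup>2 * ((\<alpha> z)\<^sup>2 + (\<beta> z)\<^sup>2 * h\<^sup>2 / 12)))" if z: "z \<in> Z" for z
  proof -
    define B where "B = \<bar>?A z\<bar> + h * \<bar>\<alpha> z\<bar> + \<bar>\<beta> z\<bar> * h\<^sup>2 / 8"
    have "sq (K z) ?T \<le> B\<^sup>2 * measure lebesgue (K z)"
    proof (rule sq_bounded)
      show "?T \<in> L2 (K z)" using L2_subset[OF T K_subset[OF z]] by simp
      fix x assume x: "x \<in> K z"
      then have s: "0 < x $ i - crn z $ i" "x $ i - crn z $ i < h" using x[unfolded mem_ocell, rule_format, of i] by auto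
      define s where "s = x $ i - crn z $ i"
      \<comment> \<open>The quadratic part equals -\<beta>/2 times s (h - s), a product between 0
        and a quarter of \<open>h\<close> squared.\<close>
      have "0 \<le> s * (h - s)" using s by (simp add: s_def)
      moreover have "s * (h - s) \<le> h\<^sup>2 / 4" using zero_le_power2[of "s - h / 2"] by (simp add: power2_eq_square field_simps)
      ultimately have "\<bar>\<beta> z / 2 * (s * (h - s))\<bar> \<le> \<bar>\<beta> z\<bar> * h\<^sup>2 / 8"
      proof -
        have "\<bar>\<beta> z / 2 * t\<bar> \<le> \<bar>\<beta> z\<bar> * h\<^sup>2 / 8" if "0 \<le> t" "t \<le> h\<^sup>2 / 4" for t
          using mult_left_mono[OF that(2), of "\<bar>\<beta> z\<bar> / 2"] that(1) by (simp add: abs_mult)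
        moreover assume "0 \<le> s * (h - s)" "s * (h - s) \<le> h\<^sup>2 / 4"
        ultimately show ?thesis by blast
      qed
      moreover have "\<bar>\<alpha> z * s\<bar> \<le> h * \<bar>\<alpha> z\<bar>" using mult_left_mono[of s h "\<bar>\<alpha> z\<bar>"] s unfolding s_def[symmetric] by (simp add: abs_mult mult.commute)
      moreover have "prim i \<alpha> \<beta> z x = ?A z + \<alpha> z * s - \<beta> z / 2 * (s * (h - s))"
        unfolding prim_def s_def by (simp add: power2_eq_square field_simps)
      ultimately show "\<bar>?T x\<bar> \<le> B" unfolding patch_eq[OF z x] B_def by linarith
    qed simp
    also have "\<dots> = ?n * B\<^sup>2" using measure_ocell[of h "crn z"] h by simp
    also have "\<dots> \<le> ?n * (3 * (?A z)\<^sup>2 + 3 * (L\<^sup>2 * ((\<alpha> z)\<^sup>2 + (\<beta> z)\<^sup>2 * h\<^sup>2 / 12)))"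
    proof (rule mult_left_mono)
      have 3: "(x + y + w)\<^sup>2 \<le> 3 * (x\<^sup>2 + y\<^sup>2 + w\<^sup>2)" for x y w :: real
        using zero_le_power2[of "x - y"] zero_le_power2[of "x - w"] zero_le_power2[of "y - w"]
        by (simp add: power2_eq_square algebra_simps)
      have "B\<^sup>2 \<le> 3 * (\<bar>?A z\<bar>\<^sup>2 + (h * \<bar>\<alpha> z\<bar>)\<^sup>2 + (\<bar>\<beta> z\<bar> * h\<^sup>2 / 8)\<^sup>2)" unfolding B_def by (rule 3)
      also have "\<dots> = 3 * (?A z)\<^sup>2 + 3 * (h\<^sup>2 * ((\<alpha> z)\<^sup>2 + (\<beta> z)\<^sup>2 * h\<^sup>2 / 64))"
        by (simp add: power_mult_distrib power_divide algebra_simps)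
      also have "\<dots> \<le> 3 * (?A z)\<^sup>2 + 3 * (L\<^sup>2 * ((\<alpha> z)\<^sup>2 + (\<beta> z)\<^sup>2 * h\<^sup>2 / 12))"
        by (intro add_mono mult_mono h2 order_refl divide_left_mono) auto
      finally show "B\<^sup>2 \<le> 3 * (?A z)\<^sup>2 + 3 * (L\<^sup>2 * ((\<alpha> z)\<^sup>2 + (\<beta> z)\<^sup>2 * h\<^sup>2 / 12))" .
    qed (use h in simp)
    finally show ?thesis .
  qed
  have "(\<Sum>l<M i. (?A (z(i := l)))\<^sup>2) \<le> L\<^sup>2 * (\<Sum>l<M i. (\<alpha> (z(i := l)))\<^sup>2)" for z
  proof -
    have "(?A (z(i := l)))\<^sup>2 \<le> real (M i) * (h\<^sup>2 * (\<Sum>l<M i. (\<alpha> (z(i := l)))\<^sup>2))" if "l < M i" for l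
    proof -
      have "(?A (z(i := l)))\<^sup>2 \<le> real l * (\<Sum>r<l. (h * \<alpha> (z(i := r)))\<^sup>2)"
        unfolding colsum_def using sum_square_le[of "\<lambda>r. h * \<alpha> (z(i := r))" l] by simp
      also have "\<dots> \<le> real (M i) * (\<Sum>r<M i. (h * \<alpha> (z(i := r)))\<^sup>2)"
        using that by (intro mult_mono sum_mono2 sum_nonneg) auto
      finally show ?thesis by (simp add: power_mult_distrib sum_distrib_left)
    qed
    then have "(\<Sum>l<M i. (?A (z(i := l)))\<^sup>2) \<le> (\<Sum>l<M i. real (M i) * (h\<^sup>2 * (\<Sum>l<M i. (\<alpha> (z(i := l)))\<^sup>2)))"
      by (intro sum_mono) simp
    then show ?thesis by (simp add: L power_mult_distrib power2_eq_square mult_ac)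
  qed
  then have "(\<Sum>z\<in>base i. \<Sum>l<M i. (?A (z(i := l)))\<^sup>2) \<le> (\<Sum>z\<in>base i. L\<^sup>2 * (\<Sum>l<M i. (\<alpha> (z(i := l)))\<^sup>2))"
    by (rule sum_mono)
  then have A: "(\<Sum>z\<in>Z. (?A z)\<^sup>2) \<le> L\<^sup>2 * (\<Sum>z\<in>Z. (\<alpha> z)\<^sup>2)"
    unfolding sum_columns[where j=i] by (simp only: sum_distrib_left[symmetric])
  have A': "(\<Sum>z\<in>Z. (?A z)\<^sup>2) \<le> L\<^sup>2 * (\<Sum>z\<in>Z. (\<alpha> z)\<^sup>2 + (\<beta> z)\<^sup>2 * h\<^sup>2 / 12)"
    by (rule order_trans[OF A]) (intro mult_left_mono sum_mono; simp)
  have "sq \<Omega> ?T = (\<Sum>z\<in>Z. sq (K z) ?T)" by (rule sq_mesh[OF T])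
  also have "\<dots> \<le> (\<Sum>z\<in>Z. ?n * (3 * (?A z)\<^sup>2 + 3 * (L\<^sup>2 * ((\<alpha> z)\<^sup>2 + (\<beta> z)\<^sup>2 * h\<^sup>2 / 12))))"
    by (rule sum_mono) (rule TK)
  also have "\<dots> = ?n * (3 * (\<Sum>z\<in>Z. (?A z)\<^sup>2) + 3 * (L\<^sup>2 * (\<Sum>z\<in>Z. (\<alpha> z)\<^sup>2 + (\<beta> z)\<^sup>2 * h\<^sup>2 / 12)))"
  proof -
    have e: "(\<Sum>z\<in>Z. k * (3 * f z + 3 * (l * g z))) = k * (3 * (\<Sum>z\<in>Z. f z) + 3 * (l * (\<Sum>z\<in>Z. g z)))" for k l :: real and f g
      by (simp add: sum.distrib sum_distrib_left algebra_simps)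
    show ?thesis by (rule e)
  qed
  also have "\<dots> \<le> ?n * (6 * (L\<^sup>2 * (\<Sum>z\<in>Z. (\<alpha> z)\<^sup>2 + (\<beta> z)\<^sup>2 * h\<^sup>2 / 12)))"
    using A' h by (intro mult_left_mono) auto
  also have "\<dots> = 6 * L\<^sup>2 * (\<Sum>z\<in>Z. ?n * ((\<alpha> z)\<^sup>2 + (\<beta> z)\<^sup>2 * h\<^sup>2 / 12))"
    unfolding sum_distrib_left[symmetric] by simp
  also have "(\<Sum>z\<in>Z. ?n * ((\<alpha> z)\<^sup>2 + (\<beta> z)\<^sup>2 * h\<^sup>2 / 12)) = sq \<Omega> v"
    unfolding sq_mesh[OF v] by (rule sum.cong) (simp_all add: vK)
  finally show ?thesis by (simp add: L_def)
qed

text \<open>A diagonal field is symmetric, and row \<open>i\<close> of its divergence is the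
  derivative of its entry in direction \<open>i\<close>. Each component of \<open>v\<close> is
  therefore integrated along its own direction; jumps of the entry across the other faces do not
  enter the divergence.\<close>

lemma inf_sup:
  assumes v: "v \<in> V_h a b h" and L: "\<And>i. (b $ i - a $ i)\<^sup>2 \<le> L"
  obtains \<tau> where "\<tau> \<in> Sigma_h a b h" "has_weak_div \<Omega> \<tau> v"
    "(\<Sum>i\<in>UNIV. \<Sum>j\<in>UNIV. sq \<Omega> (\<lambda>x. \<tau> x $ i $ j)) \<le> 6 * L * (\<Sum>i\<in>UNIV. sq \<Omega> (\<lambda>x. v x $ i))"
proof -
  obtain q where vL: "v \<in> L2 \<Omega>" and q: "\<forall>z\<in>Z. q z \<in> V_local \<and> (AE x in lebesgue_on (K z). v x = q z x)"
    using v unfolding V_h_iff by (elim conjE exE) (rule that)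
  have vi: "(\<lambda>x. v x $ i) \<in> L2 \<Omega>" for i using vL by auto
  have "\<forall>z\<in>Z. \<forall>i. \<exists>c0 c1. \<forall>x. q z x $ i = c0 + c1 * x $ i" using q unfolding V_local_def by simp
  then obtain c0 c1 where c: "\<forall>z\<in>Z. \<forall>i x. q z x $ i = c0 z i + c1 z i * x $ i" by metis
  define \<alpha> where "\<alpha> i z = c0 z i + c1 z i * (crn z $ i + h / 2)" for i z
  define \<beta> where "\<beta> i z = c1 z i" for i z
  have ae: "AE x in lebesgue_on (K z). v x $ i = \<alpha> i z + \<beta> i z * (x $ i - (crn z $ i + h / 2))" if z: "z \<in> Z" for z i
  proof -
    have "AE x in lebesgue_on (K z). v x = q z x" using q z by simp
    then show ?thesis by eventually_elim (use c z in \<open>simp add: \<alpha>_def \<beta>_def algebra_simps\<close>)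
  qed
  define T where "T i = patch (prim i (\<alpha> i) (\<beta> i))" for i
  have TL: "T i \<in> L2 \<Omega>" for i unfolding T_def by (rule patch_L2) (rule continuous_prim)
  have wp: "weak_partial \<Omega> i (T i) (\<lambda>x. v x $ i)" for i
    unfolding T_def by (rule prim_patch_weak_partial[OF vi]) (rule ae)
  define \<tau> :: "real^'n \<Rightarrow> real^'n^'n" where "\<tau> x = (\<chi> i j. if i = j then T i x else 0)" for x
  have \<tau>ij: "\<tau> x $ i $ j = (if i = j then T i x else 0)" for x i j by (simp add: \<tau>_def)
  have "(\<lambda>x. \<tau> x $ i $ j) \<in> L2 \<Omega>" for i j unfolding \<tau>ij by (cases "i = j") (simp_all add: TL)
  then have \<tau>L: "\<tau> \<in> L2 \<Omega>" by (intro L2_vecI)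
  have div: "has_weak_div \<Omega> \<tau> v"
    unfolding has_weak_div_iff[OF \<tau>L vL lmeasurable_box]
  proof (intro ballI allI)
    fix \<psi> i assume \<psi>: "\<psi> \<in> test_functions \<Omega>"
    have "(\<Sum>j\<in>UNIV. LINT x|lebesgue_on \<Omega>. partials [j] \<psi> x * \<tau> x $ i $ j)
      = (\<Sum>j\<in>UNIV. if j = i then (LINT x|lebesgue_on \<Omega>. partials [i] \<psi> x * T i x) else 0)"
      unfolding \<tau>ij by (intro sum.cong refl) auto
    also have "\<dots> = (LINT x|lebesgue_on \<Omega>. partials [i] \<psi> x * T i x)" by simp
    also have "\<dots> = - (LINT x|lebesgue_on \<Omega>. \<psi> x * v x $ i)"
      using wp[of i, unfolded weak_partial_def] \<psi> by blast
    finally show "(\<Sum>j\<in>UNIV. LINT x|lebesgue_on \<Omega>. partials [j] \<psi> x * \<tau> x $ i $ j) = - (LINT x|lebesgue_on \<Omega>. \<psi> x * v x $ i)" .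
  qed
  have "\<tau> \<in> Sigma_h a b h"
    unfolding Sigma_h_iff
  proof (intro conjI exI ballI)
    have "transpose (\<tau> x) = \<tau> x" for x by (simp add: vec_eq_iff transpose_def \<tau>ij)
    then show "\<tau> \<in> Hdiv_sym \<Omega>" unfolding Hdiv_sym_def using \<tau>L vL div by auto
    fix z assume z: "z \<in> Z"
    let ?q = "\<lambda>z x. (\<chi> i j. if i = j then prim i (\<alpha> i) (\<beta> i) z x else 0) :: real^'n^'n"
    have "AE x in lebesgue_on (K z). x \<in> K z" by (rule AE_I2) simp
    then show "AE x in lebesgue_on (K z). \<tau> x = ?q z x"
      by eventually_elim (simp add: \<tau>_def T_def patch_eq[OF z] cong: if_cong)
    have "\<exists>c0 c1 c2. \<forall>x. prim i (\<alpha> i) (\<beta> i) z x = c0 + c1 * x $ i + c2 * (x $ i)\<^sup>2" for i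
      by (rule exI[of _ "colsum i (\<alpha> i) z - \<alpha> i z * crn z $ i + \<beta> i z / 2 * ((crn z $ i + h / 2)\<^sup>2 - h\<^sup>2 / 4)"],
          rule exI[of _ "\<alpha> i z - \<beta> i z * (crn z $ i + h / 2)"], rule exI[of _ "\<beta> i z / 2"])
        (simp add: prim_def power2_eq_square field_simps)
    moreover have "\<exists>c0 c1 c2 c3. \<forall>x. (0::real) = c0 + c1 * x $ i + c2 * x $ j + c3 * (x $ i * x $ j)" for i j :: 'n
      by (rule exI[of _ 0])+ simp
    moreover have "transpose (?q z x) = ?q z x" for x by (simp add: vec_eq_iff transpose_def)
    ultimately show "?q z \<in> Sigma_local"
      unfolding Sigma_local_def mem_Collect_eq by simp
  qed
  moreover have "(\<Sum>i\<in>UNIV. \<Sum>j\<in>UNIV. sq \<Omega> (\<lambda>x. \<tau> x $ i $ j)) \<le> 6 * L * (\<Sum>i\<in>UNIV. sq \<Omega> (\<lambda>x. v x $ i))"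
    unfolding sum_distrib_left[of "6 * L"]
  proof (rule sum_mono)
    fix i
    have "(\<Sum>j\<in>UNIV. sq \<Omega> (\<lambda>x. \<tau> x $ i $ j)) = (\<Sum>j\<in>UNIV. if j = i then sq \<Omega> (T i) else 0)"
      unfolding \<tau>ij by (intro sum.cong refl) (auto simp: sq_def)
    also have "\<dots> = sq \<Omega> (T i)" by simp
    also have "\<dots> \<le> 6 * (b $ i - a $ i)\<^sup>2 * sq \<Omega> (\<lambda>x. v x $ i)"
      unfolding T_def by (rule prim_patch_bound[OF vi]) (rule ae)
    also have "\<dots> \<le> 6 * L * sq \<Omega> (\<lambda>x. v x $ i)" by (intro mult_right_mono mult_left_mono L) auto
    finally show "(\<Sum>j\<in>UNIV. sq \<Omega> (\<lambda>x. \<tau> x $ i $ j)) \<le> 6 * L * sq \<Omega> (\<lambda>x. v x $ i)" .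
  qed
  ultimately show ?thesis using div by (intro that[of \<tau>])
qed

end

section \<open>Components of the exact solution\<close>

lemma L2_inner_diff_left:
  assumes "f \<in> L2 S" "g \<in> L2 S" "k \<in> L2 S"
  shows "L2_inner S (\<lambda>x. f x - g x) k = L2_inner S f k - L2_inner S g k"
  using assms by (simp add: L2_inner_def inner_diff_left L2_inner_integrable)

lemma L2_inner_commute: "L2_inner S f g = L2_inner S g f"
  by (simp add: L2_inner_def inner_commute)

lemma L2_inner_diff_right:
  assumes "f \<in> L2 S" "g \<in> L2 S" "k \<in> L2 S"
  shows "L2_inner S k (\<lambda>x. f x - g x) = L2_inner S k f - L2_inner S k g"
  using L2_inner_diff_left[OF assms] by (simp add: L2_inner_commute[of S k])

lemma L2_inner_cong_AE:
  assumes "f \<in> L2 S" "f' \<in> L2 S" "g \<in> L2 S" "AE x in lebesgue_on S. f x = f' x"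
  shows "L2_inner S f g = L2_inner S f' g"
  unfolding L2_inner_def
proof (rule integral_cong_AE)
  show "(\<lambda>x. f x \<bullet> g x) \<in> borel_measurable (lebesgue_on S)" "(\<lambda>x. f' x \<bullet> g x) \<in> borel_measurable (lebesgue_on S)"
    using L2_inner_integrable[OF assms(1,3)] L2_inner_integrable[OF assms(2,3)] by auto
  show "AE x in lebesgue_on S. f x \<bullet> g x = f' x \<bullet> g x" using assms(4) by eventually_elim simp
qed

lemma L2_inner_self_nonneg [simp]: "0 \<le> L2_inner S f f"
  by (simp add: L2_inner_def)

lemma L2_norm_square: "(L2_norm S f)\<^sup>2 = L2_inner S f f"
  by (simp add: L2_norm_def)

lemma L2_inner_vec:
  fixes f g :: "real^'n \<Rightarrow> 'c::euclidean_space^'m"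
  assumes "f \<in> L2 S" "g \<in> L2 S"
  shows "L2_inner S f g = (\<Sum>i\<in>UNIV. L2_inner S (\<lambda>x. f x $ i) (\<lambda>x. g x $ i))"
  unfolding L2_inner_def inner_vec_def
  by (rule Bochner_Integration.integral_sum) (intro L2_inner_integrable L2_nth assms)

lemma L2_inner_vec_real:
  fixes f g :: "real^'n \<Rightarrow> real^'m"
  assumes "f \<in> L2 S" "g \<in> L2 S"
  shows "L2_inner S f g = (\<Sum>i\<in>UNIV. LINT x|lebesgue_on S. f x $ i * g x $ i)"
  unfolding L2_inner_vec[OF assms] by (simp add: L2_inner_def)

lemma L2_inner_mat:
  fixes f g :: "real^'n \<Rightarrow> real^'m^'p"
  assumes "f \<in> L2 S" "g \<in> L2 S"
  shows "L2_inner S f g = (\<Sum>i\<in>UNIV. \<Sum>j\<in>UNIV. LINT x|lebesgue_on S. f x $ i $ j * g x $ i $ j)"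
  unfolding L2_inner_vec[OF assms] by (intro sum.cong refl L2_inner_vec_real L2_nth assms)

lemma L2_inner_self_vec: "f \<in> L2 S \<Longrightarrow> L2_inner S f f = (\<Sum>i\<in>UNIV. sq S (\<lambda>x. f x $ i :: real))"
  by (simp add: L2_inner_vec_real sq_def power2_eq_square)

lemma L2_inner_self_mat: "f \<in> L2 S \<Longrightarrow> L2_inner S f f = (\<Sum>i\<in>UNIV. \<Sum>j\<in>UNIV. sq S (\<lambda>x. f x $ i $ j :: real))"
  by (simp add: L2_inner_mat sq_def power2_eq_square)

lemma L2_inner_self_diff_le:
  assumes "f \<in> L2 S" "g \<in> L2 S"
  shows "L2_inner S (\<lambda>x. f x - g x) (\<lambda>x. f x - g x) \<le> 2 * L2_inner S f f + 2 * L2_inner S g g"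
proof -
  have "L2_inner S (\<lambda>x. f x - g x) (\<lambda>x. f x - g x) \<le> (LINT x|lebesgue_on S. 2 * (f x \<bullet> f x) + 2 * (g x \<bullet> g x))"
    unfolding L2_inner_def
  proof (rule integral_mono)
    fix x
    have "0 \<le> (f x + g x) \<bullet> (f x + g x)" by simp
    then show "(f x - g x) \<bullet> (f x - g x) \<le> 2 * (f x \<bullet> f x) + 2 * (g x \<bullet> g x)"
      by (simp add: inner_simps inner_commute)
  qed (use assms in \<open>auto intro!: L2_inner_integrable L2_diff\<close>)
  then show ?thesis using assms by (simp add: L2_inner_def L2_inner_integrable)
qed

text \<open>For the empty list the function itself is used, because the chosen weak derivative of
  order zero is determined only almost everywhere.\<close>

lemma component_weak_derivs:
  fixes u :: "real^'n \<Rightarrow> real^'m^'p"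
  assumes u: "u \<in> sobolev k S" and S: "S \<in> lmeasurable"
  shows "weak_derivs S k (\<lambda>x. u x $ i $ j) (\<lambda>xs x. (if xs = [] then u x else weak_deriv S (count_list xs) u x) $ i $ j)"
  unfolding weak_derivs_def
proof (intro conjI allI impI)
  fix xs :: "'n list" assume xs: "length xs \<le> k"
  define W where "W x = (if xs = [] then u x else weak_deriv S (count_list xs) u x)" for x
  have uL: "u \<in> L2 S" using u by (simp add: sobolev_def)
  have "has_weak_deriv S (count_list []) u u" by (simp add: has_weak_deriv_def count_list_eq_iff_mset count_list_0_iff) 
  with sobolev_weak_deriv[OF u xs] uL have W: "W \<in> L2 S" "has_weak_deriv S (count_list xs) u W"
    unfolding W_def by (cases "xs = []"; simp)+
  show "(\<lambda>x. (if xs = [] then u x else weak_deriv S (count_list xs) u x) $ i $ j) \<in> L2 S"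
    unfolding W_def[symmetric] using W(1) by auto
  show "has_weak_deriv S (count_list xs) (\<lambda>x. u x $ i $ j) (\<lambda>x. (if xs = [] then u x else weak_deriv S (count_list xs) u x) $ i $ j)"
    unfolding W_def[symmetric] has_weak_deriv_def
  proof (intro ballI allI impI)
    fix \<psi> ys assume \<psi>: "\<psi> \<in> test_functions S" and ys: "\<forall>i. count_list ys i = count_list xs i"
    have nth: "(LINT x|lebesgue_on S. f x *\<^sub>R v x $ i $ j) = (LINT x|lebesgue_on S. f x *\<^sub>R v x) $ i $ j"
      if "f \<in> test_functions S" "v \<in> L2 S" for f and v :: "real^'n \<Rightarrow> real^'m^'p"
    proof -
      note int = test_function_integrable[OF that S]
      have "integrable (lebesgue_on S) (\<lambda>x. (f x *\<^sub>R v x) $ i)"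
        using test_function_integrable[OF that(1) L2_nth[OF that(2)] S] by simp
      from integral_vec_nth[OF this, of j] integral_vec_nth[OF int, of i] show ?thesis by simp
    qed
    show "(LINT x|lebesgue_on S. partials ys \<psi> x *\<^sub>R u x $ i $ j) = (- 1) ^ (\<Sum>i\<in>UNIV. count_list xs i) *\<^sub>R (LINT x|lebesgue_on S. \<psi> x *\<^sub>R W x $ i $ j)"
      unfolding nth[OF test_functions_partials[OF \<psi>] uL] nth[OF \<psi> W(1)]
      using W(2)[unfolded has_weak_deriv_def, rule_format, OF \<psi>, of ys] ys by simp
  qed
qed simp

lemma Sigma_local_diagonal:
  assumes "q \<in> Sigma_local"
  shows "\<exists>A B E. \<forall>x. q x $ i $ i = A + B * (x $ i - c) + E * (x $ i - c)\<^sup>2"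
proof -
  obtain c0 c1 c2 where q: "\<forall>x. q x $ i $ i = c0 + c1 * x $ i + c2 * (x $ i)\<^sup>2"
    using assms unfolding Sigma_local_def by blast
  show ?thesis
    by (rule exI[of _ "c0 + c1 * c + c2 * c\<^sup>2"], rule exI[of _ "c1 + 2 * c2 * c"], rule exI[of _ c2])
      (simp add: q power2_eq_square algebra_simps)
qed

lemma Sigma_local_offdiagonal:
  assumes "q \<in> Sigma_local" "i \<noteq> j"
  shows "\<exists>A B E G. \<forall>x. q x $ i $ j = A + B * (x $ i - c) + E * (x $ j - d) + G * ((x $ i - c) * (x $ j - d))"
proof -
  obtain c0 c1 c2 c3 where q: "\<forall>x. q x $ i $ j = c0 + c1 * x $ i + c2 * x $ j + c3 * (x $ i * x $ j)"
    using assms unfolding Sigma_local_def by blast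
  show ?thesis
    by (rule exI[of _ "c0 + c1 * c + c2 * d + c3 * (c * d)"], rule exI[of _ "c1 + c3 * d"], rule exI[of _ "c2 + c3 * c"], rule exI[of _ c3])
      (simp add: q algebra_simps)
qed

context mesh
begin

lemma Z_nonempty: "(\<lambda>_. 0) \<in> Z"
  using Mpos by (simp add: Z_def)

end

locale interpolation = mesh a b h M for a b :: "real^'n" and h M +
  fixes \<sigma> \<pi> :: "real^'n \<Rightarrow> real^'n^'n"
  assumes \<sigma>: "\<sigma> \<in> Hdiv_sym \<Omega>" and \<sigma>3: "\<sigma> \<in> sobolev 3 \<Omega>" and \<pi>: "is_interpolant a b h \<sigma> \<pi>"
begin

definition D :: "'n \<Rightarrow> 'n \<Rightarrow> 'n list \<Rightarrow> real^'n \<Rightarrow> real" where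
  "D i j xs x = (if xs = [] then \<sigma> x else weak_deriv \<Omega> (count_list xs) \<sigma> x) $ i $ j"

definition N :: real where "N = (sobolev_norm 3 \<Omega> \<sigma>)\<^sup>2"

lemma N_nonneg: "0 \<le> N" by (simp add: N_def)

lemma \<sigma>L2: "\<sigma> \<in> L2 \<Omega>" using Hdiv_symD(1)[OF \<sigma>] .

lemma D: "weak_derivs \<Omega> 3 (\<lambda>x. \<sigma> x $ i $ j) (D i j)"
  using component_weak_derivs[OF \<sigma>3 lmeasurable_box, of i j] unfolding D_def .

lemma D2: "weak_derivs \<Omega> 2 (\<lambda>x. \<sigma> x $ i $ j) (D i j)"
  by (rule weak_derivs_mono[OF D]) simp

lemma D_L2: "length xs \<le> 3 \<Longrightarrow> D i j xs \<in> L2 \<Omega>"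
  by (rule weak_derivs_L2[OF D])

lemma D_N:
  assumes "xs \<noteq> []" "length xs \<le> 3"
  shows "sq \<Omega> (D i j xs) \<le> N"
proof -
  let ?W = "weak_deriv \<Omega> (count_list xs) \<sigma>"
  have W: "?W \<in> L2 \<Omega>" by (rule sobolev_weak_deriv(1)[OF \<sigma>3 assms(2)])
  have "sq \<Omega> (D i j xs) = sq \<Omega> (\<lambda>x. ?W x $ i $ j)" using assms(1) by (simp add: D_def[abs_def])
  also have "\<dots> \<le> (\<Sum>j\<in>UNIV. sq \<Omega> (\<lambda>x. ?W x $ i $ j))"
    by (rule member_le_sum[of j _ "\<lambda>j. sq \<Omega> (\<lambda>x. ?W x $ i $ j)"]) auto
  also have "\<dots> \<le> (\<Sum>i\<in>UNIV. \<Sum>j\<in>UNIV. sq \<Omega> (\<lambda>x. ?W x $ i $ j))"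
    by (rule member_le_sum[of i _ "\<lambda>i. \<Sum>j\<in>UNIV. sq \<Omega> (\<lambda>x. ?W x $ i $ j)"]) (auto intro: sum_nonneg)
  also have "\<dots> = (L2_norm \<Omega> ?W)\<^sup>2" by (simp add: L2_norm_square L2_inner_self_mat[OF W])
  also have "\<dots> \<le> N" unfolding N_def by (rule sobolev_norm_ge[OF assms(2)])
  finally show ?thesis .
qed

lemma \<pi>_Sigma_h: "\<pi> \<in> Sigma_h a b h" using \<pi> by (simp add: is_interpolant_def)

definition piece :: "('n \<Rightarrow> nat) \<Rightarrow> real^'n \<Rightarrow> real^'n^'n" where
  "piece z = (SOME q. is_local_interpolant \<Omega> h (crn z) \<sigma> q \<and> (AE x in lebesgue_on (K z). \<pi> x = q x))"

lemma piece:
  assumes "z \<in> Z"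
  shows "is_local_interpolant \<Omega> h (crn z) \<sigma> (piece z)" "AE x in lebesgue_on (K z). \<pi> x = piece z x"
proof -
  have "\<exists>q. is_local_interpolant \<Omega> h (crn z) \<sigma> q \<and> (AE x in lebesgue_on (cell h (crn z)). \<pi> x = q x)"
    using \<pi> assms unfolding is_interpolant_def mesh_corners by blast
  then have "\<exists>q. is_local_interpolant \<Omega> h (crn z) \<sigma> q \<and> (AE x in lebesgue_on (K z). \<pi> x = q x)"
    by (simp only: AE_cell_iff)
  from someI_ex[OF this] show "is_local_interpolant \<Omega> h (crn z) \<sigma> (piece z)" "AE x in lebesgue_on (K z). \<pi> x = piece z x"
    unfolding piece_def by blast+
qed

lemma piece_local: "z \<in> Z \<Longrightarrow> piece z \<in> Sigma_local"
  using piece(1) unfolding is_local_interpolant_def by blast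

lemma piece_diagonal:
  assumes "z \<in> Z"
  shows "c $ i \<in> {crn z $ i, crn z $ i + h} \<Longrightarrow>
      has_trace_integral \<Omega> h (crn z) {i} c (\<lambda>x. \<sigma> x $ i $ i) (face_integral h (crn z) {i} c (\<lambda>x. piece z x $ i $ i))"
    and "(LINT x|lebesgue_on (K z). piece z x $ i $ i) = (LINT x|lebesgue_on (K z). \<sigma> x $ i $ i)"
proof -
  note p = piece(1)[OF assms, unfolded is_local_interpolant_def cell_ocell(3), THEN conjunct2]
  show "has_trace_integral \<Omega> h (crn z) {i} c (\<lambda>x. \<sigma> x $ i $ i) (face_integral h (crn z) {i} c (\<lambda>x. piece z x $ i $ i))"
    if "c $ i \<in> {crn z $ i, crn z $ i + h}"
    using p[THEN conjunct1] that by blast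
  show "(LINT x|lebesgue_on (K z). piece z x $ i $ i) = (LINT x|lebesgue_on (K z). \<sigma> x $ i $ i)"
    using p[THEN conjunct2, THEN conjunct1] by blast
qed

lemma piece_offdiagonal:
  assumes "z \<in> Z" "i \<noteq> j" "c $ i \<in> {crn z $ i, crn z $ i + h}" "c $ j \<in> {crn z $ j, crn z $ j + h}"
  shows "\<exists>m. has_trace_integral \<Omega> h (crn z) {i, j} c (\<lambda>x. \<sigma> x $ i $ j) m \<and>
             (\<forall>x\<in>face h (crn z) {i, j} c. piece z x $ i $ j = m / h ^ (CARD('n) - 2))"
  using piece(1)[OF assms(1)] assms(2-) unfolding is_local_interpolant_def by blast

text \<open>One face condition on one cell provides a sequence that converges on the whole domain,
  and this serves all cells. The zero index belongs to a cell of every mesh.\<close>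

lemma trace_exists: "\<exists>p I c m. has_trace_integral \<Omega> h p I c (\<lambda>x. \<sigma> x $ i $ j) m"
proof (cases "i = j")
  case True
  then show ?thesis using piece_diagonal(1)[OF Z_nonempty, of "crn (\<lambda>_. 0)" i] by blast
next
  case False
  from piece_offdiagonal[OF Z_nonempty this, of "crn (\<lambda>_. 0)"] show ?thesis by blast
qed

lemma C1_limits: "C1_limit \<Omega> (\<lambda>x. \<sigma> x $ i $ j) (\<lambda>k. D i j [k])" "C1_limit \<Omega> (D i j [l]) (\<lambda>k. D i j [k, l])"
  using trace_exists[of i j] trace_integral_C1_limit[OF _ D2] by blast+

lemma h2_cell: "z \<in> Z \<Longrightarrow> h2_cell a b (\<lambda>x. \<sigma> x $ i $ j) (D i j) h (crn z)"
  by unfold_locales (rule D2 C1_limits h K_subset | assumption)+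

lemma weak_div_\<sigma>: "AE x in lebesgue_on \<Omega>. \<forall>i. weak_div \<Omega> \<sigma> x $ i = (\<Sum>j\<in>UNIV. D i j [j] x)"
proof -
  let ?w = "\<lambda>x. (\<chi> i. \<Sum>j\<in>UNIV. D i j [j] x) :: real^'n"
  have L: "?w \<in> L2 \<Omega>" by (rule L2_vecI) (auto intro!: L2_sum D_L2)
  have "has_weak_div \<Omega> \<sigma> ?w"
    unfolding has_weak_div_iff[OF \<sigma>L2 L lmeasurable_box]
  proof (intro ballI allI)
    fix \<psi> i assume \<psi>: "\<psi> \<in> test_functions \<Omega>"
    have "(LINT x|lebesgue_on \<Omega>. partials [j] \<psi> x * \<sigma> x $ i $ j) = - (LINT x|lebesgue_on \<Omega>. \<psi> x * D i j [j] x)" for j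
    proof -
      have "has_weak_deriv \<Omega> (count_list [j]) (\<lambda>x. \<sigma> x $ i $ j) (D i j [j])" using D by (simp add: weak_derivs_def)
      from this[unfolded has_weak_deriv_def, rule_format, OF \<psi>, of "[j]"] show ?thesis
        unfolding sum_count_list_UNIV by simp
    qed
    moreover have "(LINT x|lebesgue_on \<Omega>. \<psi> x * ?w x $ i) = (\<Sum>j\<in>UNIV. LINT x|lebesgue_on \<Omega>. \<psi> x * D i j [j] x)"
      using test_function_integrable[OF \<psi> D_L2 lmeasurable_box] by (simp add: sum_distrib_left)
    ultimately show "(\<Sum>j\<in>UNIV. LINT x|lebesgue_on \<Omega>. partials [j] \<psi> x * \<sigma> x $ i $ j) = - (LINT x|lebesgue_on \<Omega>. \<psi> x * ?w x $ i)"
      by (simp add: sum_negf)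
  qed
  from has_weak_div_unique[OF Hdiv_symD(3)[OF \<sigma>] this \<sigma>L2 Hdiv_symD(2)[OF \<sigma>] L]
  show ?thesis by eventually_elim simp
qed

text \<open>On a cell the component \<open>i\<close> of \<open>d\<close> is affine in
  \<open>x $ i\<close>, which is the kind of weight in both cell estimates. Diagonal entries
  contribute nothing and off-diagonal ones cost \<open>h ^ 4\<close>, a better rate than that of the
  stress pairing.\<close>

lemma weak_div_consistency:
  assumes d: "d \<in> V_h a b h" and s: "0 < s"
  shows "L2_inner \<Omega> (\<lambda>x. weak_div \<Omega> \<sigma> x - weak_div \<Omega> \<pi> x) d
     \<le> real CARD('n) ^ 2 * (s * h ^ 4 * N) + real CARD('n) * L2_inner \<Omega> d d / s"
proof -
  obtain q where dL: "d \<in> L2 \<Omega>" and q: "\<forall>z\<in>Z. q z \<in> V_local \<and> (AE x in lebesgue_on (K z). d x = q z x)"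
    using d unfolding V_h_iff by (elim conjE exE) (rule that)
  have diL: "(\<lambda>x. d x $ i) \<in> L2 \<Omega>" for i using dL by auto
  have \<pi>H: "\<pi> \<in> Hdiv_sym \<Omega>" using \<pi>_Sigma_h unfolding Sigma_h_iff by blast
  let ?w = "\<lambda>x. weak_div \<Omega> \<sigma> x - weak_div \<Omega> \<pi> x"
  have wL: "?w \<in> L2 \<Omega>" using Hdiv_symD(2)[OF \<sigma>] Hdiv_symD(2)[OF \<pi>H] by auto
  have cell: "(LINT x|lebesgue_on (K z). ?w x $ i * d x $ i)
      \<le> (\<Sum>j\<in>UNIV. s * h ^ 4 * sq (K z) (D i j [i, i, j]) + sq (K z) (\<lambda>x. d x $ i) / s)" if z: "z \<in> Z" for z i
  proof -
    let ?m = "\<lambda>k. crn z $ k + h / 2"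
    have "q z \<in> V_local" using q z by blast
    then obtain c0 c1 where c: "\<forall>x. q z x $ i = c0 + c1 * x $ i" unfolding V_local_def by blast
    define \<alpha> where "\<alpha> = c0 + c1 * ?m i"
    let ?d = "\<lambda>x. \<alpha> + c1 * (x $ i - ?m i)"
    have AEd: "AE x in lebesgue_on (K z). d x $ i = ?d x"
    proof -
      have "AE x in lebesgue_on (K z). d x = q z x" using q z by blast
      then show ?thesis by eventually_elim (simp add: c \<alpha>_def algebra_simps)
    qed
    have dK: "?d \<in> L2 (K z)" by (intro L2_continuous continuous_intros) auto
    have sqd: "sq (K z) ?d = sq (K z) (\<lambda>x. d x $ i)"
      by (rule sq_cong_AE[OF dK, symmetric, THEN sym]) (use AEd L2_subset[OF diL K_subset[OF z]] in \<open>auto elim: eventually_mono\<close>)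
    have "\<exists>A B E. \<forall>x. piece z x $ k $ k = A + B * (x $ k - ?m k) + E * (x $ k - ?m k)\<^sup>2" for k
      by (rule Sigma_local_diagonal[OF piece_local[OF z]])
    then obtain A B E where dia: "\<forall>k x. piece z x $ k $ k = A k + B k * (x $ k - ?m k) + E k * (x $ k - ?m k)\<^sup>2" by metis
    have "\<forall>k l. \<exists>A B E G. k \<noteq> l \<longrightarrow> (\<forall>x. piece z x $ k $ l = A + B * (x $ k - ?m k) + E * (x $ l - ?m l) + G * ((x $ k - ?m k) * (x $ l - ?m l)))"
      using Sigma_local_offdiagonal[OF piece_local[OF z]] by blast
    then obtain A' B' E' G' where off: "\<forall>k l. k \<noteq> l \<longrightarrow> (\<forall>x. piece z x $ k $ l = A' k l + B' k l * (x $ k - ?m k) + E' k l * (x $ l - ?m l) + G' k l * ((x $ k - ?m k) * (x $ l - ?m l)))" by metis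
    define \<delta> where "\<delta> k l x = (if k = l then B k + 2 * E k * (x $ k - ?m k) else E' k l + G' k l * (x $ k - ?m k))" for k l and x :: "real^'n"
    have \<delta>: "has_partial l (\<lambda>x. piece z x $ k $ l) (\<delta> k l)" for k l
    proof (cases "k = l")
      case True
      have "has_partial k (\<lambda>x. A k + B k * (x $ k - ?m k) + E k * (x $ k - ?m k)\<^sup>2) (\<lambda>x. B k + 2 * E k * (x $ k - ?m k))"
        by (rule has_partial_coord[where f="\<lambda>s. A k + B k * (s - ?m k) + E k * (s - ?m k)\<^sup>2" and f'="\<lambda>s. B k + 2 * E k * (s - ?m k)"])
          (auto intro!: derivative_eq_intros continuous_intros)
      then show ?thesis using True dia by (simp add: \<delta>_def[abs_def])
    next
      case False
      have 1: "has_partial l (\<lambda>x::real^'n. x $ l - ?m l) (\<lambda>x. 1)"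
        by (rule has_partial_coord[where f="\<lambda>s. s - ?m l" and f'="\<lambda>s. 1"]) (auto intro!: derivative_eq_intros continuous_intros)
      have 2: "has_partial l (\<lambda>x. A' k l + B' k l * (x $ k - ?m k)) (\<lambda>x. 0)" "has_partial l (\<lambda>x. E' k l + G' k l * (x $ k - ?m k)) (\<lambda>x. 0)"
        by (rule has_partial_indep; use False in \<open>auto simp: axis_def intro!: continuous_intros\<close>)+
      from has_partial_add[OF 2(1) has_partial_mult[OF 2(2) 1]]
      show ?thesis using False off by (simp add: \<delta>_def[abs_def] distrib_right add.assoc mult.assoc)
    qed
    have "AE x in lebesgue_on (K z). \<forall>i. weak_div \<Omega> \<pi> x $ i = (\<Sum>j\<in>UNIV. \<delta> i j x)"
      by (rule weak_div_piece[OF \<pi>H z piece(2)[OF z] \<delta>])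
    moreover have "AE x in lebesgue_on (K z). \<forall>i. weak_div \<Omega> \<sigma> x $ i = (\<Sum>j\<in>UNIV. D i j [j] x)"
      by (rule AE_lebesgue_on_subset[OF _ _ K_subset[OF z] weak_div_\<sigma>]) auto
    ultimately have ae: "AE x in lebesgue_on (K z). ?w x $ i * d x $ i = (\<Sum>j\<in>UNIV. (D i j [j] x - \<delta> i j x) * ?d x)"
      using AEd by eventually_elim (simp add: sum_subtractf[symmetric] sum_distrib_right[symmetric])
    have \<delta>L: "\<delta> i j \<in> L2 (K z)" for j
      using \<delta>[of j i] by (intro L2_continuous) (auto simp: has_partial_def)
    have int: "integrable (lebesgue_on (K z)) (\<lambda>x. (D i j [j] x - \<delta> i j x) * ?d x)" for j
      by (intro L2_mult_integrable dK L2_diff \<delta>L L2_subset[OF D_L2 K_subset[OF z]]) auto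
    have "(LINT x|lebesgue_on (K z). ?w x $ i * d x $ i) = (LINT x|lebesgue_on (K z). (\<Sum>j\<in>UNIV. (D i j [j] x - \<delta> i j x) * ?d x))"
    proof (rule integral_cong_AE[OF _ _ ae])
      have "integrable (lebesgue_on (K z)) (\<lambda>x. ?w x $ i * d x $ i)"
        by (intro L2_mult_integrable L2_subset[OF diL K_subset[OF z]] L2_subset[OF L2_nth[OF wL] K_subset[OF z]]) auto
      then show "(\<lambda>x. ?w x $ i * d x $ i) \<in> borel_measurable (lebesgue_on (K z))" by auto
      show "(\<lambda>x. \<Sum>j\<in>UNIV. (D i j [j] x - \<delta> i j x) * ?d x) \<in> borel_measurable (lebesgue_on (K z))"
        using int by (intro borel_measurable_sum) auto
    qed
    also have "\<dots> = (\<Sum>j\<in>UNIV. LINT x|lebesgue_on (K z). (D i j [j] x - \<delta> i j x) * ?d x)"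
      by (rule Bochner_Integration.integral_sum) (rule int)
    also have "\<dots> \<le> (\<Sum>j\<in>UNIV. s * h ^ 4 * sq (K z) (D i j [i, i, j]) + sq (K z) ?d / s)"
    proof (rule sum_mono)
      fix j
      interpret c: h2_cell a b "\<lambda>x. \<sigma> x $ i $ j" "D i j" h "crn z" by (rule h2_cell[OF z])
      show "(LINT x|lebesgue_on (K z). (D i j [j] x - \<delta> i j x) * ?d x) \<le> s * h ^ 4 * sq (K z) (D i j [i, i, j]) + sq (K z) ?d / s"
      proof (cases "i = j")
        case True
        have "(LINT x|lebesgue_on (K z). (D i j [i] x - \<delta> i i x) * ?d x) = 0"
          by (rule c.diagonal_div_consistency[OF \<delta>]) (use piece_diagonal[OF z] True in auto)
        then have "(LINT x|lebesgue_on (K z). (D i j [j] x - \<delta> i j x) * ?d x) = 0" using True by simp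
        then show ?thesis using s h by simp
      next
        case False
        have "(LINT x|lebesgue_on (K z). (D i j [j] x - (E' i j + G' i j * (x $ i - ?m i))) * ?d x) \<le> s * h ^ 4 * sq (K z) (D i j [i, i, j]) + sq (K z) ?d / s"
          by (rule c.offdiagonal_div_consistency[OF D False, of "\<lambda>x. piece z x $ i $ j" "A' i j" "B' i j"])
            (use False off piece_offdiagonal[OF z False] s in simp_all)
        then show ?thesis using False by (simp add: \<delta>_def)
      qed
    qed
    finally show ?thesis unfolding sqd .
  qed
  have "L2_inner \<Omega> ?w d = (\<Sum>i\<in>UNIV. LINT x|lebesgue_on \<Omega>. ?w x $ i * d x $ i)" by (rule L2_inner_vec_real[OF wL dL])
  also have "\<dots> = (\<Sum>i\<in>UNIV. \<Sum>z\<in>Z. LINT x|lebesgue_on (K z). ?w x $ i * d x $ i)"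
    by (intro sum.cong refl integral_mesh L2_mult_integrable diL L2_nth wL)
  also have "\<dots> \<le> (\<Sum>i\<in>UNIV. \<Sum>z\<in>Z. \<Sum>j\<in>UNIV. s * h ^ 4 * sq (K z) (D i j [i, i, j]) + sq (K z) (\<lambda>x. d x $ i) / s)"
    by (intro sum_mono cell)
  also have "\<dots> = (\<Sum>i\<in>UNIV. \<Sum>j\<in>UNIV. s * h ^ 4 * sq \<Omega> (D i j [i, i, j]) + sq \<Omega> (\<lambda>x. d x $ i) / s)"
    unfolding sum.swap[of _ UNIV Z]
    by (simp add: sum.distrib sq_mesh[OF D_L2] sq_mesh[OF diL] sum_distrib_left sum_divide_distrib)
  also have "\<dots> \<le> (\<Sum>i\<in>UNIV. \<Sum>j\<in>(UNIV::'n set). s * h ^ 4 * N + sq \<Omega> (\<lambda>x. d x $ i) / s)"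
    by (intro sum_mono add_mono mult_left_mono D_N order_refl) (use s h in auto)
  also have "\<dots> = real CARD('n) ^ 2 * (s * h ^ 4 * N) + real CARD('n) * L2_inner \<Omega> d d / s"
    by (simp add: L2_inner_self_vec[OF dL] sum.distrib power2_eq_square sum_distrib_left[symmetric] sum_divide_distrib[symmetric] distrib_left mult.assoc)
  finally show ?thesis .
qed

end

section \<open>Consistency and error estimates\<close>

lemma real_young:
  fixes x y r :: real
  assumes "0 < r"
  shows "\<bar>x * y\<bar> \<le> r * x\<^sup>2 + y\<^sup>2 / r"
proof -
  have "0 \<le> (r * \<bar>x\<bar> - \<bar>y\<bar>)\<^sup>2 + (r * x)\<^sup>2 + y\<^sup>2" by simp
  then have "r * \<bar>x * y\<bar> \<le> r * (r * x\<^sup>2 + y\<^sup>2 / r)"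
    using assms by (simp add: power2_eq_square abs_mult algebra_simps)
  then show ?thesis using assms by (simp only: mult_le_cancel_left_pos)
qed

lemma trace_eq_inner: "trace (s :: real^'n^'n) = mat 1 \<bullet> s"
  by (simp add: trace_def inner_vec_def mat_def if_distrib[of "\<lambda>u. u * _"] cong: if_cong)

text \<open>Cauchy-Schwarz against the identity matrix, whose squared Frobenius norm is the
  dimension.\<close>

lemma trace_square_le: "(trace (s :: real^'n^'n))\<^sup>2 \<le> real CARD('n) * (s \<bullet> s)"
  using Cauchy_Schwarz_ineq[of "mat 1" s] trace_eq_inner[of "mat 1 :: real^'n^'n"]
  by (simp add: trace_eq_inner[symmetric] trace_I)

lemma compliance_inner:
  "compliance mu lam s \<bullet> t = (s \<bullet> t - lam / (2 * mu + real CARD('n) * lam) * (trace s * trace t)) / (2 * mu)" for s t :: "real^'n^'n"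
  by (simp add: compliance_def inner_diff_left trace_eq_inner[of t])

lemma compliance_diff: "compliance mu lam (s - t) = compliance mu lam s - compliance mu lam t"
  unfolding compliance_def trace_eq_inner inner_diff_right right_diff_distrib scaleR_diff_left scaleR_diff_right by simp

lemma card_ge_1: "1 \<le> real CARD('n::finite)"
  by (simp add: Suc_leI)

context
  fixes mu lam :: real
  assumes mu: "0 < mu" and lam: "0 \<le> lam"
begin

lemma lame_ratio:
  fixes n :: real
  assumes "1 \<le> n"
  shows "0 \<le> lam / (2 * mu + n * lam)" "lam / (2 * mu + n * lam) * n \<le> 1" "lam / (2 * mu + n * lam) \<le> 1"
proof -
  have p: "0 < 2 * mu + n * lam" using mu lam assms by (intro add_pos_nonneg) auto
  show "0 \<le> lam / (2 * mu + n * lam)" using p lam by simp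
  show 1: "lam / (2 * mu + n * lam) * n \<le> 1" using p mu by (simp add: field_simps)
  have "lam / (2 * mu + n * lam) * 1 \<le> lam / (2 * mu + n * lam) * n" using p lam assms by (intro mult_left_mono) auto
  with 1 show "lam / (2 * mu + n * lam) \<le> 1" by simp
qed

text \<open>By \<open>trace_square_le\<close> the trace term takes away at most the fraction k n of
  the square, and 1 - k n is \<open>2 * mu\<close> divided by \<open>2 * mu + n * lam\<close>; the
  prefactor of the compliance cancels \<open>2 * mu\<close>.\<close>

lemma compliance_coercive:
  fixes s :: "real^'n^'n"
  shows "s \<bullet> s / (2 * mu + real CARD('n) * lam) \<le> compliance mu lam s \<bullet> s"
proof -
  let ?n = "real CARD('n)"
  define k where "k = lam / (2 * mu + ?n * lam)"
  have p: "0 < 2 * mu + ?n * lam" using mu lam by (intro add_pos_nonneg) auto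
  have k: "0 \<le> k" unfolding k_def by (rule lame_ratio(1)[OF card_ge_1])
  have "k * (trace s * trace s) \<le> k * (?n * (s \<bullet> s))"
    using trace_square_le[of s] by (intro mult_left_mono k) (simp add: power2_eq_square)
  then have "(s \<bullet> s - k * (?n * (s \<bullet> s))) / (2 * mu) \<le> compliance mu lam s \<bullet> s"
    unfolding compliance_inner k_def[symmetric] using mu by (intro divide_right_mono) auto
  moreover have "(s \<bullet> s - k * (?n * (s \<bullet> s))) / (2 * mu) = s \<bullet> s / (2 * mu + ?n * lam)"
  proof -
    have "1 - k * ?n = 2 * mu / (2 * mu + ?n * lam)" using p by (simp add: k_def field_simps)
    moreover have "s \<bullet> s - k * (?n * (s \<bullet> s)) = (1 - k * ?n) * (s \<bullet> s)" by (simp add: algebra_simps)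
    ultimately show ?thesis using mu by simp
  qed
  ultimately show ?thesis by simp
qed

lemma compliance_young:
  fixes s t :: "real^'n^'n"
  assumes r: "0 < r"
  shows "\<bar>compliance mu lam s \<bullet> t\<bar> \<le> (r * (s \<bullet> s) + t \<bullet> t / r) / mu"
proof -
  let ?n = "real CARD('n)"
  define k where "k = lam / (2 * mu + ?n * lam)"
  have k: "0 \<le> k" "k * ?n \<le> 1" unfolding k_def by (rule lame_ratio[OF card_ge_1])+
  define Y where "Y = r * (s \<bullet> s) + t \<bullet> t / r"
  have Y: "0 \<le> Y" using r by (simp add: Y_def)
  have 1: "\<bar>s \<bullet> t\<bar> \<le> Y"
  proof -
    have "\<bar>s \<bullet> t\<bar> \<le> \<bar>norm s * norm t\<bar>" using Cauchy_Schwarz_ineq2[of s t] by simp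
    also have "\<dots> \<le> r * (norm s)\<^sup>2 + (norm t)\<^sup>2 / r" by (rule real_young[OF r])
    finally show ?thesis by (simp add: Y_def power2_norm_eq_inner)
  qed
  have "\<bar>trace s * trace t\<bar> \<le> r * (trace s)\<^sup>2 + (trace t)\<^sup>2 / r" by (rule real_young[OF r])
  also have "\<dots> \<le> r * (?n * (s \<bullet> s)) + (?n * (t \<bullet> t)) / r"
    using r by (intro add_mono mult_left_mono divide_right_mono trace_square_le) auto
  also have "\<dots> = ?n * Y" by (simp add: Y_def distrib_left)
  finally have "k * \<bar>trace s * trace t\<bar> \<le> k * (?n * Y)" by (rule mult_left_mono[OF _ k(1)])
  also have "\<dots> \<le> Y" using mult_right_mono[OF k(2) Y] by simp
  finally have "\<bar>k * (trace s * trace t)\<bar> \<le> Y" using k(1) by (simp add: abs_mult)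
  with 1 have "\<bar>s \<bullet> t - k * (trace s * trace t)\<bar> \<le> 2 * Y" by linarith
  then have "\<bar>s \<bullet> t - k * (trace s * trace t)\<bar> / (2 * mu) \<le> 2 * Y / (2 * mu)" using mu by (intro divide_right_mono) auto
  then show ?thesis unfolding compliance_inner k_def[symmetric] Y_def[symmetric] using mu by (simp add: abs_mult)
qed

end

lemma L2_compliance [intro]:
  fixes f :: "real^'n \<Rightarrow> real^'n^'n"
  assumes f: "f \<in> L2 S"
  shows "(\<lambda>x. compliance mu lam (f x)) \<in> L2 S"
proof -
  have tr: "(\<lambda>x. trace (f x)) \<in> L2 S"
    unfolding trace_def by (intro L2_sum L2_nth f)
  have "(\<lambda>x. (lam / (2 * mu + real CARD('n) * lam) * trace (f x)) *\<^sub>R (mat 1 :: real^'n^'n)) \<in> L2 S"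
  proof (intro L2_vecI)
    fix i j :: 'n
    have "(\<lambda>x. (lam / (2 * mu + real CARD('n) * lam) * (mat 1 :: real^'n^'n) $ i $ j) * trace (f x)) \<in> L2 S" by (rule L2_cmult[OF tr])
    then show "(\<lambda>x. ((lam / (2 * mu + real CARD('n) * lam) * trace (f x)) *\<^sub>R (mat 1 :: real^'n^'n)) $ i $ j) \<in> L2 S"
      by (simp add: mult_ac)
  qed
  then show ?thesis unfolding compliance_def by (intro L2_scaleR L2_diff f)
qed

lemma L2_inner_compliance:
  fixes f t :: "real^'n \<Rightarrow> real^'n^'n"
  assumes f: "f \<in> L2 S" and t: "t \<in> L2 S"
  shows "L2_inner S (\<lambda>x. compliance mu lam (f x)) t =
    ((\<Sum>i\<in>UNIV. \<Sum>j\<in>UNIV. LINT x|lebesgue_on S. f x $ i $ j * t x $ i $ j)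
      - lam / (2 * mu + real CARD('n) * lam) * (\<Sum>i\<in>UNIV. \<Sum>j\<in>UNIV. LINT x|lebesgue_on S. f x $ i $ i * t x $ j $ j)) / (2 * mu)"
proof -
  have int: "integrable (lebesgue_on S) (\<lambda>x. f x $ i $ j * t x $ k $ l)" for i j k l
    by (intro L2_mult_integrable L2_nth f t)
  have "L2_inner S (\<lambda>x. compliance mu lam (f x)) t =
    (LINT x|lebesgue_on S. ((\<Sum>i\<in>UNIV. \<Sum>j\<in>UNIV. f x $ i $ j * t x $ i $ j)
      - lam / (2 * mu + real CARD('n) * lam) * (\<Sum>i\<in>UNIV. \<Sum>j\<in>UNIV. f x $ i $ i * t x $ j $ j)) / (2 * mu))"
    unfolding L2_inner_def compliance_inner by (simp add: inner_vec_def trace_def sum_product)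
  also have "\<dots> = ((\<Sum>i\<in>UNIV. \<Sum>j\<in>UNIV. LINT x|lebesgue_on S. f x $ i $ j * t x $ i $ j)
      - lam / (2 * mu + real CARD('n) * lam) * (\<Sum>i\<in>UNIV. \<Sum>j\<in>UNIV. LINT x|lebesgue_on S. f x $ i $ i * t x $ j $ j)) / (2 * mu)"
    by (simp add: int)
  finally show ?thesis .
qed

lemma L2_inner_compliance_coercive:
  fixes f :: "real^'n \<Rightarrow> real^'n^'n"
  assumes "0 < mu" "0 \<le> lam" "f \<in> L2 S"
  shows "L2_inner S f f / (2 * mu + real CARD('n) * lam) \<le> L2_inner S (\<lambda>x. compliance mu lam (f x)) f"
proof -
  have "(LINT x|lebesgue_on S. f x \<bullet> f x / (2 * mu + real CARD('n) * lam)) \<le> (LINT x|lebesgue_on S. compliance mu lam (f x) \<bullet> f x)"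
    using assms by (intro integral_mono compliance_coercive) (auto intro!: L2_inner_integrable)
  then show ?thesis by (simp add: L2_inner_def)
qed

lemma L2_inner_compliance_young:
  fixes f t :: "real^'n \<Rightarrow> real^'n^'n"
  assumes "0 < mu" "0 \<le> lam" "f \<in> L2 S" "t \<in> L2 S" "0 < r"
  shows "\<bar>L2_inner S (\<lambda>x. compliance mu lam (f x)) t\<bar> \<le> (r * L2_inner S f f + L2_inner S t t / r) / mu"
proof -
  have "\<bar>L2_inner S (\<lambda>x. compliance mu lam (f x)) t\<bar> \<le> (LINT x|lebesgue_on S. \<bar>compliance mu lam (f x) \<bullet> t x\<bar>)"
    unfolding L2_inner_def by (rule integral_abs_bound)
  also have "\<dots> \<le> (LINT x|lebesgue_on S. (r * (f x \<bullet> f x) + t x \<bullet> t x / r) / mu)"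
    using assms by (intro integral_mono compliance_young)
      (auto intro!: L2_inner_integrable Bochner_Integration.integrable_divide Bochner_Integration.integrable_add integrable_mult_right)
  also have "\<dots> = (r * L2_inner S f f + L2_inner S t t / r) / mu"
    using assms by (simp add: L2_inner_def L2_inner_integrable)
  finally show ?thesis .
qed

text \<open>The entry \<open>k l\<close> varies only with \<open>x $ k\<close> and
  \<open>x $ l\<close>, so it is orthogonal to every other centred coordinate.\<close>

lemma first_moment_zero:
  fixes p :: "real^'n"
  assumes q: "q \<in> Sigma_local" and r: "r \<noteq> k" "r \<noteq> l" and h: "0 < h"
  shows "(LINT x|lebesgue_on (ocell h p). (x $ r - (p $ r + h / 2)) * q x $ k $ l) = 0"
proof (rule integral_centered_indep[OF _ _ h])
  have "(\<forall>x t. q (x + t *\<^sub>R axis r 1) $ k $ l = q x $ k $ l) \<and> continuous_on UNIV (\<lambda>x. q x $ k $ l)"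
  proof (cases "k = l")
    case True
    obtain A B E where "\<forall>x. q x $ k $ k = A + B * (x $ k - 0) + E * (x $ k - 0)\<^sup>2"
      using Sigma_local_diagonal[OF q, of k 0] by blast
    with True r show ?thesis by (auto simp: axis_def intro!: continuous_intros)
  next
    case False
    obtain A B E G where "\<forall>x. q x $ k $ l = A + B * (x $ k - 0) + E * (x $ l - 0) + G * ((x $ k - 0) * (x $ l - 0))"
      using Sigma_local_offdiagonal[OF q False, of 0 0] by blast
    with r show ?thesis by (auto simp: axis_def intro!: continuous_intros)
  qed
  then show "q (x + t *\<^sub>R axis r 1) $ k $ l = q x $ k $ l" "continuous_on UNIV (\<lambda>x. q x $ k $ l)" for x t by auto
qed

text \<open>Against the odd weight only the linear coefficient survives. It is \<open>1 / h\<close>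
  times the increment of the quadratic across the cell, the quantity that is summed by
  parts.\<close>

lemma first_moment_quadratic:
  fixes p :: "real^'n"
  assumes h: "0 < h"
  shows "(LINT x|lebesgue_on (ocell h p). (x $ i - (p $ i + h / 2)) * (A + B * (x $ i - (p $ i + h / 2)) + E * (x $ i - (p $ i + h / 2))\<^sup>2))
    = h ^ CARD('n) * (h\<^sup>2 * B) / 12"
proof -
  define m where "m = p $ i + h / 2"
  have n: "h ^ CARD('n) = h * h ^ (CARD('n) - 1)" by (simp add: power_eq_if)
  have "(LINT x|lebesgue_on (ocell h p). (x $ i - m) * (A + B * (x $ i - m) + E * (x $ i - m)\<^sup>2)) = h ^ (CARD('n) - 1) *
    ((A * (p $ i + h - m)\<^sup>2 / 2 + B * (p $ i + h - m) ^ 3 / 3 + E * (p $ i + h - m) ^ 4 / 4)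
     - (A * (p $ i - m)\<^sup>2 / 2 + B * (p $ i - m) ^ 3 / 3 + E * (p $ i - m) ^ 4 / 4))"
  proof (rule integral_coordinate[where \<phi>="\<lambda>s. (s - m) * (A + B * (s - m) + E * (s - m)\<^sup>2)"
        and \<Phi>="\<lambda>s. A * (s - m)\<^sup>2 / 2 + B * (s - m) ^ 3 / 3 + E * (s - m) ^ 4 / 4", OF _ _ h])
    show "((\<lambda>s. A * (s - m)\<^sup>2 / 2 + B * (s - m) ^ 3 / 3 + E * (s - m) ^ 4 / 4)
       has_real_derivative (s - m) * (A + B * (s - m) + E * (s - m)\<^sup>2)) (at s)" for s
      by (auto intro!: derivative_eq_intros) (simp add: power2_eq_square eval_nat_numeral field_simps)
  qed (intro continuous_intros)
  moreover have "p $ i + h - m = h / 2" "p $ i - m = - (h / 2)" by (simp_all add: m_def field_simps)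
  moreover have "A * (h / 2)\<^sup>2 / 2 + B * (h / 2) ^ 3 / 3 + E * (h / 2) ^ 4 / 4 - (A * (- (h / 2))\<^sup>2 / 2 + B * (- (h / 2)) ^ 3 / 3 + E * (- (h / 2)) ^ 4 / 4)
    = h * (h\<^sup>2 * B) / 12"
    by (simp add: power2_eq_square eval_nat_numeral field_simps)
  ultimately have "(LINT x|lebesgue_on (ocell h p). (x $ i - m) * (A + B * (x $ i - m) + E * (x $ i - m)\<^sup>2)) = h ^ (CARD('n) - 1) * (h * (h\<^sup>2 * B) / 12)"
    by (simp only:)
  then show ?thesis unfolding m_def[symmetric] n by simp
qed

context mesh
begin

text \<open>One constant of the domain that dominates its edges, hence \<open>h\<close>, and the
  constant of \<open>cross_term\<close> in every direction; it takes up the surplus powers of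
  \<open>h\<close>.\<close>

abbreviation \<Lambda> :: real where "\<Lambda> \<equiv> \<Sum>j\<in>UNIV. 4 / (b $ j - a $ j) + 20 * (b $ j - a $ j)"

lemma edge: "h \<le> b $ j - a $ j" "0 < b $ j - a $ j"
  using h M[of j] Mpos[of j] by simp_all

lemma \<Lambda>_ge: "4 / (b $ j - a $ j) + 20 * (b $ j - a $ j) \<le> \<Lambda>"
proof (rule member_le_sum[where f="\<lambda>j. 4 / (b $ j - a $ j) + 20 * (b $ j - a $ j)"])
  show "0 \<le> 4 / (b $ x - a $ x) + 20 * (b $ x - a $ x)" for x
    by (intro add_nonneg_nonneg divide_nonneg_nonneg mult_nonneg_nonneg less_imp_le[OF edge(2)]) auto
qed auto

lemma edge_le_\<Lambda>: "b $ j - a $ j \<le> \<Lambda>"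
proof -
  have "0 < 4 / (b $ j - a $ j)" using edge(2)[of j] by simp
  moreover have "0 < x \<Longrightarrow> 0 < y \<Longrightarrow> x + 20 * y \<le> L \<Longrightarrow> y \<le> L" for x y L :: real by linarith
  ultimately show ?thesis using \<Lambda>_ge[of j] edge(2)[of j] by blast
qed

lemma h_le_\<Lambda>: "h \<le> \<Lambda>"
  using edge(1) edge_le_\<Lambda> by (rule order_trans)

lemma \<Lambda>_nonneg: "0 \<le> \<Lambda>"
  using h h_le_\<Lambda> by linarith

lemma Sigma_h_uminus:
  assumes "\<tau> \<in> Sigma_h a b h"
  shows "(\<lambda>x. - \<tau> x) \<in> Sigma_h a b h"
  using Sigma_h_diff[OF Sigma_h_diff[OF assms assms] assms] by simp

end

context interpolation
begin

text \<open>The squared size of the consistency error. The part with \<open>cint\<close> stems from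
  interpolation on the cells, the added 1 from the cross terms.\<close>

abbreviation "P \<equiv> (cint TYPE('n) * (real CARD('n))\<^sup>2 + 1) * \<Lambda> * (h ^ 3 * N)"

lemma cell_error:
  assumes z: "z \<in> Z"
  shows "sq (K z) (\<lambda>x. piece z x $ i $ j - \<sigma> x $ i $ j + (\<Sum>r\<in>UNIV - {i, j}. avg h (crn z) (D i j [r]) * (x $ r - (crn z $ r + h / 2))))
    \<le> cint TYPE('n) * h ^ 4 * (\<Sum>l\<in>UNIV. \<Sum>k\<in>UNIV. sq (K z) (D i j [k, l]))"
proof -
  interpret c: h2_cell a b "\<lambda>x. \<sigma> x $ i $ j" "D i j" h "crn z" by (rule h2_cell[OF z])
  show ?thesis
  proof (cases "i = j")
    case True
    obtain A B E where q: "\<forall>x. piece z x $ i $ i = A + B * (x $ i - (crn z $ i + h / 2)) + E * (x $ i - (crn z $ i + h / 2))\<^sup>2"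
      using Sigma_local_diagonal[OF piece_local[OF z], of i "crn z $ i + h / 2"] by blast
    have "sq (K z) (\<lambda>x. piece z x $ i $ i - \<sigma> x $ i $ j + (\<Sum>r\<in>UNIV - {i}. avg h (crn z) (D i j [r]) * (x $ r - (crn z $ r + h / 2)))) \<le> cint TYPE('n) * h ^ 4 * c.V2"
    proof (rule c.diagonal_interpolation)
      show "piece z x $ i $ i = A + B * (x $ i - (crn z $ i + h / 2)) + E * (x $ i - (crn z $ i + h / 2))\<^sup>2" for x using q by blast
      show "has_trace_integral \<Omega> h (crn z) {i} c (\<lambda>x. \<sigma> x $ i $ j) (face_integral h (crn z) {i} c (\<lambda>x. piece z x $ i $ i))"
        if "c $ i \<in> {crn z $ i, crn z $ i + h}" for c using piece_diagonal(1)[OF z that] True by simp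
      show "(LINT x|lebesgue_on (K z). piece z x $ i $ i) = (LINT x|lebesgue_on (K z). \<sigma> x $ i $ j)"
        using piece_diagonal(2)[OF z, of i] True by simp
    qed
    from this[unfolded c.V2_def] show ?thesis using True by simp
  next
    case False
    obtain A B E G where q: "\<forall>x. piece z x $ i $ j = A + B * (x $ i - (crn z $ i + h / 2)) + E * (x $ j - (crn z $ j + h / 2))
        + G * ((x $ i - (crn z $ i + h / 2)) * (x $ j - (crn z $ j + h / 2)))"
      using Sigma_local_offdiagonal[OF piece_local[OF z] False, of "crn z $ i + h / 2" "crn z $ j + h / 2"] by blast
    show ?thesis unfolding c.V2_def[symmetric]
    proof (rule c.offdiagonal_interpolation[OF False])
      show "piece z x $ i $ j = A + B * (x $ i - (crn z $ i + h / 2)) + E * (x $ j - (crn z $ j + h / 2))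
        + G * ((x $ i - (crn z $ i + h / 2)) * (x $ j - (crn z $ j + h / 2)))" for x using q by blast
    qed (rule piece_offdiagonal[OF z False])
  qed
qed

text \<open>The index condition lists the products that occur in the compliance: an entry with
  itself, and through the trace a diagonal entry with another diagonal entry. Up to
  \<open>h ^ 2\<close> the error is affine in the coordinates other than \<open>i\<close> and
  \<open>j\<close>, and this part meets a nonzero first moment only in the second case.\<close>

lemma pairing_bound:
  assumes \<tau>: "\<tau> \<in> Sigma_h a b h" and s: "0 < s" and ix: "(k = i \<and> l = j) \<or> (i = j \<and> k = l \<and> k \<noteq> i)"
  shows "(LINT x|lebesgue_on \<Omega>. (\<sigma> x $ i $ j - \<pi> x $ i $ j) * \<tau> x $ k $ l) \<le> s * P + 3 * sq \<Omega> (\<lambda>x. \<tau> x $ k $ l) / s"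
proof -
  let ?t = "\<lambda>x. \<tau> x $ k $ l" and ?e = "\<lambda>x. \<sigma> x $ i $ j - \<pi> x $ i $ j" and ?n = "real CARD('n)"
  obtain q where \<tau>H: "\<tau> \<in> Hdiv_sym \<Omega>" and q: "\<forall>z\<in>Z. q z \<in> Sigma_local \<and> (AE x in lebesgue_on (K z). \<tau> x = q z x)"
    using \<tau> unfolding Sigma_h_iff by blast
  have \<pi>L: "\<pi> \<in> L2 \<Omega>" using \<pi>_Sigma_h Hdiv_symD(1) unfolding Sigma_h_iff by blast
  have tL: "?t \<in> L2 \<Omega>" by (intro L2_nth Hdiv_symD(1)[OF \<tau>H])
  have eL: "?e \<in> L2 \<Omega>" by (intro L2_diff L2_nth \<sigma>L2 \<pi>L)
  have "\<forall>z\<in>Z. \<forall>k. \<exists>A B E. \<forall>x. q z x $ k $ k = A + B * (x $ k - (crn z $ k + h / 2)) + E * (x $ k - (crn z $ k + h / 2))\<^sup>2"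
    using Sigma_local_diagonal q by blast
  then obtain A B E where dia: "\<forall>z\<in>Z. \<forall>k x. q z x $ k $ k = A z k + B z k * (x $ k - (crn z $ k + h / 2)) + E z k * (x $ k - (crn z $ k + h / 2))\<^sup>2"
    by metis
  \<comment> \<open>What the affine part leaves on a cell: nothing when an entry meets itself;
    otherwise the mean of \<open>D i j [k]\<close> times the first moment of the discrete entry
    \<open>k k\<close>.\<close>
  define X where "X z = (if k = i \<and> l = j then 0 else h ^ CARD('n) * (avg h (crn z) (D i j [k]) * (h\<^sup>2 * B z k)) / 12)" for z
  define V where "V z = (\<Sum>l\<in>UNIV. \<Sum>k\<in>UNIV. sq (K z) (D i j [k, l]))" for z
  have cell: "(LINT x|lebesgue_on (K z). ?e x * ?t x) \<le> s * (cint TYPE('n) * h ^ 4 * V z) + sq (K z) ?t / s + X z" if z: "z \<in> Z" for z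
  proof -
    let ?m = "\<lambda>r. crn z $ r + h / 2" and ?g = "\<lambda>r. avg h (crn z) (D i j [r])"
    define R where "R x = (\<Sum>r\<in>UNIV - {i, j}. ?g r * (x $ r - ?m r))" for x :: "real^'n"
    define f where "f x = piece z x $ i $ j - \<sigma> x $ i $ j + R x" for x
    have qz: "q z \<in> Sigma_local" "AE x in lebesgue_on (K z). \<tau> x = q z x" using q z by blast+
    have tK: "?t \<in> L2 (K z)" using L2_subset[OF tL K_subset[OF z]] by simp
    have eK: "?e \<in> L2 (K z)" using L2_subset[OF eL K_subset[OF z]] by simp
    have RK: "R \<in> L2 (K z)" unfolding R_def by (intro L2_continuous continuous_intros) auto
    have feq: "AE x in lebesgue_on (K z). ?e x = R x - f x"
      using piece(2)[OF z] by eventually_elim (simp add: f_def)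
    have "AE x in lebesgue_on (K z). f x = R x - ?e x" using feq by eventually_elim simp
    then have fK: "f \<in> L2 (K z)" by (rule L2_AE[OF L2_diff[OF RK eK] ocell_sets_lebesgue])
    have int: "integrable (lebesgue_on (K z)) (\<lambda>x. R x * ?t x)" "integrable (lebesgue_on (K z)) (\<lambda>x. (- f x) * ?t x)"
      by (intro L2_mult_integrable L2_uminus RK fK tK)+
    have "(LINT x|lebesgue_on (K z). ?e x * ?t x) = (LINT x|lebesgue_on (K z). (- f x) * ?t x + R x * ?t x)"
    proof (rule integral_cong_AE)
      show "(\<lambda>x. ?e x * ?t x) \<in> borel_measurable (lebesgue_on (K z))" using L2_mult_integrable[OF eK tK] by auto
      show "(\<lambda>x. (- f x) * ?t x + R x * ?t x) \<in> borel_measurable (lebesgue_on (K z))" using int by auto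
      show "AE x in lebesgue_on (K z). ?e x * ?t x = (- f x) * ?t x + R x * ?t x"
      proof -
        have "u = r - f' \<Longrightarrow> u * t = (- f') * t + r * t" for u r f' t :: real by (simp add: left_diff_distrib)
        then show ?thesis using feq by (elim eventually_mono)
      qed
    qed
    also have "\<dots> = (LINT x|lebesgue_on (K z). (- f x) * ?t x) + (LINT x|lebesgue_on (K z). R x * ?t x)"
      by (rule Bochner_Integration.integral_add[OF int(2,1)])
    also have "(LINT x|lebesgue_on (K z). R x * ?t x) = X z"
    proof -
      have qK: "(\<lambda>x. q z x $ k $ l) \<in> L2 (K z)"
        by (rule L2_AE[OF tK ocell_sets_lebesgue]) (use qz(2) in \<open>eventually_elim, simp\<close>)
      have xK: "(\<lambda>x. x $ r - ?m r) \<in> L2 (K z)" for r by (intro L2_continuous continuous_intros) auto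
      have "(LINT x|lebesgue_on (K z). R x * ?t x) = (LINT x|lebesgue_on (K z). (\<Sum>r\<in>UNIV - {i, j}. ?g r * ((x $ r - ?m r) * q z x $ k $ l)))"
      proof (rule integral_cong_AE)
        show "(\<lambda>x. R x * ?t x) \<in> borel_measurable (lebesgue_on (K z))" using int by auto
        show "(\<lambda>x. \<Sum>r\<in>UNIV - {i, j}. ?g r * ((x $ r - ?m r) * q z x $ k $ l)) \<in> borel_measurable (lebesgue_on (K z))"
          by (intro borel_measurable_sum borel_measurable_times borel_measurable_const L2D(1)[OF qK] L2D(1)[OF xK])
        show "AE x in lebesgue_on (K z). R x * ?t x = (\<Sum>r\<in>UNIV - {i, j}. ?g r * ((x $ r - ?m r) * q z x $ k $ l))"
          using qz(2) by eventually_elim (simp only: R_def sum_distrib_right mult.assoc)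
      qed
      also have "\<dots> = (\<Sum>r\<in>UNIV - {i, j}. LINT x|lebesgue_on (K z). ?g r * ((x $ r - ?m r) * q z x $ k $ l))"
        by (rule Bochner_Integration.integral_sum) (intro integrable_mult_right L2_mult_integrable xK qK)
      also have "\<dots> = (\<Sum>r\<in>UNIV - {i, j}. if r = k \<and> k = l then X z else 0)"
      proof (rule sum.cong[OF refl])
        fix r assume r: "r \<in> UNIV - {i, j}"
        show "(LINT x|lebesgue_on (K z). ?g r * ((x $ r - ?m r) * q z x $ k $ l)) = (if r = k \<and> k = l then X z else 0)"
        proof (cases "r = k \<and> k = l")
          case True
          then have ix': "\<not> (k = i \<and> l = j)" using r by auto
          have I: "(LINT x|lebesgue_on (K z). (x $ k - ?m k) * q z x $ k $ k) = h ^ CARD('n) * (h\<^sup>2 * B z k) / 12"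
            using first_moment_quadratic[OF h, of "crn z" k "A z k" "B z k" "E z k"] dia z by simp
          have "X z = ?g k * (LINT x|lebesgue_on (K z). (x $ k - ?m k) * q z x $ k $ k)"
            unfolding I X_def if_not_P[OF ix'] by simp
          then show ?thesis using True by simp
        next
          case False
          \<comment> \<open>In all remaining directions the discrete entry does not vary, so its
            first moment vanishes.\<close>
          with ix r have "r \<noteq> k" "r \<noteq> l" by auto
          then show ?thesis using False first_moment_zero[OF qz(1) _ _ h, of r k l "crn z"] by simp
        qed
      qed
      also have "\<dots> = X z"
      proof (cases "k = i \<and> l = j")
        case True
        then show ?thesis by (auto simp: X_def intro!: sum.neutral)
      next
        case False
        with ix have "i = j" "k = l" "k \<noteq> i" by auto
        then show ?thesis by simp
      qed
      finally show ?thesis .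
    qed
    also have "(LINT x|lebesgue_on (K z). (- f x) * ?t x) \<le> s * sq (K z) f + sq (K z) ?t / s"
      using L2_Young[OF L2_uminus[OF fK] tK s] by (simp add: sq_uminus)
    also have "s * sq (K z) f \<le> s * (cint TYPE('n) * h ^ 4 * V z)"
      unfolding f_def R_def V_def using cell_error[OF z] s by (intro mult_left_mono) auto
    finally show ?thesis by simp
  qed
  have "(LINT x|lebesgue_on \<Omega>. ?e x * ?t x) = (\<Sum>z\<in>Z. LINT x|lebesgue_on (K z). ?e x * ?t x)"
    by (rule integral_mesh[OF L2_mult_integrable[OF eL tL]])
  also have "\<dots> \<le> (\<Sum>z\<in>Z. s * (cint TYPE('n) * h ^ 4 * V z) + sq (K z) ?t / s + X z)" by (rule sum_mono) (rule cell)
  also have "\<dots> = s * (cint TYPE('n) * h ^ 4 * (\<Sum>z\<in>Z. V z)) + sq \<Omega> ?t / s + (\<Sum>z\<in>Z. X z)"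
    by (simp add: sum.distrib sum_distrib_left sum_divide_distrib sq_mesh[OF tL])
  finally have total: "(LINT x|lebesgue_on \<Omega>. ?e x * ?t x) \<le> s * (cint TYPE('n) * h ^ 4 * (\<Sum>z\<in>Z. V z)) + sq \<Omega> ?t / s + (\<Sum>z\<in>Z. X z)" .
  have V_le: "(\<Sum>z\<in>Z. V z) \<le> ?n\<^sup>2 * N"
  proof -
    have "(\<Sum>z\<in>Z. V z) = (\<Sum>l\<in>UNIV. \<Sum>k\<in>UNIV. sq \<Omega> (D i j [k, l]))"
      unfolding V_def sum.swap[of _ UNIV Z] by (simp add: sq_mesh[OF D_L2])
    also have "\<dots> \<le> (\<Sum>l\<in>(UNIV::'n set). \<Sum>k\<in>(UNIV::'n set). N)" by (intro sum_mono D_N) auto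
    finally show ?thesis by (simp add: power2_eq_square)
  qed
  have X_le: "(\<Sum>z\<in>Z. X z) \<le> s * (h ^ 3 * \<Lambda> * N) + 2 * sq \<Omega> ?t / s"
  proof (cases "k = i \<and> l = j")
    case True
    have "0 \<le> \<Lambda>" using h h_le_\<Lambda> by linarith
    then show ?thesis using True s h N_nonneg by (simp add: X_def)
  next
    case False
    with ix have kl: "i = j" "k = l" "k \<noteq> i" by auto
    let ?L = "b $ k - a $ k"
    have "(\<Sum>z\<in>Z. X z) = (\<Sum>z\<in>Z. h ^ CARD('n) * (avg h (crn z) (D i j [k]) * (h\<^sup>2 * B z k))) / 12"
      unfolding X_def if_not_P[OF False] by (rule sum_divide_distrib[symmetric])
    also have "\<dots> \<le> (s * h ^ 3 * (4 / ?L + 20 * ?L) * (sq \<Omega> (D i j [k]) + sq \<Omega> (D i j [k, k])) + 18 * sq \<Omega> (\<lambda>x. \<tau> x $ k $ k) / s) / 12"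
    proof (rule divide_right_mono[OF cross_term[OF C1_limits(2) \<tau>H _ _ _ s refl]])
      show "q z \<in> Sigma_local" "AE x in lebesgue_on (K z). \<tau> x = q z x"
        "q z x $ k $ k = A z k + B z k * (x $ k - (crn z $ k + h / 2)) + E z k * (x $ k - (crn z $ k + h / 2))\<^sup>2" if "z \<in> Z" for z x
        using q dia that by blast+
    qed simp
    also have "\<dots> \<le> (s * h ^ 3 * \<Lambda> * (N + N) + 18 * sq \<Omega> (\<lambda>x. \<tau> x $ k $ k) / s) / 12"
      using edge(2)[of k] s h by (intro divide_right_mono add_mono mult_mono \<Lambda>_ge D_N order_refl mult_nonneg_nonneg add_nonneg_nonneg \<Lambda>_nonneg) auto
    \<comment> \<open>The divisor 12 of the first moment brings the doubled \<open>N\<close> below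
      \<open>N\<close> and 18 below 2 times 12.\<close>
    also have "\<dots> \<le> s * (h ^ 3 * \<Lambda> * N) + 2 * sq \<Omega> ?t / s"
    proof -
      have "0 \<le> s * h ^ 3 * \<Lambda> * N" using s h h_le_\<Lambda> N_nonneg by (intro mult_nonneg_nonneg) auto
      moreover have "0 \<le> sq \<Omega> ?t / s" using s by simp
      ultimately show ?thesis using kl by (simp add: field_simps)
    qed
    finally show ?thesis .
  qed
  note total
  also have "s * (cint TYPE('n) * h ^ 4 * (\<Sum>z\<in>Z. V z)) + sq \<Omega> ?t / s + (\<Sum>z\<in>Z. X z)
      \<le> s * (cint TYPE('n) * h ^ 4 * (?n\<^sup>2 * N)) + sq \<Omega> ?t / s + (s * (h ^ 3 * \<Lambda> * N) + 2 * sq \<Omega> ?t / s)"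
    by (rule add_mono[OF add_right_mono[OF mult_left_mono[OF mult_left_mono[OF V_le]]] X_le]) (use s h in simp_all)
  also have "s * (cint TYPE('n) * h ^ 4 * (?n\<^sup>2 * N)) + sq \<Omega> ?t / s + (s * (h ^ 3 * \<Lambda> * N) + 2 * sq \<Omega> ?t / s) \<le> s * P + 3 * sq \<Omega> ?t / s"
  proof -
    \<comment> \<open>One power of \<open>h\<close> is exchanged for \<Lambda>, so that the
      interpolation terms share the rate of the boundary terms.\<close>
    have "h ^ 4 = h * h ^ 3" by (simp add: eval_nat_numeral)
    also have "\<dots> \<le> \<Lambda> * h ^ 3" using h h_le_\<Lambda> by (intro mult_right_mono) auto
    finally have "s * (cint TYPE('n) * h ^ 4 * (?n\<^sup>2 * N)) \<le> s * (cint TYPE('n) * (\<Lambda> * h ^ 3) * (?n\<^sup>2 * N))"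
      using s N_nonneg by (intro mult_left_mono mult_right_mono) auto
    then show ?thesis by (simp add: algebra_simps)
  qed
  finally show ?thesis .
qed

end

section \<open>Error equations\<close>

lemma L2_inner_compliance_diff:
  fixes f g t :: "real^'n \<Rightarrow> real^'n^'n"
  assumes "f \<in> L2 S" "g \<in> L2 S" "t \<in> L2 S"
  shows "L2_inner S (\<lambda>x. compliance mu lam (f x - g x)) t
    = L2_inner S (\<lambda>x. compliance mu lam (f x)) t - L2_inner S (\<lambda>x. compliance mu lam (g x)) t"
  unfolding compliance_diff by (intro L2_inner_diff_left L2_compliance assms)

lemma Hdiv_norm_square: "(Hdiv_norm S \<tau>)\<^sup>2 = L2_inner S \<tau> \<tau> + L2_inner S (weak_div S \<tau>) (weak_div S \<tau>)"
  by (simp add: Hdiv_norm_def L2_norm_square)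

text \<open>The choice of \<open>s\<close> makes the second term on the right exactly half of the
  left side. The Young parameters of the stress and the displacement estimates are fixed
  here.\<close>

lemma absorb:
  fixes c mu r A y :: real
  assumes c: "0 < c" and mu: "0 < mu" and r: "0 < r"
    and le: "\<And>s. 0 < s \<Longrightarrow> c * y \<le> (s * A + r * y / s) / mu"
  shows "y \<le> 4 * r * A / (c * mu)\<^sup>2"
proof -
  define s where "s = 2 * r / (c * mu)"
  have s: "0 < s" using c mu r by (simp add: s_def)
  have k: "r * y / s / mu = c * y / 2" using c mu r by (simp add: s_def field_simps)
  have "c * y \<le> s * A / mu + c * y / 2" using le[OF s, unfolded add_divide_distrib k] .
  then have "c * y \<le> 2 * (s * A / mu)" by simp
  also have "\<dots> = c * (4 * r * A / (c * mu)\<^sup>2)" using c mu by (simp add: s_def field_simps power2_eq_square)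
  finally show ?thesis using c by (simp only: mult_le_cancel_left_pos)
qed

context interpolation
begin

lemma P_nonneg: "0 \<le> P"
  using h h_le_\<Lambda> N_nonneg by (intro mult_nonneg_nonneg add_nonneg_nonneg) auto

lemma \<pi>L2: "\<pi> \<in> L2 \<Omega>" and \<pi>_Hdiv: "\<pi> \<in> Hdiv_sym \<Omega>"
  using \<pi>_Sigma_h Hdiv_symD(1) unfolding Sigma_h_iff by blast+

text \<open>The one-sided bound is applied to \<tau> and to its negative, which is again a discrete
  stress.\<close>

lemma pairing_abs_bound:
  assumes \<tau>: "\<tau> \<in> Sigma_h a b h" and s: "0 < s" and ix: "(k = i \<and> l = j) \<or> (i = j \<and> k = l \<and> k \<noteq> i)"
  shows "\<bar>LINT x|lebesgue_on \<Omega>. (\<sigma> x - \<pi> x) $ i $ j * \<tau> x $ k $ l\<bar> \<le> s * P + 3 * sq \<Omega> (\<lambda>x. \<tau> x $ k $ l) / s"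
proof -
  have "(LINT x|lebesgue_on \<Omega>. (\<sigma> x $ i $ j - \<pi> x $ i $ j) * (- \<tau> x) $ k $ l) = - (LINT x|lebesgue_on \<Omega>. (\<sigma> x $ i $ j - \<pi> x $ i $ j) * \<tau> x $ k $ l)"
    by simp
  then show ?thesis
    using pairing_bound[OF \<tau> s ix] pairing_bound[OF Sigma_h_uminus[OF \<tau>] s ix] by (simp add: sq_uminus)
qed

text \<open>The trace part pairs every diagonal entry of the error with every diagonal entry of
  \<tau>, so each of the latter is counted n times; this turns the constant 3 into 3 n.\<close>

lemma compliance_consistency:
  assumes mu: "0 < mu" and lam: "0 \<le> lam" and \<tau>: "\<tau> \<in> Sigma_h a b h" and s: "0 < s"
  shows "\<bar>L2_inner \<Omega> (\<lambda>x. compliance mu lam (\<sigma> x - \<pi> x)) \<tau>\<bar>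
    \<le> (s * ((real CARD('n))\<^sup>2 * P) + 3 * real CARD('n) * L2_inner \<Omega> \<tau> \<tau> / s) / mu"
proof -
  let ?n = "real CARD('n)"
  have n: "1 \<le> ?n" by (rule card_ge_1)
  have \<tau>L: "\<tau> \<in> L2 \<Omega>" using \<tau> Hdiv_symD(1) unfolding Sigma_h_iff by blast
  define S where "S = L2_inner \<Omega> \<tau> \<tau>"
  have S: "S = (\<Sum>i\<in>UNIV. \<Sum>j\<in>UNIV. sq \<Omega> (\<lambda>x. \<tau> x $ i $ j))" "0 \<le> S" by (simp_all add: S_def L2_inner_self_mat[OF \<tau>L] sum_nonneg)
  define k where "k = lam / (2 * mu + ?n * lam)"
  have k: "0 \<le> k" "k \<le> 1" unfolding k_def by (rule lame_ratio[OF mu lam n])+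
  define X where "X = (\<Sum>i\<in>UNIV. \<Sum>j\<in>UNIV. LINT x|lebesgue_on \<Omega>. (\<sigma> x - \<pi> x) $ i $ j * \<tau> x $ i $ j)"
  define Y where "Y = (\<Sum>i\<in>UNIV. \<Sum>j\<in>UNIV. LINT x|lebesgue_on \<Omega>. (\<sigma> x - \<pi> x) $ i $ i * \<tau> x $ j $ j)"
  define B where "B = s * (?n\<^sup>2 * P) + 3 * ?n * S / s"
  have X: "\<bar>X\<bar> \<le> B"
  proof -
    have "\<bar>X\<bar> \<le> (\<Sum>i\<in>UNIV. \<Sum>j\<in>UNIV. \<bar>LINT x|lebesgue_on \<Omega>. (\<sigma> x - \<pi> x) $ i $ j * \<tau> x $ i $ j\<bar>)"
      unfolding X_def by (rule order_trans[OF sum_abs]) (intro sum_mono sum_abs)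
    also have "\<dots> \<le> (\<Sum>i\<in>UNIV. \<Sum>j\<in>UNIV. s * P + 3 * sq \<Omega> (\<lambda>x. \<tau> x $ i $ j) / s)"
      by (intro sum_mono pairing_abs_bound[OF \<tau> s]) simp
    also have "\<dots> = s * (?n\<^sup>2 * P) + 3 * S / s"
      by (simp add: S(1) sum.distrib sum_distrib_left[symmetric] sum_divide_distrib[symmetric] power2_eq_square)
    also have "\<dots> \<le> B" using n S(2) s unfolding B_def by (intro add_left_mono divide_right_mono mult_right_mono) auto
    finally show ?thesis .
  qed
  have Y: "\<bar>Y\<bar> \<le> B"
  proof -
    have "\<bar>Y\<bar> \<le> (\<Sum>i\<in>UNIV. \<Sum>j\<in>UNIV. \<bar>LINT x|lebesgue_on \<Omega>. (\<sigma> x - \<pi> x) $ i $ i * \<tau> x $ j $ j\<bar>)"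
      unfolding Y_def by (rule order_trans[OF sum_abs]) (intro sum_mono sum_abs)
    also have "\<dots> \<le> (\<Sum>i\<in>(UNIV::'n set). \<Sum>j\<in>UNIV. s * P + 3 * sq \<Omega> (\<lambda>x. \<tau> x $ j $ j) / s)"
      by (intro sum_mono pairing_abs_bound[OF \<tau> s]) auto
    also have "\<dots> = s * (?n\<^sup>2 * P) + 3 * ?n * (\<Sum>j\<in>UNIV. sq \<Omega> (\<lambda>x. \<tau> x $ j $ j)) / s"
      by (simp add: sum.distrib sum_distrib_left[symmetric] sum_divide_distrib[symmetric] power2_eq_square distrib_left)
    also have "\<dots> \<le> B"
    proof -
      have "(\<Sum>j\<in>UNIV. sq \<Omega> (\<lambda>x. \<tau> x $ j $ j)) \<le> S"
        unfolding S(1) by (intro sum_mono member_le_sum[where f="\<lambda>j. sq \<Omega> (\<lambda>x. \<tau> x $ i $ j)" for i]) auto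
      then show ?thesis unfolding B_def using s by (intro add_left_mono divide_right_mono mult_left_mono) auto
    qed
    finally show ?thesis .
  qed
  have "\<bar>k * Y\<bar> \<le> 1 * \<bar>Y\<bar>" unfolding abs_mult using k by (intro mult_right_mono) auto
  with X Y have "\<bar>X - k * Y\<bar> \<le> 2 * B" by linarith
  then have "\<bar>X - k * Y\<bar> / (2 * mu) \<le> 2 * B / (2 * mu)" using mu by (intro divide_right_mono) auto
  moreover have "L2_inner \<Omega> (\<lambda>x. compliance mu lam (\<sigma> x - \<pi> x)) \<tau> = (X - k * Y) / (2 * mu)"
    unfolding X_def Y_def k_def by (rule L2_inner_compliance[OF L2_diff[OF \<sigma>L2 \<pi>L2] \<tau>L])
  ultimately show ?thesis unfolding S_def[symmetric] B_def[symmetric] using mu by (simp add: abs_mult)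
qed

context
  fixes mu lam :: real and f u u\<^sub>h w :: "real^'n \<Rightarrow> real^'n" and \<sigma>\<^sub>h :: "real^'n \<Rightarrow> real^'n^'n"
  assumes mu: "0 < mu" and lam: "0 \<le> lam"
    and cont: "solves_mixed_problem \<Omega> mu lam f (Hdiv_sym \<Omega>) (L2 \<Omega>) \<sigma> u"
    and disc: "solves_mixed_problem \<Omega> mu lam f (Sigma_h a b h) (V_h a b h) \<sigma>\<^sub>h u\<^sub>h"
    and proj: "is_L2_projection a b h u w"
begin

abbreviation "E \<equiv> \<lambda>x. \<sigma>\<^sub>h x - \<pi> x"
abbreviation "d \<equiv> weak_div \<Omega> E"
abbreviation "sqn g \<equiv> L2_inner \<Omega> g g"
abbreviation "A g \<equiv> L2_inner \<Omega> (\<lambda>x. compliance mu lam (g x))"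

lemma Sigma_h_L2: "\<tau> \<in> Sigma_h a b h \<Longrightarrow> \<tau> \<in> L2 \<Omega>" and Sigma_h_Hdiv: "\<tau> \<in> Sigma_h a b h \<Longrightarrow> \<tau> \<in> Hdiv_sym \<Omega>"
  using Hdiv_symD(1) unfolding Sigma_h_iff by blast+

lemma V_h_L2: "v \<in> V_h a b h \<Longrightarrow> v \<in> L2 \<Omega>"
  unfolding V_h_iff by blast

lemma \<sigma>h: "\<sigma>\<^sub>h \<in> Sigma_h a b h" and uh: "u\<^sub>h \<in> V_h a b h" and u: "u \<in> L2 \<Omega>" and w: "w \<in> V_h a b h"
  using disc cont proj by (simp_all add: solves_mixed_problem_def is_L2_projection_def)

lemma E: "E \<in> Sigma_h a b h"
  by (rule Sigma_h_diff[OF \<sigma>h \<pi>_Sigma_h])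

lemma d: "d \<in> V_h a b h"
  by (rule weak_div_V_h[OF E])

text \<open>The error \<open>d\<close> lies in both displacement spaces, so testing the second
  equations with it replaces the divergence of the discrete stress by that of \<sigma>. Only the
  interpolation error of the divergence remains.\<close>

lemma divergence_error: "sqn d \<le> 4 * real CARD('n) ^ 3 * (\<Lambda> * (h ^ 3 * N))"
proof -
  note L = V_h_L2[OF d] Hdiv_symD(2)[OF Sigma_h_Hdiv[OF \<sigma>h]] Hdiv_symD(2)[OF \<pi>_Hdiv] Hdiv_symD(2)[OF \<sigma>]
  have "sqn d = L2_inner \<Omega> (\<lambda>x. weak_div \<Omega> \<sigma>\<^sub>h x - weak_div \<Omega> \<pi> x) d"
    by (rule L2_inner_cong_AE[OF L(1) L2_diff[OF L(2,3)] L(1) Hdiv_sym_diff(2)[OF Sigma_h_Hdiv[OF \<sigma>h] \<pi>_Hdiv]])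
  also have "\<dots> = L2_inner \<Omega> (weak_div \<Omega> \<sigma>\<^sub>h) d - L2_inner \<Omega> (weak_div \<Omega> \<pi>) d"
    by (rule L2_inner_diff_left[OF L(2,3,1)])
  also have "L2_inner \<Omega> (weak_div \<Omega> \<sigma>\<^sub>h) d = L2_inner \<Omega> (weak_div \<Omega> \<sigma>) d"
    using cont disc d L(1) by (simp add: solves_mixed_problem_def)
  also have "L2_inner \<Omega> (weak_div \<Omega> \<sigma>) d - L2_inner \<Omega> (weak_div \<Omega> \<pi>) d = L2_inner \<Omega> (\<lambda>x. weak_div \<Omega> \<sigma> x - weak_div \<Omega> \<pi> x) d"
    by (rule L2_inner_diff_left[OF L(4,3,1), symmetric])
  \<comment> \<open>With the parameter \<open>s\<close> equal to 2 n, the last term is half of the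
    left side.\<close>
  also have "\<dots> \<le> (real CARD('n))\<^sup>2 * ((2 * real CARD('n)) * h ^ 4 * N) + real CARD('n) * sqn d / (2 * real CARD('n))"
    by (rule weak_div_consistency[OF d]) simp
  finally have "sqn d \<le> (real CARD('n))\<^sup>2 * ((2 * real CARD('n)) * h ^ 4 * N) + real CARD('n) * sqn d / (2 * real CARD('n))" .
  then have "sqn d \<le> 4 * real CARD('n) ^ 3 * (h ^ 4 * N)" by (simp add: power2_eq_square power3_eq_cube)
  also have "h ^ 4 * N \<le> \<Lambda> * (h ^ 3 * N)"
  proof -
    have "h * (h ^ 3 * N) \<le> \<Lambda> * (h ^ 3 * N)" using h h_le_\<Lambda> N_nonneg by (intro mult_right_mono) auto
    then show ?thesis by (simp add: eval_nat_numeral)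
  qed
  finally show ?thesis by simp
qed

lemma inf_sup_\<Lambda>:
  assumes v: "v \<in> V_h a b h"
  obtains \<tau> where "\<tau> \<in> Sigma_h a b h" "AE x in lebesgue_on \<Omega>. weak_div \<Omega> \<tau> x = v x" "sqn \<tau> \<le> 6 * \<Lambda>\<^sup>2 * sqn v"
proof -
  have "(b $ i - a $ i)\<^sup>2 \<le> \<Lambda>\<^sup>2" for i
    using edge_le_\<Lambda>[of i] edge(2)[of i] by (intro power_mono) auto
  from inf_sup[OF v this] obtain \<tau> where \<tau>: "\<tau> \<in> Sigma_h a b h" "has_weak_div \<Omega> \<tau> v"
    "(\<Sum>i\<in>UNIV. \<Sum>j\<in>UNIV. sq \<Omega> (\<lambda>x. \<tau> x $ i $ j)) \<le> 6 * \<Lambda>\<^sup>2 * (\<Sum>i\<in>UNIV. sq \<Omega> (\<lambda>x. v x $ i))" by blast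
  note H = Hdiv_symD[OF Sigma_h_Hdiv[OF \<tau>(1)]]
  show ?thesis
  proof (rule that[OF \<tau>(1)])
    show "AE x in lebesgue_on \<Omega>. weak_div \<Omega> \<tau> x = v x"
      by (rule has_weak_div_unique[OF H(3) \<tau>(2) H(1,2) V_h_L2[OF v]])
    show "sqn \<tau> \<le> 6 * \<Lambda>\<^sup>2 * sqn v"
      using \<tau>(3) by (simp add: L2_inner_self_mat[OF H(1)] L2_inner_self_vec[OF V_h_L2[OF v]])
  qed
qed

text \<open>A discrete stress with divergence \<open>d\<close> and controlled norm is subtracted
  from the error. The remainder \<open>F\<close> has divergence zero, so the displacements drop out
  of both problems, and coercivity bounds \<open>F\<close> by the consistency error and the
  subtracted field.\<close>

lemma stress_error: "sqn E \<le> (8 * (3 * real CARD('n) + 1) * (2 * mu + real CARD('n) * lam)\<^sup>2 / mu\<^sup>2 + 2) * ((real CARD('n))\<^sup>2 * P + 6 * \<Lambda>\<^sup>2 * sqn d)"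
proof -
  obtain \<tau> where \<tau>: "\<tau> \<in> Sigma_h a b h" "AE x in lebesgue_on \<Omega>. weak_div \<Omega> \<tau> x = d x" "sqn \<tau> \<le> 6 * \<Lambda>\<^sup>2 * sqn d"
    using inf_sup_\<Lambda>[OF d] .
  define F where "F = (\<lambda>x. E x - \<tau> x)"
  have F: "F \<in> Sigma_h a b h" unfolding F_def by (rule Sigma_h_diff[OF E \<tau>(1)])
  note L = Sigma_h_L2[OF F] Sigma_h_L2[OF E] Sigma_h_L2[OF \<tau>(1)] Sigma_h_L2[OF \<sigma>h]
  have p: "0 < 2 * mu + real CARD('n) * lam" using mu lam by (intro add_pos_nonneg) auto
  have "AE x in lebesgue_on \<Omega>. weak_div \<Omega> F x = weak_div \<Omega> E x - weak_div \<Omega> \<tau> x"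
    unfolding F_def by (rule Hdiv_sym_diff(2)[OF Sigma_h_Hdiv[OF E] Sigma_h_Hdiv[OF \<tau>(1)]])
  then have div0: "AE x in lebesgue_on \<Omega>. weak_div \<Omega> F x = 0"
    using \<tau>(2) by eventually_elim simp
  \<comment> \<open>Applied to both displacements, this leaves only the compliance terms of the two
    first equations.\<close>
  have orth: "L2_inner \<Omega> (weak_div \<Omega> F) g = 0" if "g \<in> L2 \<Omega>" for g
    using L2_inner_cong_AE[OF Hdiv_symD(2)[OF Sigma_h_Hdiv[OF F]] L2_zero that div0] by (simp add: L2_inner_def)
  have "A \<sigma> F = 0" using cont Sigma_h_Hdiv[OF F] orth[OF u] unfolding solves_mixed_problem_def by force
  moreover have "A \<sigma>\<^sub>h F = 0" using disc F orth[OF V_h_L2[OF uh]] unfolding solves_mixed_problem_def by force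
  moreover have "A E F = A \<sigma>\<^sub>h F - A \<pi> F" by (rule L2_inner_compliance_diff[OF L(4) \<pi>L2 L(1)])
  moreover have "A (\<lambda>x. \<sigma> x - \<pi> x) F = A \<sigma> F - A \<pi> F" by (rule L2_inner_compliance_diff[OF \<sigma>L2 \<pi>L2 L(1)])
  moreover have "A F F = A E F - A \<tau> F"
    using L2_inner_compliance_diff[OF L(2,3,1)] unfolding F_def[symmetric] by (simp add: F_def)
  ultimately have AFF: "A F F = A (\<lambda>x. \<sigma> x - \<pi> x) F - A \<tau> F" by simp
  have "1 / (2 * mu + real CARD('n) * lam) * sqn F \<le> (s * ((real CARD('n))\<^sup>2 * P + sqn \<tau>) + (3 * real CARD('n) + 1) * sqn F / s) / mu" if s: "0 < s" for s
  proof -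
    have "sqn F / (2 * mu + real CARD('n) * lam) \<le> A F F" by (rule L2_inner_compliance_coercive[OF mu lam L(1)])
    also have "\<dots> \<le> (s * ((real CARD('n))\<^sup>2 * P) + 3 * real CARD('n) * sqn F / s) / mu + (s * sqn \<tau> + sqn F / s) / mu"
      using compliance_consistency[OF mu lam F s] L2_inner_compliance_young[OF mu lam L(3,1) s] unfolding AFF by linarith
    also have "\<dots> = (s * ((real CARD('n))\<^sup>2 * P + sqn \<tau>) + (3 * real CARD('n) + 1) * sqn F / s) / mu"
      by (simp add: add_divide_distrib distrib_left distrib_right)
    finally show ?thesis by simp
  qed
  from absorb[OF _ mu _ this] have "sqn F \<le> 4 * (3 * real CARD('n) + 1) * ((real CARD('n))\<^sup>2 * P + sqn \<tau>) / (1 / (2 * mu + real CARD('n) * lam) * mu)\<^sup>2"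
    using p by simp
  also have "\<dots> = 4 * (3 * real CARD('n) + 1) * (2 * mu + real CARD('n) * lam)\<^sup>2 / mu\<^sup>2 * ((real CARD('n))\<^sup>2 * P + sqn \<tau>)"
    by (simp add: power_divide)
  finally have SF: "sqn F \<le> 4 * (3 * real CARD('n) + 1) * (2 * mu + real CARD('n) * lam)\<^sup>2 / mu\<^sup>2 * ((real CARD('n))\<^sup>2 * P + sqn \<tau>)" .
  have "sqn E \<le> 2 * sqn F + 2 * sqn \<tau>"
  proof -
    have "(\<lambda>x. - \<tau> x) \<in> L2 \<Omega>" using L(3) by auto
    from L2_inner_self_diff_le[OF L(1) this] show ?thesis by (simp add: F_def L2_inner_def)
  qed
  \<comment> \<open>The nonnegative \<open>P\<close> term is added to the last summand so that both
    share one bracket.\<close>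
  also have "\<dots> \<le> 2 * (4 * (3 * real CARD('n) + 1) * (2 * mu + real CARD('n) * lam)\<^sup>2 / mu\<^sup>2 * ((real CARD('n))\<^sup>2 * P + sqn \<tau>)) + 2 * ((real CARD('n))\<^sup>2 * P + sqn \<tau>)"
    using P_nonneg by (intro add_mono mult_left_mono SF) auto
  also have "\<dots> = (8 * (3 * real CARD('n) + 1) * (2 * mu + real CARD('n) * lam)\<^sup>2 / mu\<^sup>2 + 2) * ((real CARD('n))\<^sup>2 * P + sqn \<tau>)"
    by (simp add: distrib_right)
  also have "\<dots> \<le> (8 * (3 * real CARD('n) + 1) * (2 * mu + real CARD('n) * lam)\<^sup>2 / mu\<^sup>2 + 2) * ((real CARD('n))\<^sup>2 * P + 6 * \<Lambda>\<^sup>2 * sqn d)"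
    by (intro mult_left_mono add_left_mono \<tau>(3)) simp
  finally show ?thesis .
qed

text \<open>The test stress has divergence \<open>v\<close>. As \<open>u - w\<close> is orthogonal
  to \<open>v\<close>, the squared norm of \<open>v\<close> is the pairing of that divergence with
  the difference of the two displacements, and the first equations of both problems turn this into
  compliance terms.\<close>

lemma displacement_error: "sqn (\<lambda>x. u\<^sub>h x - w x) \<le> 4 * ((3 * real CARD('n) + 1) * (6 * \<Lambda>\<^sup>2)) * ((real CARD('n))\<^sup>2 * P + sqn E) / mu\<^sup>2"
proof -
  define v where "v = (\<lambda>x. u\<^sub>h x - w x)"
  have v: "v \<in> V_h a b h" unfolding v_def by (rule V_h_diff[OF uh w])
  obtain \<tau> where \<tau>: "\<tau> \<in> Sigma_h a b h" "AE x in lebesgue_on \<Omega>. weak_div \<Omega> \<tau> x = v x" "sqn \<tau> \<le> 6 * \<Lambda>\<^sup>2 * sqn v"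
    using inf_sup_\<Lambda>[OF v] .
  note L = Sigma_h_L2[OF \<tau>(1)] V_h_L2[OF v] V_h_L2[OF uh] V_h_L2[OF w]
  have \<Lambda>: "0 < \<Lambda>" using h h_le_\<Lambda> by linarith
  have "L2_inner \<Omega> v u - L2_inner \<Omega> v w = 0"
    using proj v L2_inner_diff_right[OF u L(4,2)] by (simp add: is_L2_projection_def L2_inner_commute[of _ v])
  moreover have "sqn v = L2_inner \<Omega> v u\<^sub>h - L2_inner \<Omega> v w"
    using L2_inner_diff_right[OF L(3,4,2)] by (simp add: v_def)
  moreover have "L2_inner \<Omega> v g = L2_inner \<Omega> (weak_div \<Omega> \<tau>) g" if "g \<in> L2 \<Omega>" for g
    by (rule L2_inner_cong_AE[OF Hdiv_symD(2)[OF Sigma_h_Hdiv[OF \<tau>(1)]] L(2) that \<tau>(2), symmetric])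
  moreover have "A \<sigma> \<tau> + L2_inner \<Omega> (weak_div \<Omega> \<tau>) u = 0"
    using cont Sigma_h_Hdiv[OF \<tau>(1)] unfolding solves_mixed_problem_def by blast
  moreover have "A \<sigma>\<^sub>h \<tau> + L2_inner \<Omega> (weak_div \<Omega> \<tau>) u\<^sub>h = 0"
    using disc \<tau>(1) unfolding solves_mixed_problem_def by blast
  moreover have "A E \<tau> = A \<sigma>\<^sub>h \<tau> - A \<pi> \<tau>" by (rule L2_inner_compliance_diff[OF Sigma_h_L2[OF \<sigma>h] \<pi>L2 L(1)])
  moreover have "A (\<lambda>x. \<sigma> x - \<pi> x) \<tau> = A \<sigma> \<tau> - A \<pi> \<tau>" by (rule L2_inner_compliance_diff[OF \<sigma>L2 \<pi>L2 L(1)])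
  ultimately have sv: "sqn v = A (\<lambda>x. \<sigma> x - \<pi> x) \<tau> - A E \<tau>" using u L(3) by simp
  have "1 * sqn v \<le> (s * ((real CARD('n))\<^sup>2 * P + sqn E) + (3 * real CARD('n) + 1) * (6 * \<Lambda>\<^sup>2) * sqn v / s) / mu" if s: "0 < s" for s
  proof -
    have "sqn v \<le> (s * ((real CARD('n))\<^sup>2 * P) + 3 * real CARD('n) * sqn \<tau> / s) / mu + (s * sqn E + sqn \<tau> / s) / mu"
      using compliance_consistency[OF mu lam \<tau>(1) s] L2_inner_compliance_young[OF mu lam Sigma_h_L2[OF E] L(1) s] unfolding sv by linarith
    also have "\<dots> = (s * ((real CARD('n))\<^sup>2 * P + sqn E) + (3 * real CARD('n) + 1) * sqn \<tau> / s) / mu"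
      by (simp add: add_divide_distrib distrib_left distrib_right)
    also have "\<dots> \<le> (s * ((real CARD('n))\<^sup>2 * P + sqn E) + (3 * real CARD('n) + 1) * (6 * \<Lambda>\<^sup>2 * sqn v) / s) / mu"
      using s mu by (intro divide_right_mono add_left_mono mult_left_mono \<tau>(3)) auto
    finally show ?thesis by (simp add: mult.assoc)
  qed
  from absorb[OF _ mu _ this] have "sqn v \<le> 4 * ((3 * real CARD('n) + 1) * (6 * \<Lambda>\<^sup>2)) * ((real CARD('n))\<^sup>2 * P + sqn E) / (1 * mu)\<^sup>2"
    using \<Lambda> by simp
  then show ?thesis by (simp add: v_def)
qed

end

end

theorem theorem3p1:
  fixes a b :: "real^'n" and mu lam :: real
  assumes "2 \<le> CARD('n)"
    and "\<forall>i. a $ i < b $ i"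
    and "0 < mu" and "0 \<le> lam"
  shows "\<exists>C::real. \<forall>h f \<sigma> u \<sigma>\<^sub>h u\<^sub>h \<pi> w.
    admissible_mesh_size a b h \<longrightarrow>
    f \<in> L2 (box a b) \<longrightarrow>
    solves_mixed_problem (box a b) mu lam f (Hdiv_sym (box a b)) (L2 (box a b)) \<sigma> u \<longrightarrow>
    solves_mixed_problem (box a b) mu lam f (Sigma_h a b h) (V_h a b h) \<sigma>\<^sub>h u\<^sub>h \<longrightarrow>
    \<sigma> \<in> sobolev 3 (box a b) \<longrightarrow>
    u \<in> sobolev 1 (box a b) \<longrightarrow>
    is_interpolant a b h \<sigma> \<pi> \<longrightarrow>
    is_L2_projection a b h u w \<longrightarrow>
    (Hdiv_norm (box a b) (\<lambda>x. \<sigma>\<^sub>h x - \<pi> x))\<^sup>2 + (L2_norm (box a b) (\<lambda>x. u\<^sub>h x - w x))\<^sup>2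
      \<le> C * h ^ 3 * ((sobolev_norm 3 (box a b) \<sigma>)\<^sup>2 + (sobolev_norm 1 (box a b) u)\<^sup>2)"
proof -
  define n where "n = real CARD('n)"
  \<comment> \<open>The same quantity as \<Lambda>. It depends on \<open>a\<close> and
    \<open>b\<close> only, so that all constants can be fixed before the mesh size is
    introduced.\<close>
  define L where "L = (\<Sum>j\<in>UNIV. 4 / (b $ j - a $ j) + 20 * (b $ j - a $ j))"
  define p where "p = n\<^sup>2 * ((cint TYPE('n) * n\<^sup>2 + 1) * L)"
  define Cd where "Cd = 4 * n ^ 3 * L"
  define CE where "CE = (8 * (3 * n + 1) * (2 * mu + n * lam)\<^sup>2 / mu\<^sup>2 + 2) * (p + 6 * L\<^sup>2 * Cd)"
  define Cv where "Cv = 4 * ((3 * n + 1) * (6 * L\<^sup>2)) * (p + CE) / mu\<^sup>2"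
  have n0: "0 \<le> n" by (simp add: n_def)
  have L0: "0 \<le> L" unfolding L_def using assms(2) by (intro sum_nonneg add_nonneg_nonneg) (auto simp: less_imp_le)
  have p0: "0 \<le> p" unfolding p_def using L0 by (intro mult_nonneg_nonneg) auto
  have C0: "0 \<le> Cd" "0 \<le> CE" "0 \<le> Cv"
    unfolding Cd_def CE_def Cv_def using n0 L0 p0 by (intro mult_nonneg_nonneg add_nonneg_nonneg divide_nonneg_nonneg; simp)+
  show ?thesis
  proof (intro exI allI impI)
    fix h :: real and f u uh w :: "real^'n \<Rightarrow> real^'n" and \<sigma> \<sigma>h \<pi> :: "real^'n \<Rightarrow> real^'n^'n"
    assume adm: "admissible_mesh_size a b h" and f: "f \<in> L2 (box a b)"
      and cont: "solves_mixed_problem (box a b) mu lam f (Hdiv_sym (box a b)) (L2 (box a b)) \<sigma> u"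
      and disc: "solves_mixed_problem (box a b) mu lam f (Sigma_h a b h) (V_h a b h) \<sigma>h uh"
      and \<sigma>3: "\<sigma> \<in> sobolev 3 (box a b)" and \<pi>: "is_interpolant a b h \<sigma> \<pi>" and pr: "is_L2_projection a b h u w"
    have h: "0 < h" and "\<forall>i. \<exists>m::nat. b $ i - a $ i = real m * h" using adm by (auto simp: admissible_mesh_size_def)
    then obtain M :: "'n \<Rightarrow> nat" where M: "\<forall>i. b $ i - a $ i = real (M i) * h" by metis
    have "0 < M i" for i
    proof (rule ccontr)
      assume "\<not> 0 < M i"
      then have "b $ i - a $ i = 0" using M by simp
      moreover have "a $ i < b $ i" using assms(2) by blast
      ultimately show False by simp
    qed
    then interpret interpolation a b h M \<sigma> \<pi>
      by unfold_locales (use h M \<sigma>3 \<pi> cont in \<open>auto simp: solves_mixed_problem_def\<close>)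
    note ctx = assms(3,4) cont disc pr
    define X where "X = h ^ 3 * N"
    have X: "0 \<le> X" using h N_nonneg by (simp add: X_def)
    have P: "n\<^sup>2 * P = p * X" by (simp add: p_def X_def n_def L_def)
    have d: "L2_inner \<Omega> (weak_div \<Omega> (\<lambda>x. \<sigma>h x - \<pi> x)) (weak_div \<Omega> (\<lambda>x. \<sigma>h x - \<pi> x)) \<le> Cd * X" (is "?d \<le> _")
      using divergence_error[OF ctx] by (simp add: Cd_def X_def n_def L_def mult.assoc)
    have E: "L2_inner \<Omega> (\<lambda>x. \<sigma>h x - \<pi> x) (\<lambda>x. \<sigma>h x - \<pi> x) \<le> CE * X" (is "?E \<le> _")
    proof -
      have "?E \<le> (8 * (3 * n + 1) * (2 * mu + n * lam)\<^sup>2 / mu\<^sup>2 + 2) * (n\<^sup>2 * P + 6 * L\<^sup>2 * ?d)"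
        using stress_error[OF ctx] unfolding n_def L_def .
      also have "\<dots> \<le> (8 * (3 * n + 1) * (2 * mu + n * lam)\<^sup>2 / mu\<^sup>2 + 2) * (p * X + 6 * L\<^sup>2 * (Cd * X))"
        unfolding P using n0 by (intro mult_left_mono add_left_mono d) auto
      also have "\<dots> = CE * X" by (simp add: CE_def distrib_right mult.assoc)
      finally show ?thesis .
    qed
    have v: "L2_inner \<Omega> (\<lambda>x. uh x - w x) (\<lambda>x. uh x - w x) \<le> Cv * X" (is "?v \<le> _")
    proof -
      have "?v \<le> 4 * ((3 * n + 1) * (6 * L\<^sup>2)) * (n\<^sup>2 * P + ?E) / mu\<^sup>2"
        using displacement_error[OF ctx] unfolding n_def L_def .
      also have "\<dots> \<le> 4 * ((3 * n + 1) * (6 * L\<^sup>2)) * (p * X + CE * X) / mu\<^sup>2"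
        unfolding P using n0 by (intro divide_right_mono mult_left_mono add_left_mono E) auto
      also have "\<dots> = Cv * X" by (simp add: Cv_def distrib_right mult.assoc)
      finally show ?thesis .
    qed
    have "(Hdiv_norm \<Omega> (\<lambda>x. \<sigma>h x - \<pi> x))\<^sup>2 + (L2_norm \<Omega> (\<lambda>x. uh x - w x))\<^sup>2 \<le> (CE + Cd + Cv) * X"
      using d E v unfolding Hdiv_norm_square L2_norm_square distrib_right by linarith
    also have "\<dots> = (CE + Cd + Cv) * h ^ 3 * (sobolev_norm 3 \<Omega> \<sigma>)\<^sup>2" by (simp add: X_def N_def)
    also have "\<dots> \<le> (CE + Cd + Cv) * h ^ 3 * ((sobolev_norm 3 \<Omega> \<sigma>)\<^sup>2 + (sobolev_norm 1 \<Omega> u)\<^sup>2)"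
      using C0 h by (intro mult_left_mono) auto
    finally show "(Hdiv_norm \<Omega> (\<lambda>x. \<sigma>h x - \<pi> x))\<^sup>2 + (L2_norm \<Omega> (\<lambda>x. uh x - w x))\<^sup>2
      \<le> (CE + Cd + Cv) * h ^ 3 * ((sobolev_norm 3 \<Omega> \<sigma>)\<^sup>2 + (sobolev_norm 1 \<Omega> u)\<^sup>2)" .
  qed
qed

end
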